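(* Let $n\in\mathbb N$, $\beta\in Q_n^+$ and $\widehat{\mathscr H}_\beta\in\{\widehat{\mathscr H}_\beta(q),\widehat H_\beta\}$. The following rules extend uniquely to a faithful representation $\widehat\rho_\beta$ of $\widehat{\mathscr H}_\beta$ on $\widetilde{\mathrm{Pol}}_\beta$. For all $\mathbf i,\mathbf j\in I^\beta$, $f\in\widetilde{\mathcal P_n}$, $1\le r<n$, $1\le k\le n$: in the non-degenerate case $\widehat{\mathscr H}_\beta=\widehat{\mathscr H}_\beta(q)$, $$\hat X_k^{\pm1}\hat e(\mathbf i)\cdot f_{\mathbf i}=t_k(\mathbf i)^{\pm1}f_{\mathbf i},\qquad \hat e(\mathbf j)\cdot f_{\mathbf i}=\delta_{\mathbf i\mathbf j}f_{\mathbf i},$$ $$\hat T_r\hat e(\mathbf i)\cdot f_{\mathbf i}=\Bigl(\frac{t_{r+1}-qt_r}{t_{r+1}-t_r}s_r(f)\Bigr)_{s_r\mathbf i}+(q-1)\frac{t_{r+1}(\mathbf i)}{t_{r+1}(\mathbf i)-t_r(\mathbf i)}f_{\mathbf i};$$ in the degenerate case $\widehat{\mathscr H}_\beta=\widehat H_\beta$, $$\hat x_k\hat e(\mathbf i)\cdot f_{\mathbf i}=t_k(\mathbf i)f_{\mathbf i},\qquad \hat e(\mathbf j)\cdot f_{\mathbf i}=\delta_{\mathbf i\mathbf j}f_{\mathbf i},$$ $$\hat s_r\hat e(\mathbf i)\cdot f_{\mathbf i}=\Bigl(\frac{t_{r+1}-t_r-1}{t_{r+1}-t_r}s_r(f)\Bigr)_{s_r\mathbf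 i}+\frac1{t_{r+1}(\mathbf i)-t_r(\mathbf i)}f_{\mathbf i}.$$
   Context: **Settings.** $K$ is a field, $e\in\{0,2,3,\dots\}$, $I=\mathbb Z/e\mathbb Z$. Non-degenerate setting: $1\ne q\in K^\times$, and $e$ is the least positive integer $k$ with $1+q+\dots+q^{k-1}=0$, or $e=0$ if there is none. Degenerate setting: $\operatorname{char}K=e$. $Q^+=\bigoplus_{i\in I}\mathbb N\alpha_i$ ($\alpha_i$ simple roots), $P^+=\bigoplus_{i\in I}\mathbb N\Lambda_i$ ($\Lambda_i$ fundamental weights); $Q_n^+$ is the set of $\sum k_i\alpha_i$ with $\sum k_i=n$; $I^\beta=\{\mathbf i\in I^n:\alpha_{i_1}+\dots+\alpha_{i_n}=\beta\}$. $S_n$ acts on $I^n$ by place permutations, $(w\mathbf i)_{w(k)}=i_k$; $s_r=(r,r+1)$. **Hecke algebras.** $\mathscr H_n(q)$: generators $T_1,\dots,T_{n-1},X_1^{\pm1},\dots,X_n^{\pm1}$; relations $(T_i-q)(T_i+1)=0$, $T_iT_{i+1}T_i=T_{i+1}T_iT_{i+1}$, $T_iT_k=T_kT_i$ ($|i-k|>1$), the $X_i^{\pm1}$ commute, $X_kX_k^{-1}=1=X_k^{-1}X_k$, $T_iX_k=X_kT_i$ ($k\ne i,i+1$), $X_{i+1}=q^{-1}T_iX_iT_i$. For $\Lambda=\Lambda_{\kappa_1}+\dots+\Lambda_{\kappa_\ell}\in P^+$, $\mathscr H_n^\Lambda(q)$ is the quotient by the ideal generated by $\prod_j(X_1-q^{\kappa_j})$,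 $L_r$ the image of $X_r$. $H_n$: generators $s_1,\dots,s_{n-1},x_1,\dots,x_n$; relations $s_i^2=1$, braid relations, $x_ix_k=x_kx_i$, $s_ix_k=x_ks_i$ ($k\ne i,i+1$), $x_{i+1}=s_ix_is_i+s_i$. $H_n^\Lambda$ is the quotient by the ideal generated by $\prod_j(x_1-\kappa_j1_K)$, $L_r$ the image of $x_r$. In both cases $e(\mathbf i)$ ($\mathbf i\in I^n$) is the (possibly zero) idempotent of the cyclotomic algebra projecting every finite dimensional module onto the simultaneous generalized eigenspace where $L_r$ has eigenvalue $q^{i_r}$ (resp. $i_r\cdot1_K$) for all $r$. **Modified affine Hecke algebras.** $P^+$ is directed by $\Lambda'\ge\Lambda\iff\Lambda'-\Lambda\in P^+$, with canonical surjections of the cyclotomic algebras for $\Lambda'$ onto those for $\Lambda$. In $\varprojlim_\Lambda\mathscr H_n^\Lambda(q)$ (resp. $\varprojlim_\Lambda H_n^\Lambda$) let $\hat T_k,\hat X_r$ (resp. $\hat s_k,\hat x_r$) be the images of $T_k,X_r$ (resp. $s_k,x_r$), and $\hat e(\mathbf i)$ the idempotent with all components $e(\mathbf i)$. For $i_r\ne i_s$, $(\hat X_r-\hat X_s)\hat e(\mathbf i)$ (resp. $(\hat x_r-\hat x_s)\hat e(\mathbf i)$) is invertible in the algebra $\hat e(\mathbf i)(\varprojlim)\hat e(\mathbf i)$, the inverse being denoted $(\hat X_r-\hat X_s)^{-1}\hat e(\mathbf i)$ (resp. $(\hat x_r-\hat x_s)^{-1}\hat e(\mathbf i)$). $\widehat{\mathscr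 H}_\beta(q)$ is the $K$-subalgebra generated by $\hat T_k\hat e(\mathbf i),\hat X_r^{\pm1}\hat e(\mathbf i),\hat e(\mathbf i)$ and $(\hat X_r-\hat X_s)^{-1}\hat e(\mathbf i)$ ($\mathbf i\in I^\beta$, $r<s$, $i_r\ne i_s$ for the last); $\widehat H_\beta$ is the $K$-subalgebra generated by $\hat s_k\hat e(\mathbf i),\hat x_r\hat e(\mathbf i),\hat e(\mathbf i)$ and $(\hat x_r-\hat x_s)^{-1}\hat e(\mathbf i)$ (same conditions). The identity is $\sum_{\mathbf i\in I^\beta}\hat e(\mathbf i)$. **Polynomial space.** For each $\mathbf i\in I^\beta$ let $t_1(\mathbf i),\dots,t_n(\mathbf i)$ be algebraically independent indeterminates, and let $\widetilde{\mathrm{Pol}}_n(\mathbf i)$ be the localization of $K[t_1(\mathbf i)^{\pm1},\dots,t_n(\mathbf i)^{\pm1}]$ (non-degenerate case) or $K[t_1(\mathbf i),\dots,t_n(\mathbf i)]$ (degenerate case) obtained by inverting all $t_r(\mathbf i)-t_s(\mathbf i)$, $r\ne s$. Put $\widetilde{\mathrm{Pol}}_\beta=\bigoplus_{\mathbf i\in I^\beta}\widetilde{\mathrm{Pol}}_n(\mathbf i)$. Similarly $\widetilde{\mathcal P_n}$ is the localization of $K[t_1^{\pm1},\dots,t_n^{\pm1}]$ (resp. $K[t_1,\dots,t_n]$) obtained by inverting all $t_r-t_s$, $r\ne s$; $S_n$ acts on it by $w(t_k)=t_{w(k)}$. For $f\in\widetilde{\mathcal P_n}$, $f_{\mathbf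 i}\in\widetilde{\mathrm{Pol}}_n(\mathbf i)$ is its image under the isomorphism $t_k\mapsto t_k(\mathbf i)$. The elements $\hat X_k^{\pm1}\hat e(\mathbf i)$, $\hat T_r\hat e(\mathbf i)$, etc. act by zero on $\widetilde{\mathrm{Pol}}_n(\mathbf j)$ for $\mathbf j\ne\mathbf i$. *)

theory Defs
  imports
    "HOL-Library.Poly_Mapping"
    "HOL-Library.Multiset"
    "HOL-Library.FuncSet"
    "HOL-Combinatorics.Permutations"
    "HOL-Computational_Algebra.Fraction_Field"
    "HOL-Algebra.QuotRing"
    "Jordan_Normal_Form.Matrix"
begin

section \<open>Settings, residues, weights\<close>

text \<open>The non-degenerate setting carries the parameter \<open>q\<close>; the ground field is the
  type \<open>'k\<close>.\<close>

datatype 'k setting = NonDeg 'k | Deg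

definition quantum_char :: "'k::field \<Rightarrow> nat" where
  "quantum_char q =
     (if \<exists>k>0. (\<Sum>j<k. q ^ j) = 0 then (LEAST k. k > 0 \<and> (\<Sum>j<k. q ^ j) = 0) else 0)"

fun admissible :: "nat \<Rightarrow> 'k::field setting \<Rightarrow> bool" where
  "admissible e (NonDeg q) \<longleftrightarrow> q \<noteq> 0 \<and> q \<noteq> 1 \<and> e = quantum_char q"
| "admissible e (Deg :: 'k setting) \<longleftrightarrow> CHAR('k) = e"

text \<open>\<open>I = \<int>/e\<int>\<close>, by canonical representatives: all of \<open>\<int>\<close> for \<open>e = 0\<close>
  (as \<open>i mod 0 = i\<close>), and \<open>{0..<e}\<close> for \<open>e > 0\<close>.\<close>

definition residues_mod :: "nat \<Rightarrow> int set" where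
  "residues_mod e = {i. i mod int e = i}"

text \<open>\<open>q\<^sup>i\<close>, respectively \<open>i \<cdot> 1\<close>. Under \<^const>\<open>admissible\<close> this depends only on
  the class of \<open>i\<close> modulo \<open>e\<close>.\<close>

fun residue_val :: "'k::field setting \<Rightarrow> int \<Rightarrow> 'k" where
  "residue_val (NonDeg q) i = q powi i"
| "residue_val Deg i = of_int i"

text \<open>An element \<open>\<Sum> k\<^sub>i \<alpha>\<^sub>i\<close> of \<open>Q\<^sup>+\<close> (or \<open>\<Sum> k\<^sub>i \<Lambda>\<^sub>i\<close> of \<open>P\<^sup>+\<close>) is the multiset on \<open>I\<close> in which
  \<open>i\<close> has multiplicity \<open>k\<^sub>i\<close>. The order on \<open>P\<^sup>+\<close> is then \<open>\<subseteq>#\<close>.\<close>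

definition Qplus :: "nat \<Rightarrow> nat \<Rightarrow> int multiset set" where
  "Qplus e n = {\<beta>. set_mset \<beta> \<subseteq> residues_mod e \<and> size \<beta> = n}"

definition Pplus :: "nat \<Rightarrow> int multiset set" where
  "Pplus e = {\<Lambda>. set_mset \<Lambda> \<subseteq> residues_mod e}"

definition res_seqs :: "nat \<Rightarrow> nat \<Rightarrow> (nat \<Rightarrow> int) set" where
  "res_seqs e n = {1..n} \<rightarrow>\<^sub>E residues_mod e"

definition I_beta :: "nat \<Rightarrow> nat \<Rightarrow> int multiset \<Rightarrow> (nat \<Rightarrow> int) set" where
  "I_beta e n \<beta> = {i \<in> res_seqs e n. image_mset i (mset_set {1..n}) = \<beta>}"

definition place_perm :: "(nat \<Rightarrow> nat) \<Rightarrow> (nat \<Rightarrow> int) \<Rightarrow> (nat \<Rightarrow> int)" where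
  "place_perm w i = i \<circ> inv_into UNIV w"

lemma place_perm_apply: "bij w \<Longrightarrow> place_perm w i (w k) = i k"
  by (simp add: place_perm_def bij_is_inj)

definition simple_refl :: "nat \<Rightarrow> nat \<Rightarrow> nat" where
  "simple_refl r = transpose r (r + 1)"


section \<open>Free algebras\<close>

text \<open>The free algebra is the monoid algebra of the free monoid, with concatenation written
  additively as \<^theory>\<open>HOL-Library.Poly_Mapping\<close> requires.\<close>

instantiation list :: (type) monoid_add
begin
definition "0 = []"
definition "xs + ys = xs @ ys"
instance by standard (simp_all add: zero_list_def plus_list_def)
end

definition cst :: "'k::zero \<Rightarrow> 'm::zero \<Rightarrow>\<^sub>0 'k" where
  "cst c = Poly_Mapping.single 0 c"

text \<open>\<open>gT r\<close> stands for \<open>T\<^sub>r\<close> (non-degenerate) or \<open>s\<^sub>r\<close> (degenerate), \<open>gX r\<close> for \<open>X\<^sub>r\<close> or \<open>x\<^sub>r\<close>, and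
  \<open>gXinv r\<close> for \<open>X\<^sub>r\<^sup>-\<^sup>1\<close>.\<close>

datatype gen = gT nat | gX nat | gXinv nat

type_synonym 'k free = "gen list \<Rightarrow>\<^sub>0 'k"

definition gen_elt :: "gen \<Rightarrow> 'k::field free" where
  "gen_elt g = Poly_Mapping.single [g] 1"

abbreviation "T\<^sub>g r \<equiv> gen_elt (gT r)"
abbreviation "X\<^sub>g r \<equiv> gen_elt (gX r)"
abbreviation "Xi\<^sub>g r \<equiv> gen_elt (gXinv r)"

definition free_alg :: "gen set \<Rightarrow> ('k::field free) ring" where
  "free_alg G = \<lparr>carrier = {p. \<forall>w\<in>Poly_Mapping.keys p. set w \<subseteq> G},
     monoid.mult = (*), one = 1, zero = 0, add = (+)\<rparr>"


section \<open>Affine and cyclotomic (degenerate) Hecke algebras\<close>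

fun hecke_gens :: "'k setting \<Rightarrow> nat \<Rightarrow> gen set" where
  "hecke_gens (NonDeg q) n = gT ` {1..<n} \<union> gX ` {1..n} \<union> gXinv ` {1..n}"
| "hecke_gens Deg n = gT ` {1..<n} \<union> gX ` {1..n}"

definition common_rels :: "nat \<Rightarrow> 'k::field free set" where
  "common_rels n =
     {T\<^sub>g i * T\<^sub>g (i+1) * T\<^sub>g i - T\<^sub>g (i+1) * T\<^sub>g i * T\<^sub>g (i+1) | i. 1 \<le> i \<and> i + 1 < n}
   \<union> {T\<^sub>g i * T\<^sub>g k - T\<^sub>g k * T\<^sub>g i | i k.
        i \<in> {1..<n} \<and> k \<in> {1..<n} \<and> \<bar>int i - int k\<bar> > 1}
   \<union> {T\<^sub>g i * X\<^sub>g k - X\<^sub>g k * T\<^sub>g i | i k. i \<in> {1..<n} \<and> k \<in> {1..n} \<and> k \<noteq> i \<and> k \<noteq> i + 1}"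

fun hecke_rels :: "'k::field setting \<Rightarrow> nat \<Rightarrow> 'k free set" where
  "hecke_rels (NonDeg q) n = common_rels n
   \<union> {(T\<^sub>g i - cst q) * (T\<^sub>g i + 1) | i. i \<in> {1..<n}}
   \<union> {gen_elt a * gen_elt b - gen_elt b * gen_elt a | a b.
        a \<in> gX ` {1..n} \<union> gXinv ` {1..n} \<and> b \<in> gX ` {1..n} \<union> gXinv ` {1..n}}
   \<union> {X\<^sub>g k * Xi\<^sub>g k - 1 | k. k \<in> {1..n}}
   \<union> {Xi\<^sub>g k * X\<^sub>g k - 1 | k. k \<in> {1..n}}
   \<union> {X\<^sub>g (i+1) - cst (inverse q) * T\<^sub>g i * X\<^sub>g i * T\<^sub>g i | i. i \<in> {1..<n}}"
| "hecke_rels Deg n = common_rels n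
   \<union> {T\<^sub>g i * T\<^sub>g i - 1 | i. i \<in> {1..<n}}
   \<union> {X\<^sub>g i * X\<^sub>g k - X\<^sub>g k * X\<^sub>g i | i k. i \<in> {1..n} \<and> k \<in> {1..n}}
   \<union> {X\<^sub>g (i+1) - (T\<^sub>g i * X\<^sub>g i * T\<^sub>g i + T\<^sub>g i) | i. i \<in> {1..<n}}"

definition hecke_ideal :: "'k::field setting \<Rightarrow> nat \<Rightarrow> 'k free set" where
  "hecke_ideal st n = genideal (free_alg (hecke_gens st n)) (hecke_rels st n)"

definition affine_hecke :: "'k::field setting \<Rightarrow> nat \<Rightarrow> ('k free set) ring" where
  "affine_hecke st n = free_alg (hecke_gens st n) Quot hecke_ideal st n"

definition aff_class :: "'k::field setting \<Rightarrow> nat \<Rightarrow> 'k free \<Rightarrow> 'k free set" where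
  "aff_class st n p = a_r_coset (free_alg (hecke_gens st n)) (hecke_ideal st n) p"

text \<open>The product over \<open>\<Lambda>\<close> is written out in every possible order of its factors; the factors
  commute in the affine algebra, so all these words have the same class. For \<open>n = 0\<close> there is no
  \<open>X\<^sub>1\<close>, and the cyclotomic algebra is the affine one, namely the ground field.\<close>

definition cyclotomic_ideal ::
  "'k::field setting \<Rightarrow> nat \<Rightarrow> int multiset \<Rightarrow> 'k free set set" where
  "cyclotomic_ideal st n \<Lambda> = genideal (affine_hecke st n)
     {aff_class st n (prod_list (map (\<lambda>\<kappa>. X\<^sub>g 1 - cst (residue_val st \<kappa>)) ks)) | ks.
        mset ks = \<Lambda> \<and> n \<ge> 1}"

definition cyclotomic_hecke ::
  "'k::field setting \<Rightarrow> nat \<Rightarrow> int multiset \<Rightarrow> ('k free set set) ring" where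
  "cyclotomic_hecke st n \<Lambda> = affine_hecke st n Quot cyclotomic_ideal st n \<Lambda>"

definition cyc_class ::
  "'k::field setting \<Rightarrow> nat \<Rightarrow> int multiset \<Rightarrow> 'k free \<Rightarrow> 'k free set set" where
  "cyc_class st n \<Lambda> p =
     a_r_coset (affine_hecke st n) (cyclotomic_ideal st n \<Lambda>) (aff_class st n p)"

text \<open>The canonical surjection onto the cyclotomic algebra of \<open>\<Lambda>\<close>: a coset of the smaller ideal
  of some \<open>\<Lambda>' \<supseteq># \<Lambda>\<close> is sent to the coset of the ideal of \<open>\<Lambda>\<close> that contains it.\<close>

definition cyc_proj ::
  "'k::field setting \<Rightarrow> nat \<Rightarrow> int multiset \<Rightarrow> 'k free set set \<Rightarrow> 'k free set set" where
  "cyc_proj st n \<Lambda> C = set_add (affine_hecke st n) (cyclotomic_ideal st n \<Lambda>) C"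


section \<open>The idempotents \<open>e(i)\<close>\<close>

text \<open>A \<open>K\<close>-algebra is given as a ring \<open>A\<close> with the map \<open>\<iota>\<close> sending \<open>c\<close> to \<open>c \<cdot> 1\<close>. A finite
  dimensional module, up to isomorphism, is a matrix representation on \<open>K\<^sup>d\<close>.\<close>

definition fd_module ::
  "('a, 'b) ring_scheme \<Rightarrow> ('k::field \<Rightarrow> 'a) \<Rightarrow> nat \<Rightarrow> ('a \<Rightarrow> 'k mat) \<Rightarrow> bool" where
  "fd_module A \<iota> d M \<longleftrightarrow>
     M \<in> Ring.ring_hom A (ring_mat TYPE('k) d ()) \<and> (\<forall>c. M (\<iota> c) = c \<cdot>\<^sub>m 1\<^sub>m d)"

definition sim_gen_eigenspace ::
  "nat \<Rightarrow> (nat \<Rightarrow> 'a) \<Rightarrow> (nat \<Rightarrow> 'k::field) \<Rightarrow> nat \<Rightarrow> ('a \<Rightarrow> 'k mat) \<Rightarrow> 'k vec set" where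
  "sim_gen_eigenspace n L c d M =
     {v \<in> carrier_vec d. \<forall>r\<in>{1..n}. \<exists>N.
        ((M (L r) - c r \<cdot>\<^sub>m 1\<^sub>m d) ^\<^sub>m N) *\<^sub>v v = 0\<^sub>v d}"

text \<open>The projection is the one along the decomposition of a module into all its simultaneous
  generalized eigenspaces.\<close>

definition is_residue_idem ::
  "nat \<Rightarrow> 'k::field setting \<Rightarrow> nat \<Rightarrow> int multiset \<Rightarrow> (nat \<Rightarrow> int) \<Rightarrow> 'k free set set \<Rightarrow> bool"
where
  "is_residue_idem e st n \<Lambda> i u \<longleftrightarrow>
     (let A = cyclotomic_hecke st n \<Lambda>;
          W = (\<lambda>j. sim_gen_eigenspace n (\<lambda>r. cyc_class st n \<Lambda> (X\<^sub>g r))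
                     (\<lambda>r. residue_val st (j r)))
      in u \<in> carrier A \<and> u \<otimes>\<^bsub>A\<^esub> u = u \<and>
         (\<forall>d M. fd_module A (\<lambda>c. cyc_class st n \<Lambda> (cst c)) d M \<longrightarrow>
            (\<lambda>v. M u *\<^sub>v v) ` carrier_vec d = W i d M \<and>
            (\<forall>v \<in> W i d M. M u *\<^sub>v v = v) \<and>
            (\<forall>j \<in> res_seqs e n - {i}. \<forall>v \<in> W j d M. M u *\<^sub>v v = 0\<^sub>v d)))"

definition residue_idem ::
  "nat \<Rightarrow> 'k::field setting \<Rightarrow> nat \<Rightarrow> int multiset \<Rightarrow> (nat \<Rightarrow> int) \<Rightarrow> 'k free set set" where
  "residue_idem e st n \<Lambda> i = (THE u. is_residue_idem e st n \<Lambda> i u)"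


section \<open>The inverse limit and the modified affine Hecke algebra\<close>

type_synonym 'k limit = "int multiset \<Rightarrow> 'k free set set"

definition hecke_limit :: "nat \<Rightarrow> 'k::field setting \<Rightarrow> nat \<Rightarrow> ('k limit) ring" where
  "hecke_limit e st n =
     \<lparr>carrier = {f \<in> (\<Pi>\<^sub>E \<Lambda> \<in> Pplus e. carrier (cyclotomic_hecke st n \<Lambda>)).
        \<forall>\<Lambda> \<in> Pplus e. \<forall>\<Lambda>' \<in> Pplus e. \<Lambda> \<subseteq># \<Lambda>' \<longrightarrow> cyc_proj st n \<Lambda> (f \<Lambda>') = f \<Lambda>},
      monoid.mult = (\<lambda>f g. \<lambda>\<Lambda>\<in>Pplus e. f \<Lambda> \<otimes>\<^bsub>cyclotomic_hecke st n \<Lambda>\<^esub> g \<Lambda>),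
      one = (\<lambda>\<Lambda>\<in>Pplus e. \<one>\<^bsub>cyclotomic_hecke st n \<Lambda>\<^esub>),
      zero = (\<lambda>\<Lambda>\<in>Pplus e. \<zero>\<^bsub>cyclotomic_hecke st n \<Lambda>\<^esub>),
      add = (\<lambda>f g. \<lambda>\<Lambda>\<in>Pplus e. f \<Lambda> \<oplus>\<^bsub>cyclotomic_hecke st n \<Lambda>\<^esub> g \<Lambda>)\<rparr>"

definition hat :: "nat \<Rightarrow> 'k::field setting \<Rightarrow> nat \<Rightarrow> 'k free \<Rightarrow> 'k limit" where
  "hat e st n p = (\<lambda>\<Lambda>\<in>Pplus e. cyc_class st n \<Lambda> p)"

definition hat_idem ::
  "nat \<Rightarrow> 'k::field setting \<Rightarrow> nat \<Rightarrow> (nat \<Rightarrow> int) \<Rightarrow> 'k limit" where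
  "hat_idem e st n i = (\<lambda>\<Lambda>\<in>Pplus e. residue_idem e st n \<Lambda> i)"

definition hat_at ::
  "nat \<Rightarrow> 'k::field setting \<Rightarrow> nat \<Rightarrow> 'k free \<Rightarrow> (nat \<Rightarrow> int) \<Rightarrow> 'k limit" where
  "hat_at e st n p i = hat e st n p \<otimes>\<^bsub>hecke_limit e st n\<^esub> hat_idem e st n i"

text \<open>The inverse of \<open>a\<close> in the algebra \<open>u R u\<close>, whose identity is the idempotent \<open>u\<close>.\<close>

definition corner_inverse :: "('a, 'b) ring_scheme \<Rightarrow> 'a \<Rightarrow> 'a \<Rightarrow> 'a" where
  "corner_inverse R u a = (THE y. y \<in> {u \<otimes>\<^bsub>R\<^esub> z \<otimes>\<^bsub>R\<^esub> u | z. z \<in> carrier R} \<and>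
     a \<otimes>\<^bsub>R\<^esub> y = u \<and> y \<otimes>\<^bsub>R\<^esub> a = u)"

fun unit_gens :: "'k setting \<Rightarrow> nat \<Rightarrow> gen set" where
  "unit_gens (NonDeg q) n = gX ` {1..n} \<union> gXinv ` {1..n}"
| "unit_gens Deg n = gX ` {1..n}"

definition modified_gens ::
  "nat \<Rightarrow> 'k::field setting \<Rightarrow> nat \<Rightarrow> int multiset \<Rightarrow> 'k limit set" where
  "modified_gens e st n \<beta> =
     {hat_at e st n (T\<^sub>g k) i | k i. k \<in> {1..<n} \<and> i \<in> I_beta e n \<beta>}
   \<union> {hat_at e st n (gen_elt g) i | g i. g \<in> unit_gens st n \<and> i \<in> I_beta e n \<beta>}
   \<union> {hat_idem e st n i | i. i \<in> I_beta e n \<beta>}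
   \<union> {corner_inverse (hecke_limit e st n) (hat_idem e st n i)
        (hat_at e st n (X\<^sub>g r - X\<^sub>g s) i) | r s i.
        i \<in> I_beta e n \<beta> \<and> 1 \<le> r \<and> r < s \<and> s \<le> n \<and> i r \<noteq> i s}"

text \<open>The subalgebra generated by \<open>S\<close>, not assumed to contain the identity of \<open>R\<close>.\<close>

inductive_set subalg_gen :: "('a, 'b) ring_scheme \<Rightarrow> ('k \<Rightarrow> 'a) \<Rightarrow> 'a set \<Rightarrow> 'a set"
  for R and \<iota> and S where
  incl: "x \<in> S \<Longrightarrow> x \<in> subalg_gen R \<iota> S"
| zero: "\<zero>\<^bsub>R\<^esub> \<in> subalg_gen R \<iota> S"
| add: "x \<in> subalg_gen R \<iota> S \<Longrightarrow> y \<in> subalg_gen R \<iota> S \<Longrightarrow> x \<oplus>\<^bsub>R\<^esub> y \<in> subalg_gen R \<iota> S"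
| mult: "x \<in> subalg_gen R \<iota> S \<Longrightarrow> y \<in> subalg_gen R \<iota> S \<Longrightarrow> x \<otimes>\<^bsub>R\<^esub> y \<in> subalg_gen R \<iota> S"
| scal: "x \<in> subalg_gen R \<iota> S \<Longrightarrow> \<iota> c \<otimes>\<^bsub>R\<^esub> x \<in> subalg_gen R \<iota> S"

definition limit_const :: "nat \<Rightarrow> 'k::field setting \<Rightarrow> nat \<Rightarrow> 'k \<Rightarrow> 'k limit" where
  "limit_const e st n c = hat e st n (cst c)"

definition modified_hecke ::
  "nat \<Rightarrow> 'k::field setting \<Rightarrow> nat \<Rightarrow> int multiset \<Rightarrow> ('k limit) ring" where
  "modified_hecke e st n \<beta> = (hecke_limit e st n)
     \<lparr>carrier := subalg_gen (hecke_limit e st n) (limit_const e st n) (modified_gens e st n \<beta>),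
      one := (\<Oplus>\<^bsub>hecke_limit e st n\<^esub> i \<in> I_beta e n \<beta>. hat_idem e st n i)\<rparr>"


section \<open>The polynomial space\<close>

text \<open>Localizations of the polynomial ring are realized inside the field of rational functions in
  variables indexed by \<open>\<nat>\<close>, of which only those with index in \<open>{1..n}\<close> are used.\<close>

type_synonym 'k mpol = "(nat \<Rightarrow>\<^sub>0 nat) \<Rightarrow>\<^sub>0 'k"
type_synonym 'k ratfun = "'k mpol fract"

abbreviation fract_of :: "'a::idom \<Rightarrow> 'a \<Rightarrow> 'a fract" where
  "fract_of \<equiv> Fraction_Field.Fract"

definition pvar :: "nat \<Rightarrow> 'k::field mpol" where
  "pvar k = Poly_Mapping.single (Poly_Mapping.single k 1) 1"

definition polys :: "nat \<Rightarrow> 'k::field mpol set" where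
  "polys n = {p. \<forall>m\<in>Poly_Mapping.keys p. Poly_Mapping.keys m \<subseteq> {1..n}}"

text \<open>Localizing the Laurent polynomials at all \<open>t\<^sub>r - t\<^sub>s\<close> amounts to localizing the polynomials at
  all \<open>t\<^sub>r\<close> and \<open>t\<^sub>r - t\<^sub>s\<close>.\<close>

inductive_set denoms :: "'k::field setting \<Rightarrow> nat \<Rightarrow> 'k mpol set"
  for st :: "'k setting" and n where
  one: "1 \<in> denoms st n"
| diff: "p \<in> denoms st n \<Longrightarrow> r \<in> {1..n} \<Longrightarrow> s \<in> {1..n} \<Longrightarrow> r \<noteq> s \<Longrightarrow>
    p * (pvar r - pvar s) \<in> denoms st n"
| var: "p \<in> denoms st n \<Longrightarrow> r \<in> {1..n} \<Longrightarrow> st = NonDeg q \<Longrightarrow> p * pvar r \<in> denoms st n"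

definition Pn :: "'k::field setting \<Rightarrow> nat \<Rightarrow> 'k ratfun set" where
  "Pn st n = {fract_of p d | p d. p \<in> polys n \<and> d \<in> denoms st n}"

definition tvar :: "nat \<Rightarrow> 'k::field ratfun" where
  "tvar k = fract_of (pvar k) 1"

definition rat_const :: "'k::field \<Rightarrow> 'k ratfun" where
  "rat_const c = fract_of (cst c) 1"

text \<open>The action \<open>w(t\<^sub>k) = t\<^bsub>w(k)\<^esub>\<close>: the coefficient of a monomial \<open>m\<close> in \<open>w(p)\<close> is the
  coefficient in \<open>p\<close> of the monomial whose exponent at \<open>k\<close> is that of \<open>m\<close> at \<open>w(k)\<close>.\<close>

definition perm_poly :: "(nat \<Rightarrow> nat) \<Rightarrow> 'k::field mpol \<Rightarrow> 'k mpol" where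
  "perm_poly w p = Poly_Mapping.map_key (Poly_Mapping.map_key w) p"

definition perm_rat :: "(nat \<Rightarrow> nat) \<Rightarrow> 'k::field ratfun \<Rightarrow> 'k ratfun" where
  "perm_rat w f =
     (THE g. \<exists>a b. b \<noteq> 0 \<and> f = fract_of a b \<and> g = fract_of (perm_poly w a) (perm_poly w b))"

lemma map_key_surj_inj:
  fixes w :: "nat \<Rightarrow> nat"
  assumes "bij w"
  shows "inj (Poly_Mapping.map_key w :: (nat \<Rightarrow>\<^sub>0 nat) \<Rightarrow> _)"
proof (rule injI)
  fix x y :: "nat \<Rightarrow>\<^sub>0 nat"
  assume eq: "Poly_Mapping.map_key w x = Poly_Mapping.map_key w y"
  show "x = y"
  proof (rule poly_mapping_eqI)
    fix k
    obtain l where k: "k = w l" using assms by (meson bij_pointE)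
    have "Poly_Mapping.lookup (Poly_Mapping.map_key w x) l
        = Poly_Mapping.lookup (Poly_Mapping.map_key w y) l" using eq by simp
    then show "Poly_Mapping.lookup x k = Poly_Mapping.lookup y k"
      using bij_is_inj[OF assms] by (simp add: map_key.rep_eq k)
  qed
qed

lemma perm_poly_single:
  assumes "bij w"
  shows "perm_poly w (Poly_Mapping.single (Poly_Mapping.map_key w m) c) = Poly_Mapping.single m c"
  using map_key_single[OF map_key_surj_inj[OF assms]] by (simp add: perm_poly_def)

lemma perm_poly_pvar:
  assumes "bij w"
  shows "perm_poly w (pvar k :: 'k::field mpol) = pvar (w k)"
proof -
  have "Poly_Mapping.map_key w (Poly_Mapping.single (w k) 1) = (Poly_Mapping.single k 1 :: nat \<Rightarrow>\<^sub>0 nat)"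
    using map_key_single[OF bij_is_inj[OF assms]] by simp
  then show ?thesis
    using perm_poly_single[OF assms, of "Poly_Mapping.single (w k) 1" "1::'k"] by (simp add: pvar_def)
qed

lemma perm_poly_add: "bij w \<Longrightarrow> perm_poly w (p + q) = perm_poly w p + perm_poly w q"
  by (simp add: perm_poly_def map_key_plus map_key_surj_inj)

lemma perm_poly_mult_single:
  assumes w: "bij w"
  shows "perm_poly w (Poly_Mapping.single m c * q) = perm_poly w (Poly_Mapping.single m c) * perm_poly w q"
proof -
  let ?f = "Poly_Mapping.map_key (inv_into UNIV w) :: (nat \<Rightarrow>\<^sub>0 nat) \<Rightarrow> _"
  have winv: "bij (inv_into UNIV w)" by (rule bij_imp_bij_inv[OF w])
  have f: "Poly_Mapping.map_key w (?f l) = l" for l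
    by (rule poly_mapping_eqI)
      (simp add: map_key.rep_eq bij_is_inj[OF w] bij_is_inj[OF winv])
  have s: "perm_poly w (Poly_Mapping.single l d) = Poly_Mapping.single (?f l) d" for l and d :: 'a
    using perm_poly_single[OF w, of "?f l" d] by (simp add: f)
  show ?thesis
  proof (induction q rule: update_induct)
    case const
    then show ?case by (simp add: perm_poly_def map_key_surj_inj[OF w])
  next
    case (update q k d)
    have u: "Poly_Mapping.update k d q = Poly_Mapping.single k d + q"
      using update(1) by (intro poly_mapping_eqI)
        (auto simp: lookup_update lookup_add lookup_single in_keys_iff when_def)
    show ?case
      by (simp add: u distrib_left perm_poly_add[OF w] update.IH mult_single s
          map_key_plus[OF bij_is_inj[OF winv]])
  qed
qed

lemma perm_poly_mult:
  assumes w: "bij w"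
  shows "perm_poly w (p * q) = perm_poly w p * perm_poly w q"
proof (induction p rule: update_induct)
  case const
  then show ?case by (simp add: perm_poly_def map_key_surj_inj[OF w])
next
  case (update p k d)
  have u: "Poly_Mapping.update k d p = Poly_Mapping.single k d + p"
    using update(1) by (intro poly_mapping_eqI)
      (auto simp: lookup_update lookup_add lookup_single in_keys_iff when_def)
  show ?case
    by (simp add: u distrib_right perm_poly_add[OF w] update.IH perm_poly_mult_single[OF w])
qed

lemma perm_poly_eq_0:
  assumes w: "bij w" and "perm_poly w p = 0"
  shows "p = 0"
proof (rule poly_mapping_eqI)
  fix m
  let ?l = "Poly_Mapping.map_key (inv_into UNIV w) m :: nat \<Rightarrow>\<^sub>0 nat"
  have winv: "bij (inv_into UNIV w)" by (rule bij_imp_bij_inv[OF w])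
  have "Poly_Mapping.map_key w ?l = m"
    by (rule poly_mapping_eqI)
      (simp add: map_key.rep_eq bij_is_inj[OF w] bij_is_inj[OF winv])
  moreover have "Poly_Mapping.lookup (perm_poly w p) ?l = 0" using assms(2) by simp
  ultimately show "Poly_Mapping.lookup p m = Poly_Mapping.lookup 0 m"
    by (simp add: perm_poly_def map_key.rep_eq map_key_surj_inj[OF w])
qed

lemma perm_rat_Fract:
  assumes w: "bij w" and b: "b \<noteq> 0"
  shows "perm_rat w (fract_of a b) = fract_of (perm_poly w a) (perm_poly w b)"
  unfolding perm_rat_def
proof (rule the_equality)
  show "\<exists>a' b'. b' \<noteq> 0 \<and> fract_of a b = fract_of a' b' \<and>
      fract_of (perm_poly w a) (perm_poly w b) = fract_of (perm_poly w a') (perm_poly w b')"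
    using b by blast
next
  fix g
  assume "\<exists>a' b'. b' \<noteq> 0 \<and> fract_of a b = fract_of a' b' \<and> g = fract_of (perm_poly w a') (perm_poly w b')"
  then obtain a' b' where h: "b' \<noteq> 0" "fract_of a b = fract_of a' b'"
    "g = fract_of (perm_poly w a') (perm_poly w b')" by blast
  from h(1,2) b have "a * b' = a' * b" by (simp add: eq_fract)
  then have "perm_poly w a * perm_poly w b' = perm_poly w a' * perm_poly w b"
    by (metis perm_poly_mult[OF w])
  moreover have "perm_poly w b \<noteq> 0" "perm_poly w b' \<noteq> 0"
    using perm_poly_eq_0[OF w] h(1) b by blast+
  ultimately show "g = fract_of (perm_poly w a) (perm_poly w b)"
    by (simp add: h(3) eq_fract)
qed

text \<open>The direct sum of the spaces \<open>Pol\<^sub>n(i)\<close>, each a copy of \<^const>\<open>Pn\<close> with \<open>t\<^sub>k(i)\<close> for \<open>t\<^sub>k\<close>.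
  The element \<open>f\<^sub>i\<close> is \<open>comp_at i f\<close>.\<close>

definition Pol_beta ::
  "nat \<Rightarrow> 'k::field setting \<Rightarrow> nat \<Rightarrow> int multiset \<Rightarrow> ((nat \<Rightarrow> int) \<Rightarrow>\<^sub>0 'k ratfun) set" where
  "Pol_beta e st n \<beta> = {v. Poly_Mapping.keys v \<subseteq> I_beta e n \<beta> \<and>
     (\<forall>i. Poly_Mapping.lookup v i \<in> Pn st n)}"

abbreviation comp_at :: "(nat \<Rightarrow> int) \<Rightarrow> 'k::field ratfun \<Rightarrow> (nat \<Rightarrow> int) \<Rightarrow>\<^sub>0 'k ratfun" where
  "comp_at i f \<equiv> Poly_Mapping.single i f"

definition scale :: "'k::field \<Rightarrow> ('i \<Rightarrow>\<^sub>0 'k ratfun) \<Rightarrow> ('i \<Rightarrow>\<^sub>0 'k ratfun)" where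
  "scale c v = Poly_Mapping.map (\<lambda>f. rat_const c * f) v"


section \<open>Representations\<close>

definition is_representation ::
  "('a, 'b) ring_scheme \<Rightarrow> ('k::field \<Rightarrow> 'a \<Rightarrow> 'a) \<Rightarrow> ('i \<Rightarrow>\<^sub>0 'k ratfun) set \<Rightarrow>
   ('a \<Rightarrow> ('i \<Rightarrow>\<^sub>0 'k ratfun) \<Rightarrow> ('i \<Rightarrow>\<^sub>0 'k ratfun)) \<Rightarrow> bool" where
  "is_representation A smul V \<rho> \<longleftrightarrow>
     (\<forall>h\<in>carrier A. \<forall>v\<in>V. \<rho> h v \<in> V) \<and>
     (\<forall>h\<in>carrier A. \<forall>v\<in>V. \<forall>w\<in>V. \<rho> h (v + w) = \<rho> h v + \<rho> h w) \<and>
     (\<forall>h\<in>carrier A. \<forall>c. \<forall>v\<in>V. \<rho> h (scale c v) = scale c (\<rho> h v)) \<and>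
     (\<forall>v\<in>V. \<rho> \<one>\<^bsub>A\<^esub> v = v) \<and>
     (\<forall>h\<in>carrier A. \<forall>h'\<in>carrier A. \<forall>v\<in>V. \<rho> (h \<otimes>\<^bsub>A\<^esub> h') v = \<rho> h (\<rho> h' v)) \<and>
     (\<forall>h\<in>carrier A. \<forall>h'\<in>carrier A. \<forall>v\<in>V. \<rho> (h \<oplus>\<^bsub>A\<^esub> h') v = \<rho> h v + \<rho> h' v) \<and>
     (\<forall>c. \<forall>h\<in>carrier A. \<forall>v\<in>V. \<rho> (smul c h) v = scale c (\<rho> h v))"

definition faithful ::
  "('a, 'b) ring_scheme \<Rightarrow> 'v set \<Rightarrow> ('a \<Rightarrow> 'v \<Rightarrow> 'v) \<Rightarrow> bool" where
  "faithful A V \<rho> \<longleftrightarrow>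
     (\<forall>h\<in>carrier A. \<forall>h'\<in>carrier A. (\<forall>v\<in>V. \<rho> h v = \<rho> h' v) \<longrightarrow> h = h')"

definition modified_smult ::
  "nat \<Rightarrow> 'k::field setting \<Rightarrow> nat \<Rightarrow> 'k \<Rightarrow> 'k limit \<Rightarrow> 'k limit" where
  "modified_smult e st n c h = limit_const e st n c \<otimes>\<^bsub>hecke_limit e st n\<^esub> h"

fun action_rules ::
  "nat \<Rightarrow> 'k::field setting \<Rightarrow> nat \<Rightarrow> int multiset \<Rightarrow>
   ('k limit \<Rightarrow> ((nat \<Rightarrow> int) \<Rightarrow>\<^sub>0 'k ratfun) \<Rightarrow> ((nat \<Rightarrow> int) \<Rightarrow>\<^sub>0 'k ratfun)) \<Rightarrow> bool" where
  "action_rules e (NonDeg q) n \<beta> \<rho> \<longleftrightarrow>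
     (\<forall>i\<in>I_beta e n \<beta>. \<forall>j\<in>I_beta e n \<beta>. \<forall>f\<in>Pn (NonDeg q) n.
        (\<forall>k\<in>{1..n}.
           \<rho> (hat_at e (NonDeg q) n (X\<^sub>g k) j) (comp_at i f) = (if j = i then comp_at i (tvar k * f) else 0) \<and>
           \<rho> (hat_at e (NonDeg q) n (Xi\<^sub>g k) j) (comp_at i f) =
             (if j = i then comp_at i (inverse (tvar k) * f) else 0)) \<and>
        \<rho> (hat_idem e (NonDeg q) n j) (comp_at i f) = (if j = i then comp_at i f else 0) \<and>
        (\<forall>r\<in>{1..<n}.
           \<rho> (hat_at e (NonDeg q) n (T\<^sub>g r) j) (comp_at i f) =
             (if j = i then
                comp_at (place_perm (simple_refl r) i)
                   ((tvar (r+1) - rat_const q * tvar r) / (tvar (r+1) - tvar r)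
                      * perm_rat (simple_refl r) f)
                + comp_at i (rat_const (q - 1) * (tvar (r+1) / (tvar (r+1) - tvar r)) * f)
              else 0)))"
| "action_rules e Deg n \<beta> \<rho> \<longleftrightarrow>
     (\<forall>i\<in>I_beta e n \<beta>. \<forall>j\<in>I_beta e n \<beta>. \<forall>f\<in>Pn Deg n.
        (\<forall>k\<in>{1..n}.
           \<rho> (hat_at e Deg n (X\<^sub>g k) j) (comp_at i f) = (if j = i then comp_at i (tvar k * f) else 0)) \<and>
        \<rho> (hat_idem e Deg n j) (comp_at i f) = (if j = i then comp_at i f else 0) \<and>
        (\<forall>r\<in>{1..<n}.
           \<rho> (hat_at e Deg n (T\<^sub>g r) j) (comp_at i f) =
             (if j = i then
                comp_at (place_perm (simple_refl r) i)
                   ((tvar (r+1) - tvar r - 1) / (tvar (r+1) - tvar r)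
                      * perm_rat (simple_refl r) f)
                + comp_at i (1 / (tvar (r+1) - tvar r) * f)
              else 0)))"

end

theory Submission
  imports Defs "Jordan_Normal_Form.Char_Poly" "HOL-Library.Function_Algebras"
begin

text \<open>The formulas of the theorem make functions \<open>I\<^sup>n \<rightarrow> K(t\<^sub>1, \<dots>, t\<^sub>n)\<close> a module over the affine Hecke algebra
  on which symmetric polynomials act centrally. In each cyclotomic quotient \<open>e(i)\<close> is a polynomial in
  the \<open>L\<^sub>r\<close>, built from partial fractions of an annihilating polynomial.

  \<^emph>\<open>Existence.\<close> Let \<open>Sec\<close> be the functions on \<open>I\<^sup>\<beta>\<close> whose value at \<open>i\<close> is regular at the point
  \<open>(q\<^sup>i\<^sup>1, \<dots>, q\<^sup>i\<^sup>n)\<close> (respectively \<open>(i\<^sub>1, \<dots>, i\<^sub>n)\<close>), and \<open>J\<close> the ideal of symmetric polynomials vanishing at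
  these points. The orbit polynomial \<open>\<Prod>\<^sub>b (X\<^sub>1 - q\<^sup>b)\<close>, \<open>b\<close> running over \<open>\<beta>\<close>, differs from
  \<open>\<Prod>\<^sub>r (X\<^sub>1 - X\<^sub>r) = 0\<close> by an element of \<open>J[X\<^sub>1]\<close>, so the cyclotomic ideal of \<open>N \<beta>\<close> maps \<open>Sec\<close> to
  \<open>J\<^sup>N Sec\<close>. As these submodules have zero intersection, an element of the inverse limit has at most
  one operator approximated by its components, and each element of the modified algebra has one.

  \<^emph>\<open>Faithfulness.\<close> For \<open>x\<close> in the modified algebra and \<open>j \<in> I\<^sup>\<beta>\<close> there are a product \<open>D\<close> of differences
  \<open>X\<^sub>r - X\<^sub>s\<close> with \<open>j\<^sub>r \<noteq> j\<^sub>s\<close> and an element \<open>h\<close> of the affine algebra with \<open>D e(j) x = e(j) h\<close>. If \<open>x\<close> acts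
  by zero, then \<open>h\<close> annihilates all polynomials. The affine algebra is spanned by \<open>n!\<close> normal words over
  the polynomials, and their operators span the \<open>n!\<close> linearly independent permutations, so \<open>h = 0\<close>.
  Since \<open>D\<close> is invertible on \<open>e(j)\<close>, \<open>e(j) x = 0\<close> for all \<open>j\<close>.\<close>

section \<open>Linear extension on monoid algebras\<close>

text \<open>The inverse limit cannot be compared with operators on the polynomial space itself. For
  n = 2 and i_1 = i_2 the symmetric polynomial (t_1 - t_2)^2 lies in J and is a unit there, so
  powers of J separate nothing. Hence the comparison takes place on \<open>Sec\<close>, where such
  poles are absent. It is carried to all vectors by a symmetric common denominator, which commutes
  with every operator. The idempotent e(i) is specified only by its effect on finite dimensional
  modules. Pinning it down needs one faithful module of this kind; this is why the cyclotomic
  algebras are shown to be finite dimensional and their regular representation is built. The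
  polynomial annihilating X_(r+1) is obtained from that of X_r by the intertwiner
  \<open>phi r\<close>, a polynomial multiple of the reflection part of T_r. The rules do not
  mention the inverses of X_r - X_s. A representation obeying them is still determined, since they
  fix X_r - X_s on the component of i, where it acts invertibly.\<close>

lemma poly_mapping_sum_singles:
  "p = (\<Sum>m\<in>Poly_Mapping.keys p. Poly_Mapping.single m (Poly_Mapping.lookup p m))"
  by (rule poly_mapping_eqI) (simp add: lookup_sum lookup_single when_def in_keys_iff sum.delta)

lemma poly_mapping_additive_induct [case_names single add]:
  assumes "\<And>m c. P (Poly_Mapping.single m c)" "\<And>p q. P p \<Longrightarrow> P q \<Longrightarrow> P (p + q)"
  shows "P (p :: 'a \<Rightarrow>\<^sub>0 'b::comm_monoid_add)"
proof -
  have "P (\<Sum>m\<in>A. Poly_Mapping.single m (Poly_Mapping.lookup p m))" if "finite A" for A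
    using that
  proof (induction A)
    case empty
    \<comment> \<open>The empty sum is a single with coefficient 0; its monomial is
      arbitrary.\<close>
    show ?case using assms(1)[of undefined 0] by simp
  qed (simp add: assms)
  then show ?thesis
    using poly_mapping_sum_singles[of p] by (metis finite_keys)
qed

text \<open>The coefficient is an argument of \<open>\<phi>\<close>, so the target needs addition
  only. Evaluation, restriction of words, the action on vectors and \<open>Px\<close> are all
  instances.\<close>

definition lin_ext :: "('m \<Rightarrow> 'k \<Rightarrow> 'r) \<Rightarrow> ('m \<Rightarrow>\<^sub>0 'k::zero) \<Rightarrow> 'r::ab_group_add" where
  "lin_ext \<phi> p = (\<Sum>m\<in>Poly_Mapping.keys p. \<phi> m (Poly_Mapping.lookup p m))"

locale additive_family =
  fixes \<phi> :: "'m \<Rightarrow> 'k::ab_group_add \<Rightarrow> 'r::ab_group_add"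
  assumes add: "\<phi> m (c + d) = \<phi> m c + \<phi> m d"
begin

lemma zero [simp]: "\<phi> m 0 = 0"
  using add[of m 0 0] by simp

lemma lin_ext_superset:
  "finite A \<Longrightarrow> Poly_Mapping.keys p \<subseteq> A \<Longrightarrow>
    lin_ext \<phi> p = (\<Sum>m\<in>A. \<phi> m (Poly_Mapping.lookup p m))"
  unfolding lin_ext_def by (rule sum.mono_neutral_left) (auto simp: in_keys_iff)

lemma lin_ext_add: "lin_ext \<phi> (p + q) = lin_ext \<phi> p + lin_ext \<phi> q"
proof -
  let ?A = "Poly_Mapping.keys p \<union> Poly_Mapping.keys q"
  have "lin_ext \<phi> (p + q) = (\<Sum>m\<in>?A. \<phi> m (Poly_Mapping.lookup (p + q) m))"
    by (rule lin_ext_superset) (auto simp: keys_add)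
  also have "\<dots> = lin_ext \<phi> p + lin_ext \<phi> q"
    by (subst (1 2) lin_ext_superset[of ?A]) (auto simp: lookup_add add sum.distrib)
  finally show ?thesis .
qed

lemma lin_ext_single [simp]: "lin_ext \<phi> (Poly_Mapping.single m c) = \<phi> m c"
  by (simp add: lin_ext_def)

lemma lin_ext_zero [simp]: "lin_ext \<phi> 0 = 0"
  by (simp add: lin_ext_def)

lemma lin_ext_uminus: "lin_ext \<phi> (- p) = - lin_ext \<phi> p"
  using lin_ext_add[of p "- p"] by (simp add: eq_neg_iff_add_eq_0 add.commute)

lemma lin_ext_diff: "lin_ext \<phi> (p - q) = lin_ext \<phi> p - lin_ext \<phi> q"
  using lin_ext_add[of p "- q"] by (simp add: lin_ext_uminus)

end

lemma cst_0 [simp]: "cst 0 = 0"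
  and cst_1 [simp]: "cst 1 = 1"
  and cst_add: "cst (a + b) = cst a + cst b"
  by (simp_all add: cst_def single_add)

lemma cst_mult: "cst (a * b) = (cst a * cst b :: 'm::monoid_add \<Rightarrow>\<^sub>0 'k::field)"
  by (simp add: cst_def mult_single)

lemma cst_uminus: "cst (- a) = - (cst a :: 'm::monoid_add \<Rightarrow>\<^sub>0 'k::field)"
  by (simp add: cst_def single_uminus)

lemma cst_diff: "cst (a - b) = (cst a - cst b :: 'm::monoid_add \<Rightarrow>\<^sub>0 'k::field)"
  by (simp add: cst_def single_diff)

lemma cst_power: "cst (a ^ k) = (cst a ^ k :: 'm::monoid_add \<Rightarrow>\<^sub>0 'k::field)"
  by (induction k) (simp_all add: cst_mult)

lemma cst_comm: "p * cst a = (cst a * p :: 'm::monoid_add \<Rightarrow>\<^sub>0 'k::field)"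
  by (induction p rule: poly_mapping_additive_induct)
    (simp_all add: cst_def mult_single mult.commute distrib_left distrib_right)

lemma cst_left_comm: "p * (cst a * r) = cst a * (p * (r :: 'm::monoid_add \<Rightarrow>\<^sub>0 'k::field))"
  by (metis cst_comm mult.assoc)

lemma cst_eq_iff [simp]: "cst a = cst b \<longleftrightarrow> a = b"
  unfolding cst_def by (metis lookup_single_eq)

lemma cst_eq_0_iff [simp]: "cst a = 0 \<longleftrightarrow> a = 0"
  using cst_eq_iff[of a 0] by (simp del: cst_eq_iff)


section \<open>Polynomials and their evaluation\<close>

lemma polys_induct [consumes 1, case_names const var add mult]:
  assumes p: "\<And>m. m \<in> Poly_Mapping.keys p \<Longrightarrow> Poly_Mapping.keys m \<subseteq> S"
    and const: "\<And>c. P (cst c)" and var: "\<And>k. k \<in> S \<Longrightarrow> P (pvar k)"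
    and add: "\<And>p q. P p \<Longrightarrow> P q \<Longrightarrow> P (p + q)" and mult: "\<And>p q. P p \<Longrightarrow> P q \<Longrightarrow> P (p * q)"
  shows "P (p :: 'k::field mpol)"
proof -
  have one: "P 1" using const[of 1] by simp
  have pow: "P (Poly_Mapping.single (Poly_Mapping.single k a) 1)" if "k \<in> S" for k a
  proof (induction a)
    case 0
    then show ?case using one by simp
  next
    case (Suc a)
    have "Poly_Mapping.single (Poly_Mapping.single k (Suc a)) 1
        = pvar k * (Poly_Mapping.single (Poly_Mapping.single k a) 1 :: 'k mpol)"
      by (simp add: pvar_def mult_single single_add[symmetric])
    then show ?case using mult[OF var[OF that] Suc] by simp
  qed
  have mon: "P (Poly_Mapping.single (\<Sum>k\<in>A. Poly_Mapping.single k (f k)) 1)"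
    if "finite A" "A \<subseteq> S" for A and f :: "nat \<Rightarrow> nat"
    using that
  proof (induction A)
    case empty
    then show ?case using one by simp
  next
    case (insert k A)
    then have "P (Poly_Mapping.single (Poly_Mapping.single k (f k)) 1
        * Poly_Mapping.single (\<Sum>k\<in>A. Poly_Mapping.single k (f k)) 1)"
      by (intro mult pow) auto
    then show ?case
      using insert.hyps by (simp add: mult_single)
  qed
  have single: "P (Poly_Mapping.single m c)" if "Poly_Mapping.keys m \<subseteq> S" for m c
  proof -
    have "P (Poly_Mapping.single m 1)"
      using mon[OF finite_keys that, of "Poly_Mapping.lookup m"]
      by (simp add: poly_mapping_sum_singles[of m, symmetric])
    from mult[OF const[of c] this] show ?thesis
      by (simp add: cst_def mult_single)
  qed
  have "P (\<Sum>m\<in>A. Poly_Mapping.single m (Poly_Mapping.lookup p m))"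
    if "finite A" "A \<subseteq> Poly_Mapping.keys p" for A
    using that
  proof (induction A)
    case empty
    then show ?case using const[of 0] by simp
  next
    case (insert m A)
    then show ?case using p by (simp add: add single)
  qed
  then show ?thesis
    using poly_mapping_sum_singles[of p] by (metis finite_keys order_refl)
qed

lemma polys_n_induct [consumes 1, case_names const var add mult]:
  assumes "p \<in> polys n"
    and "\<And>c. P (cst c)" and "\<And>k. k \<in> {1..n} \<Longrightarrow> P (pvar k)"
    and "\<And>p q. P p \<Longrightarrow> P q \<Longrightarrow> P (p + q)" and "\<And>p q. P p \<Longrightarrow> P q \<Longrightarrow> P (p * q)"
  shows "P (p :: 'k::field mpol)"
  by (rule polys_induct[of p "{1..n}" P]) (use assms in \<open>auto simp: polys_def\<close>)

lemmas mpol_induct [case_names const var add mult] = polys_induct[where S = UNIV, OF subset_UNIV]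

lemma polys_cst [simp]: "cst c \<in> polys n"
  by (simp add: polys_def cst_def)

lemma polys_0 [simp]: "0 \<in> polys n" and polys_1 [simp]: "1 \<in> polys n"
  using polys_cst[of 0 n] polys_cst[of 1 n] by simp_all

lemma polys_pvar [simp]: "k \<in> {1..n} \<Longrightarrow> pvar k \<in> polys n"
  by (simp add: polys_def pvar_def)

lemma polys_add: "p \<in> polys n \<Longrightarrow> q \<in> polys n \<Longrightarrow> p + q \<in> polys n"
  using keys_add[of p q] by (auto simp: polys_def)

lemma polys_mult:
  assumes "p \<in> polys n" "q \<in> polys n"
  shows "p * q \<in> polys n"
  unfolding polys_def
proof (intro CollectI ballI)
  fix m
  assume "m \<in> Poly_Mapping.keys (p * q)"
  then obtain a b where "a \<in> Poly_Mapping.keys p" "b \<in> Poly_Mapping.keys q" "m = a + b"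
    using keys_mult[of p q] by auto
  then show "Poly_Mapping.keys m \<subseteq> {1..n}"
    using assms keys_add[of a b] unfolding polys_def by blast
qed

lemma polys_uminus: "p \<in> polys n \<Longrightarrow> - p \<in> polys n"
  by (simp add: polys_def)

lemma polys_diff: "p \<in> polys n \<Longrightarrow> q \<in> polys n \<Longrightarrow> p - q \<in> polys n"
  using polys_add[of p n "- q"] by (simp add: polys_uminus)

lemma polys_power: "p \<in> polys n \<Longrightarrow> p ^ k \<in> polys n"
  by (induction k) (simp_all add: polys_mult)

lemma polys_prod: "(\<And>x. x \<in> A \<Longrightarrow> f x \<in> polys n) \<Longrightarrow> prod f A \<in> polys n"
  by (induction A rule: infinite_finite_induct) (simp_all add: polys_mult)

lemma polys_sum: "(\<And>x. x \<in> A \<Longrightarrow> f x \<in> polys n) \<Longrightarrow> sum f A \<in> polys n"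
  by (induction A rule: infinite_finite_induct) (simp_all add: polys_add)

lemma pvar_eq_iff [simp]: "pvar r = (pvar s :: 'k::field mpol) \<longleftrightarrow> r = s"
  by (metis One_nat_def lookup_single_eq lookup_single_not_eq one_neq_zero pvar_def)

lemma pvar_nonzero [simp]: "pvar r \<noteq> (0 :: 'k::field mpol)"
  by (metis lookup_single_eq lookup_zero one_neq_zero pvar_def)

lemma comm_ring_hom_cst: "comm_ring_hom (cst :: 'k::field \<Rightarrow> 'm::comm_monoid_add \<Rightarrow>\<^sub>0 'k)"
  by standard (simp_all add: cst_add cst_mult)

lemma comm_ring_hom_comp:
  "comm_ring_hom f \<Longrightarrow> comm_ring_hom g \<Longrightarrow> comm_ring_hom (\<lambda>x. f (g x))"
proof -
  assume "comm_ring_hom f" "comm_ring_hom g"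
  then interpret f: comm_ring_hom f + g: comm_ring_hom g .
  show ?thesis
    by standard (simp_all add: f.hom_add g.hom_add f.hom_mult g.hom_mult)
qed

text \<open>Uniqueness in the universal property of the polynomial ring: identities between
  substitutions are checked on constants and variables.\<close>

lemma comm_ring_hom_mpol_eqI:
  assumes f: "comm_ring_hom (f :: 'k::field mpol \<Rightarrow> 'r::comm_ring_1)" and g: "comm_ring_hom g"
    and "\<And>c. f (cst c) = g (cst c)" "\<And>k. f (pvar k) = g (pvar k)"
  shows "f p = g p"
proof -
  interpret f: comm_ring_hom f by fact
  interpret g: comm_ring_hom g by fact
  show ?thesis
    by (induction p rule: mpol_induct) (simp_all add: assms f.hom_add g.hom_add f.hom_mult g.hom_mult)
qed

definition mono_eval :: "(nat \<Rightarrow> 'r::comm_ring_1) \<Rightarrow> (nat \<Rightarrow>\<^sub>0 nat) \<Rightarrow> 'r" where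
  "mono_eval \<rho> m = (\<Prod>k\<in>Poly_Mapping.keys m. \<rho> k ^ Poly_Mapping.lookup m k)"

lemma mono_eval_superset:
  "finite A \<Longrightarrow> Poly_Mapping.keys m \<subseteq> A \<Longrightarrow> mono_eval \<rho> m = (\<Prod>k\<in>A. \<rho> k ^ Poly_Mapping.lookup m k)"
  unfolding mono_eval_def by (rule prod.mono_neutral_left) (auto simp: in_keys_iff)

lemma mono_eval_add: "mono_eval \<rho> (m + m') = mono_eval \<rho> m * mono_eval \<rho> m'"
proof -
  let ?A = "Poly_Mapping.keys m \<union> Poly_Mapping.keys m'"
  have "mono_eval \<rho> (m + m') = (\<Prod>k\<in>?A. \<rho> k ^ Poly_Mapping.lookup (m + m') k)"
    by (rule mono_eval_superset) (auto simp: keys_add)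
  also have "\<dots> = mono_eval \<rho> m * mono_eval \<rho> m'"
    by (subst (1 2) mono_eval_superset[of ?A]) (auto simp: lookup_add power_add prod.distrib)
  finally show ?thesis .
qed

lemma mono_eval_0 [simp]: "mono_eval \<rho> 0 = 1"
  and mono_eval_single [simp]: "mono_eval \<rho> (Poly_Mapping.single k (Suc 0)) = \<rho> k"
  by (simp_all add: mono_eval_def)

text \<open>The target is left open because two are used: polynomials in an extra variable for
  \<open>expand\<close>, and \<open>mpol\<close> itself for the back substitution in
  \<open>expand_eq_0D\<close>.\<close>

definition mp_eval :: "('k::field \<Rightarrow> 'r::comm_ring_1) \<Rightarrow> (nat \<Rightarrow> 'r) \<Rightarrow> 'k mpol \<Rightarrow> 'r" where
  "mp_eval \<phi> \<rho> = lin_ext (\<lambda>m c. \<phi> c * mono_eval \<rho> m)"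

context
  fixes \<phi> :: "'k::field \<Rightarrow> 'r::comm_ring_1"
  assumes hom: "comm_ring_hom \<phi>"
begin

interpretation comm_ring_hom \<phi> by (rule hom)

interpretation additive_family "\<lambda>m c. \<phi> c * mono_eval \<rho> m" for \<rho>
  by standard (simp add: hom_add distrib_right)

lemma mp_eval_cst [simp]: "mp_eval \<phi> \<rho> (cst c) = \<phi> c"
  by (simp add: mp_eval_def cst_def)

lemma mp_eval_pvar [simp]: "mp_eval \<phi> \<rho> (pvar k) = \<rho> k"
  by (simp add: mp_eval_def pvar_def)

lemma comm_ring_hom_mp_eval: "comm_ring_hom (mp_eval \<phi> \<rho>)"
proof
  show "mp_eval \<phi> \<rho> 0 = 0" by (simp add: mp_eval_def)
  show "mp_eval \<phi> \<rho> 1 = 1" using mp_eval_cst[of \<rho> 1] by simp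
  show add: "mp_eval \<phi> \<rho> (p + q) = mp_eval \<phi> \<rho> p + mp_eval \<phi> \<rho> q" for p q
    by (simp add: mp_eval_def lin_ext_add)
  have single: "mp_eval \<phi> \<rho> (Poly_Mapping.single m c * q)
      = mp_eval \<phi> \<rho> (Poly_Mapping.single m c) * mp_eval \<phi> \<rho> q" for m c q
    by (induction q rule: poly_mapping_additive_induct)
      (simp_all add: add distrib_left, simp add: mp_eval_def mult_single mono_eval_add hom_mult ac_simps)
  show "mp_eval \<phi> \<rho> (p * q) = mp_eval \<phi> \<rho> p * mp_eval \<phi> \<rho> q" for p q
    by (induction p rule: poly_mapping_additive_induct) (simp_all add: single add distrib_right)
qed

end


section \<open>Rational functions\<close>

lemma comm_ring_hom_perm_poly:
  assumes "bij w"
  shows "comm_ring_hom (perm_poly w :: 'k::field mpol \<Rightarrow> _)"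
proof
  show "perm_poly w (p + q) = perm_poly w p + perm_poly w q" for p q :: "'k mpol"
    by (rule perm_poly_add[OF assms])
  show "perm_poly w (p * q) = perm_poly w p * perm_poly w q" for p q :: "'k mpol"
    by (rule perm_poly_mult[OF assms])
  show "perm_poly w (0 :: 'k mpol) = 0"
    by (simp add: perm_poly_def map_key_surj_inj[OF assms])
  show "perm_poly w (1 :: 'k mpol) = 1"
    using perm_poly_single[OF assms, of 0 "1 :: 'k"] map_key_zero[of w] assms
    by (simp add: bij_is_inj)
qed

lemma perm_poly_cst [simp]: "bij w \<Longrightarrow> perm_poly w (cst c) = (cst c :: 'k::field mpol)"
  using perm_poly_single[of w 0 c] map_key_zero[of w] by (simp add: cst_def bij_is_inj)

lemma polys_perm_poly:
  assumes "w permutes {1..n}" and p: "p \<in> polys n"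
  shows "perm_poly w p \<in> polys n"
proof -
  have w: "bij w" using assms(1) by (rule permutes_bij)
  show ?thesis
    using p
  proof (induction p rule: polys_n_induct)
    case (var k)
    then show ?case
      using permutes_in_image[OF assms(1)] by (simp add: perm_poly_pvar[OF w])
  qed (simp_all add: w perm_poly_add perm_poly_mult polys_add polys_mult)
qed

lemma perm_poly_comp:
  assumes "bij w" "bij w'"
  shows "perm_poly w (perm_poly w' p) = perm_poly (w \<circ> w') (p :: 'k::field mpol)"
proof (rule comm_ring_hom_mpol_eqI[where f = "\<lambda>p. perm_poly w (perm_poly w' p)"])
  show "comm_ring_hom (\<lambda>p. perm_poly w (perm_poly w' p) :: 'k mpol)"
    by (rule comm_ring_hom_comp[of "perm_poly w" "perm_poly w'"])
      (simp_all add: assms comm_ring_hom_perm_poly)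
  show "comm_ring_hom (perm_poly (w \<circ> w') :: 'k mpol \<Rightarrow> _)"
    by (rule comm_ring_hom_perm_poly) (simp add: assms bij_comp)
  have c: "bij (w \<circ> w')" by (simp add: assms bij_comp)
  show "perm_poly w (perm_poly w' (cst c)) = perm_poly (w \<circ> w') (cst c)" for c :: 'k
    using assms c by (simp del: comp_apply)
  show "perm_poly w (perm_poly w' (pvar k)) = perm_poly (w \<circ> w') (pvar k :: 'k mpol)" for k
    using assms by (simp only: perm_poly_pvar[OF c] perm_poly_pvar[OF assms(1)]
        perm_poly_pvar[OF assms(2)] comp_apply)
qed

definition emb :: "'k::field mpol \<Rightarrow> 'k ratfun" where
  "emb p = fract_of p 1"

lemma comm_ring_hom_emb: "comm_ring_hom (emb :: 'k::field mpol \<Rightarrow> _)"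
  by standard (simp_all add: emb_def Zero_fract_def One_fract_def)

global_interpretation emb: comm_ring_hom "emb :: 'k::field mpol \<Rightarrow> _"
  by (rule comm_ring_hom_emb)

lemma emb_eq_iff [simp]: "emb p = emb q \<longleftrightarrow> p = q"
  by (simp add: emb_def eq_fract)

lemma emb_eq_0_iff [simp]: "emb p = 0 \<longleftrightarrow> p = 0"
  using emb_eq_iff[of p 0] by (simp del: emb_eq_iff)

lemma fract_of_emb: "d \<noteq> 0 \<Longrightarrow> fract_of p d = emb p / emb d"
  by (simp add: emb_def divide_fract_def)

lemma ratfun_cases: obtains p d where "d \<noteq> 0" "f = emb p / emb d"
  by (cases f) (auto simp: fract_of_emb)

lemma tvar_emb: "tvar k = emb (pvar k)" and rat_const_emb: "rat_const c = emb (cst c)"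
  by (simp_all add: tvar_def rat_const_def emb_def)

lemma tvar_eq_iff [simp]: "tvar r = (tvar s :: 'k::field ratfun) \<longleftrightarrow> r = s"
  unfolding tvar_emb emb_eq_iff by (rule pvar_eq_iff)

lemma tvar_nonzero [simp]: "tvar r \<noteq> (0 :: 'k::field ratfun)"
  unfolding tvar_emb emb_eq_0_iff by (rule pvar_nonzero)

lemma rat_const_0 [simp]: "rat_const 0 = 0" and rat_const_1 [simp]: "rat_const 1 = 1"
  and rat_const_add: "rat_const (a + b) = rat_const a + rat_const b"
  and rat_const_mult: "rat_const (a * b) = rat_const a * rat_const b"
  by (simp_all add: rat_const_emb cst_add cst_mult emb.hom_add emb.hom_mult)

lemma rat_const_diff: "rat_const (a - b) = rat_const a - rat_const b"
  and rat_const_uminus: "rat_const (- a) = - rat_const a"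
  by (simp_all add: rat_const_emb cst_diff cst_uminus emb.hom_minus emb.hom_uminus)

context
  fixes w :: "nat \<Rightarrow> nat"
  assumes w: "bij w"
begin

interpretation pp: comm_ring_hom "perm_poly w :: 'k::field mpol \<Rightarrow> _"
  by (rule comm_ring_hom_perm_poly[OF w])

lemma perm_poly_eq_0_iff: "perm_poly w p = 0 \<longleftrightarrow> p = 0"
  using perm_poly_eq_0[OF w] by auto

lemma perm_rat_emb_divide:
  "d \<noteq> 0 \<Longrightarrow> perm_rat w (emb p / emb d) = emb (perm_poly w p) / emb (perm_poly w d)"
  using perm_rat_Fract[OF w, of d p] by (simp add: fract_of_emb perm_poly_eq_0_iff)

lemma perm_rat_emb: "perm_rat w (emb p) = emb (perm_poly w p)"
  using perm_rat_emb_divide[of 1 p] by simp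

lemma perm_rat_tvar [simp]: "perm_rat w (tvar k) = tvar (w k)"
  and perm_rat_const [simp]: "perm_rat w (rat_const c) = rat_const c"
  by (simp_all add: tvar_emb rat_const_emb perm_rat_emb perm_poly_pvar[OF w] w)

lemma perm_rat_0 [simp]: "perm_rat w 0 = 0" and perm_rat_1 [simp]: "perm_rat w 1 = 1"
  using perm_rat_emb[of 0] perm_rat_emb[of 1] by simp_all

lemma perm_rat_add: "perm_rat w (f + g) = perm_rat w f + perm_rat w g"
proof -
  obtain p d where d: "d \<noteq> 0" and f: "f = emb p / emb d" by (rule ratfun_cases)
  obtain p' d' where d': "d' \<noteq> 0" and g: "g = emb p' / emb d'" by (rule ratfun_cases)
  have "f + g = emb (p * d' + p' * d) / emb (d * d')"
    using d d' by (simp add: f g emb.hom_add emb.hom_mult field_simps)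
  moreover have "perm_rat w (emb (p * d' + p' * d) / emb (d * d'))
      = emb (perm_poly w (p * d' + p' * d)) / emb (perm_poly w (d * d'))"
    by (rule perm_rat_emb_divide) (simp add: d d')
  ultimately show ?thesis
    using d d' by (simp add: f g perm_rat_emb_divide perm_poly_eq_0_iff pp.hom_add pp.hom_mult
        emb.hom_add emb.hom_mult field_simps)
qed

lemma perm_rat_mult: "perm_rat w (f * g) = perm_rat w f * perm_rat w g"
proof -
  obtain p d where d: "d \<noteq> 0" and f: "f = emb p / emb d" by (rule ratfun_cases)
  obtain p' d' where d': "d' \<noteq> 0" and g: "g = emb p' / emb d'" by (rule ratfun_cases)
  have "f * g = emb (p * p') / emb (d * d')"
    using d d' by (simp add: f g emb.hom_mult)
  moreover have "perm_rat w (emb (p * p') / emb (d * d'))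
      = emb (perm_poly w (p * p')) / emb (perm_poly w (d * d'))"
    by (rule perm_rat_emb_divide) (simp add: d d')
  ultimately show ?thesis
    using d d' by (simp add: f g perm_rat_emb_divide pp.hom_mult emb.hom_mult)
qed

lemma perm_rat_uminus: "perm_rat w (- f) = - perm_rat w f"
  using perm_rat_add[of f "- f"] by (simp add: eq_neg_iff_add_eq_0 add.commute)

lemma perm_rat_diff: "perm_rat w (f - g) = perm_rat w f - perm_rat w g"
  using perm_rat_add[of f "- g"] by (simp add: perm_rat_uminus)

lemma perm_rat_inverse: "perm_rat w (inverse f) = inverse (perm_rat w f)"
proof (cases "f = 0")
  case False
  have "perm_rat w f * perm_rat w (inverse f) = 1"
    using False by (simp add: perm_rat_mult[symmetric])
  then show ?thesis by (metis inverse_unique)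
qed simp

lemma perm_rat_divide: "perm_rat w (f / g) = perm_rat w f / perm_rat w g"
  by (simp add: divide_inverse perm_rat_mult perm_rat_inverse)

end

lemma perm_rat_comp:
  assumes "bij w" "bij w'"
  shows "perm_rat w (perm_rat w' f) = perm_rat (w \<circ> w') f"
proof -
  obtain p d where d: "d \<noteq> 0" and f: "f = emb p / emb d" by (rule ratfun_cases)
  then show ?thesis
    using assms by (simp add: f perm_rat_emb_divide perm_poly_eq_0_iff perm_poly_comp bij_comp)
qed

lemma perm_rat_id: "perm_rat id f = f"
proof -
  have pp: "perm_poly id p = p" for p :: "'a mpol"
  proof (rule comm_ring_hom_mpol_eqI[where f = "perm_poly id"])
    show "comm_ring_hom (perm_poly id :: 'a mpol \<Rightarrow> _)"
      by (rule comm_ring_hom_perm_poly) simp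
    show "comm_ring_hom (\<lambda>p :: 'a mpol. p)" by standard auto
    show "perm_poly id (cst c) = cst c" for c :: 'a by (rule perm_poly_cst) simp
    show "perm_poly id (pvar k) = pvar k" for k using perm_poly_pvar[of id k] by simp
  qed
  show ?thesis
    by (rule ratfun_cases[of f]) (simp add: perm_rat_emb_divide pp)
qed

section \<open>Two-sided ideals of the free algebra\<close>

text \<open>Type class counterpart of \<open>genideal\<close>. Its induction rule is what transports
  the defining relations through the quotient maps and through the action.\<close>

inductive_set two_sided :: "'r::ring_1 set \<Rightarrow> 'r set" for S where
  base: "x \<in> S \<Longrightarrow> x \<in> two_sided S"
| zero: "0 \<in> two_sided S"
| add: "x \<in> two_sided S \<Longrightarrow> y \<in> two_sided S \<Longrightarrow> x + y \<in> two_sided S"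
| lmult: "x \<in> two_sided S \<Longrightarrow> a * x \<in> two_sided S"
| rmult: "x \<in> two_sided S \<Longrightarrow> x * a \<in> two_sided S"

lemma two_sided_mono:
  assumes "S \<subseteq> S'" "x \<in> two_sided S"
  shows "x \<in> two_sided S'"
  using assms(2) by induction (use assms(1) in \<open>auto intro: two_sided.intros\<close>)

lemma two_sided_uminus: "x \<in> two_sided S \<Longrightarrow> - x \<in> two_sided S"
  using two_sided.lmult[of x S "- 1"] by simp

lemma two_sided_diff: "x \<in> two_sided S \<Longrightarrow> y \<in> two_sided S \<Longrightarrow> x - y \<in> two_sided S"
  using two_sided.add[OF _ two_sided_uminus] by fastforce

lemma two_sided_sum: "(\<And>x. x \<in> A \<Longrightarrow> f x \<in> two_sided S) \<Longrightarrow> sum f A \<in> two_sided S"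
  by (induction A rule: infinite_finite_induct) (auto intro: two_sided.intros)

text \<open>Working in the total free algebra, with all generators, keeps ring normalization available.\<close>

definition congr :: "'r::ring_1 set \<Rightarrow> 'r \<Rightarrow> 'r \<Rightarrow> bool" where
  "congr S x y \<longleftrightarrow> x - y \<in> two_sided S"

lemma congr_refl [simp]: "congr S x x"
  by (simp add: congr_def two_sided.zero)

lemma congr_sym: "congr S x y \<Longrightarrow> congr S y x"
  unfolding congr_def using two_sided_uminus by fastforce

lemma congr_trans [trans]: "congr S x y \<Longrightarrow> congr S y z \<Longrightarrow> congr S x z"
  unfolding congr_def using two_sided.add by fastforce

lemma congr_eq_trans [trans]: "congr S x y \<Longrightarrow> y = z \<Longrightarrow> congr S x z"
  and eq_congr_trans [trans]: "x = y \<Longrightarrow> congr S y z \<Longrightarrow> congr S x z"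
  by simp_all

lemma congr_add: "congr S x y \<Longrightarrow> congr S x' y' \<Longrightarrow> congr S (x + x') (y + y')"
  unfolding congr_def using two_sided.add by (fastforce simp: algebra_simps)

lemma congr_diff: "congr S x y \<Longrightarrow> congr S x' y' \<Longrightarrow> congr S (x - x') (y - y')"
  unfolding congr_def using two_sided_diff by (fastforce simp: algebra_simps)

lemma congr_mult:
  assumes "congr S x y" "congr S x' y'"
  shows "congr S (x * x') (y * y')"
proof -
  have "(x - y) * x' + y * (x' - y') \<in> two_sided S"
    using assms unfolding congr_def by (intro two_sided.add[OF two_sided.rmult two_sided.lmult])
  then show ?thesis by (simp add: congr_def algebra_simps)
qed

lemma congr_sum: "(\<And>x. x \<in> A \<Longrightarrow> congr S (f x) (g x)) \<Longrightarrow> congr S (sum f A) (sum g A)"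
  unfolding congr_def by (auto simp: sum_subtractf[symmetric] intro: two_sided_sum)

lemma congr_mono: "S \<subseteq> S' \<Longrightarrow> congr S x y \<Longrightarrow> congr S' x y"
  unfolding congr_def by (rule two_sided_mono)

lemma congr_0_iff: "congr S x 0 \<longleftrightarrow> x \<in> two_sided S"
  by (simp add: congr_def)

lemma congr_diff_0_iff: "congr S (x - y) 0 \<longleftrightarrow> congr S x y"
  by (simp add: congr_def)

text \<open>Letters foreign to the setting are set to zero, so the total free algebra modulo these
  relations is still the affine algebra.\<close>

definition hrels :: "'k::field setting \<Rightarrow> nat \<Rightarrow> 'k free set" where
  "hrels st n = hecke_rels st n \<union> gen_elt ` (- hecke_gens st n)"

definition cycrels :: "'k::field setting \<Rightarrow> nat \<Rightarrow> int multiset \<Rightarrow> 'k free set" where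
  "cycrels st n \<Lambda> = {prod_list (map (\<lambda>\<kappa>. X\<^sub>g 1 - cst (residue_val st \<kappa>)) ks) | ks.
     mset ks = \<Lambda> \<and> n \<ge> 1}"

abbreviation crels :: "'k::field setting \<Rightarrow> nat \<Rightarrow> int multiset \<Rightarrow> 'k free set" where
  "crels st n \<Lambda> \<equiv> hrels st n \<union> cycrels st n \<Lambda>"


section \<open>The cyclotomic algebras as quotients of the free algebra\<close>

definition words_in :: "gen set \<Rightarrow> 'k::field free set" where
  "words_in G = {p. \<forall>w\<in>Poly_Mapping.keys p. set w \<subseteq> G}"

lemma words_in_cst [simp]: "cst c \<in> words_in G"
  by (simp add: words_in_def cst_def zero_list_def)

lemma words_in_0 [simp]: "0 \<in> words_in G" and words_in_1 [simp]: "1 \<in> words_in G"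
  using words_in_cst[of 0 G] words_in_cst[of 1 G] by simp_all

lemma words_in_gen_elt [simp]: "gen_elt g \<in> words_in G \<longleftrightarrow> g \<in> G"
  by (simp add: words_in_def gen_elt_def)

lemma words_in_add: "p \<in> words_in G \<Longrightarrow> q \<in> words_in G \<Longrightarrow> p + q \<in> words_in G"
  using keys_add[of p q] by (auto simp: words_in_def)

lemma words_in_uminus: "p \<in> words_in G \<Longrightarrow> - p \<in> words_in G"
  by (simp add: words_in_def)

lemma words_in_diff: "p \<in> words_in G \<Longrightarrow> q \<in> words_in G \<Longrightarrow> p - q \<in> words_in G"
  using words_in_add[of p G "- q"] by (simp add: words_in_uminus)

lemma words_in_mult:
  assumes "p \<in> words_in G" "q \<in> words_in G"
  shows "p * q \<in> words_in G"
  unfolding words_in_def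
proof (intro CollectI ballI)
  fix w
  assume "w \<in> Poly_Mapping.keys (p * q)"
  then obtain a b where "a \<in> Poly_Mapping.keys p" "b \<in> Poly_Mapping.keys q" "w = a @ b"
    using keys_mult[of p q] by (auto simp: plus_list_def)
  then show "set w \<subseteq> G"
    using assms unfolding words_in_def by auto
qed

lemma words_in_prod_list: "(\<And>p. p \<in> set ps \<Longrightarrow> p \<in> words_in G) \<Longrightarrow> prod_list ps \<in> words_in G"
  by (induction ps) (simp_all add: words_in_mult)

lemmas words_in_intros = words_in_add words_in_diff words_in_mult

lemma free_alg_simps [simp]:
  "carrier (free_alg G) = words_in G" "x \<otimes>\<^bsub>free_alg G\<^esub> y = x * y" "x \<oplus>\<^bsub>free_alg G\<^esub> y = x + y"
  "\<one>\<^bsub>free_alg G\<^esub> = 1" "\<zero>\<^bsub>free_alg G\<^esub> = 0"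
  by (simp_all add: free_alg_def words_in_def)

lemma ring_free_alg: "ring (free_alg G)"
proof (rule ringI)
  show "abelian_group (free_alg G)"
    by (rule abelian_groupI)
      (auto simp: words_in_intros algebra_simps intro!: bexI[of _ "- x" for x] words_in_uminus)
  show "Group.monoid (free_alg G)"
    by standard (auto simp: words_in_intros mult.assoc)
qed (auto simp: algebra_simps)

lemma free_alg_minus [simp]:
  assumes "x \<in> words_in G" "y \<in> words_in G"
  shows "x \<ominus>\<^bsub>free_alg G\<^esub> y = x - y"
proof -
  interpret ring "free_alg G" by (rule ring_free_alg)
  have "\<ominus>\<^bsub>free_alg G\<^esub> y = - y"
    using assms by (intro minus_equality) (simp_all add: words_in_uminus)
  then show ?thesis by (simp add: a_minus_def)
qed

lemma hecke_rels_words: "hecke_rels st n \<subseteq> words_in (hecke_gens st n)"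
proof (cases st)
  case (NonDeg q)
  then show ?thesis
    by (auto simp: common_rels_def intro!: words_in_intros)
next
  case Deg
  then show ?thesis
    by (auto simp: common_rels_def intro!: words_in_intros)
qed

text \<open>The retraction of the total free algebra onto the words over \<open>G\<close>: a word
  with a foreign letter goes to 0. It is multiplicative, and modulo \<open>hrels\<close> it is the
  identity, since a foreign letter puts its word into the ideal.\<close>

definition restrict_words :: "gen set \<Rightarrow> 'k::field free \<Rightarrow> 'k free" where
  "restrict_words G = lin_ext (\<lambda>w c. if set w \<subseteq> G then Poly_Mapping.single w c else 0)"

global_interpretation restrict_words:
  additive_family "\<lambda>w (c :: 'k::field). if set w \<subseteq> G then Poly_Mapping.single w c else 0" for G
  by unfold_locales (simp_all add: single_add)

lemma restrict_words_add: "restrict_words G (p + q) = restrict_words G p + restrict_words G q"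
  by (simp add: restrict_words_def restrict_words.lin_ext_add)

lemma restrict_words_0: "restrict_words G 0 = 0"
  by (simp add: restrict_words_def)

lemma restrict_words_single [simp]:
  "restrict_words G (Poly_Mapping.single w c) = (if set w \<subseteq> G then Poly_Mapping.single w c else 0)"
  by (simp add: restrict_words_def)

lemma restrict_words_mult: "restrict_words G (p * q) = restrict_words G p * restrict_words G q"
proof (induction p rule: poly_mapping_additive_induct)
  case (single m c)
  show ?case
    by (induction q rule: poly_mapping_additive_induct)
      (auto simp: mult_single plus_list_def restrict_words_add distrib_left)
qed (simp add: distrib_right restrict_words_add)

lemma restrict_words_id: "p \<in> words_in G \<Longrightarrow> restrict_words G p = p"
proof -
  assume p: "p \<in> words_in G"
  have "restrict_words G p = (\<Sum>w\<in>Poly_Mapping.keys p. Poly_Mapping.single w (Poly_Mapping.lookup p w))"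
    unfolding restrict_words_def lin_ext_def using p by (intro sum.cong) (auto simp: words_in_def)
  then show ?thesis using poly_mapping_sum_singles[of p] by simp
qed

lemma restrict_words_in: "restrict_words G p \<in> words_in G"
  by (induction p rule: poly_mapping_additive_induct)
    (simp_all add: restrict_words_add words_in_add, auto simp: words_in_def)

lemma gen_elt_Cons: "Poly_Mapping.single (g # w) c = gen_elt g * Poly_Mapping.single w c"
  by (simp add: gen_elt_def mult_single plus_list_def)

lemma restrict_words_congr: "congr (hrels st n) (restrict_words (hecke_gens st n) p) p"
proof (induction p rule: poly_mapping_additive_induct)
  case (single w c)
  have "Poly_Mapping.single w c \<in> two_sided (hrels st n)" if "\<not> set w \<subseteq> hecke_gens st n"
    using that
  proof (induction w)
    case (Cons g w)
    show ?case
    proof (cases "g \<in> hecke_gens st n")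
      case True
      then show ?thesis using Cons by (auto simp: gen_elt_Cons intro: two_sided.lmult)
    next
      case False
      then have "gen_elt g \<in> two_sided (hrels st n)"
        by (auto simp: hrels_def intro: two_sided.base)
      then show ?thesis by (auto simp: gen_elt_Cons intro: two_sided.rmult)
    qed
  qed simp
  then show ?case by (auto simp: congr_def intro: two_sided_uminus two_sided.zero)
qed (simp add: restrict_words_add congr_add)

context
  fixes R (structure) and I
  assumes I: "ideal I R"
begin

interpretation ideal I R by (rule I)

lemma quot_class_surj: "a \<in> carrier (R Quot I) \<Longrightarrow> \<exists>x\<in>carrier R. a = I +> x"
  by (auto simp: FactRing_def A_RCOSETS_def')

lemma quot_class_eq_iff:
  "x \<in> carrier R \<Longrightarrow> y \<in> carrier R \<Longrightarrow> I +> x = I +> y \<longleftrightarrow> x \<ominus> y \<in> I"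
  using quotient_eq_iff_same_a_r_cos[OF I] by blast

end

context
  fixes st :: "'k::field setting" and n :: nat
begin

abbreviation "FG \<equiv> free_alg (hecke_gens st n) :: 'k free ring"

interpretation F: ring FG by (rule ring_free_alg)

lemma ideal_hecke_ideal: "ideal (hecke_ideal st n) FG"
  unfolding hecke_ideal_def using hecke_rels_words by (intro F.genideal_ideal) simp

lemma ring_affine_hecke: "ring (affine_hecke st n)"
  unfolding affine_hecke_def by (rule ideal.quotient_is_ring[OF ideal_hecke_ideal])

lemma aff_class_hom: "aff_class st n \<in> Ring.ring_hom FG (affine_hecke st n)"
  using ideal.rcos_ring_hom[OF ideal_hecke_ideal]
  by (simp add: aff_class_def[abs_def] affine_hecke_def)

interpretation A: ring "affine_hecke st n" by (rule ring_affine_hecke)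

lemma cyc_gens_closed:
  "{aff_class st n (prod_list (map (\<lambda>\<kappa>. X\<^sub>g 1 - cst (residue_val st \<kappa>)) ks)) | ks.
     mset ks = \<Lambda> \<and> n \<ge> 1} \<subseteq> carrier (affine_hecke st n)"
proof clarify
  fix ks :: "int list"
  assume "1 \<le> n"
  then have "gX 1 \<in> hecke_gens st n" by (cases st) auto
  then have "prod_list (map (\<lambda>\<kappa>. X\<^sub>g 1 - cst (residue_val st \<kappa>)) ks) \<in> carrier FG"
    by (auto intro!: words_in_prod_list words_in_diff)
  then show "aff_class st n (prod_list (map (\<lambda>\<kappa>. X\<^sub>g 1 - cst (residue_val st \<kappa>)) ks))
      \<in> carrier (affine_hecke st n)"
    by (rule ring_hom_closed[OF aff_class_hom])
qed

lemma ideal_cyclotomic_ideal: "ideal (cyclotomic_ideal st n \<Lambda>) (affine_hecke st n)"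
  unfolding cyclotomic_ideal_def by (rule A.genideal_ideal[OF cyc_gens_closed])

lemma ring_cyclotomic_hecke: "ring (cyclotomic_hecke st n \<Lambda>)"
  unfolding cyclotomic_hecke_def by (rule ideal.quotient_is_ring[OF ideal_cyclotomic_ideal])

lemma cyc_class_hom: "cyc_class st n \<Lambda> \<in> Ring.ring_hom FG (cyclotomic_hecke st n \<Lambda>)"
proof -
  have "(a_r_coset (affine_hecke st n) (cyclotomic_ideal st n \<Lambda>)) \<circ> aff_class st n
      \<in> Ring.ring_hom FG (cyclotomic_hecke st n \<Lambda>)"
    by (rule ring_hom_trans[OF aff_class_hom])
      (simp add: cyclotomic_hecke_def ideal.rcos_ring_hom[OF ideal_cyclotomic_ideal])
  then show ?thesis by (simp add: cyc_class_def[abs_def] comp_def)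
qed

text \<open>The class map of the cyclotomic algebra, extended to the total free algebra so that it
  is defined and multiplicative everywhere.\<close>

definition kap :: "int multiset \<Rightarrow> 'k free \<Rightarrow> 'k free set set" where
  "kap \<Lambda> p = cyc_class st n \<Lambda> (restrict_words (hecke_gens st n) p)"

lemma kap_words: "p \<in> words_in (hecke_gens st n) \<Longrightarrow> kap \<Lambda> p = cyc_class st n \<Lambda> p"
  by (simp add: kap_def restrict_words_id)

lemma kap_closed: "kap \<Lambda> p \<in> carrier (cyclotomic_hecke st n \<Lambda>)"
  unfolding kap_def by (rule ring_hom_closed[OF cyc_class_hom]) (simp add: restrict_words_in)

lemma kap_add: "kap \<Lambda> (p + q) = kap \<Lambda> p \<oplus>\<^bsub>cyclotomic_hecke st n \<Lambda>\<^esub> kap \<Lambda> q"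
  unfolding kap_def restrict_words_add
  using ring_hom_add[OF cyc_class_hom] by (simp add: restrict_words_in)

lemma kap_mult: "kap \<Lambda> (p * q) = kap \<Lambda> p \<otimes>\<^bsub>cyclotomic_hecke st n \<Lambda>\<^esub> kap \<Lambda> q"
  unfolding kap_def restrict_words_mult
  using ring_hom_mult[OF cyc_class_hom] by (simp add: restrict_words_in)

lemma kap_1: "kap \<Lambda> 1 = \<one>\<^bsub>cyclotomic_hecke st n \<Lambda>\<^esub>"
  using ring_hom_one[OF cyc_class_hom] by (simp add: kap_words)

lemma kap_0: "kap \<Lambda> 0 = \<zero>\<^bsub>cyclotomic_hecke st n \<Lambda>\<^esub>"
  using ring_hom_zero[OF cyc_class_hom F.ring_axioms ring_cyclotomic_hecke] by (simp add: kap_words)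

lemma kap_surj:
  assumes "a \<in> carrier (cyclotomic_hecke st n \<Lambda>)"
  shows "\<exists>p\<in>words_in (hecke_gens st n). a = kap \<Lambda> p"
proof -
  obtain b where b: "b \<in> carrier (affine_hecke st n)"
    "a = a_r_coset (affine_hecke st n) (cyclotomic_ideal st n \<Lambda>) b"
    using quot_class_surj[OF ideal_cyclotomic_ideal] assms unfolding cyclotomic_hecke_def by blast
  obtain p where "p \<in> carrier FG" "b = aff_class st n p"
    using quot_class_surj[OF ideal_hecke_ideal] b(1) unfolding affine_hecke_def aff_class_def by blast
  then show ?thesis using b(2) by (auto simp: kap_words cyc_class_def)
qed

lemma kap_two_sided:
  assumes "p \<in> two_sided (crels st n \<Lambda>)"
  shows "kap \<Lambda> p = \<zero>\<^bsub>cyclotomic_hecke st n \<Lambda>\<^esub>"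
  using assms
proof (induction p rule: two_sided.induct)
  case (base p)
  have class0: "cyc_class st n \<Lambda> p = \<zero>\<^bsub>cyclotomic_hecke st n \<Lambda>\<^esub>"
    if "aff_class st n p \<in> cyclotomic_ideal st n \<Lambda>" for p
    using that A.a_coset_join2[OF _ additive_subgroup.a_subgroup[OF ideal.axioms(1)[OF ideal_cyclotomic_ideal]]]
      additive_subgroup.a_Hcarr[OF ideal.axioms(1)[OF ideal_cyclotomic_ideal]]
    by (simp add: cyc_class_def cyclotomic_hecke_def FactRing_def)
  consider "p \<in> hecke_rels st n" | g where "p = gen_elt g" "g \<notin> hecke_gens st n" | "p \<in> cycrels st n \<Lambda>"
    using base by (auto simp: hrels_def)
  then show ?case
  proof cases
    case 1
    then have p: "p \<in> words_in (hecke_gens st n)" using hecke_rels_words by blast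
    have "p \<in> hecke_ideal st n"
      unfolding hecke_ideal_def using 1 hecke_rels_words
      by (intro set_mp[OF F.genideal_self]) simp_all
    then have "aff_class st n p = \<zero>\<^bsub>affine_hecke st n\<^esub>"
      using F.a_coset_join2[OF _ additive_subgroup.a_subgroup[OF ideal.axioms(1)[OF ideal_hecke_ideal]]] p
      by (simp add: aff_class_def affine_hecke_def FactRing_def)
    then have "aff_class st n p \<in> cyclotomic_ideal st n \<Lambda>"
      by (simp add: additive_subgroup.zero_closed[OF ideal.axioms(1)[OF ideal_cyclotomic_ideal]])
    then show ?thesis using class0 p by (simp add: kap_words)
  next
    case 2
    then have "restrict_words (hecke_gens st n) p = 0"
      by (simp add: gen_elt_def)
    then show ?thesis using kap_0 by (simp add: kap_def restrict_words_0)
  next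
    case 3
    then obtain ks where ks: "p = prod_list (map (\<lambda>\<kappa>. X\<^sub>g 1 - cst (residue_val st \<kappa>)) ks)"
      "mset ks = \<Lambda>" "1 \<le> n"
      by (auto simp: cycrels_def)
    then have "gX 1 \<in> hecke_gens st n" by (cases st) auto
    then have "p \<in> words_in (hecke_gens st n)"
      by (auto simp: ks(1) intro!: words_in_prod_list words_in_diff)
    moreover have "aff_class st n p \<in> cyclotomic_ideal st n \<Lambda>"
      unfolding cyclotomic_ideal_def using ks by (intro set_mp[OF A.genideal_self[OF cyc_gens_closed]]) auto
    ultimately show ?thesis using class0 by (simp add: kap_words)
  qed
next
  case zero
  show ?case by (rule kap_0)
next
  case (add x y)
  interpret C: ring "cyclotomic_hecke st n \<Lambda>" by (rule ring_cyclotomic_hecke)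
  show ?case using add by (simp add: kap_add)
next
  case (lmult x a)
  interpret C: ring "cyclotomic_hecke st n \<Lambda>" by (rule ring_cyclotomic_hecke)
  show ?case using lmult by (simp add: kap_mult kap_closed)
next
  case (rmult x a)
  interpret C: ring "cyclotomic_hecke st n \<Lambda>" by (rule ring_cyclotomic_hecke)
  show ?case using rmult by (simp add: kap_mult kap_closed)
qed

text \<open>Minimality of \<open>genideal\<close>: the inductive ideal, cut down to the admissible
  words, is an ideal of \<open>FG\<close> that contains the relations.\<close>

lemma hecke_ideal_two_sided: "hecke_ideal st n \<subseteq> two_sided (hrels st n)"
proof -
  let ?I = "two_sided (hrels st n) \<inter> words_in (hecke_gens st n)"
  have "ideal ?I FG"
  proof (rule idealI[OF ring_free_alg])
    show "subgroup ?I (add_monoid FG)"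
    proof (rule group.subgroupI[OF F.a_group])
      fix a
      assume a: "a \<in> ?I"
      then have "\<ominus>\<^bsub>FG\<^esub> a = - a"
        by (intro F.minus_equality) (simp_all add: words_in_uminus)
      then have "inv\<^bsub>add_monoid FG\<^esub> a = - a" unfolding a_inv_def .
      then show "inv\<^bsub>add_monoid FG\<^esub> a \<in> ?I"
        using a by (metis IntD1 IntD2 IntI two_sided_uminus words_in_uminus)
    next
      show "?I \<noteq> {}" using two_sided.zero words_in_0 by blast
    qed (auto intro: two_sided.add words_in_add)
  qed (auto intro: two_sided.lmult two_sided.rmult words_in_mult)
  moreover have "hecke_rels st n \<subseteq> ?I"
    using hecke_rels_words by (auto simp: hrels_def intro: two_sided.base)
  ultimately have "hecke_ideal st n \<subseteq> ?I"
    unfolding hecke_ideal_def by (rule F.genideal_minimal)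
  then show ?thesis by blast
qed

text \<open>Minimality again, one quotient further up: the class map is onto, so the image of the
  inductive ideal is an ideal of the affine algebra.\<close>

lemma cyclotomic_ideal_two_sided:
  "cyclotomic_ideal st n \<Lambda> \<subseteq> aff_class st n ` (two_sided (crels st n \<Lambda>) \<inter> words_in (hecke_gens st n))"
proof -
  let ?P = "two_sided (crels st n \<Lambda>) \<inter> words_in (hecke_gens st n)"
  let ?I = "aff_class st n ` ?P"
  interpret h: ring_hom_ring FG "affine_hecke st n" "aff_class st n"
    by (rule ring_hom_ringI2[OF ring_free_alg ring_affine_hecke aff_class_hom])
  have surj: "\<exists>p\<in>words_in (hecke_gens st n). x = aff_class st n p" if "x \<in> carrier (affine_hecke st n)" for x
    using quot_class_surj[OF ideal_hecke_ideal] that unfolding affine_hecke_def aff_class_def by simp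
  have "ideal ?I (affine_hecke st n)"
  proof (rule idealI[OF ring_affine_hecke])
    show "subgroup ?I (add_monoid (affine_hecke st n))"
    proof (rule group.subgroupI[OF A.a_group])
      show "?I \<subseteq> carrier (add_monoid (affine_hecke st n))" by auto
      show "?I \<noteq> {}" using two_sided.zero words_in_0 by blast
      fix a b
      assume "a \<in> ?I"
      then obtain p where p: "p \<in> ?P" "a = aff_class st n p" by blast
      have "\<ominus>\<^bsub>FG\<^esub> p = - p"
        using p by (intro F.minus_equality) (simp_all add: words_in_uminus)
      then have "\<ominus>\<^bsub>affine_hecke st n\<^esub> a = aff_class st n (- p)"
        using p h.hom_a_inv[of p] by simp
      then have "inv\<^bsub>add_monoid (affine_hecke st n)\<^esub> a = aff_class st n (- p)"
        unfolding a_inv_def .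
      moreover have "- p \<in> ?P" using p by (simp add: two_sided_uminus words_in_uminus)
      ultimately show "inv\<^bsub>add_monoid (affine_hecke st n)\<^esub> a \<in> ?I" by (metis imageI)
      assume "b \<in> ?I"
      then obtain q where q: "q \<in> ?P" "b = aff_class st n q" by blast
      have "a \<oplus>\<^bsub>affine_hecke st n\<^esub> b = aff_class st n (p + q)"
        using p q h.hom_add[of p q] by simp
      then show "a \<otimes>\<^bsub>add_monoid (affine_hecke st n)\<^esub> b \<in> ?I"
        using p q by (auto intro!: imageI two_sided.add words_in_add)
    qed
    fix a x
    assume "a \<in> ?I" "x \<in> carrier (affine_hecke st n)"
    then obtain p q where p: "p \<in> ?P" "a = aff_class st n p"
      and q: "q \<in> words_in (hecke_gens st n)" "x = aff_class st n q"
      using surj by blast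
    have "x \<otimes>\<^bsub>affine_hecke st n\<^esub> a = aff_class st n (q * p)"
      "a \<otimes>\<^bsub>affine_hecke st n\<^esub> x = aff_class st n (p * q)"
      using p q h.hom_mult[of p q] h.hom_mult[of q p] by simp_all
    then show "x \<otimes>\<^bsub>affine_hecke st n\<^esub> a \<in> ?I" "a \<otimes>\<^bsub>affine_hecke st n\<^esub> x \<in> ?I"
      using p q by (simp_all add: imageI two_sided.lmult two_sided.rmult words_in_mult)
  qed
  moreover have "prod_list (map (\<lambda>\<kappa>. X\<^sub>g 1 - cst (residue_val st \<kappa>)) ks) \<in> ?P"
    if "mset ks = \<Lambda>" "1 \<le> n" for ks
  proof -
    have "gX 1 \<in> hecke_gens st n" using that(2) by (cases st) auto
    then show ?thesis
      using that by (auto simp: cycrels_def intro!: two_sided.base words_in_prod_list words_in_diff)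
  qed
  ultimately show ?thesis
    unfolding cyclotomic_ideal_def by (intro A.genideal_minimal) auto
qed

text \<open>The two nested quotients become a single congruence on the free algebra; from here on
  cyclotomic algebras are handled through \<open>congr\<close>.\<close>

theorem kap_eq_iff: "kap \<Lambda> p = kap \<Lambda> q \<longleftrightarrow> congr (crels st n \<Lambda>) p q"
proof -
  interpret C: ring "cyclotomic_hecke st n \<Lambda>" by (rule ring_cyclotomic_hecke)
  interpret h: ring_hom_ring FG "affine_hecke st n" "aff_class st n"
    by (rule ring_hom_ringI2[OF ring_free_alg ring_affine_hecke aff_class_hom])
  have split: "kap \<Lambda> p = kap \<Lambda> q \<oplus>\<^bsub>cyclotomic_hecke st n \<Lambda>\<^esub> kap \<Lambda> (p - q)"
    using kap_add[of \<Lambda> q "p - q"] by simp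
  have "congr (crels st n \<Lambda>) p q" if "kap \<Lambda> p = kap \<Lambda> q"
  proof -
    let ?r = "restrict_words (hecke_gens st n) (p - q)"
    have r: "?r \<in> words_in (hecke_gens st n)" by (rule restrict_words_in)
    have "kap \<Lambda> q \<oplus>\<^bsub>cyclotomic_hecke st n \<Lambda>\<^esub> kap \<Lambda> (p - q)
        = kap \<Lambda> q \<oplus>\<^bsub>cyclotomic_hecke st n \<Lambda>\<^esub> \<zero>\<^bsub>cyclotomic_hecke st n \<Lambda>\<^esub>"
      using split that by (simp add: kap_closed)
    then have "kap \<Lambda> (p - q) = \<zero>\<^bsub>cyclotomic_hecke st n \<Lambda>\<^esub>"
      using C.add.l_cancel_one[OF kap_closed kap_closed] by (simp add: kap_closed)
    then have "a_r_coset (affine_hecke st n) (cyclotomic_ideal st n \<Lambda>) (aff_class st n ?r)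
        = cyclotomic_ideal st n \<Lambda>"
      by (simp add: kap_def cyc_class_def cyclotomic_hecke_def FactRing_def)
    then have "aff_class st n ?r \<in> cyclotomic_ideal st n \<Lambda>"
      using r A.a_coset_join1[OF _ _ additive_subgroup.a_subgroup[OF ideal.axioms(1)[OF ideal_cyclotomic_ideal]]]
      by simp
    then obtain t where t: "t \<in> two_sided (crels st n \<Lambda>)" "t \<in> words_in (hecke_gens st n)"
      "aff_class st n ?r = aff_class st n t"
      using cyclotomic_ideal_two_sided by blast
    \<comment> \<open>Equal classes in the affine algebra only give equality up to the inner ideal,
      which is absorbed next.\<close>
    then have "?r - t \<in> hecke_ideal st n"
      using quot_class_eq_iff[OF ideal_hecke_ideal, of ?r t] r unfolding aff_class_def by simp
    then have "?r - t \<in> two_sided (crels st n \<Lambda>)"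
      using hecke_ideal_two_sided two_sided_mono[OF Un_upper1] by blast
    then have "congr (crels st n \<Lambda>) ?r t" by (simp add: congr_def)
    moreover have "congr (crels st n \<Lambda>) t 0" using t(1) by (simp add: congr_0_iff)
    moreover have "congr (crels st n \<Lambda>) (p - q) ?r"
      by (rule congr_sym[OF congr_mono[OF Un_upper1 restrict_words_congr]])
    ultimately show ?thesis
      by (metis congr_trans congr_diff_0_iff)
  qed
  moreover have "kap \<Lambda> p = kap \<Lambda> q" if "congr (crels st n \<Lambda>) p q"
    using split kap_two_sided that by (simp add: congr_def kap_closed)
  ultimately show ?thesis by blast
qed

end

section \<open>Comparison of the cyclotomic relations of different weights\<close>

lemma cycrels_mono:
  assumes "\<Lambda> \<subseteq># \<Lambda>'" "p \<in> two_sided (crels st n \<Lambda>')"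
  shows "p \<in> two_sided (crels st n \<Lambda>)"
  using assms(2)
proof (induction p rule: two_sided.induct)
  case (base p)
  show ?case
  proof (cases "p \<in> hrels st n")
    case False
    then obtain ks where ks: "p = prod_list (map (\<lambda>\<kappa>. X\<^sub>g 1 - cst (residue_val st \<kappa>)) ks)"
      "mset ks = \<Lambda>'" "1 \<le> n"
      using base by (auto simp: cycrels_def)
    \<comment> \<open>The factors X_1 - c are polynomials in one letter and commute in the free
      algebra itself, so the product depends on the multiset only. A generator for the larger weight
      then splits off one for the smaller weight.\<close>
    have comm: "prod_list (map (\<lambda>\<kappa>. X\<^sub>g 1 - cst (residue_val st \<kappa>)) as)
        = prod_list (map (\<lambda>\<kappa>. X\<^sub>g 1 - cst (residue_val st \<kappa>)) bs :: 'a free list)"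
      if "mset as = mset bs" for as bs
    proof -
      have ex: "(x - cst a) * (x - cst b) = x * x - cst b * x - cst a * x + cst a * cst b"
        for a b and x :: "'a free"
        using cst_comm[of x b] by (simp add: left_diff_distrib right_diff_distrib)
      have c: "(X\<^sub>g 1 - cst a) * (X\<^sub>g 1 - cst b) = (X\<^sub>g 1 - cst b) * (X\<^sub>g 1 - cst a :: 'a free)" for a b
        using cst_comm[of "cst a" b] unfolding ex by simp
      have "fold (\<lambda>\<kappa> x. (X\<^sub>g 1 - cst (residue_val st \<kappa>)) * x) as
          = fold (\<lambda>\<kappa> x. (X\<^sub>g 1 - cst (residue_val st \<kappa>)) * (x :: 'a free)) bs"
        by (rule fold_multiset_equiv[OF _ that])
          (simp add: fun_eq_iff mult.assoc[symmetric] c[simplified])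
      moreover have "prod_list (map f cs) = fold (\<lambda>\<kappa> x. f \<kappa> * x) (rev cs) 1" for f :: "int \<Rightarrow> 'a free" and cs
        by (induction cs) simp_all
      moreover have "fold (\<lambda>\<kappa> x. (X\<^sub>g 1 - cst (residue_val st \<kappa>)) * x) (rev as)
          = fold (\<lambda>\<kappa> x. (X\<^sub>g 1 - cst (residue_val st \<kappa>)) * (x :: 'a free)) (rev bs)"
        by (rule fold_multiset_equiv) (simp_all add: that fun_eq_iff mult.assoc[symmetric] c[simplified])
      ultimately show ?thesis by simp
    qed
    obtain as bs where ab: "mset as = \<Lambda>" "mset bs = \<Lambda>' - \<Lambda>"
      using ex_mset by metis
    then have m: "mset ks = mset (as @ bs)" using ks(2) assms(1) by simp
    have "p = prod_list (map (\<lambda>\<kappa>. X\<^sub>g 1 - cst (residue_val st \<kappa>)) as)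
        * prod_list (map (\<lambda>\<kappa>. X\<^sub>g 1 - cst (residue_val st \<kappa>)) bs)"
      unfolding ks(1) comm[OF m] by simp
    moreover have "prod_list (map (\<lambda>\<kappa>. X\<^sub>g 1 - cst (residue_val st \<kappa>)) as) \<in> cycrels st n \<Lambda>"
      unfolding cycrels_def using ab(1) ks(3) by blast
    ultimately show ?thesis by (metis UnI2 two_sided.base two_sided.rmult)
  qed (auto intro: two_sided.base)
qed (auto intro: two_sided.intros)

lemma congr_crels_mono:
  "\<Lambda> \<subseteq># \<Lambda>' \<Longrightarrow> congr (crels st n \<Lambda>') p q \<Longrightarrow> congr (crels st n \<Lambda>) p q"
  unfolding congr_def by (rule cycrels_mono)

lemma congr_hrels_crels: "congr (hrels st n) p q \<Longrightarrow> congr (crels st n \<Lambda>) p q"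
  by (rule congr_mono[OF Un_upper1])

section \<open>The two settings as one\<close>

text \<open>Both settings are instances of \<open>(T - q)(T + 1) = 0\<close>, \<open>q X\<^sub>i\<^sub>+\<^sub>1 = T\<^sub>i X\<^sub>i T\<^sub>i + h T\<^sub>i\<close>, with
  \<open>h = 0\<close> in the non-degenerate and \<open>q = h = 1\<close> in the degenerate case.\<close>

fun qpar :: "'k::field setting \<Rightarrow> 'k" where
  "qpar (NonDeg q) = q"
| "qpar Deg = 1"

fun hpar :: "'k::field setting \<Rightarrow> 'k" where
  "hpar (NonDeg q) = 0"
| "hpar Deg = 1"

lemma gT_in_hecke_gens [simp]: "gT r \<in> hecke_gens st n \<longleftrightarrow> r \<in> {1..<n}"
  and gX_in_hecke_gens [simp]: "gX r \<in> hecke_gens st n \<longleftrightarrow> r \<in> {1..n}"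
  by (cases st; auto)+

lemma gXinv_in_hecke_gens [simp]:
  "gXinv r \<in> hecke_gens st n \<longleftrightarrow> r \<in> {1..n} \<and> st \<noteq> Deg"
  by (cases st) auto

text \<open>The defining relations, with scalars arranged so that both settings read alike; with q =
  1 the quadratic relation (T - 1)(T + 1) = 0 is T^2 = 1.\<close>

lemma gen_cong:
  fixes st :: "'k::field setting"
  shows "i \<in> {1..<n} \<Longrightarrow> congr (hrels st n) ((T\<^sub>g i - cst (qpar st)) * (T\<^sub>g i + 1)) 0"
    and "1 \<le> i \<Longrightarrow> i + 1 < n \<Longrightarrow>
      congr (hrels st n) (T\<^sub>g i * T\<^sub>g (i+1) * T\<^sub>g i) (T\<^sub>g (i+1) * T\<^sub>g i * T\<^sub>g (i+1))"
    and "i \<in> {1..<n} \<Longrightarrow> k \<in> {1..<n} \<Longrightarrow> \<bar>int i - int k\<bar> > 1 \<Longrightarrow>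
      congr (hrels st n) (T\<^sub>g i * T\<^sub>g k) (T\<^sub>g k * T\<^sub>g i)"
    and "i \<in> {1..<n} \<Longrightarrow> k \<in> {1..n} \<Longrightarrow> k \<noteq> i \<Longrightarrow> k \<noteq> i + 1 \<Longrightarrow>
      congr (hrels st n) (T\<^sub>g i * X\<^sub>g k) (X\<^sub>g k * T\<^sub>g i)"
    and "i \<in> {1..n} \<Longrightarrow> k \<in> {1..n} \<Longrightarrow> congr (hrels st n) (X\<^sub>g i * X\<^sub>g k) (X\<^sub>g k * X\<^sub>g i)"
    and "i \<in> {1..<n} \<Longrightarrow> qpar st \<noteq> 0 \<Longrightarrow>
      congr (hrels st n) (cst (qpar st) * X\<^sub>g (i+1)) (T\<^sub>g i * X\<^sub>g i * T\<^sub>g i + cst (hpar st) * T\<^sub>g i)"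
    and "st = NonDeg q \<Longrightarrow> k \<in> {1..n} \<Longrightarrow> congr (hrels st n) (Xi\<^sub>g k * X\<^sub>g k) 1"
    and "st = NonDeg q \<Longrightarrow> k \<in> {1..n} \<Longrightarrow> congr (hrels st n) (X\<^sub>g k * Xi\<^sub>g k) 1"
    and "g \<notin> hecke_gens st n \<Longrightarrow> congr (hrels st n) (gen_elt g) 0"
proof -
  have base: "congr (hrels st n) x y" if "x - y \<in> hrels st n" for x y
    using that by (simp add: congr_def two_sided.base)
  have common: "congr (hrels st n) x y" if "x - y \<in> common_rels n" for x y
    using that by (intro base) (cases st; auto simp: hrels_def)
  show "congr (hrels st n) ((T\<^sub>g i - cst (qpar st)) * (T\<^sub>g i + 1)) 0" if "i \<in> {1..<n}"
  proof (cases st)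
    case (NonDeg q)
    then show ?thesis using that by (intro base) (auto simp: hrels_def)
  next
    case Deg
    have "(T\<^sub>g i - cst (qpar st)) * (T\<^sub>g i + 1) = T\<^sub>g i * T\<^sub>g i - 1"
      using Deg by (simp add: algebra_simps)
    then show ?thesis using that Deg by (intro base) (simp add: hrels_def, blast)
  qed
  show "congr (hrels st n) (T\<^sub>g i * T\<^sub>g (i+1) * T\<^sub>g i) (T\<^sub>g (i+1) * T\<^sub>g i * T\<^sub>g (i+1))"
    if "1 \<le> i" "i + 1 < n"
    using that unfolding common_rels_def by (intro common) (auto simp: common_rels_def)
  show "congr (hrels st n) (T\<^sub>g i * T\<^sub>g k) (T\<^sub>g k * T\<^sub>g i)"
    if "i \<in> {1..<n}" "k \<in> {1..<n}" "\<bar>int i - int k\<bar> > 1"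
    using that by (intro common) (auto simp: common_rels_def)
  show "congr (hrels st n) (T\<^sub>g i * X\<^sub>g k) (X\<^sub>g k * T\<^sub>g i)"
    if "i \<in> {1..<n}" "k \<in> {1..n}" "k \<noteq> i" "k \<noteq> i + 1"
    using that by (intro common) (auto simp: common_rels_def)
  show "congr (hrels st n) (X\<^sub>g i * X\<^sub>g k) (X\<^sub>g k * X\<^sub>g i)" if "i \<in> {1..n}" "k \<in> {1..n}"
  proof (cases st)
    case (NonDeg q)
    have "X\<^sub>g i * X\<^sub>g k - X\<^sub>g k * X\<^sub>g i \<in> {gen_elt a * gen_elt b - gen_elt b * gen_elt a | a b.
        a \<in> gX ` {1..n} \<union> gXinv ` {1..n} \<and> b \<in> gX ` {1..n} \<union> gXinv ` {1..n}}"
      using that by blast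
    then have "X\<^sub>g i * X\<^sub>g k - X\<^sub>g k * X\<^sub>g i \<in> hrels st n"
      unfolding hrels_def NonDeg hecke_rels.simps by blast
    then show ?thesis by (rule base)
  next
    case Deg
    then show ?thesis using that by (intro base) (auto simp: hrels_def)
  qed
  show "congr (hrels st n) (cst (qpar st) * X\<^sub>g (i+1)) (T\<^sub>g i * X\<^sub>g i * T\<^sub>g i + cst (hpar st) * T\<^sub>g i)"
    if "i \<in> {1..<n}" "qpar st \<noteq> 0"
  proof (cases st)
    case (NonDeg q)
    have "congr (hrels st n) (X\<^sub>g (i+1)) (cst (inverse q) * T\<^sub>g i * X\<^sub>g i * T\<^sub>g i)"
      using that NonDeg by (intro base) (auto simp: hrels_def)
    from congr_mult[OF congr_refl[of _ "cst q"] this] show ?thesis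
      using that NonDeg by (simp add: mult.assoc[symmetric] cst_mult[symmetric])
  next
    case Deg
    then show ?thesis using that by (intro base) (auto simp: hrels_def)
  qed
  show "congr (hrels st n) (Xi\<^sub>g k * X\<^sub>g k) 1" "congr (hrels st n) (X\<^sub>g k * Xi\<^sub>g k) 1"
    if "st = NonDeg q" "k \<in> {1..n}"
    using that by (intro base; auto simp: hrels_def)+
  show "congr (hrels st n) (gen_elt g) 0" if "g \<notin> hecke_gens st n"
    using that by (intro base; auto simp: hrels_def)+
qed


section \<open>The polynomial action\<close>

text \<open>The diagonal coefficient of a Demazure-Lusztig operator: T_r will act as (q - b) s_r +
  b, where b is this expression at x = t_r, y = t_(r+1).\<close>

definition bq :: "'a \<Rightarrow> 'a \<Rightarrow> 'a \<Rightarrow> 'a \<Rightarrow> 'a::field" where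
  "bq q h x y = ((q - 1) * y + h) / (y - x)"

text \<open>The identities behind the quadratic, Bernstein and braid relations.\<close>

lemma bq_swap: "x \<noteq> y \<Longrightarrow> bq q h x y + bq q h y x = q - 1"
  unfolding bq_def by (simp add: divide_simps) (simp add: algebra_simps)

lemma bq_quad: "x \<noteq> y \<Longrightarrow> (q - bq q h x y) * (q - bq q h y x) + bq q h x y * bq q h x y = (q - 1) * bq q h x y + q"
  unfolding bq_def by (simp add: divide_simps) (simp add: algebra_simps)

lemma bq_X1: "x \<noteq> y \<Longrightarrow> y * bq q h y x + x * bq q h x y = - h"
  unfolding bq_def by (simp add: divide_simps) (simp add: algebra_simps)

lemma bq_X2: "x \<noteq> y \<Longrightarrow>
  y * ((q - bq q h x y) * (q - bq q h y x)) + x * (bq q h x y * bq q h x y) = q * y - h * bq q h x y"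
  unfolding bq_def by (simp add: divide_simps) (simp add: algebra_simps)

lemma bq_braid1: "x \<noteq> y \<Longrightarrow> y \<noteq> z \<Longrightarrow> x \<noteq> z \<Longrightarrow>
  bq q h x y * bq q h x z = bq q h x z * bq q h z y + bq q h x y * bq q h y z"
  unfolding bq_def by (simp add: divide_simps) (simp add: algebra_simps)

lemma bq_braid2: "x \<noteq> y \<Longrightarrow> y \<noteq> z \<Longrightarrow> x \<noteq> z \<Longrightarrow>
  bq q h y z * bq q h x z = bq q h x z * bq q h y x + bq q h x y * bq q h y z"
  unfolding bq_def by (simp add: divide_simps) (simp add: algebra_simps)

text \<open>With the swapped values eliminated by \<open>bq_swap\<close>, the difference of the two
  sides is a - b times the defect of \<open>bq_braid1\<close>.\<close>

lemma bq_braid3: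
  assumes "x \<noteq> y" "y \<noteq> z" "x \<noteq> z"
  shows "(q - bq q h x y) * (q - bq q h y x) * bq q h x z + bq q h x y * bq q h x y * bq q h y z
    = (q - bq q h y z) * (q - bq q h z y) * bq q h x z + bq q h y z * bq q h y z * bq q h x y"
proof -
  define a b c where "a = bq q h x y" and "b = bq q h y z" and "c = bq q h x z"
  have 1: "bq q h y x = q - 1 - a" "bq q h z y = q - 1 - b"
    using bq_swap[of x y q h] bq_swap[of y z q h] assms by (simp_all add: a_def b_def algebra_simps)
  have 2: "a * c = c * (q - 1 - b) + a * b"
    using bq_braid1[OF assms, of q h] by (simp add: 1 a_def b_def c_def)
  have "(q - a) * (q - (q - 1 - a)) * c + a * a * b - ((q - b) * (q - (q - 1 - b)) * c + b * b * a)
      = (a - b) * (c * (q - 1 - b) + a * b - a * c)"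
    by (simp add: algebra_simps)
  then show ?thesis
    unfolding 1 a_def[symmetric] b_def[symmetric] c_def[symmetric] using 2 by simp
qed

text \<open>Indices are all functions \<open>nat \<Rightarrow> int\<close>, so that no residue
  condition enters the verification of the relations; a block is cut out later by
  \<open>rest\<close>.\<close>

type_synonym 'k pvec = "(nat \<Rightarrow> int) \<Rightarrow> 'k ratfun"

definition sact :: "nat \<Rightarrow> 'k::field pvec \<Rightarrow> 'k pvec" where
  "sact r v = (\<lambda>j. perm_rat (simple_refl r) (v (j \<circ> simple_refl r)))"

definition bco :: "'k::field setting \<Rightarrow> nat \<Rightarrow> 'k ratfun" where
  "bco st r = bq (rat_const (qpar st)) (rat_const (hpar st)) (tvar r) (tvar (r + 1))"

text \<open>Foreign letters act by zero, in accordance with \<open>hrels\<close>. No coefficient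
  depends on the index \<open>j\<close>.\<close>

definition gact :: "'k::field setting \<Rightarrow> nat \<Rightarrow> gen \<Rightarrow> 'k pvec \<Rightarrow> 'k pvec" where
  "gact st n g v = (\<lambda>j. if g \<in> hecke_gens st n then
     case g of gT r \<Rightarrow> (rat_const (qpar st) - bco st r) * sact r v j + bco st r * v j
       | gX k \<Rightarrow> tvar k * v j | gXinv k \<Rightarrow> inverse (tvar k) * v j
     else 0)"

definition wact :: "'k::field setting \<Rightarrow> nat \<Rightarrow> gen list \<Rightarrow> 'k pvec \<Rightarrow> 'k pvec" where
  "wact st n w v = foldr (gact st n) w v"

definition act :: "'k::field setting \<Rightarrow> nat \<Rightarrow> 'k free \<Rightarrow> 'k pvec \<Rightarrow> 'k pvec" where
  "act st n = lin_ext (\<lambda>w c v j. rat_const c * wact st n w v j)"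

lemma bij_simple_refl [simp]: "bij (simple_refl r)"
  by (simp add: simple_refl_def)

lemma simple_refl_involutory [simp]: "simple_refl r (simple_refl r k) = k"
  by (simp add: simple_refl_def)

lemma simple_refl_comp [simp]: "simple_refl r \<circ> simple_refl r = id"
  by (simp add: fun_eq_iff)

lemma simple_refl_apply [simp]:
  "simple_refl r r = Suc r" "simple_refl r (Suc r) = r"
  "k \<noteq> r \<Longrightarrow> k \<noteq> Suc r \<Longrightarrow> simple_refl r k = k"
  by (simp_all add: simple_refl_def)

lemma simple_refl_permutes: "r \<in> {1..<n} \<Longrightarrow> simple_refl r permutes {1..n}"
  unfolding simple_refl_def by (rule permutes_swap_id) auto

lemma place_perm_simple_refl: "place_perm (simple_refl r) i = i \<circ> simple_refl r"
  by (simp add: place_perm_def simple_refl_def)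

abbreviation sr :: "nat \<Rightarrow> 'k::field ratfun \<Rightarrow> 'k ratfun" where
  "sr r \<equiv> perm_rat (simple_refl r)"

lemmas sr_simps = perm_rat_add[OF bij_simple_refl] perm_rat_mult[OF bij_simple_refl]
  perm_rat_diff[OF bij_simple_refl] perm_rat_uminus[OF bij_simple_refl]
  perm_rat_divide[OF bij_simple_refl] perm_rat_inverse[OF bij_simple_refl]

lemma sr_sr [simp]: "sr r (sr r f) = f"
  by (simp add: perm_rat_comp perm_rat_id)

lemma sr_bq [simp]: "sr r (bq (rat_const q) (rat_const h) x y) = bq (rat_const q) (rat_const h) (sr r x) (sr r y)"
  by (simp add: bq_def sr_simps)

lemma sact_sact [simp]: "sact r (sact r v) = v"
  by (simp add: sact_def comp_assoc)

lemma sact_comm: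
  assumes "Suc r < s \<or> Suc s < r"
  shows "sact r (sact s v) = sact s (sact r v)"
proof -
  have "simple_refl r \<circ> simple_refl s = simple_refl s \<circ> simple_refl r"
    using assms by (auto simp: fun_eq_iff simple_refl_def transpose_def)
  then show ?thesis by (simp add: sact_def perm_rat_comp comp_assoc)
qed

lemma sact_braid: "sact r (sact (Suc r) (sact r v)) = sact (Suc r) (sact r (sact (Suc r) v))"
proof -
  have "simple_refl r \<circ> (simple_refl (Suc r) \<circ> simple_refl r)
      = simple_refl (Suc r) \<circ> (simple_refl r \<circ> simple_refl (Suc r))"
    by (auto simp: fun_eq_iff simple_refl_def transpose_def)
  then show ?thesis by (simp add: sact_def perm_rat_comp comp_assoc bij_comp)
qed

lemma sact_add: "sact r (u + v) = sact r u + sact r v"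
  by (simp add: fun_eq_iff sact_def sr_simps)

lemma sact_scale: "sact r (\<lambda>j. c * v j) j = sr r c * sact r v j"
  by (simp add: sact_def sr_simps)

lemma sact_lincomb: "sact r (\<lambda>j. c * u j + d * v j) j = sr r c * sact r u j + sr r d * sact r v j"
  by (simp add: sact_def sr_simps)

lemma gact_add: "gact st n g (u + v) = gact st n g u + gact st n g v"
  by (cases g) (auto simp: fun_eq_iff gact_def sact_add algebra_simps)

lemma gact_zero: "gact st n g 0 = 0"
  using gact_add[of st n g 0 0] by simp

lemma wact_Nil [simp]: "wact st n [] v = v"
  and wact_Cons [simp]: "wact st n (g # w) v = gact st n g (wact st n w v)"
  and wact_append: "wact st n (w @ w') v = wact st n w (wact st n w' v)"
  by (simp_all add: wact_def)

lemma wact_add: "wact st n w (u + v) = wact st n w u + wact st n w v"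
proof (induction w)
  case (Cons g w)
  show ?case unfolding wact_Cons Cons.IH gact_add ..
qed simp

text \<open>The reflection is the only ingredient of an operator that moves scalars. Special cases
  are constants, symmetric common denominators and the elements of J.\<close>

lemma gact_symmetric:
  assumes "\<And>r. r \<in> {1..<n} \<Longrightarrow> sr r c = c"
  shows "gact st n g (\<lambda>j. c * v j) = (\<lambda>j. c * gact st n g v j)"
  using assms by (cases g) (auto simp: fun_eq_iff gact_def sact_scale algebra_simps)

lemma wact_symmetric:
  assumes "\<And>r. r \<in> {1..<n} \<Longrightarrow> sr r c = c"
  shows "wact st n w (\<lambda>j. c * v j) = (\<lambda>j. c * wact st n w v j)"
proof (induction w)
  case (Cons g w)
  show ?case unfolding wact_Cons Cons.IH by (rule gact_symmetric[OF assms])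
qed simp

interpretation act: additive_family "\<lambda>w c v j. rat_const c * wact st n w v j"
  for st :: "'k::field setting" and n
  by standard (simp add: fun_eq_iff rat_const_add distrib_right)

lemma act_plus: "act st n (p + q) v = act st n p v + act st n q v"
  by (simp add: act_def act.lin_ext_add)

lemma act_diff: "act st n (p - q) v = act st n p v - act st n q v"
  by (simp add: act_def act.lin_ext_diff)

lemma act_0 [simp]: "act st n 0 v = 0"
  by (simp add: act_def)

lemma act_single: "act st n (Poly_Mapping.single w c) v = (\<lambda>j. rat_const c * wact st n w v j)"
  by (simp add: act_def)

lemma act_cst [simp]: "act st n (cst c) v = (\<lambda>j. rat_const c * v j)"
  by (simp add: cst_def act_single zero_list_def)

lemma act_1 [simp]: "act st n 1 v = v"
  using act_cst[of st n 1 v] by simp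

lemma act_gen_elt [simp]: "act st n (gen_elt g) v = gact st n g v"
  by (simp add: gen_elt_def act_single)

lemma act_add: "act st n p (u + v) = act st n p u + act st n p v"
proof (induction p rule: poly_mapping_additive_induct)
  case (single w c)
  show ?case unfolding act_single wact_add by (simp add: fun_eq_iff distrib_left)
next
  case (add p q)
  show ?case unfolding act_plus add.IH by (simp only: ac_simps)
qed

lemma act_symmetric:
  assumes "\<And>r. r \<in> {1..<n} \<Longrightarrow> sr r c = c"
  shows "act st n p (\<lambda>j. c * v j) = (\<lambda>j. c * act st n p v j)"
proof (induction p rule: poly_mapping_additive_induct)
  case (single w d)
  have "wact st n w (\<lambda>j. c * v j) = (\<lambda>j. c * wact st n w v j)"
    by (rule wact_symmetric[OF assms])
  then show ?case by (simp only: act_single mult.left_commute)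
next
  case (add p q)
  show ?case unfolding act_plus add.IH by (simp add: fun_eq_iff distrib_left)
qed

lemma act_zero_vec [simp]: "act st n p 0 = 0"
  using act_add[of st n p 0 0] by simp

lemma act_uminus_vec: "act st n p (- v) = - act st n p v"
  using act_add[of st n p v "- v"] by (simp add: eq_neg_iff_add_eq_0 add.commute)

lemma act_diff_vec: "act st n p (u - v) = act st n p u - act st n p v"
  using act_add[of st n p u "- v"] by (simp add: act_uminus_vec)

lemma act_mult: "act st n (p * q) v = act st n p (act st n q v)"
proof (induction p rule: poly_mapping_additive_induct)
  case (single w c)
  show ?case
  proof (induction q rule: poly_mapping_additive_induct)
    case (single w' d)
    have "wact st n w (\<lambda>j. rat_const d * wact st n w' v j) = (\<lambda>j. rat_const d * wact st n w (wact st n w' v) j)"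
      by (rule wact_symmetric) simp
    then show ?case
      by (simp add: mult_single act_single fun_eq_iff plus_list_def wact_append rat_const_mult mult.assoc)
  next
    case (add q q')
    show ?case unfolding distrib_left act_plus act_add add.IH ..
  qed
next
  case (add p p')
  show ?case unfolding distrib_right act_plus add.IH ..
qed

text \<open>A right factor acts on the vector before the relation does, so \<open>Q\<close> has to
  be stable; a left factor acts on the result, so \<open>U\<close> has to be.\<close>

lemma act_two_sided:
  assumes "p \<in> two_sided S"
    and S: "\<And>s v. s \<in> S \<Longrightarrow> v \<in> Q \<Longrightarrow> act st n s v \<in> U"
    and Q: "\<And>p v. v \<in> Q \<Longrightarrow> act st n p v \<in> Q"
    and U: "\<And>p v. v \<in> U \<Longrightarrow> act st n p v \<in> U" "0 \<in> U" "\<And>u v. u \<in> U \<Longrightarrow> v \<in> U \<Longrightarrow> u + v \<in> U"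
    and "v \<in> Q"
  shows "act st n p v \<in> U"
  using assms(1,7)
  by (induction p arbitrary: v rule: two_sided.induct) (auto simp: act_plus act_mult S Q U)

lemma gact_T:
  assumes "r \<in> {1..<n}"
  shows "gact st n (gT r) v j
    = (rat_const (qpar st) - bco st r) * sact r v j + bco st r * v j"
  using assms by (simp add: gact_def)

lemma gact_X: "k \<in> {1..n} \<Longrightarrow> gact st n (gX k) v j = tvar k * v j"
  by (simp add: gact_def)

lemma gact_Xinv: "gXinv k \<in> hecke_gens st n \<Longrightarrow> gact st n (gXinv k) v j = inverse (tvar k) * v j"
  by (simp add: gact_def)

lemma sact_gact_T:
  assumes "r \<in> {1..<n}"
  shows "sact s (gact st n (gT r) v) j
    = (rat_const (qpar st) - sr s (bco st r)) * sact s (sact r v) j + sr s (bco st r) * sact s v j"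
proof -
  have "gact st n (gT r) v = (\<lambda>j. (rat_const (qpar st) - bco st r) * sact r v j + bco st r * v j)"
    using gact_T[OF assms] by blast
  then show ?thesis by (simp add: sact_lincomb sr_simps)
qed

lemma sact_lincomb4:
  "sact s (\<lambda>j. a * (b * u j + c * v j) + d * (e * w j + f * x j)) j
   = sr s a * (sr s b * sact s u j + sr s c * sact s v j) + sr s d * (sr s e * sact s w j + sr s f * sact s x j)"
  by (simp add: sact_def sr_simps)

text \<open>The values at the six elements of S_3 (\<open>v\<close>, \<open>s1\<close>,
  \<open>s2\<close>, \<open>p1\<close>, \<open>p2\<close>, \<open>f\<close>) are treated as
  unknowns. Those of length at least two cancel, and the coefficients of \<open>s1\<close>,
  \<open>s2\<close> and \<open>v\<close> are exactly the three assumptions.\<close>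

lemma braid_combination:
  fixes q :: "'a::comm_ring"
  assumes "A * C = C * B' + A * B" "B * C = C * A' + A * B"
    "(q - A) * (q - A') * C + A * A * B = (q - B) * (q - B') * C + B * B * A"
  shows "(q - A) * ((q - C) * ((q - B) * f + B * p1) + C * ((q - A') * v + A' * s1))
      + A * ((q - B) * ((q - C) * p2 + C * s2) + B * ((q - A) * s1 + A * v))
    = (q - B) * ((q - C) * ((q - A) * f + A * p2) + C * ((q - B') * v + B' * s2))
      + B * ((q - A) * ((q - C) * p1 + C * s1) + A * ((q - B) * s2 + B * v))" (is "?L = ?R")
proof -
  have "?L - ?R = (q - B) * s2 * (A * C - (C * B' + A * B)) - (q - A) * s1 * (B * C - (C * A' + A * B))
      + v * ((q - A) * (q - A') * C + A * A * B - ((q - B) * (q - B') * C + B * B * A))"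
    by (simp add: algebra_simps)
  then show ?thesis unfolding assms by simp
qed

lemma act_braid:
  assumes "1 \<le> i" "Suc i < n"
  shows "gact st n (gT i) (gact st n (gT (Suc i)) (gact st n (gT i) v))
    = gact st n (gT (Suc i)) (gact st n (gT i) (gact st n (gT (Suc i)) v))"
proof
  fix j
  define q h where "q = rat_const (qpar st)" and "h = rat_const (hpar st)"
  define x y z :: "'a ratfun" where "x = tvar i" and "y = tvar (Suc i)" and "z = tvar (Suc (Suc i))"
  have ne: "x \<noteq> y" "y \<noteq> z" "x \<noteq> z" by (simp_all add: x_def y_def z_def)
  have i: "i \<in> {1..<n}" "Suc i \<in> {1..<n}" using assms by auto
  have b: "bco st i = bq q h x y" "bco st (Suc i) = bq q h y z"
    "sr i (bq q h x y) = bq q h y x" "sr i (bq q h y z) = bq q h x z" "sr i (bq q h x z) = bq q h y z"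
    "sr (Suc i) (bq q h x y) = bq q h x z" "sr (Suc i) (bq q h y z) = bq q h z y"
    "sr (Suc i) (bq q h x z) = bq q h x y"
    by (simp_all add: bco_def q_def h_def x_def y_def z_def)
  have q: "sr k q = q" for k by (simp add: q_def)
  have T: "gact st n (gT i) v = (\<lambda>j. (q - bq q h x y) * sact i v j + bq q h x y * v j)"
    "gact st n (gT (Suc i)) v = (\<lambda>j. (q - bq q h y z) * sact (Suc i) v j + bq q h y z * v j)" for v
    unfolding q_def by (simp_all add: fun_eq_iff gact_T[OF i(1)] gact_T[OF i(2)] b(1,2)[unfolded q_def])
  have L: "gact st n (gT (Suc i)) (gact st n (gT i) v)
      = (\<lambda>j. (q - bq q h y z) * ((q - bq q h x z) * sact (Suc i) (sact i v) j + bq q h x z * sact (Suc i) v j)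
          + bq q h y z * ((q - bq q h x y) * sact i v j + bq q h x y * v j))"
    unfolding T by (simp add: fun_eq_iff sact_lincomb sr_simps b q)
  have R: "gact st n (gT i) (gact st n (gT (Suc i)) v)
      = (\<lambda>j. (q - bq q h x y) * ((q - bq q h x z) * sact i (sact (Suc i) v) j + bq q h x z * sact i v j)
          + bq q h x y * ((q - bq q h y z) * sact (Suc i) v j + bq q h y z * v j))"
    unfolding T by (simp add: fun_eq_iff sact_lincomb sr_simps b q)
  have L3: "gact st n (gT i) (gact st n (gT (Suc i)) (gact st n (gT i) v)) j
      = (q - bq q h x y) * ((q - bq q h x z) * ((q - bq q h y z) * sact i (sact (Suc i) (sact i v)) j
            + bq q h y z * sact i (sact (Suc i) v) j)
          + bq q h x z * ((q - bq q h y x) * v j + bq q h y x * sact i v j))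
        + bq q h x y * ((q - bq q h y z) * ((q - bq q h x z) * sact (Suc i) (sact i v) j + bq q h x z * sact (Suc i) v j)
          + bq q h y z * ((q - bq q h x y) * sact i v j + bq q h x y * v j))"
    unfolding L by (simp add: T(1) sact_lincomb4 sr_simps b q)
  have R3: "gact st n (gT (Suc i)) (gact st n (gT i) (gact st n (gT (Suc i)) v)) j
      = (q - bq q h y z) * ((q - bq q h x z) * ((q - bq q h x y) * sact (Suc i) (sact i (sact (Suc i) v)) j
            + bq q h x y * sact (Suc i) (sact i v) j)
          + bq q h x z * ((q - bq q h z y) * v j + bq q h z y * sact (Suc i) v j))
        + bq q h y z * ((q - bq q h x y) * ((q - bq q h x z) * sact i (sact (Suc i) v) j + bq q h x z * sact i v j)
          + bq q h x y * ((q - bq q h y z) * sact (Suc i) v j + bq q h y z * v j))"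
    unfolding R by (simp add: T(2) sact_lincomb4 sr_simps b q)
  define A B C where "A = bq q h x y" and "B = bq q h y z" and "C = bq q h x z"
  define A' B' where "A' = bq q h y x" and "B' = bq q h z y"
  have id: "A * C = C * B' + A * B" "B * C = C * A' + A * B"
    "(q - A) * (q - A') * C + A * A * B = (q - B) * (q - B') * C + B * B * A"
    using bq_braid1[OF ne, of q h] bq_braid2[OF ne, of q h] bq_braid3[OF ne, of q h]
    by (simp_all add: A_def B_def C_def A'_def B'_def)
  show "gact st n (gT i) (gact st n (gT (Suc i)) (gact st n (gT i) v)) j
    = gact st n (gT (Suc i)) (gact st n (gT i) (gact st n (gT (Suc i)) v)) j"
    unfolding L3 R3 sact_braid
    unfolding A_def[symmetric] B_def[symmetric] C_def[symmetric] A'_def[symmetric] B'_def[symmetric]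
    by (rule braid_combination[OF id])
qed

lemma act_far_comm:
  assumes "i \<in> {1..<n}" "k \<in> {1..<n}" "Suc i < k \<or> Suc k < i"
  shows "gact st n (gT i) (gact st n (gT k) v) = gact st n (gT k) (gact st n (gT i) v)"
proof
  fix j
  have "sr i (bco st k) = bco st k" "sr k (bco st i) = bco st i"
    using assms(3) by (auto simp: bco_def)
  then show "gact st n (gT i) (gact st n (gT k) v) j = gact st n (gT k) (gact st n (gT i) v) j"
    using sact_comm[OF assms(3), of v]
    by (simp add: gact_T[OF assms(1)] gact_T[OF assms(2)] sact_gact_T[OF assms(1)] sact_gact_T[OF assms(2)]
        algebra_simps)
qed

lemma gact_T_twice:
  assumes "i \<in> {1..<n}"
  shows "gact st n (gT i) (gact st n (gT i) v) j
    = rat_const (qpar st - 1) * gact st n (gT i) v j + rat_const (qpar st) * v j"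
proof -
  define q h where "q = rat_const (qpar st)" and "h = rat_const (hpar st)"
  define x y :: "'a ratfun" where "x = tvar i" and "y = tvar (Suc i)"
  have ne: "x \<noteq> y" by (simp add: x_def y_def)
  have b: "bco st i = bq q h x y" "sr i (bq q h x y) = bq q h y x"
    by (simp_all add: bco_def q_def h_def x_def y_def)
  define A B where "A = bq q h x y" and "B = bq q h y x"
  have id: "A + B = q - 1" "(q - A) * (q - B) + A * A = (q - 1) * A + q"
    using bq_swap[OF ne, of q h] bq_quad[OF ne, of q h] by (simp_all add: A_def B_def)
  show ?thesis
    unfolding gact_T[OF assms] sact_gact_T[OF assms] b(1)
    unfolding b(2) sact_sact rat_const_diff rat_const_1
    unfolding q_def[symmetric] A_def[symmetric] B_def[symmetric]
  proof -
    have "(q - A) * ((q - B) * v j + B * sact i v j) + A * ((q - A) * sact i v j + A * v j)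
        = ((q - A) * (q - B) + A * A) * v j + (A + B) * ((q - A) * sact i v j)"
      by (simp add: algebra_simps)
    then show "(q - A) * ((q - B) * v j + B * sact i v j) + A * ((q - A) * sact i v j + A * v j)
        = (q - 1) * ((q - A) * sact i v j + A * v j) + q * v j"
      unfolding id by (simp add: algebra_simps)
  qed
qed

lemma act_TXT:
  assumes "i \<in> {1..<n}"
  shows "gact st n (gT i) (gact st n (gX i) (gact st n (gT i) v)) j
    = rat_const (qpar st) * (tvar (Suc i) * v j) - rat_const (hpar st) * gact st n (gT i) v j"
proof -
  define q h where "q = rat_const (qpar st)" and "h = rat_const (hpar st)"
  define x y :: "'a ratfun" where "x = tvar i" and "y = tvar (Suc i)"
  have ne: "x \<noteq> y" by (simp add: x_def y_def)
  have b: "bco st i = bq q h x y" "sr i (bq q h x y) = bq q h y x"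
    by (simp_all add: bco_def q_def h_def x_def y_def)
  have X: "gact st n (gX i) u = (\<lambda>j. x * u j)" for u
    using assms by (simp add: fun_eq_iff gact_X x_def)
  have sx: "sr i x = y" by (simp add: x_def y_def)
  define A B where "A = bq q h x y" and "B = bq q h y x"
  have id: "y * B + x * A = - h" "y * ((q - A) * (q - B)) + x * (A * A) = q * y - h * A"
    using bq_X1[OF ne, of q h] bq_X2[OF ne, of q h] by (simp_all add: A_def B_def)
  have T: "gact st n (gT i) u j = (q - A) * sact i u j + A * u j" for u j
    by (simp only: gact_T[OF assms] b(1) q_def A_def)
  have XT: "gact st n (gX i) (gact st n (gT i) v) = (\<lambda>j. (x * (q - A)) * sact i v j + (x * A) * v j)"
    unfolding X T by (simp add: algebra_simps)
  have sA: "sr i A = B" "sr i q = q" by (simp_all add: A_def B_def b(2), simp add: q_def)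
  show ?thesis
    unfolding XT T[of "\<lambda>j. _ j + _ j"] T[of v] sact_lincomb sact_sact
    unfolding sr_simps sA sx q_def[symmetric] h_def[symmetric] y_def[symmetric]
  proof -
    have "(q - A) * (y * (q - B) * v j + y * B * sact i v j) + A * (x * (q - A) * sact i v j + x * A * v j)
        = (y * ((q - A) * (q - B)) + x * (A * A)) * v j + (y * B + x * A) * ((q - A) * sact i v j)"
      by (simp add: algebra_simps)
    then show "(q - A) * (y * (q - B) * v j + y * B * sact i v j) + A * (x * (q - A) * sact i v j + x * A * v j)
        = q * (y * v j) - h * ((q - A) * sact i v j + A * v j)"
      unfolding id by (simp add: algebra_simps)
  qed
qed

lemma act_hecke_rels:
  assumes q0: "qpar st \<noteq> 0" and "s \<in> hrels st n"
  shows "act st n s v = 0"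
proof -
  note red = act_diff act_plus act_mult fun_eq_iff
  have common: "act st n s v = 0" if "s \<in> common_rels n"
  proof -
    consider i where "s = T\<^sub>g i * T\<^sub>g (i+1) * T\<^sub>g i - T\<^sub>g (i+1) * T\<^sub>g i * T\<^sub>g (i+1)" "1 \<le> i" "i + 1 < n"
      | i k where "s = T\<^sub>g i * T\<^sub>g k - T\<^sub>g k * T\<^sub>g i" "i \<in> {1..<n}" "k \<in> {1..<n}" "\<bar>int i - int k\<bar> > 1"
      | i k where "s = T\<^sub>g i * X\<^sub>g k - X\<^sub>g k * T\<^sub>g i" "i \<in> {1..<n}" "k \<in> {1..n}" "k \<noteq> i" "k \<noteq> i + 1"
      using \<open>s \<in> common_rels n\<close> by (auto simp: common_rels_def)
    then show ?thesis
    proof cases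
      case 1
      then show ?thesis using act_braid[of i n st v] by (simp add: act_diff act_mult)
    next
      case 2
      then have "Suc i < k \<or> Suc k < i" by auto
      then show ?thesis using 2 act_far_comm[of i n k st v] by (simp add: act_diff act_mult)
    next
      case (3 i k)
      have X: "gact st n (gX k) u = (\<lambda>j. tvar k * u j)" for u
        using 3 by (simp add: fun_eq_iff gact_X)
      have "act st n s v = gact st n (gT i) (gact st n (gX k) v) - gact st n (gX k) (gact st n (gT i) v)"
        unfolding 3(1) by (simp add: act_diff act_mult)
      also have "\<dots> = 0"
        using 3 by (simp add: fun_eq_iff X gact_T sact_scale algebra_simps)
      finally show ?thesis .
    qed
  qed
  consider "s \<in> hecke_rels st n" | g where "s = gen_elt g" "g \<notin> hecke_gens st n"
    using assms(2) by (auto simp: hrels_def)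
  then show ?thesis
  proof cases
    case 2
    then show ?thesis by (simp add: gact_def fun_eq_iff)
  next
    case 1
    show ?thesis
    proof (cases st)
      case (NonDeg q)
      have nd: "gXinv k \<in> hecke_gens st n" if "k \<in> {1..n}" for k using that NonDeg by simp
      consider "s \<in> common_rels n"
        | i where "s = (T\<^sub>g i - cst q) * (T\<^sub>g i + 1)" "i \<in> {1..<n}"
        | a b where "s = gen_elt a * gen_elt b - gen_elt b * gen_elt a"
            "a \<in> gX ` {1..n} \<union> gXinv ` {1..n}" "b \<in> gX ` {1..n} \<union> gXinv ` {1..n}"
        | k where "s = X\<^sub>g k * Xi\<^sub>g k - 1" "k \<in> {1..n}"
        | k where "s = Xi\<^sub>g k * X\<^sub>g k - 1" "k \<in> {1..n}"
        | i where "s = X\<^sub>g (i+1) - cst (inverse q) * T\<^sub>g i * X\<^sub>g i * T\<^sub>g i" "i \<in> {1..<n}"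
        using 1 NonDeg by auto
      then show ?thesis
      proof cases
        case (2 i)
        have "act st n s v j = 0" for j
          unfolding 2(1) act_mult act_diff act_plus act_gen_elt act_1 gact_add
          using NonDeg gact_T_twice[OF 2(2), of st v]
          by (simp add: act_cst rat_const_diff algebra_simps)
        then show ?thesis by (simp add: fun_eq_iff)
      next
        case 3
        then show ?thesis using nd by (auto simp: red gact_X gact_Xinv)
      next
        case 6
        have "rat_const (inverse q) * rat_const q = (1 :: 'a ratfun)"
          using q0 NonDeg by (simp add: rat_const_mult[symmetric])
        then show ?thesis
          using 6 NonDeg act_TXT[OF 6(2), of st v] gact_X[of "Suc i" n st v for i]
          by (simp add: red mult.assoc[symmetric])
      qed (use common nd in \<open>auto simp: red gact_X gact_Xinv\<close>)
    next
      case Deg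
      consider "s \<in> common_rels n"
        | i where "s = T\<^sub>g i * T\<^sub>g i - 1" "i \<in> {1..<n}"
        | i k where "s = X\<^sub>g i * X\<^sub>g k - X\<^sub>g k * X\<^sub>g i" "i \<in> {1..n}" "k \<in> {1..n}"
        | i where "s = X\<^sub>g (i+1) - (T\<^sub>g i * X\<^sub>g i * T\<^sub>g i + T\<^sub>g i)" "i \<in> {1..<n}"
        using 1 Deg by auto
      then show ?thesis
      proof cases
        case 2
        then show ?thesis using Deg gact_T_twice[OF 2(2), of st v] by (simp add: red)
      next
        case 3
        then show ?thesis by (simp add: red gact_X)
      next
        case 4
        then show ?thesis
          using Deg act_TXT[OF 4(2), of st v] gact_X[of "Suc i" n st v for i] by (simp add: red)
      qed (use common in auto)
    qed
  qed
qed

theorem act_congr: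
  assumes "qpar st \<noteq> 0" "congr (hrels st n) p p'"
  shows "act st n p v = act st n p' v"
proof -
  have "act st n (p - p') v \<in> {0}"
    by (rule act_two_sided[of _ "hrels st n" UNIV]) (use assms in \<open>auto simp: congr_def act_hecke_rels\<close>)
  then show ?thesis by (simp add: act_diff)
qed

lemma polys_n_induct_closed [consumes 1, case_names const var add mult]:
  assumes "p \<in> polys n"
    and "\<And>c. P (cst c)" and "\<And>k. k \<in> {1..n} \<Longrightarrow> P (pvar k)"
    and "\<And>p q. p \<in> polys n \<Longrightarrow> q \<in> polys n \<Longrightarrow> P p \<Longrightarrow> P q \<Longrightarrow> P (p + q)"
    and "\<And>p q. p \<in> polys n \<Longrightarrow> q \<in> polys n \<Longrightarrow> P p \<Longrightarrow> P q \<Longrightarrow> P (p * q)"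
  shows "P (p :: 'k::field mpol)"
proof -
  have "p \<in> polys n \<and> P p"
    using assms(1) by (induction rule: polys_n_induct) (simp_all add: assms polys_add polys_mult)
  then show ?thesis ..
qed

section \<open>Residues\<close>

locale hecke =
  fixes e n :: nat and st :: "'k::field setting"
  assumes admissible: "admissible e st"
begin

abbreviation "q \<equiv> qpar st"
abbreviation "h \<equiv> hpar st"
abbreviation "val \<equiv> residue_val st"
abbreviation hcong (infix "\<approx>" 50) where "hcong \<equiv> congr (hrels st n)"
abbreviation ccong where "ccong \<Lambda> \<equiv> congr (crels st n \<Lambda>)"

lemma q_nonzero [simp]: "q \<noteq> 0"
  using admissible by (cases st) auto

text \<open>Both residue maps follow the affine map x -> q x + h. It relates neighbouring
  eigenvalues, see \<open>phi_sq_root\<close>.\<close>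

lemma val_Suc: "val (k + 1) = q * val k + h"
  using admissible by (cases st) (auto simp: power_int_add)

lemma val_pred: "q * val (k - 1) = val k - h"
  using val_Suc[of "k - 1"] by simp

lemma mod_residues: "k mod int e \<in> residues_mod e"
  by (simp add: residues_mod_def)

lemma quantum_sum: "(q' - 1) * (\<Sum>j<k. q' ^ j) = (q' :: 'k) ^ k - 1"
  by (simp add: power_diff_1_eq)

text \<open>For e > 0 the vanishing sum 1 + q + ... + q^(e-1), multiplied by q - 1, gives q^e = 1.
  The degenerate case is divisibility by the characteristic.\<close>

lemma val_mod: "val (k mod int e) = val k"
proof (cases st)
  case (NonDeg q')
  then have q': "q' \<noteq> 0" "e = quantum_char q'" using admissible by auto
  have "q' ^ e = 1"
  proof (cases "e = 0")
    case False
    let ?P = "\<lambda>k. k > 0 \<and> (\<Sum>j<k. q' ^ j) = 0"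
    have "\<exists>k. ?P k" "e = (LEAST k. ?P k)"
      using False q' by (auto simp: quantum_char_def split: if_splits)
    then have "?P e" using LeastI_ex[of ?P] by simp
    then show ?thesis using quantum_sum[of q' e] by simp
  qed simp
  then have "q' powi (int e * d) = 1" for d
    by (simp add: power_int_mult)
  moreover have "q' powi (int e * (k div int e) + k mod int e)
      = q' powi (int e * (k div int e)) * q' powi (k mod int e)"
    using q' by (intro power_int_add) simp
  ultimately have "q' powi k = q' powi (k mod int e)"
    by (simp only: mult_div_mod_eq mult_1)
  then show ?thesis using NonDeg by simp
next
  case Deg
  then have c: "CHAR('k) = e" using admissible by simp
  have "of_int (int e * d) = (0 :: 'k)" for d
    unfolding of_int_eq_0_iff_char_dvd c by simp
  then have "of_int (int e * (k div int e) + k mod int e) = (of_int (k mod int e) :: 'k)"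
    unfolding of_int_add by (simp only: add_0)
  then have "of_int k = (of_int (k mod int e) :: 'k)" by (simp only: mult_div_mod_eq)
  then show ?thesis using Deg by simp
qed

text \<open>If q^d = 1 with d > 0, then the geometric sum of length d vanishes because q is not 1,
  so e is positive and at most d. Representatives differ by less than e.\<close>

lemma val_inj:
  assumes ab: "a \<in> residues_mod e" "b \<in> residues_mod e" and eq: "val a = val b"
  shows "a = b"
proof (cases st)
  case (NonDeg q')
  then have q': "q' \<noteq> 0" "q' \<noteq> 1" "e = quantum_char q'" using admissible by auto
  have False if "a \<in> residues_mod e" "b \<in> residues_mod e" "b < a" "q' powi a = q' powi b" for a b
  proof -
    define d where "d = nat (a - b)"
    have d: "d > 0" "a = b + int d" using that by (auto simp: d_def)
    have "q' powi b * q' ^ d = q' powi b"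
      using that(4) q'(1) unfolding d(2) by (simp add: power_int_add)
    then have "q' ^ d = 1" using q'(1) by simp
    then have z: "(\<Sum>j<d. q' ^ j) = 0" using quantum_sum[of q' d] q'(2) by simp
    then have ex: "\<exists>k>0. (\<Sum>j<k. q' ^ j) = 0" using d by blast
    then have e: "e = (LEAST k. k > 0 \<and> (\<Sum>j<k. q' ^ j) = 0)"
      by (simp add: q'(3) quantum_char_def)
    have "e \<le> d" unfolding e using z d by (intro Least_le) simp
    moreover have "e > 0"
      using LeastI_ex[of "\<lambda>k. k > 0 \<and> (\<Sum>j<k. q' ^ j) = 0"] ex e by simp
    ultimately have "int e \<le> a - b" using d by simp
    moreover have "0 \<le> b" "a < int e"
      using that \<open>e > 0\<close> by (simp_all add: residues_mod_def) (metis of_nat_0_less_iff pos_mod_sign pos_mod_bound)+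
    ultimately show False by simp
  qed
  then show ?thesis using ab eq NonDeg by (metis linorder_neqE residue_val.simps(1))
next
  case Deg
  then have c: "CHAR('k) = e" using admissible by simp
  have "of_int (a - b) = (0 :: 'k)" using eq Deg by simp
  then have "int e dvd a - b" by (simp only: of_int_eq_0_iff_char_dvd c)
  then have "a mod int e = b mod int e" by (simp add: mod_eq_dvd_iff)
  then show ?thesis using ab by (simp add: residues_mod_def)
qed

lemma act_hcong: "p \<approx> p' \<Longrightarrow> act st n p v = act st n p' v"
  by (rule act_congr[OF q_nonzero])


section \<open>Polynomials in the commuting generators\<close>

text \<open>The letters come in increasing order, which fixes one word per monomial. Variables with
  index outside 1..n are dropped, so \<open>Px\<close> is faithful to the polynomial only on
  \<open>polys n\<close>.\<close>

definition xm :: "(nat \<Rightarrow>\<^sub>0 nat) \<Rightarrow> 'k free" where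
  "xm m = prod_list (map (\<lambda>k. X\<^sub>g k ^ Poly_Mapping.lookup m k) [1..<Suc n])"

definition Px :: "'k mpol \<Rightarrow> 'k free" where
  "Px = lin_ext (\<lambda>m c. cst c * xm m)"

interpretation Px: additive_family "\<lambda>m c. cst c * xm m"
  by standard (simp add: cst_add distrib_right)

lemma Px_add: "Px (p + p') = Px p + Px p'" and Px_diff: "Px (p - p') = Px p - Px p'"
  and Px_uminus: "Px (- p) = - Px p" and Px_0 [simp]: "Px 0 = 0"
  by (simp_all add: Px_def Px.lin_ext_add Px.lin_ext_diff Px.lin_ext_uminus)

lemma Px_cst [simp]: "Px (cst c) = cst c"
proof -
  have "prod_list (map (\<lambda>k. 1) ks) = (1 :: 'k free)" for ks :: "nat list"
    by (induction ks) simp_all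
  then have "xm 0 = 1" by (simp add: xm_def del: upt_Suc)
  then show ?thesis by (simp add: Px_def cst_def[where 'm = "nat \<Rightarrow>\<^sub>0 nat"])
qed

lemma Px_1 [simp]: "Px 1 = 1"
  using Px_cst[of 1] by simp

lemma Px_pvar [simp]:
  assumes "k \<in> {1..n}"
  shows "Px (pvar k) = X\<^sub>g k"
proof -
  have decomp: "[1..<Suc n] = [1..<k] @ k # [Suc k..<Suc n]"
    using assms by (metis atLeastAtMost_iff less_Suc_eq_le upt_conv_Cons upt_add_eq_append le_add_diff_inverse
        le_SucI)
  have one: "prod_list (map (\<lambda>i. X\<^sub>g i ^ Poly_Mapping.lookup (Poly_Mapping.single k 1) i) ks) = (1 :: 'k free)"
    if "k \<notin> set ks" for ks
    using that by (induction ks) (auto simp: lookup_single when_def)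
  have "xm (Poly_Mapping.single k 1) = X\<^sub>g k"
    unfolding xm_def decomp using one[of "[1..<k]"] one[of "[Suc k..<Suc n]"] by (simp del: upt_Suc)
  then show ?thesis by (simp add: Px_def pvar_def)
qed

lemma commute_power:
  assumes "congr S (x * y) (y * x)"
  shows "congr S (x ^ a * y) (y * x ^ a)"
proof (induction a)
  case (Suc a)
  have "congr S (x * (x ^ a * y)) (x * (y * x ^ a))"
    by (intro congr_mult congr_refl Suc)
  also have "x * (y * x ^ a) = (x * y) * x ^ a" by (simp add: mult.assoc)
  also have "congr S \<dots> (y * x * x ^ a)"
    by (intro congr_mult congr_refl assms)
  finally show ?case by (simp add: mult.assoc)
qed simp

lemma commute_prod_list:
  assumes "\<And>x. x \<in> set xs \<Longrightarrow> congr S (x * y) (y * x)"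
  shows "congr S (prod_list xs * y) (y * prod_list xs)"
  using assms
proof (induction xs)
  case (Cons x xs)
  have "congr S (prod_list xs * y) (y * prod_list xs)" using Cons by auto
  then have "congr S (x * (prod_list xs * y)) (x * (y * prod_list xs))"
    by (rule congr_mult[OF congr_refl])
  also have "x * (y * prod_list xs) = (x * y) * prod_list xs" by (simp add: mult.assoc)
  also have "congr S \<dots> (y * x * prod_list xs)"
    by (rule congr_mult[OF _ congr_refl]) (simp add: Cons.prems)
  finally show ?case by (simp add: mult.assoc)
qed simp

lemma xm_add: "xm (m + m') \<approx> xm m * xm m'"
proof -
  have gen: "prod_list (map (\<lambda>k. X\<^sub>g k ^ (a k + b k)) ks)
      \<approx> prod_list (map (\<lambda>k. X\<^sub>g k ^ a k) ks) * prod_list (map (\<lambda>k. X\<^sub>g k ^ b k) ks)"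
    if "set ks \<subseteq> {1..n}" for ks and a b :: "nat \<Rightarrow> nat"
    using that
  proof (induction ks)
    case (Cons k ks)
    let ?A = "prod_list (map (\<lambda>k. X\<^sub>g k ^ a k) ks) :: 'k free"
    let ?B = "prod_list (map (\<lambda>k. X\<^sub>g k ^ b k) ks) :: 'k free"
    have xx: "X\<^sub>g i * X\<^sub>g k \<approx> X\<^sub>g k * X\<^sub>g i" if "i \<in> set ks" for i
      by (rule gen_cong(5)) (use that Cons.prems in auto)
    have "X\<^sub>g i ^ a i * X\<^sub>g k ^ b k \<approx> X\<^sub>g k ^ b k * X\<^sub>g i ^ a i" if "i \<in> set ks" for i
      by (rule commute_power[OF congr_sym[OF commute_power[OF congr_sym[OF xx[OF that]]]]])
    then have c: "?A * X\<^sub>g k ^ b k \<approx> X\<^sub>g k ^ b k * ?A"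
      by (intro commute_prod_list) auto
    have "X\<^sub>g k ^ (a k + b k) * prod_list (map (\<lambda>k. X\<^sub>g k ^ (a k + b k)) ks)
        \<approx> X\<^sub>g k ^ (a k + b k) * (?A * ?B)"
      using Cons by (intro congr_mult congr_refl) auto
    also have "\<dots> = X\<^sub>g k ^ a k * (X\<^sub>g k ^ b k * ?A) * ?B" by (simp add: power_add mult.assoc)
    also have "\<dots> \<approx> X\<^sub>g k ^ a k * (?A * X\<^sub>g k ^ b k) * ?B"
      by (intro congr_mult congr_refl congr_sym[OF c])
    finally show ?case by (simp add: mult.assoc)
  qed simp
  show ?thesis unfolding xm_def lookup_add by (rule gen) auto
qed

text \<open>Only a congruence: products of ordered words have to be reordered by the commutation of
  the X_k.\<close>

lemma Px_mult: "Px (p * p') \<approx> Px p * Px p'"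
proof (induction p rule: poly_mapping_additive_induct)
  case (single m c)
  show ?case
  proof (induction p' rule: poly_mapping_additive_induct)
    case (single m' d)
    have "cst (c * d) * xm (m + m') \<approx> cst (c * d) * (xm m * xm m')"
      by (intro congr_mult congr_refl xm_add)
    then show ?case
      by (simp add: Px_def mult_single cst_mult mult.assoc cst_left_comm[of "xm m"])
  qed (simp_all add: distrib_left Px_add congr_add)
qed (simp_all add: distrib_right Px_add congr_add)

lemma Px_comm: "Px p * Px p' \<approx> Px p' * Px p"
proof -
  have "Px p * Px p' \<approx> Px (p * p')" by (rule congr_sym[OF Px_mult])
  also have "p * p' = p' * p" by (rule mult.commute)
  also have "Px \<dots> \<approx> Px p' * Px p" by (rule Px_mult)
  finally show ?thesis .
qed

lemma Px_cst_mult: "Px (cst c * p) = cst c * Px p"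
  by (induction p rule: poly_mapping_additive_induct)
    (simp_all add: Px_def Px.lin_ext_add distrib_left cst_def[where 'm = "nat \<Rightarrow>\<^sub>0 nat"] mult_single cst_mult mult.assoc)

lemma act_Px: "p \<in> polys n \<Longrightarrow> act st n (Px p) v = (\<lambda>j. emb p * v j)"
proof (induction p arbitrary: v rule: polys_n_induct)
  case (mult p p')
  have "act st n (Px (p * p')) v = act st n (Px p * Px p') v"
    by (rule act_hcong[OF Px_mult])
  then show ?case by (simp add: act_mult mult emb.hom_mult mult.assoc)
qed (simp_all add: rat_const_emb tvar_emb gact_def fun_eq_iff Px_add act_plus emb.hom_add distrib_right)


section \<open>Straightening\<close>

abbreviation sp :: "nat \<Rightarrow> 'k mpol \<Rightarrow> 'k mpol" where
  "sp r \<equiv> perm_poly (simple_refl r)"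

lemma sp_hom: "sp r (p + p') = sp r p + sp r p'" "sp r (p * p') = sp r p * sp r p'"
  "sp r (p - p') = sp r p - sp r p'" "sp r (- p) = - sp r p" "sp r (p ^ a) = sp r p ^ a"
  "sp r 0 = 0" "sp r 1 = 1" "sp r (cst c) = cst c" "sp r (pvar k) = pvar (simple_refl r k)"
proof -
  interpret comm_ring_hom "sp r" by (rule comm_ring_hom_perm_poly) simp
  show "sp r (p + p') = sp r p + sp r p'" "sp r (p * p') = sp r p * sp r p'"
    "sp r (p - p') = sp r p - sp r p'" "sp r (- p) = - sp r p" "sp r (p ^ a) = sp r p ^ a"
    "sp r 0 = 0" "sp r 1 = 1" "sp r (cst c) = cst c" "sp r (pvar k) = pvar (simple_refl r k)"
    by (simp_all add: hom_add hom_mult hom_minus hom_uminus hom_power perm_poly_pvar)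
qed

lemma sp_polys: "r \<in> {1..<n} \<Longrightarrow> p \<in> polys n \<Longrightarrow> sp r p \<in> polys n"
  by (rule polys_perm_poly[OF simple_refl_permutes])

text \<open>The numerator of \<open>bco\<close>.\<close>

definition Bp :: "nat \<Rightarrow> 'k mpol" where
  "Bp r = cst (q - 1) * pvar (Suc r) + cst h"

lemma Bp_polys: "r \<in> {1..<n} \<Longrightarrow> Bp r \<in> polys n"
  unfolding Bp_def by (intro polys_add polys_mult polys_cst polys_pvar) auto

lemma T_square:
  assumes "r \<in> {1..<n}"
  shows "T\<^sub>g r * T\<^sub>g r \<approx> cst (q - 1) * T\<^sub>g r + cst q"
proof -
  have "T\<^sub>g r * T\<^sub>g r - (cst (q - 1) * T\<^sub>g r + cst q) = (T\<^sub>g r - cst q) * (T\<^sub>g r + 1)"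
    by (simp add: algebra_simps cst_diff)
  then show ?thesis
    using gen_cong(1)[OF assms, of st] by (metis congr_diff_0_iff)
qed

text \<open>T_r is invertible with q T_r^-1 = T_r - (q - 1). Multiplying T_r X_r T_r = q X_(r+1) - h
  T_r by this on the right gives the first rule, on the left the second.\<close>

lemma T_X:
  assumes r: "r \<in> {1..<n}"
  shows "T\<^sub>g r * X\<^sub>g r \<approx> X\<^sub>g (Suc r) * T\<^sub>g r - Px (Bp r)"
    and "T\<^sub>g r * X\<^sub>g (Suc r) \<approx> X\<^sub>g r * T\<^sub>g r + Px (Bp r)"
proof -
  let ?T = "T\<^sub>g r :: 'k free" and ?X = "X\<^sub>g r :: 'k free" and ?Y = "X\<^sub>g (Suc r) :: 'k free"
  have B: "Px (Bp r) = cst (q - 1) * ?Y + cst h"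
    using r by (simp add: Bp_def Px_add Px_cst_mult)
  have unscale: "x \<approx> y" if "cst q * x \<approx> cst q * y" for x y
  proof -
    have "cst (inverse q) * (cst q * x) \<approx> cst (inverse q) * (cst q * y)"
      by (rule congr_mult[OF congr_refl that])
    moreover have "cst (inverse q) * (cst q * z) = z" for z :: "'k free"
      by (metis cst_1 cst_mult left_inverse mult.assoc mult_1 q_nonzero)
    ultimately show ?thesis by simp
  qed
  have TXT: "?T * ?X * ?T \<approx> cst q * ?Y - cst h * ?T"
  proof -
    have "(?T * ?X * ?T + cst h * ?T) - cst h * ?T \<approx> cst q * ?Y - cst h * ?T"
      using congr_sym[OF gen_cong(6)[OF r q_nonzero]] by (intro congr_diff congr_refl) simp
    then show ?thesis by simp
  qed
  have inv: "?T * (?T - cst (q - 1)) \<approx> cst q" "(?T - cst (q - 1)) * ?T \<approx> cst q"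
    using congr_diff[OF T_square[OF r] congr_refl[of _ "cst (q - 1) * ?T"]]
    by (simp_all add: algebra_simps cst_comm[of ?T])
  have "cst q * (?T * ?X) = (?T * ?X) * cst q" by (simp add: cst_comm)
  also have "\<dots> \<approx> (?T * ?X) * (?T * (?T - cst (q - 1)))"
    by (intro congr_mult congr_refl congr_sym[OF inv(1)])
  also have "\<dots> = (?T * ?X * ?T) * (?T - cst (q - 1))" by (simp add: mult.assoc)
  also have "\<dots> \<approx> (cst q * ?Y - cst h * ?T) * (?T - cst (q - 1))"
    by (intro congr_mult congr_refl TXT)
  also have "\<dots> = cst q * ?Y * (?T - cst (q - 1)) - cst h * (?T * (?T - cst (q - 1)))"
    by (simp add: left_diff_distrib mult.assoc)
  also have "\<dots> \<approx> cst q * ?Y * (?T - cst (q - 1)) - cst h * cst q"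
    by (intro congr_diff congr_mult congr_refl inv)
  also have "\<dots> = cst q * (?Y * ?T - Px (Bp r))"
    unfolding B by (simp only: mult.assoc right_diff_distrib cst_comm[of ?Y] cst_comm[of "cst h"]
        distrib_left diff_diff_eq)
  finally show "?T * ?X \<approx> ?Y * ?T - Px (Bp r)" by (rule unscale)
  have "cst q * (?X * ?T) = cst q * ?X * ?T" by (simp add: mult.assoc)
  also have "\<dots> \<approx> (?T - cst (q - 1)) * ?T * ?X * ?T"
    by (intro congr_mult congr_refl congr_sym[OF inv(2)])
  also have "\<dots> = (?T - cst (q - 1)) * (?T * ?X * ?T)" by (simp add: mult.assoc)
  also have "\<dots> \<approx> (?T - cst (q - 1)) * (cst q * ?Y - cst h * ?T)"
    by (intro congr_mult congr_refl TXT)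
  also have "\<dots> = (?T - cst (q - 1)) * (cst q * ?Y) - cst h * ((?T - cst (q - 1)) * ?T)"
    by (simp add: right_diff_distrib cst_left_comm)
  also have "\<dots> \<approx> (?T - cst (q - 1)) * (cst q * ?Y) - cst h * cst q"
    by (intro congr_diff congr_mult congr_refl inv)
  also have "\<dots> = cst q * (?T * ?Y - Px (Bp r))"
    unfolding B by (simp only: right_diff_distrib left_diff_distrib distrib_left cst_left_comm[of ?T]
        cst_left_comm[of "cst (q - 1)"] cst_comm[of "cst h"] diff_diff_eq)
  finally have "?X * ?T \<approx> ?T * ?Y - Px (Bp r)" by (rule unscale)
  then have "?X * ?T + Px (Bp r) \<approx> ?T * ?Y - Px (Bp r) + Px (Bp r)"
    by (intro congr_add congr_refl)
  then show "?T * ?Y \<approx> ?X * ?T + Px (Bp r)" by (simp add: congr_sym)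
qed

text \<open>The Bernstein relation, with \<open>d\<close> the divided difference of
  \<open>p\<close>. Producing \<open>d\<close> within the induction avoids division: for products it
  obeys the twisted Leibniz rule \<open>sp r p * d' + d * p'\<close>.\<close>

lemma straighten:
  assumes r: "r \<in> {1..<n}" and "p \<in> polys n"
  shows "\<exists>d\<in>polys n. (pvar (Suc r) - pvar r) * d = p - sp r p \<and>
    T\<^sub>g r * Px p \<approx> Px (sp r p) * T\<^sub>g r + Px (Bp r * d)"
  using assms(2)
proof (induction p rule: polys_n_induct_closed)
  case (const c)
  show ?case by (intro bexI[of _ 0]) (simp_all add: sp_hom cst_comm)
next
  case (var k)
  consider "k = r" | "k = Suc r" | "k \<noteq> r" "k \<noteq> Suc r" by blast
  then show ?case
  proof cases
    case 1
    then show ?thesis using r T_X(1)[OF r]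
      by (intro bexI[of _ "- 1"]) (simp_all add: sp_hom Px_uminus polys_uminus)
  next
    case 2
    then show ?thesis using r T_X(2)[OF r]
      by (intro bexI[of _ 1]) (simp_all add: sp_hom)
  next
    case 3
    then show ?thesis using r var gen_cong(4)[OF r var, of st]
      by (intro bexI[of _ 0]) (simp_all add: sp_hom)
  qed
next
  case (add p p')
  then obtain d d' where d: "d \<in> polys n" "(pvar (Suc r) - pvar r) * d = p - sp r p"
      "T\<^sub>g r * Px p \<approx> Px (sp r p) * T\<^sub>g r + Px (Bp r * d)"
    and d': "d' \<in> polys n" "(pvar (Suc r) - pvar r) * d' = p' - sp r p'"
      "T\<^sub>g r * Px p' \<approx> Px (sp r p') * T\<^sub>g r + Px (Bp r * d')" by blast
  have "T\<^sub>g r * Px (p + p') \<approx> Px (sp r (p + p')) * T\<^sub>g r + Px (Bp r * (d + d'))"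
    using congr_add[OF d(3) d'(3)] by (simp add: Px_add sp_hom distrib_left distrib_right ac_simps)
  then show ?case
    using d d' by (intro bexI[of _ "d + d'"]) (simp_all add: distrib_left sp_hom polys_add)
next
  case (mult p p')
  then obtain d d' where d: "d \<in> polys n" "(pvar (Suc r) - pvar r) * d = p - sp r p"
      "T\<^sub>g r * Px p \<approx> Px (sp r p) * T\<^sub>g r + Px (Bp r * d)"
    and d': "d' \<in> polys n" "(pvar (Suc r) - pvar r) * d' = p' - sp r p'"
      "T\<^sub>g r * Px p' \<approx> Px (sp r p') * T\<^sub>g r + Px (Bp r * d')" by blast
  let ?d = "sp r p * d' + d * p'"
  have "T\<^sub>g r * Px (p * p') \<approx> T\<^sub>g r * (Px p * Px p')"
    by (intro congr_mult congr_refl Px_mult)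
  also have "\<dots> = T\<^sub>g r * Px p * Px p'" by (simp add: mult.assoc)
  also have "\<dots> \<approx> (Px (sp r p) * T\<^sub>g r + Px (Bp r * d)) * Px p'"
    by (intro congr_mult congr_refl d(3))
  also have "\<dots> = Px (sp r p) * (T\<^sub>g r * Px p') + Px (Bp r * d) * Px p'"
    by (simp add: distrib_right mult.assoc)
  also have "\<dots> \<approx> Px (sp r p) * (Px (sp r p') * T\<^sub>g r + Px (Bp r * d')) + Px (Bp r * d * p')"
    by (intro congr_add congr_mult congr_refl d'(3) congr_sym[OF Px_mult])
  also have "\<dots> = Px (sp r p) * Px (sp r p') * T\<^sub>g r + Px (sp r p) * Px (Bp r * d') + Px (Bp r * d * p')"
    by (simp add: distrib_left mult.assoc)
  also have "\<dots> \<approx> Px (sp r p * sp r p') * T\<^sub>g r + Px (sp r p * (Bp r * d')) + Px (Bp r * d * p')"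
    by (intro congr_add congr_mult congr_refl congr_sym[OF Px_mult])
  also have "\<dots> = Px (sp r (p * p')) * T\<^sub>g r + Px (Bp r * ?d)"
    by (simp add: Px_add[symmetric] sp_hom algebra_simps)
  finally have "T\<^sub>g r * Px (p * p') \<approx> Px (sp r (p * p')) * T\<^sub>g r + Px (Bp r * ?d)" .
  moreover have "(pvar (Suc r) - pvar r) * ?d = p * p' - sp r (p * p')"
  proof -
    have "(pvar (Suc r) - pvar r) * ?d
        = sp r p * ((pvar (Suc r) - pvar r) * d') + ((pvar (Suc r) - pvar r) * d) * p'"
      by (simp add: algebra_simps)
    then show ?thesis unfolding d(2) d'(2) by (simp add: sp_hom algebra_simps)
  qed
  moreover have "?d \<in> polys n"
    by (intro polys_add polys_mult sp_polys[OF r] mult.hyps d d')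
  ultimately show ?case by blast
qed

end

section \<open>Comaximality in commutative rings\<close>

definition comax :: "'a::comm_ring_1 \<Rightarrow> 'a \<Rightarrow> bool" where
  "comax a b \<longleftrightarrow> (\<exists>u v. u * a + v * b = 1)"

lemma comax_sym: "comax a b \<Longrightarrow> comax b a"
  unfolding comax_def by (metis add.commute)

lemma comax_1 [simp]: "comax a 1"
  unfolding comax_def by (intro exI[of _ 0] exI[of _ 1]) simp

lemma comax_mult:
  assumes "comax a b" "comax a c"
  shows "comax a (b * c)"
proof -
  obtain u v u' v' where "u * a + v * b = 1" "u' * a + v' * c = 1"
    using assms unfolding comax_def by blast
  then have "(u * a + v * b) * (u' * a + v' * c) = 1" by simp
  then have "(u * u' * a + u * v' * c + v * b * u') * a + (v * v') * (b * c) = 1"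
    by (simp add: algebra_simps)
  then show ?thesis unfolding comax_def by blast
qed

lemma comax_power: "comax a b \<Longrightarrow> comax a (b ^ k)"
  by (induction k) (simp_all add: comax_mult)

lemma comax_powers: "comax a b \<Longrightarrow> comax (a ^ l) (b ^ k)"
  by (rule comax_power[OF comax_sym[OF comax_power[OF comax_sym]]])

lemma comax_prod: "(\<And>x. x \<in> A \<Longrightarrow> comax a (f x)) \<Longrightarrow> comax a (prod f A)"
  by (induction A rule: infinite_finite_induct) (simp_all add: comax_mult)

lemma comax_diff_unit: "(a - b) * c = 1 \<Longrightarrow> comax a b"
  unfolding comax_def by (intro exI[of _ c] exI[of _ "- c"]) (simp add: algebra_simps)

text \<open>Each term of the binomial expansion contains x^k or y^l. This makes a difference of two
  commuting nilpotent elements nilpotent in \<open>eps_invert\<close>.\<close>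

lemma diff_power_split: "\<exists>A B. (x - y) ^ (k + l) = A * x ^ k + B * (y :: 'a::comm_ring_1) ^ l"
proof (induction "k + l" arbitrary: k l)
  case 0
  then show ?case by (intro exI[of _ 1] exI[of _ 0]) simp
next
  case (Suc m)
  show ?case
  proof (cases "k = 0 \<or> l = 0")
    case True
    then show ?thesis
    proof
      assume "k = 0"
      then show ?thesis by (intro exI[of _ "(x - y) ^ (k + l)"] exI[of _ 0]) simp
    next
      assume "l = 0"
      then show ?thesis by (intro exI[of _ 0] exI[of _ "(x - y) ^ (k + l)"]) simp
    qed
  next
    case False
    then obtain k' l' where kl: "k = Suc k'" "l = Suc l'" by (metis not0_implies_Suc)
    have "m = k' + l" "m = k + l'" using Suc(2) kl by auto
    then obtain A B A' B' where
      1: "(x - y) ^ m = A * x ^ k' + B * y ^ l" and 2: "(x - y) ^ m = A' * x ^ k + B' * y ^ l'"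
      using Suc(1) by metis
    have "(x - y) ^ (k + l) = x * (x - y) ^ m - y * (x - y) ^ m"
      unfolding Suc(2)[symmetric] by (simp add: algebra_simps)
    also have "\<dots> = x * (A * x ^ k' + B * y ^ l) - y * (A' * x ^ k + B' * y ^ l')"
      using 1 2 by simp
    also have "\<dots> = (A - y * A') * x ^ k + (x * B - B') * y ^ l"
      by (simp add: kl algebra_simps)
    finally show ?thesis by blast
  qed
qed

text \<open>A new element \<open>c\<close> is comaximal to the product over \<open>B\<close>, say s
  P(c) + t prod = 1; the old coefficients are rescaled by s and the new one is t.\<close>

lemma partial_fractions:
  fixes P :: "'b \<Rightarrow> 'a::comm_ring_1"
  assumes "finite B" "\<And>a b. a \<in> B \<Longrightarrow> b \<in> B \<Longrightarrow> a \<noteq> b \<Longrightarrow> comax (P a) (P b)" "B \<noteq> {}"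
  shows "\<exists>u. (\<Sum>a\<in>B. u a * prod P (B - {a})) = 1"
  using assms(1,3,2)
proof (induction B rule: finite_ne_induct)
  case (singleton x)
  then show ?case by (intro exI[of _ "\<lambda>_. 1"]) simp
next
  case (insert c B)
  then obtain u where u: "(\<Sum>a\<in>B. u a * prod P (B - {a})) = 1" by auto
  have "comax (P c) (prod P B)"
    using insert by (intro comax_prod) auto
  then obtain s t where st: "s * P c + t * prod P B = 1" unfolding comax_def by blast
  define u' where "u' a = (if a = c then t else s * u a)" for a
  have "(\<Sum>a\<in>insert c B. u' a * prod P (insert c B - {a}))
      = u' c * prod P B + (\<Sum>a\<in>B. u' a * prod P (insert c B - {a}))"
    using insert by simp
  also have "(\<Sum>a\<in>B. u' a * prod P (insert c B - {a})) = (\<Sum>a\<in>B. (s * P c) * (u a * prod P (B - {a})))"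
  proof (rule sum.cong)
    fix a assume a: "a \<in> B"
    then have "a \<noteq> c" "insert c B - {a} = insert c (B - {a})" using insert by auto
    then show "u' a * prod P (insert c B - {a}) = (s * P c) * (u a * prod P (B - {a}))"
      using a insert by (simp add: u'_def ac_simps)
  qed simp
  also have "u' c * prod P B + \<dots> = 1"
    using st u by (simp add: u'_def sum_distrib_left[symmetric] add.commute)
  finally show ?case by blast
qed

text \<open>Modulo \<open>g\<close> each factor is divisible by the corresponding x - c, hence so is
  the product. In \<open>rootp_step\<close> the role of \<open>g\<close> is played by the square of
  the intertwiner.\<close>

lemma prod_list_split:
  fixes x :: "'a::comm_ring_1"
  assumes "\<And>a. a \<in> set ks \<Longrightarrow> \<exists>A B. w a = g * A + (x - c a) * B"
  shows "\<exists>A B. prod_list (map w ks) = g * A + prod_list (map (\<lambda>a. x - c a) ks) * B"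
  using assms
proof (induction ks)
  case Nil
  then show ?case by (intro exI[of _ 0] exI[of _ 1]) simp
next
  case (Cons a ks)
  then obtain A B A' B' where 1: "w a = g * A + (x - c a) * B"
    and 2: "prod_list (map w ks) = g * A' + prod_list (map (\<lambda>a. x - c a) ks) * B'" by fastforce
  let ?P = "prod_list (map (\<lambda>a. x - c a) ks)"
  have "prod_list (map w (a # ks)) = (g * A + (x - c a) * B) * (g * A' + ?P * B')"
    using 1 2 by simp
  also have "\<dots> = g * (A * (g * A' + ?P * B') + (x - c a) * B * A') + (x - c a) * ?P * (B * B')"
    by (simp add: algebra_simps)
  finally show ?case by auto
qed

section \<open>Substitution into polynomials in one variable\<close>

definition pe :: "'k::field poly \<Rightarrow> 'k mpol \<Rightarrow> 'k mpol" where
  "pe f x = poly (map_poly cst f) x"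

lemma comm_ring_hom_pe: "comm_ring_hom (\<lambda>f. pe f x)"
proof -
  interpret c: comm_ring_hom "cst :: 'a \<Rightarrow> 'a mpol" by (rule comm_ring_hom_cst)
  interpret m: map_poly_comm_ring_hom "cst :: 'a \<Rightarrow> 'a mpol" ..
  show ?thesis
    by standard (simp_all add: pe_def m.hom_add m.hom_mult)
qed

lemma pe_linear: "pe [:- a, 1:] x = x - cst a"
  by (simp add: pe_def map_poly_pCons cst_uminus)

lemma hom_pe:
  assumes "comm_ring_hom (f :: 'k::field mpol \<Rightarrow> 'k mpol)" "\<And>c. f (cst c) = cst c"
  shows "f (pe p x) = pe p (f x)"
proof -
  interpret f: comm_ring_hom f by fact
  have e: "f (poly P x) = poly (map_poly f P) (f x)" for P
    by (induction P) (simp_all add: map_poly_pCons f.hom_add f.hom_mult)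
  have "map_poly f (map_poly cst p) = map_poly cst p"
    by (rule poly_eqI) (simp add: coeff_map_poly assms(2))
  then show ?thesis unfolding pe_def e by simp
qed

lemma pe_polys:
  assumes "x \<in> polys n"
  shows "pe f x \<in> polys n"
  unfolding pe_def poly_altdef
  by (intro polys_sum polys_mult polys_power assms) (simp add: coeff_map_poly)


context hecke
begin

section \<open>Intertwiners\<close>

lemma T_symmetric_comm:
  assumes r: "r \<in> {1..<n}" and p: "p \<in> polys n" "sp r p = p"
  shows "T\<^sub>g r * Px p \<approx> Px p * T\<^sub>g r"
proof -
  obtain d where d: "(pvar (Suc r) - pvar r) * d = p - sp r p"
      "T\<^sub>g r * Px p \<approx> Px (sp r p) * T\<^sub>g r + Px (Bp r * d)"
    using straighten[OF r p(1)] by blast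
  have "d = 0" using d(1) p(2) by simp
  then show ?thesis using d(2) p(2) by simp
qed

text \<open>The intertwiner (t_(r+1) - t_r)(T_r - b). On vectors it is a multiple of the reflection
  s_r, so it moves polynomials past itself without the correction term of
  \<open>straighten\<close>.\<close>

definition phi :: "nat \<Rightarrow> 'k free" where
  "phi r = Px (pvar (Suc r) - pvar r) * T\<^sub>g r - Px (Bp r)"

lemma phi_Px:
  assumes r: "r \<in> {1..<n}" and p: "p \<in> polys n"
  shows "phi r * Px p \<approx> Px (sp r p) * phi r"
proof -
  obtain d where d: "(pvar (Suc r) - pvar r) * d = p - sp r p"
      "T\<^sub>g r * Px p \<approx> Px (sp r p) * T\<^sub>g r + Px (Bp r * d)"
    using straighten[OF r p] by blast
  let ?D = "pvar (Suc r) - pvar r :: 'k mpol"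
  have "phi r * Px p = Px ?D * (T\<^sub>g r * Px p) - Px (Bp r) * Px p"
    by (simp add: phi_def left_diff_distrib mult.assoc)
  also have "\<dots> \<approx> Px ?D * (Px (sp r p) * T\<^sub>g r + Px (Bp r * d)) - Px (Bp r * p)"
    by (intro congr_diff congr_mult[OF congr_refl d(2)] congr_sym[OF Px_mult])
  also have "\<dots> = (Px ?D * Px (sp r p)) * T\<^sub>g r + Px ?D * Px (Bp r * d) - Px (Bp r * p)"
    by (simp add: distrib_left mult.assoc)
  also have "\<dots> \<approx> (Px (sp r p) * Px ?D) * T\<^sub>g r + Px (?D * (Bp r * d)) - Px (Bp r * p)"
    by (intro congr_diff congr_add congr_refl congr_mult[OF Px_comm congr_refl] congr_sym[OF Px_mult])
  also have "\<dots> = Px (sp r p) * (Px ?D * T\<^sub>g r) - Px (sp r p * Bp r)"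
  proof -
    have "?D * (Bp r * d) - Bp r * p = - (sp r p * Bp r)"
      using arg_cong[OF d(1), of "\<lambda>z. Bp r * z"] by (simp add: algebra_simps)
    then have "Px (?D * (Bp r * d)) - Px (Bp r * p) = - Px (sp r p * Bp r)"
      by (simp add: Px_diff[symmetric] Px_uminus[symmetric])
    then show ?thesis by (simp add: mult.assoc algebra_simps)
  qed
  also have "\<dots> \<approx> Px (sp r p) * (Px ?D * T\<^sub>g r) - Px (sp r p) * Px (Bp r)"
    by (intro congr_diff congr_refl Px_mult)
  also have "\<dots> = Px (sp r p) * phi r"
    by (simp add: phi_def right_diff_distrib)
  finally show ?thesis .
qed

text \<open>The square of \<open>phi r\<close> as a polynomial in y = t_(r+1), x = t_r. Up to the
  factor -q it is (y - (q x + h))(y - (x - h)/q): it vanishes exactly at neighbouring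
  residues.\<close>

definition phi_sq :: "'k mpol \<Rightarrow> 'k mpol \<Rightarrow> 'k mpol" where
  "phi_sq y x = (cst (q - 1) * y + cst h) * (cst (q - 1) * x + cst h) - cst q * (y - x) ^ 2"

lemma phi_phi:
  assumes r: "r \<in> {1..<n}"
  shows "phi r * phi r \<approx> Px (phi_sq (pvar (Suc r)) (pvar r))"
proof -
  let ?D = "pvar (Suc r) - pvar r :: 'k mpol"
  let ?B = "Bp r" and ?B' = "sp r (Bp r)" and ?T = "T\<^sub>g r :: 'k free"
  have D: "?D \<in> polys n" using r by (intro polys_diff polys_pvar) auto
  have sD: "sp r ?D = - ?D" by (simp add: sp_hom)
  have P: "Px p * (Px p' * x) \<approx> Px (p * p') * x" for p p' x
    unfolding mult.assoc[symmetric] by (intro congr_mult[OF _ congr_refl] congr_sym[OF Px_mult])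
  have "phi r * phi r = (phi r * Px ?D) * ?T - phi r * Px ?B"
    by (simp add: phi_def[of r] right_diff_distrib mult.assoc)
  also have "\<dots> \<approx> (Px (sp r ?D) * phi r) * ?T - Px ?B' * phi r"
    by (intro congr_diff congr_mult[OF _ congr_refl] phi_Px r D Bp_polys)
  also have "\<dots> = Px ?B' * Px ?B - Px ?D * (Px ?D * (?T * ?T)) + Px ?D * (Px ?B * ?T) - Px ?B' * (Px ?D * ?T)"
    unfolding sD Px_uminus phi_def by (simp only: right_diff_distrib left_diff_distrib mult.assoc
        mult_minus_left mult_minus_right) (simp add: algebra_simps)
  also have "\<dots> \<approx> Px (?B' * ?B) - Px (?D * ?D) * (cst (q - 1) * ?T + cst q) + Px (?D * ?B) * ?T - Px (?B' * ?D) * ?T"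
    by (intro congr_diff congr_add P congr_sym[OF Px_mult]
        congr_trans[OF P congr_mult[OF congr_refl T_square[OF r]]])
  also have "\<dots> = Px (?B' * ?B - cst q * (?D * ?D)) + Px (?D * (?B - ?B' - cst (q - 1) * ?D)) * ?T"
  proof -
    have c: "Px (?D * ?D) * (cst (q - 1) * ?T + cst q)
        = Px (cst (q - 1) * (?D * ?D)) * ?T + Px (cst q * (?D * ?D))"
      by (simp only: Px_cst_mult distrib_left cst_left_comm[of "Px _"] cst_comm[of "Px _"] mult.assoc)
    have "?D * (?B - ?B' - cst (q - 1) * ?D) = ?D * ?B - ?B' * ?D - cst (q - 1) * (?D * ?D)"
      by (simp add: algebra_simps)
    then show ?thesis unfolding c by (simp add: Px_diff left_diff_distrib)
  qed
  also have "\<dots> = Px (phi_sq (pvar (Suc r)) (pvar r))"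
  proof -
    \<comment> \<open>This is the remaining coefficient of T_r; it vanishes because
      \<open>Bp r\<close> is affine in t_(r+1) with slope q - 1.\<close>
    have "?B - ?B' - cst (q - 1) * ?D = 0"
      by (simp add: Bp_def sp_hom algebra_simps)
    moreover have "?B' * ?B - cst q * (?D * ?D) = phi_sq (pvar (Suc r)) (pvar r)"
      by (simp add: Bp_def sp_hom phi_sq_def power2_eq_square mult.commute)
    ultimately show ?thesis by simp
  qed
  finally show ?thesis .
qed


section \<open>Spectra of the generators in cyclotomic quotients\<close>

text \<open>The kernel of \<open>Px\<close> into the cyclotomic algebra. As an ideal of a
  commutative ring it can be handled by comaximality.\<close>

definition Iz :: "int multiset \<Rightarrow> 'k mpol \<Rightarrow> bool" where
  "Iz \<Lambda> p \<longleftrightarrow> ccong \<Lambda> (Px p) 0"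

lemma Iz_mult: "Iz \<Lambda> p \<Longrightarrow> Iz \<Lambda> (p * p')"
  unfolding Iz_def
  using congr_trans[OF congr_hrels_crels[OF Px_mult] congr_mult[OF _ congr_refl, of _ "Px p" 0 "Px p'"]] by simp

lemma Iz_mult2: "Iz \<Lambda> p \<Longrightarrow> Iz \<Lambda> (p' * p)"
  using Iz_mult by (simp add: mult.commute)

lemma Iz_add: "Iz \<Lambda> p \<Longrightarrow> Iz \<Lambda> p' \<Longrightarrow> Iz \<Lambda> (p + p')"
  unfolding Iz_def Px_add using congr_add[of _ "Px p" 0 "Px p'" 0] by simp

lemma Iz_uminus: "Iz \<Lambda> p \<Longrightarrow> Iz \<Lambda> (- p)"
  using Iz_mult[of \<Lambda> p "- 1"] by simp

lemma Iz_diff: "Iz \<Lambda> p \<Longrightarrow> Iz \<Lambda> p' \<Longrightarrow> Iz \<Lambda> (p - p')"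
  using Iz_add[of \<Lambda> p "- p'"] Iz_uminus by simp

lemma Iz_0 [simp]: "Iz \<Lambda> 0"
  by (simp add: Iz_def)

lemma Iz_sum: "(\<And>x. x \<in> A \<Longrightarrow> Iz \<Lambda> (f x)) \<Longrightarrow> Iz \<Lambda> (sum f A)"
  by (induction A rule: infinite_finite_induct) (simp_all add: Iz_add)

lemma Iz_dvd: "p dvd p' \<Longrightarrow> Iz \<Lambda> p \<Longrightarrow> Iz \<Lambda> p'"
  by (auto elim!: dvdE intro: Iz_mult)

lemma Iz_mono: "\<Lambda> \<subseteq># \<Lambda>' \<Longrightarrow> Iz \<Lambda>' p \<Longrightarrow> Iz \<Lambda> p"
  unfolding Iz_def by (rule congr_crels_mono)

lemma Iz_diff_iff: "Iz \<Lambda> (p - p') \<longleftrightarrow> ccong \<Lambda> (Px p) (Px p')"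
  by (simp add: Iz_def Px_diff congr_diff_0_iff)

lemma Iz_comax:
  assumes "comax a b" "Iz \<Lambda> (a * p)" "Iz \<Lambda> (b * p)"
  shows "Iz \<Lambda> p"
proof -
  obtain u v where "u * a + v * b = 1" using assms(1) unfolding comax_def by blast
  then have "p = (u * a + v * b) * p" by simp
  also have "\<dots> = u * (a * p) + v * (b * p)" by (simp add: algebra_simps)
  finally show ?thesis using assms(2,3) by (metis Iz_add Iz_mult2)
qed

lemma comax_linear: "a \<noteq> b \<Longrightarrow> comax ((x - cst a) ^ k) ((x - cst b :: 'k mpol) ^ l)"
  by (intro comax_powers comax_diff_unit[of _ _ "cst (1 / (b - a))"])
    (simp add: cst_mult[symmetric] cst_diff[symmetric])

section \<open>Annihilating polynomials of the X_r\<close>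

definition rootp :: "int list \<Rightarrow> 'k mpol \<Rightarrow> 'k mpol" where
  "rootp ks x = prod_list (map (\<lambda>k. x - cst (val k)) ks)"

lemma rootp_append: "rootp (ks @ ls) x = rootp ks x * rootp ls x"
  by (simp add: rootp_def)

lemma rootp_polys: "x \<in> polys n \<Longrightarrow> rootp ks x \<in> polys n"
  by (induction ks) (simp_all add: rootp_def polys_mult polys_diff)

lemma sp_rootp: "sp r (rootp ks x) = rootp ks (sp r x)"
  by (induction ks) (simp_all add: rootp_def sp_hom)

lemma phi_sq_root:
  "cst (- inverse q) * phi_sq y (cst (val a)) = (y - cst (val (a + 1))) * (y - cst (val (a - 1)))"
proof -
  have p: "val (a - 1) = inverse q * (val a - h)"
    using val_pred[of a] by (simp add: field_simps)
  define c a' h' iq :: "'k mpol" where "c = cst q" and "a' = cst (val a)" and "h' = cst h" and "iq = cst (inverse q)"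
  have i: "iq * c = 1" by (simp add: iq_def c_def cst_mult[symmetric])
  have "- iq * (((c - 1) * y + h') * ((c - 1) * a' + h') - c * (y - a') ^ 2)
      = (y - (c * a' + h')) * (y - iq * (a' - h'))"
  proof -
    have "- iq * (((c - 1) * y + h') * ((c - 1) * a' + h') - c * (y - a') ^ 2)
        - (y - (c * a' + h')) * (y - iq * (a' - h'))
      = (iq * c - 1) * (y ^ 2 - c * y * a' - y * h')"
      by (simp add: algebra_simps power2_eq_square)
    then show ?thesis unfolding i by simp
  qed
  then show ?thesis
    unfolding phi_sq_def val_Suc p cst_add cst_mult cst_diff cst_uminus
    by (simp add: c_def a'_def h'_def iq_def)
qed

text \<open>Since f(X_(r+1)) phi^2 = phi f(X_r) phi, the left side dies with f(X_r). On the
  eigenvalue \<open>val k\<close> of X_r, phi^2 has in X_(r+1) only the roots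
  \<open>val (k + 1)\<close> and \<open>val (k - 1)\<close>. So the eigenvalues of X_(r+1) lie among
  those of X_r and their neighbours.\<close>

lemma rootp_step:
  assumes r: "r \<in> {1..<n}" and f: "Iz \<Lambda> (rootp ks (pvar r))"
  shows "\<exists>ks'. Iz \<Lambda> (rootp ks' (pvar (Suc r)))"
proof -
  let ?x = "pvar r :: 'k mpol" and ?y = "pvar (Suc r) :: 'k mpol"
  have xy: "?x \<in> polys n" "?y \<in> polys n" using r by (auto intro!: polys_pvar)
  have "ccong \<Lambda> (Px (rootp ks ?y * phi_sq ?y ?x)) 0"
  proof -
    have "Px (rootp ks ?y * phi_sq ?y ?x) \<approx> Px (rootp ks ?y) * Px (phi_sq ?y ?x)"
      by (rule Px_mult)
    also have "\<dots> \<approx> Px (rootp ks ?y) * (phi r * phi r)"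
      by (intro congr_mult[OF congr_refl] congr_sym[OF phi_phi[OF r]])
    also have "\<dots> = Px (sp r (rootp ks ?x)) * phi r * phi r"
      by (simp add: sp_rootp sp_hom mult.assoc)
    also have "\<dots> \<approx> phi r * Px (rootp ks ?x) * phi r"
      by (intro congr_mult[OF _ congr_refl] congr_sym[OF phi_Px[OF r]] rootp_polys xy)
    finally have 1: "ccong \<Lambda> (Px (rootp ks ?y * phi_sq ?y ?x)) (phi r * Px (rootp ks ?x) * phi r)"
      by (rule congr_hrels_crels)
    have "ccong \<Lambda> (phi r * Px (rootp ks ?x) * phi r) (phi r * 0 * phi r)"
      using f unfolding Iz_def by (intro congr_mult[OF congr_mult[OF congr_refl] congr_refl])
    with 1 show ?thesis using congr_trans by fastforce
  qed
  then have I1: "Iz \<Lambda> (rootp ks ?y * phi_sq ?y ?x)" by (simp add: Iz_def)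
  \<comment> \<open>The two neighbour roots of \<open>k\<close>; by \<open>phi_sq_root\<close> this
    is a scalar multiple of phi^2 modulo X_r - \<open>val k\<close>.\<close>
  define w where "w k = (?y - cst (val (k + 1))) * (?y - cst (val (k - 1)))" for k
  have "\<exists>A B. prod_list (map w ks) = phi_sq ?y ?x * A + prod_list (map (\<lambda>k. ?x - cst (val k)) ks) * B"
  proof (rule prod_list_split)
    fix k
    let ?c = "cst (val k) :: 'k mpol"
    let ?D = "- ((cst (q - 1) * ?y + cst h) * cst (q - 1)) - cst q * (2 * ?y - ?c - ?x)"
    have "phi_sq ?y ?c = phi_sq ?y ?x + (?x - ?c) * ?D"
      by (simp add: phi_sq_def algebra_simps power2_eq_square)
    then have "w k = cst (- inverse q) * (phi_sq ?y ?x + (?x - ?c) * ?D)"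
      unfolding w_def using phi_sq_root[of ?y k] by simp
    then have "w k = phi_sq ?y ?x * cst (- inverse q) + (?x - ?c) * (cst (- inverse q) * ?D)"
      by (simp only: distrib_left mult.commute mult.left_commute)
    then show "\<exists>A B. w k = phi_sq ?y ?x * A + (?x - cst (val k)) * B" by blast
  qed
  then obtain A B where AB: "prod_list (map w ks) = phi_sq ?y ?x * A + rootp ks ?x * B"
    unfolding rootp_def by blast
  have "prod_list (map w ks) = rootp (map (\<lambda>k. k + 1) ks) ?y * rootp (map (\<lambda>k. k - 1) ks) ?y"
    by (induction ks) (simp_all add: w_def rootp_def ac_simps)
  then have "rootp (ks @ map (\<lambda>k. k + 1) ks @ map (\<lambda>k. k - 1) ks) ?y = rootp ks ?y * prod_list (map w ks)"
    by (simp only: rootp_append)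
  also have "\<dots> = (rootp ks ?y * phi_sq ?y ?x) * A + rootp ks ?x * (B * rootp ks ?y)"
    unfolding AB by (simp add: algebra_simps)
  finally have "rootp (ks @ map (\<lambda>k. k + 1) ks @ map (\<lambda>k. k - 1) ks) ?y
      = (rootp ks ?y * phi_sq ?y ?x) * A + rootp ks ?x * (B * rootp ks ?y)" .
  then show ?thesis using I1 f by (metis Iz_add Iz_mult)
qed

text \<open>The induction starts from the cyclotomic relation, whose factors are the linear factors
  of X_1.\<close>

lemma rootp_ex: "k \<in> {1..n} \<Longrightarrow> \<exists>ks. Iz \<Lambda> (rootp ks (pvar k))"
proof (induction k)
  case (Suc k)
  show ?case
  proof (cases "k = 0")
    case True
    obtain ks where ks: "mset ks = \<Lambda>" using ex_mset by blast
    have "Px (rootp ls (pvar 1)) \<approx> prod_list (map (\<lambda>\<kappa>. X\<^sub>g 1 - cst (val \<kappa>)) ls)" for ls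
    proof (induction ls)
      case (Cons l ls)
      have "Px ((pvar 1 - cst (val l)) * rootp ls (pvar 1)) \<approx> Px (pvar 1 - cst (val l)) * Px (rootp ls (pvar 1))"
        by (rule Px_mult)
      also have "\<dots> \<approx> (X\<^sub>g 1 - cst (val l)) * prod_list (map (\<lambda>\<kappa>. X\<^sub>g 1 - cst (val \<kappa>)) ls)"
        using Suc.prems by (intro congr_mult Cons.IH) (simp add: Px_diff)
      finally show ?case by (simp add: rootp_def)
    qed (simp add: rootp_def)
    then have "ccong \<Lambda> (Px (rootp ks (pvar 1))) (prod_list (map (\<lambda>\<kappa>. X\<^sub>g 1 - cst (val \<kappa>)) ks))"
      by (rule congr_hrels_crels)
    moreover have "prod_list (map (\<lambda>\<kappa>. X\<^sub>g 1 - cst (val \<kappa>)) ks) \<in> cycrels st n \<Lambda>"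
      unfolding cycrels_def using ks Suc.prems True by auto
    then have "ccong \<Lambda> (prod_list (map (\<lambda>\<kappa>. X\<^sub>g 1 - cst (val \<kappa>)) ks)) 0"
      unfolding congr_0_iff by (intro two_sided.base UnI2)
    ultimately have "Iz \<Lambda> (rootp ks (pvar (Suc k)))"
      unfolding Iz_def using True congr_trans by simp blast
    then show ?thesis ..
  next
    case False
    then show ?thesis using Suc rootp_step[of k] by auto
  qed
qed simp


section \<open>Residue idempotents as polynomials\<close>

text \<open>The data \<open>(B, M, \<eta>)\<close>: a finite set of residues, an exponent and the partial fraction idempotents
  of \<open>\<Prod>\<^sub>b (Z - val b)\<^sup>M\<close>, a polynomial annihilating all \<open>X\<^sub>r\<close>.\<close>

definition valid :: "int multiset \<Rightarrow> int set \<Rightarrow> nat \<Rightarrow> (int \<Rightarrow> 'k poly) \<Rightarrow> bool" where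
  "valid \<Lambda> B M \<eta> \<longleftrightarrow> finite B \<and> B \<subseteq> residues_mod e \<and> (\<forall>a. a \<notin> B \<longrightarrow> \<eta> a = 0) \<and> (\<Sum>a\<in>B. \<eta> a) = 1 \<and>
     (\<forall>r\<in>{1..n}. \<forall>a. Iz \<Lambda> ((pvar r - cst (val a)) ^ M * pe (\<eta> a) (pvar r)))"

text \<open>Data for a larger weight serve every smaller one; this is the source of coherence in
  \<open>EL_coherent\<close>.\<close>

lemma valid_mono: "\<Lambda> \<subseteq># \<Lambda>' \<Longrightarrow> valid \<Lambda>' B M \<eta> \<Longrightarrow> valid \<Lambda> B M \<eta>"
  unfolding valid_def using Iz_mono by blast

lemma ex_valid: "\<exists>B M \<eta>. valid \<Lambda> B M \<eta>"
proof -
  obtain L where L: "\<And>r. r \<in> {1..n} \<Longrightarrow> Iz \<Lambda> (rootp (L r) (pvar r))"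
    using choice[of "\<lambda>r ks. r \<in> {1..n} \<longrightarrow> Iz \<Lambda> (rootp ks (pvar r))"] rootp_ex by blast
  \<comment> \<open>The residue 0 keeps \<open>B\<close> nonempty, as
    \<open>partial_fractions\<close> requires, when no eigenvalue is listed (for instance for n =
    0).\<close>
  define B where "B = insert 0 (\<Union>r\<in>{1..n}. (\<lambda>k. k mod int e) ` set (L r))"
  \<comment> \<open>One exponent for all r: the sum of the lengths bounds the multiplicity of each
    root in each list.\<close>
  define M where "M = (\<Sum>r\<in>{1..n}. length (L r))"
  have B: "finite B" "B \<subseteq> residues_mod e" "B \<noteq> {}"
    using mod_residues by (auto simp: B_def residues_mod_def)
  define rB where "rB x = (\<Prod>b\<in>B. x - cst (val b))" for x :: "'k mpol"
  have dvd: "rootp ks x dvd rB x ^ length ks" if "(\<lambda>k. k mod int e) ` set ks \<subseteq> B" for ks x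
    using that
  proof (induction ks)
    case (Cons k ks)
    have "x - cst (val k) dvd rB x"
      unfolding rB_def using Cons.prems val_mod[of k] by (intro dvd_prodI[OF B(1), THEN dvd_trans[rotated]]) auto
    then show ?case using Cons by (auto simp: rootp_def intro!: mult_dvd_mono)
  qed (simp add: rootp_def)
  have rB: "Iz \<Lambda> (rB (pvar r) ^ M)" if r: "r \<in> {1..n}" for r
  proof -
    have "length (L r) \<le> M" unfolding M_def using r by (intro member_le_sum) auto
    then have "rootp (L r) (pvar r) dvd rB (pvar r) ^ M"
      using dvd[of "L r" "pvar r"] r by (intro dvd_trans[OF dvd le_imp_power_dvd]) (auto simp: B_def)
    then show ?thesis using Iz_dvd L[OF r] by blast
  qed
  define P where "P b = ([:- val b, 1:] :: 'k poly) ^ M" for b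
  have "\<exists>u. (\<Sum>a\<in>B. u a * prod P (B - {a})) = 1"
  proof (rule partial_fractions[OF B(1) _ B(3)])
    fix a b assume ab: "a \<in> B" "b \<in> B" "a \<noteq> b"
    then have "val a \<noteq> val b" using val_inj B(2) by blast
    then have "comax [:- val a, 1:] [:- val b, 1:]"
      by (intro comax_diff_unit[of _ _ "[:1 / (val b - val a):]"]) (simp add: one_pCons)
    then show "comax (P a) (P b)" unfolding P_def by (rule comax_powers)
  qed
  then obtain u where u: "(\<Sum>a\<in>B. u a * prod P (B - {a})) = 1" by blast
  define \<eta> where "\<eta> a = (if a \<in> B then u a * prod P (B - {a}) else 0)" for a
  have "Iz \<Lambda> ((pvar r - cst (val a)) ^ M * pe (\<eta> a) (pvar r))" if r: "r \<in> {1..n}" for r a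
  proof (cases "a \<in> B")
    case True
    interpret pe: comm_ring_hom "\<lambda>f. pe f (pvar r :: 'k mpol)" by (rule comm_ring_hom_pe)
    have "(pvar r - cst (val a)) ^ M * pe (\<eta> a) (pvar r) = pe (P a * \<eta> a) (pvar r)"
      by (simp add: P_def pe.hom_mult pe.hom_power pe_linear)
    also have "P a * \<eta> a = u a * prod P B"
      using True B(1) by (simp add: \<eta>_def prod.remove[of B a P])
    also have "pe \<dots> (pvar r) = pe (u a) (pvar r) * rB (pvar r) ^ M"
      by (simp add: pe.hom_mult pe.hom_prod P_def pe.hom_power pe_linear rB_def prod_power_distrib)
    finally show ?thesis using rB[OF r] by (simp add: Iz_mult2)
  next
    case False
    interpret pe: comm_ring_hom "\<lambda>f. pe f (pvar r :: 'k mpol)" by (rule comm_ring_hom_pe)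
    show ?thesis using False by (simp add: \<eta>_def)
  qed
  then have "valid \<Lambda> B M \<eta>"
    unfolding valid_def using B u by (auto simp: \<eta>_def)
  then show ?thesis by blast
qed

definition eps :: "(int \<Rightarrow> 'k poly) \<Rightarrow> (nat \<Rightarrow> int) \<Rightarrow> 'k mpol" where
  "eps \<eta> i = (\<Prod>r\<in>{1..n}. pe (\<eta> (i r)) (pvar r))"

lemma eps_polys [simp]: "eps \<eta> i \<in> polys n"
  unfolding eps_def by (intro polys_prod pe_polys polys_pvar)

lemma sp_eps:
  assumes r: "r \<in> {1..<n}"
  shows "sp r (eps \<eta> i) = eps \<eta> (i \<circ> simple_refl r)"
proof -
  interpret comm_ring_hom "sp r" by (rule comm_ring_hom_perm_poly) simp
  have "sp r (eps \<eta> i) = (\<Prod>k\<in>{1..n}. pe (\<eta> (i k)) (pvar (simple_refl r k)))"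
    unfolding eps_def hom_prod by (simp add: hom_pe[OF comm_ring_hom_perm_poly] perm_poly_pvar)
  also have "\<dots> = (\<Prod>k\<in>{1..n}. pe (\<eta> (i (simple_refl r k))) (pvar k))"
    by (rule prod.reindex_bij_witness[of _ "simple_refl r" "simple_refl r"])
      (use permutes_in_image[OF simple_refl_permutes[OF r]] in auto)
  finally show ?thesis by (simp add: eps_def)
qed

context
  fixes \<Lambda> B M \<eta>
  assumes v: "valid \<Lambda> B M \<eta>"
begin

text \<open>Expansion of the product over r of the identities 1 = sum of \<eta>_a(X_r).\<close>

lemma eps_sum: "(\<Sum>i\<in>{1..n} \<rightarrow>\<^sub>E B. eps \<eta> i) = 1"
proof -
  have "(\<Sum>i\<in>{1..n} \<rightarrow>\<^sub>E B. eps \<eta> i) = (\<Prod>r\<in>{1..n}. \<Sum>a\<in>B. pe (\<eta> a) (pvar r))"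
    unfolding eps_def using v by (subst prod_sum_PiE) (auto simp: valid_def)
  also have "\<dots> = (\<Prod>r\<in>{1..n}. 1)"
  proof (rule prod.cong)
    fix r
    interpret pe: comm_ring_hom "\<lambda>f. pe f (pvar r :: 'k mpol)" by (rule comm_ring_hom_pe)
    show "(\<Sum>a\<in>B. pe (\<eta> a) (pvar r)) = 1"
      using v by (simp add: pe.hom_sum[symmetric] valid_def)
  qed simp
  finally show ?thesis by simp
qed

lemma eps_factor: "r \<in> {1..n} \<Longrightarrow> \<exists>p. eps \<eta> i = pe (\<eta> (i r)) (pvar r) * p"
  unfolding eps_def using prod.remove[of "{1..n}" r "\<lambda>r. pe (\<eta> (i r)) (pvar r)"] by blast

lemma eps_nilpotent: "r \<in> {1..n} \<Longrightarrow> Iz \<Lambda> ((pvar r - cst (val (i r))) ^ M * eps \<eta> i)"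
proof -
  assume r: "r \<in> {1..n}"
  obtain p where p: "eps \<eta> i = pe (\<eta> (i r)) (pvar r) * p" using eps_factor[OF r] by blast
  have "Iz \<Lambda> ((pvar r - cst (val (i r))) ^ M * pe (\<eta> (i r)) (pvar r))"
    using v r by (simp add: valid_def)
  from Iz_mult[OF this, of p] show ?thesis by (simp add: p mult.assoc)
qed

lemma eps_outside:
  assumes "r \<in> {1..n}" "i r \<notin> B"
  shows "eps \<eta> i = 0"
proof -
  interpret pe: comm_ring_hom "\<lambda>f. pe f (pvar r :: 'k mpol)" by (rule comm_ring_hom_pe)
  show ?thesis using v eps_factor[OF assms(1), of i] assms(2) by (auto simp: valid_def)
qed

text \<open>The product is killed by powers of X_r - \<open>val (i r)\<close> and X_r -
  \<open>val (j r)\<close>, which are comaximal.\<close>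

lemma eps_orthogonal:
  assumes r: "r \<in> {1..n}" and "i r \<noteq> j r"
  shows "Iz \<Lambda> (eps \<eta> i * eps \<eta> j)"
proof (cases "i r \<in> B \<and> j r \<in> B")
  case True
  then have "val (i r) \<noteq> val (j r)"
    using v val_inj assms(2) unfolding valid_def by blast
  then show ?thesis
  proof (rule Iz_comax[OF comax_linear])
    show "Iz \<Lambda> ((pvar r - cst (val (i r))) ^ M * (eps \<eta> i * eps \<eta> j))"
      using Iz_mult[OF eps_nilpotent[OF r, of i], of "eps \<eta> j"] by (simp add: mult.assoc)
    show "Iz \<Lambda> ((pvar r - cst (val (j r))) ^ M * (eps \<eta> i * eps \<eta> j))"
      using Iz_mult[OF eps_nilpotent[OF r, of j], of "eps \<eta> i"] by (simp add: mult.assoc mult.commute)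
  qed
next
  case False
  then show ?thesis using eps_outside[OF r, of i] eps_outside[OF r, of j] by auto
qed

lemma eps_extensional_neq: "i \<in> extensional A \<Longrightarrow> j \<in> extensional A \<Longrightarrow> i \<noteq> j \<Longrightarrow> \<exists>r\<in>A. i r \<noteq> j r"
  by (metis extensionalityI)

text \<open>Multiply eps by 1, the sum of all of them, and discard the mixed products.
  Extensionality ensures that distinct indices differ at some r in 1..n.\<close>

lemma eps_idem:
  assumes "i \<in> extensional {1..n}"
  shows "Iz \<Lambda> (eps \<eta> i * eps \<eta> i - eps \<eta> i)"
proof (cases "i \<in> {1..n} \<rightarrow>\<^sub>E B")
  case True
  have fin: "finite ({1..n} \<rightarrow>\<^sub>E B)" using v by (intro finite_PiE) (auto simp: valid_def)
  have "eps \<eta> i = eps \<eta> i * (\<Sum>j\<in>{1..n} \<rightarrow>\<^sub>E B. eps \<eta> j)" by (simp only: eps_sum mult_1_right)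
  also have "\<dots> = eps \<eta> i * eps \<eta> i + (\<Sum>j\<in>({1..n} \<rightarrow>\<^sub>E B) - {i}. eps \<eta> i * eps \<eta> j)"
    using True fin by (simp add: sum_distrib_left sum.remove[of _ i] distrib_left)
  finally have "eps \<eta> i * eps \<eta> i - eps \<eta> i = - (\<Sum>j\<in>({1..n} \<rightarrow>\<^sub>E B) - {i}. eps \<eta> i * eps \<eta> j)"
    by (metis add_diff_cancel_left' minus_diff_eq)
  moreover have "Iz \<Lambda> (eps \<eta> i * eps \<eta> j)" if "j \<in> ({1..n} \<rightarrow>\<^sub>E B) - {i}" for j
    using eps_extensional_neq[of i "{1..n}" j] assms that eps_orthogonal by (auto simp: PiE_def)
  then have "Iz \<Lambda> (- (\<Sum>j\<in>({1..n} \<rightarrow>\<^sub>E B) - {i}. eps \<eta> i * eps \<eta> j))"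
    by (intro Iz_uminus Iz_sum)
  ultimately show ?thesis by metis
next
  case False
  then obtain r where "r \<in> {1..n}" "i r \<notin> B" using assms unfolding PiE_iff by blast
  then have "eps \<eta> i = 0" by (rule eps_outside)
  then show ?thesis by simp
qed

text \<open>On e(i) the element X_r - X_s is a nonzero scalar plus a nilpotent, so a finite
  geometric series inverts it.\<close>

lemma eps_invert:
  assumes r: "r \<in> {1..n}" and s: "s \<in> {1..n}" and ne: "val (i r) \<noteq> val (i s)"
  shows "\<exists>g\<in>polys n. Iz \<Lambda> ((pvar r - pvar s) * g * eps \<eta> i - eps \<eta> i)"
proof -
  let ?X = "pvar r - cst (val (i r)) :: 'k mpol" and ?Y = "pvar s - cst (val (i s)) :: 'k mpol"
  let ?c = "inverse (val (i r) - val (i s))"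
  \<comment> \<open>Chosen so that 1 - x is X_r - X_s divided by its eigenvalue; x is a multiple of
    the difference of two elements whose M-th powers vanish on e(i), hence its power M + M
    does.\<close>
  define x where "x = cst (- ?c) * (?X - ?Y)"
  define g where "g = cst ?c * (\<Sum>k<M + M. x ^ k)"
  have x: "x \<in> polys n" unfolding x_def using r s by (intro polys_mult polys_diff) auto
  have u: "1 - x = cst ?c * (pvar r - pvar s)"
  proof -
    have "cst ?c * (cst (val (i r)) - cst (val (i s))) = (1 :: 'k mpol)"
      using ne by (simp add: cst_mult[symmetric] cst_diff[symmetric])
    then show ?thesis by (simp add: x_def cst_uminus algebra_simps)
  qed
  have gx: "(pvar r - pvar s) * g = 1 - x ^ (M + M)"
    unfolding g_def one_diff_power_eq u by (simp add: ac_simps)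
  obtain C D where CD: "(?X - ?Y) ^ (M + M) = C * ?X ^ M + D * ?Y ^ M"
    using diff_power_split by blast
  define w :: "'k mpol" where "w = cst (- ?c) ^ (M + M)"
  have "(pvar r - pvar s) * g * eps \<eta> i - eps \<eta> i = - (x ^ (M + M) * eps \<eta> i)"
    unfolding gx by (simp add: algebra_simps)
  also have "x ^ (M + M) = w * (C * ?X ^ M + D * ?Y ^ M)"
    unfolding x_def power_mult_distrib CD w_def ..
  also have "- (w * (C * ?X ^ M + D * ?Y ^ M) * eps \<eta> i)
      = - ((w * C) * (?X ^ M * eps \<eta> i) + (w * D) * (?Y ^ M * eps \<eta> i))"
    by (simp only: algebra_simps)
  also have "Iz \<Lambda> \<dots>" by (intro Iz_uminus Iz_add Iz_mult2 eps_nilpotent r s)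
  finally have "Iz \<Lambda> ((pvar r - pvar s) * g * eps \<eta> i - eps \<eta> i)" .
  moreover have "g \<in> polys n" unfolding g_def by (intro polys_mult polys_sum polys_power x polys_cst)
  ultimately show ?thesis by blast
qed

end

section \<open>A spanning set of the affine algebra\<close>

definition Tw :: "nat list \<Rightarrow> 'k free" where
  "Tw u = prod_list (map T\<^sub>g u)"

lemma Tw_simps [simp]: "Tw [] = 1" "Tw (k # u) = T\<^sub>g k * Tw u" "Tw (u @ w) = Tw u * Tw w"
  by (simp_all add: Tw_def)

text \<open>Products of one representative \<open>T\<^sub>m T\<^sub>m\<^sub>-\<^sub>1 \<cdots> T\<^sub>i\<close> for each coset of \<open>S\<^sub>m\<close> in \<open>S\<^sub>m\<^sub>+\<^sub>1\<close>.\<close>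

fun normal_words :: "nat \<Rightarrow> nat list set" where
  "normal_words 0 = {[]}"
| "normal_words (Suc m) = (\<lambda>(u, i). u @ rev [i..<Suc (Suc m)]) ` (normal_words m \<times> {1..Suc (Suc m)})"

lemma finite_normal_words [simp]: "finite (normal_words m)"
  by (induction m) simp_all

lemma card_normal_words: "card (normal_words m) \<le> fact (Suc m)"
proof (induction m)
  case (Suc m)
  have "card (normal_words (Suc m)) \<le> card (normal_words m \<times> {1..Suc (Suc m)})"
    unfolding normal_words.simps by (rule card_image_le) simp
  also have "\<dots> = Suc (Suc m) * card (normal_words m)" by simp
  also have "\<dots> \<le> Suc (Suc m) * fact (Suc m)" using Suc by (rule mult_le_mono2)
  finally show ?case by simp
qed simp

lemma normal_words_letters: "u \<in> normal_words m \<Longrightarrow> set u \<subseteq> {1..m}"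
proof (induction m arbitrary: u)
  case (Suc m)
  then show ?case by (fastforce simp del: upt_Suc)
qed simp

lemma Nil_normal_words: "[] \<in> normal_words m"
proof (induction m)
  case (Suc m)
  then show ?case
    unfolding normal_words.simps by (intro image_eqI[of _ _ "([], Suc (Suc m))"]) simp_all
qed simp

text \<open>The left span over polynomials, modulo the affine relations. Coefficients in
  \<open>polys n\<close> are those that \<open>straighten\<close> can move.\<close>

definition LS :: "nat list set \<Rightarrow> 'k free set" where
  "LS A = {p. \<exists>c. (\<forall>u. c u \<in> polys n) \<and> p \<approx> (\<Sum>u\<in>A. Px (c u) * Tw u)}"

lemma LS_cong: "p \<approx> p' \<Longrightarrow> p' \<in> LS A \<Longrightarrow> p \<in> LS A"
  unfolding LS_def using congr_trans by blast

lemma LS_0 [simp]: "0 \<in> LS A"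
  unfolding LS_def by (intro CollectI exI[of _ "\<lambda>_. 0"]) simp

lemma LS_add:
  assumes "p \<in> LS A" "p' \<in> LS A"
  shows "p + p' \<in> LS A"
proof -
  obtain c c' where "\<forall>u. c u \<in> polys n" "p \<approx> (\<Sum>u\<in>A. Px (c u) * Tw u)"
    "\<forall>u. c' u \<in> polys n" "p' \<approx> (\<Sum>u\<in>A. Px (c' u) * Tw u)"
    using assms unfolding LS_def by blast
  then have "p + p' \<approx> (\<Sum>u\<in>A. Px (c u + c' u) * Tw u)" "\<forall>u. c u + c' u \<in> polys n"
    using congr_add[of "hrels st n" p "\<Sum>u\<in>A. Px (c u) * Tw u" p' "\<Sum>u\<in>A. Px (c' u) * Tw u"]
    by (simp_all add: Px_add distrib_right sum.distrib polys_add)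
  then show ?thesis unfolding LS_def by (intro CollectI exI[of _ "\<lambda>u. c u + c' u"]) simp
qed

lemma LS_sum: "(\<And>x. x \<in> B \<Longrightarrow> f x \<in> LS A) \<Longrightarrow> sum f B \<in> LS A"
  by (induction B rule: infinite_finite_induct) (simp_all add: LS_add)

lemma LS_Px:
  assumes "p \<in> LS A" "g \<in> polys n"
  shows "Px g * p \<in> LS A"
proof -
  obtain c where c: "\<forall>u. c u \<in> polys n" "p \<approx> (\<Sum>u\<in>A. Px (c u) * Tw u)"
    using assms unfolding LS_def by blast
  have "Px g * p \<approx> Px g * (\<Sum>u\<in>A. Px (c u) * Tw u)" by (rule congr_mult[OF congr_refl c(2)])
  also have "\<dots> = (\<Sum>u\<in>A. (Px g * Px (c u)) * Tw u)" by (simp add: sum_distrib_left mult.assoc)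
  also have "\<dots> \<approx> (\<Sum>u\<in>A. Px (g * c u) * Tw u)"
    by (intro congr_sum congr_mult[OF congr_sym[OF Px_mult] congr_refl])
  finally show ?thesis
    unfolding LS_def using c(1) assms(2)
    by (intro CollectI exI[of _ "\<lambda>u. g * c u"]) (simp add: polys_mult)
qed

lemma LS_cst: "p \<in> LS A \<Longrightarrow> cst c * p \<in> LS A"
  using LS_Px[of p A "cst c"] by simp

lemma LS_base:
  assumes "finite A" "u \<in> A"
  shows "Tw u \<in> LS A"
proof -
  have "(\<Sum>w\<in>A. Px (if w = u then 1 else 0) * Tw w) = (\<Sum>w\<in>A. if w = u then Tw w else 0)"
    by (intro sum.cong) auto
  also have "\<dots> = Tw u" using assms by simp
  finally show ?thesis
    unfolding LS_def by (intro CollectI exI[of _ "\<lambda>w. if w = u then 1 else 0"]) simp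
qed

lemma LS_rmult:
  assumes "\<And>u. u \<in> A \<Longrightarrow> Tw u * x \<in> LS A'" "p \<in> LS A"
  shows "p * x \<in> LS A'"
proof -
  obtain c where c: "\<forall>u. c u \<in> polys n" "p \<approx> (\<Sum>u\<in>A. Px (c u) * Tw u)"
    using assms unfolding LS_def by blast
  have "p * x \<approx> (\<Sum>u\<in>A. Px (c u) * Tw u) * x" by (rule congr_mult[OF c(2) congr_refl])
  also have "\<dots> = (\<Sum>u\<in>A. Px (c u) * (Tw u * x))" by (simp add: sum_distrib_right mult.assoc)
  finally show ?thesis
    by (rule LS_cong) (intro LS_sum LS_Px assms(1), use c in auto)
qed

text \<open>The tail C = T_(m+1) ... T_i absorbs T_k in four ways. For k + 1 < i it commutes and
  goes to the head; for k + 1 = i it lengthens the tail; for k = i the quadratic relation applies;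
  for k > i a braid move gives C T_k = T_(k-1) C, again a matter of the head.\<close>

lemma normal_words_T:
  "m < n \<or> m = 0 \<Longrightarrow> u \<in> normal_words m \<Longrightarrow> k \<in> {1..m} \<Longrightarrow> Tw u * T\<^sub>g k \<in> LS (normal_words m)"
proof (induction m arbitrary: u k)
  case (Suc m)
  then obtain u' i where u: "u' \<in> normal_words m" "i \<in> {1..Suc (Suc m)}"
    "u = u' @ rev [i..<Suc (Suc m)]" by (auto simp del: upt_Suc)
  have mn: "Suc m < n" using Suc.prems by simp
  have base: "Tw w * Tw (rev [j..<Suc (Suc m)]) \<in> LS (normal_words (Suc m))"
    if "w \<in> normal_words m" "j \<in> {1..Suc (Suc m)}" for w j
  proof -
    have "w @ rev [j..<Suc (Suc m)] \<in> normal_words (Suc m)"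
      unfolding normal_words.simps using that by (intro image_eqI[of _ _ "(w, j)"]) simp_all
    from LS_base[OF _ this] show ?thesis by (simp del: upt_Suc normal_words.simps)
  qed
  let ?C = "Tw (rev [i..<Suc (Suc m)])"
  have shift: "Tw u * T\<^sub>g k \<in> LS (normal_words (Suc m))"
    if "?C * T\<^sub>g k \<approx> T\<^sub>g l * ?C" "l \<in> {1..m}" for l
  proof -
    have "Tw u * T\<^sub>g k = Tw u' * (?C * T\<^sub>g k)" unfolding u(3) by (simp add: mult.assoc del: upt_Suc)
    also have "\<dots> \<approx> Tw u' * (T\<^sub>g l * ?C)" by (rule congr_mult[OF congr_refl that(1)])
    also have "\<dots> = (Tw u' * T\<^sub>g l) * ?C" by (simp add: mult.assoc)
    finally have "Tw u * T\<^sub>g k \<approx> (Tw u' * T\<^sub>g l) * ?C" .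
    moreover have "Tw u' * T\<^sub>g l \<in> LS (normal_words m)"
      by (rule Suc.IH) (use mn u that(2) in auto)
    then have "(Tw u' * T\<^sub>g l) * ?C \<in> LS (normal_words (Suc m))"
      by (rule LS_rmult[rotated]) (rule base[OF _ u(2)])
    ultimately show ?thesis by (rule LS_cong)
  qed
  have far: "T\<^sub>g a * T\<^sub>g b \<approx> T\<^sub>g b * T\<^sub>g a" if "a \<in> {1..Suc m}" "b \<in> {1..Suc m}" "Suc a < b \<or> Suc b < a" for a b
    using that mn by (intro gen_cong(3)) auto
  have commutes: "Tw w * T\<^sub>g b \<approx> T\<^sub>g b * Tw w"
    if "b \<in> {1..Suc m}" "\<And>a. a \<in> set w \<Longrightarrow> a \<in> {1..Suc m} \<and> (Suc a < b \<or> Suc b < a)" for w b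
    unfolding Tw_def by (rule commute_prod_list) (use that far in auto)
  consider "k + 1 < i" | "k + 1 = i" | "k = i" | "i < k" by linarith
  then show ?case
  proof cases
    case 1
    have "?C * T\<^sub>g k \<approx> T\<^sub>g k * ?C"
      using 1 Suc.prems u by (intro commutes) (auto simp del: upt_Suc)
    then show ?thesis using 1 u Suc.prems by (intro shift) auto
  next
    case 2
    have "[k..<Suc (Suc m)] = k # [i..<Suc (Suc m)]"
      using 2 Suc.prems u by (metis Suc_eq_plus1 atLeastAtMost_iff le_imp_less_Suc upt_conv_Cons less_SucI)
    then have "Tw u * T\<^sub>g k = Tw u' * Tw (rev [k..<Suc (Suc m)])"
      unfolding u(3) by (simp add: mult.assoc del: upt_Suc)
    then show ?thesis using base[OF u(1), of k] Suc.prems by simp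
  next
    case 3
    have split: "[i..<Suc (Suc m)] = i # [Suc i..<Suc (Suc m)]"
      using 3 Suc.prems by (intro upt_conv_Cons) auto
    let ?C' = "Tw (rev [Suc i..<Suc (Suc m)])"
    have "Tw u * T\<^sub>g k = Tw u' * ?C' * (T\<^sub>g i * T\<^sub>g i)"
      unfolding u(3) split 3 by (simp add: mult.assoc del: upt_Suc)
    also have "\<dots> \<approx> Tw u' * ?C' * (cst (q - 1) * T\<^sub>g i + cst q)"
      using 3 Suc.prems mn by (intro congr_mult[OF congr_refl] T_square) auto
    also have "\<dots> = cst (q - 1) * (Tw u' * ?C) + cst q * (Tw u' * ?C')"
      unfolding split by (simp only: rev.simps Tw_simps mult_1_right distrib_left cst_left_comm[of "Tw _"]
          cst_comm[of "Tw _"] mult.assoc)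
    finally show ?thesis
      by (rule LS_cong) (intro LS_add LS_cst base u; use 3 Suc.prems in auto)
  next
    case 4
    then obtain l where l: "k = Suc l" "i \<le> l" "1 \<le> l" using u(2) by (cases k) auto
    have k: "Suc l \<le> Suc m" using Suc.prems l by simp
    have "[i..<Suc (Suc m)] = [i..<l] @ [l..<Suc (Suc m)]"
      using upt_add_eq_append[of i l "Suc (Suc m) - l"] l k by simp
    moreover have "[l..<Suc (Suc m)] = l # k # [Suc k..<Suc (Suc m)]"
      using l k by (simp add: upt_conv_Cons del: upt_Suc)
    ultimately have split: "rev [i..<Suc (Suc m)] = rev [Suc k..<Suc (Suc m)] @ [k, l] @ rev [i..<l]"
      by (simp del: upt_Suc)
    let ?A = "Tw (rev [Suc k..<Suc (Suc m)])" and ?B = "Tw (rev [i..<l])"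
    have "?C * T\<^sub>g k = ?A * T\<^sub>g k * T\<^sub>g l * (?B * T\<^sub>g k)"
      unfolding split by (simp add: mult.assoc del: upt_Suc)
    also have "\<dots> \<approx> ?A * T\<^sub>g k * T\<^sub>g l * (T\<^sub>g k * ?B)"
      using l k u by (intro congr_mult[OF congr_refl] commutes) auto
    also have "\<dots> = ?A * (T\<^sub>g k * T\<^sub>g l * T\<^sub>g k) * ?B" by (simp add: mult.assoc)
    also have "\<dots> \<approx> ?A * (T\<^sub>g l * T\<^sub>g k * T\<^sub>g l) * ?B"
      using gen_cong(2)[of l n st] l k mn
      by (intro congr_mult[OF congr_mult[OF congr_refl] congr_refl]) (simp add: congr_sym)
    also have "\<dots> = (?A * T\<^sub>g l) * (T\<^sub>g k * T\<^sub>g l * ?B)" by (simp add: mult.assoc)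
    also have "\<dots> \<approx> (T\<^sub>g l * ?A) * (T\<^sub>g k * T\<^sub>g l * ?B)"
      using l k by (intro congr_mult[OF _ congr_refl] commutes) (auto simp del: upt_Suc)
    also have "\<dots> = T\<^sub>g l * ?C" unfolding split by (simp add: mult.assoc del: upt_Suc)
    finally show ?thesis using l k by (intro shift[of l]) auto
  qed
qed simp

text \<open>By truncated subtraction both n = 0 and n = 1 give the empty word only.\<close>

abbreviation "NF \<equiv> normal_words (n - Suc 0)"

lemma NF_letters: "u \<in> NF \<Longrightarrow> set u \<subseteq> {1..<n}"
  using normal_words_letters[of u "n - Suc 0"] by fastforce

lemma LS_right_T: "p \<in> LS NF \<Longrightarrow> k \<in> {1..<n} \<Longrightarrow> p * T\<^sub>g k \<in> LS NF"
  by (rule LS_rmult[OF normal_words_T]) auto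

lemma LS_1: "1 \<in> LS NF"
  using LS_base[OF finite_normal_words Nil_normal_words] by simp

lemma LS_Tw: "set u \<subseteq> {1..<n} \<Longrightarrow> Tw u \<in> LS NF"
  by (induction u rule: rev_induct) (simp_all add: LS_1 LS_right_T)

text \<open>The letter is straightened past the coefficient, and the lengthened word is expanded
  again through \<open>LS_Tw\<close>.\<close>

lemma LS_left_T:
  assumes k: "k \<in> {1..<n}" and "p \<in> LS NF"
  shows "T\<^sub>g k * p \<in> LS NF"
proof -
  obtain c where c: "\<forall>u. c u \<in> polys n" "p \<approx> (\<Sum>u\<in>NF. Px (c u) * Tw u)"
    using assms unfolding LS_def by blast
  have "T\<^sub>g k * p \<approx> T\<^sub>g k * (\<Sum>u\<in>NF. Px (c u) * Tw u)" by (rule congr_mult[OF congr_refl c(2)])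
  also have "\<dots> = (\<Sum>u\<in>NF. T\<^sub>g k * Px (c u) * Tw u)" by (simp add: sum_distrib_left mult.assoc)
  finally have 1: "T\<^sub>g k * p \<approx> (\<Sum>u\<in>NF. T\<^sub>g k * Px (c u) * Tw u)" .
  have "T\<^sub>g k * Px (c u) * Tw u \<in> LS NF" if u: "u \<in> NF" for u
  proof -
    obtain d where d: "d \<in> polys n" "T\<^sub>g k * Px (c u) \<approx> Px (sp k (c u)) * T\<^sub>g k + Px (Bp k * d)"
      using straighten[OF k] c(1) by blast
    have "T\<^sub>g k * Px (c u) * Tw u \<approx> (Px (sp k (c u)) * T\<^sub>g k + Px (Bp k * d)) * Tw u"
      by (rule congr_mult[OF d(2) congr_refl])
    also have "\<dots> = Px (sp k (c u)) * Tw (k # u) + Px (Bp k * d) * Tw u"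
      by (simp add: distrib_right mult.assoc)
    finally show ?thesis
      using k c(1) d(1) NF_letters[OF u]
      by (elim LS_cong) (intro LS_add LS_Px LS_Tw sp_polys polys_mult Bp_polys; simp)
  qed
  then show ?thesis by (intro LS_cong[OF 1] LS_sum)
qed

text \<open>Symmetric, hence commuting with every T_r, and divisible by every X_k: a power of it
  clears all inverse letters.\<close>

definition Xall :: "'k mpol" where
  "Xall = (\<Prod>k\<in>{1..n}. pvar k)"

lemma Xall_polys [simp]: "Xall \<in> polys n"
  unfolding Xall_def by (intro polys_prod polys_pvar)

lemma sp_Xall:
  assumes "r \<in> {1..<n}"
  shows "sp r Xall = Xall"
proof -
  interpret comm_ring_hom "sp r" by (rule comm_ring_hom_perm_poly) simp
  have "sp r Xall = (\<Prod>k\<in>{1..n}. pvar (simple_refl r k))"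
    unfolding Xall_def hom_prod by (simp add: perm_poly_pvar)
  also have "\<dots> = Xall"
    unfolding Xall_def using permutes_in_image[OF simple_refl_permutes[OF assms]]
    by (intro prod.reindex_bij_witness[of _ "simple_refl r" "simple_refl r"]) auto
  finally show ?thesis .
qed

text \<open>Each inverse letter costs one factor \<open>Xall\<close>, and the power passes the
  letters T and X to reach the rest of the word. The degenerate setting has no inverse letters, so
  the power stays 0 there.\<close>

lemma LS_all: "\<exists>L. (st = Deg \<longrightarrow> L = 0) \<and> Px (Xall ^ L) * p \<in> LS NF"
proof (induction p rule: poly_mapping_additive_induct)
  case (single w c)
  show ?case
  proof (induction w)
    case Nil
    have "Poly_Mapping.single [] c = (cst c :: 'k free)" by (simp add: cst_def zero_list_def)
    then show ?case using LS_cst[OF LS_1, of c] by (intro exI[of _ 0]) simp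
  next
    case (Cons g w)
    then obtain L where L: "st = Deg \<longrightarrow> L = 0" "Px (Xall ^ L) * Poly_Mapping.single w c \<in> LS NF" by blast
    let ?p = "Poly_Mapping.single w c :: 'k free"
    show ?case
    proof (cases "g \<in> hecke_gens st n")
      case False
      have "gen_elt g * ?p \<approx> 0 * ?p" by (rule congr_mult[OF gen_cong(9)[OF False] congr_refl])
      then show ?thesis by (intro exI[of _ 0]) (simp add: gen_elt_Cons LS_cong[of _ 0])
    next
      case True
      show ?thesis
      proof (cases g)
        case (gT k)
        have "Px (Xall ^ L) * (T\<^sub>g k * ?p) = Px (Xall ^ L) * T\<^sub>g k * ?p" by (simp add: mult.assoc)
        also have "\<dots> \<approx> T\<^sub>g k * Px (Xall ^ L) * ?p"
          using True gT by (intro congr_mult[OF _ congr_refl] congr_sym[OF T_symmetric_comm] polys_power)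
            (simp_all add: sp_hom sp_Xall)
        also have "\<dots> = T\<^sub>g k * (Px (Xall ^ L) * ?p)" by (simp add: mult.assoc)
        finally have "Px (Xall ^ L) * (gen_elt g * ?p) \<in> LS NF"
          using True gT L(2) by (simp add: LS_cong LS_left_T)
        then show ?thesis using L(1) unfolding gen_elt_Cons by blast
      next
        case (gX k)
        then have k: "k \<in> {1..n}" using True by simp
        have "Px (Xall ^ L) * (X\<^sub>g k * ?p) = Px (Xall ^ L) * Px (pvar k) * ?p" using k by (simp add: mult.assoc)
        also have "\<dots> \<approx> Px (pvar k) * Px (Xall ^ L) * ?p"
          by (intro congr_mult[OF _ congr_refl] Px_comm)
        also have "\<dots> = Px (pvar k) * (Px (Xall ^ L) * ?p)" by (simp add: mult.assoc)
        finally have "Px (Xall ^ L) * (gen_elt g * ?p) \<in> LS NF"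
          unfolding gX by (rule LS_cong) (intro LS_Px L polys_pvar k)
        then show ?thesis using L(1) unfolding gen_elt_Cons by blast
      next
        case (gXinv k)
        then have k: "k \<in> {1..n}" and nd: "st \<noteq> Deg" using True by simp_all
        then obtain q' where q': "st = NonDeg q'" by (cases st) auto
        let ?R = "\<Prod>j\<in>{1..n} - {k}. pvar j :: 'k mpol"
        have R: "?R \<in> polys n" by (intro polys_prod polys_pvar) auto
        \<comment> \<open>The additional factor is used up on this letter: \<open>?R\<close>
          contains the remaining variables, and X_k cancels against its inverse.\<close>
        have X: "Xall ^ Suc L = (?R * Xall ^ L) * pvar k"
          using k by (simp add: Xall_def prod.remove[of _ k] ac_simps)
        have "Px (Xall ^ Suc L) * (Xi\<^sub>g k * ?p) \<approx> Px (?R * Xall ^ L) * Px (pvar k) * (Xi\<^sub>g k * ?p)"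
          unfolding X by (intro congr_mult[OF _ congr_refl] Px_mult)
        also have "\<dots> = Px (?R * Xall ^ L) * (X\<^sub>g k * Xi\<^sub>g k) * ?p"
          using k by (simp add: mult.assoc)
        also have "\<dots> \<approx> Px (?R) * Px (Xall ^ L) * 1 * ?p"
          by (intro congr_mult[OF congr_mult congr_refl] Px_mult gen_cong(8)[OF q' k])
        also have "\<dots> = Px ?R * (Px (Xall ^ L) * ?p)" by (simp add: mult.assoc)
        finally have "Px (Xall ^ Suc L) * (gen_elt g * ?p) \<in> LS NF"
          unfolding gXinv by (rule LS_cong) (intro LS_Px L R)
        then show ?thesis using nd unfolding gen_elt_Cons by blast
      qed
    qed
  qed
next
  case (add p p')
  then obtain L L' where L: "st = Deg \<longrightarrow> L = 0" "Px (Xall ^ L) * p \<in> LS NF"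
    and L': "st = Deg \<longrightarrow> L' = 0" "Px (Xall ^ L') * p' \<in> LS NF" by blast
  have more: "Px (Xall ^ (a + b)) * x \<in> LS NF" if "Px (Xall ^ a) * x \<in> LS NF" for a b x
  proof -
    have "Px (Xall ^ (a + b)) * x \<approx> Px (Xall ^ b) * Px (Xall ^ a) * x"
      unfolding power_add mult.commute[of "Xall ^ a"] by (intro congr_mult[OF Px_mult congr_refl])
    then show ?thesis using LS_Px[OF that polys_power[OF Xall_polys], of b]
      by (simp add: LS_cong mult.assoc)
  qed
  have "Px (Xall ^ (L + L')) * (p + p') \<in> LS NF"
    using more[OF L(2), of L'] more[OF L'(2), of L] by (simp add: distrib_left add.commute LS_add)
  then show ?case using L(1) L'(1) by (metis add_0)
qed


section \<open>The cyclotomic algebras are finite dimensional\<close>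

definition KS :: "int multiset \<Rightarrow> 'k free set \<Rightarrow> 'k free set" where
  "KS \<Lambda> B = {p. \<exists>c. ccong \<Lambda> p (\<Sum>b\<in>B. cst (c b) * b)}"

lemma KS_cong: "ccong \<Lambda> p p' \<Longrightarrow> p' \<in> KS \<Lambda> B \<Longrightarrow> p \<in> KS \<Lambda> B"
  unfolding KS_def using congr_trans by blast

lemma KS_0 [simp]: "0 \<in> KS \<Lambda> B"
  unfolding KS_def by (intro CollectI exI[of _ "\<lambda>_. 0"]) simp

lemma KS_add:
  assumes "p \<in> KS \<Lambda> B" "p' \<in> KS \<Lambda> B"
  shows "p + p' \<in> KS \<Lambda> B"
proof -
  obtain c c' where "ccong \<Lambda> p (\<Sum>b\<in>B. cst (c b) * b)" "ccong \<Lambda> p' (\<Sum>b\<in>B. cst (c' b) * b)"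
    using assms unfolding KS_def by blast
  then have "ccong \<Lambda> (p + p') (\<Sum>b\<in>B. cst (c b + c' b) * b)"
    using congr_add[of _ p _ p'] by (fastforce simp: cst_add distrib_right sum.distrib)
  then show ?thesis unfolding KS_def by (intro CollectI exI[of _ "\<lambda>b. c b + c' b"])
qed

lemma KS_cst:
  assumes "p \<in> KS \<Lambda> B"
  shows "cst a * p \<in> KS \<Lambda> B"
proof -
  obtain c where "ccong \<Lambda> p (\<Sum>b\<in>B. cst (c b) * b)"
    using assms unfolding KS_def by blast
  then have "ccong \<Lambda> (cst a * p) (\<Sum>b\<in>B. cst (a * c b) * b)"
    using congr_mult[OF congr_refl, of _ p _ "cst a"]
    by (fastforce simp: cst_mult sum_distrib_left mult.assoc)
  then show ?thesis unfolding KS_def by (intro CollectI exI[of _ "\<lambda>b. a * c b"])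
qed

lemma KS_sum: "(\<And>x. x \<in> A \<Longrightarrow> f x \<in> KS \<Lambda> B) \<Longrightarrow> sum f A \<in> KS \<Lambda> B"
  by (induction A rule: infinite_finite_induct) (simp_all add: KS_add)

lemma KS_base:
  assumes "finite B" "b \<in> B"
  shows "b \<in> KS \<Lambda> B"
proof -
  have "(\<Sum>w\<in>B. cst (if w = b then 1 else 0) * w) = (\<Sum>w\<in>B. if w = b then w else 0)"
    by (intro sum.cong) auto
  also have "\<dots> = b" using assms by simp
  finally show ?thesis
    unfolding KS_def by (intro CollectI exI[of _ "\<lambda>w. if w = b then 1 else 0"]) simp
qed

lemma KS_map:
  assumes "\<And>b. b \<in> B \<Longrightarrow> x * b * y \<in> KS \<Lambda> B'" "p \<in> KS \<Lambda> B"
  shows "x * p * y \<in> KS \<Lambda> B'"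
proof -
  obtain c where c: "ccong \<Lambda> p (\<Sum>b\<in>B. cst (c b) * b)"
    using assms unfolding KS_def by blast
  have "ccong \<Lambda> (x * p * y) (x * (\<Sum>b\<in>B. cst (c b) * b) * y)"
    by (intro congr_mult[OF congr_mult[OF congr_refl c] congr_refl])
  also have "\<dots> = (\<Sum>b\<in>B. cst (c b) * (x * b * y))"
    by (simp add: sum_distrib_left sum_distrib_right mult.assoc cst_left_comm[of x])
  finally show ?thesis by (rule KS_cong) (intro KS_sum KS_cst assms(1))
qed

text \<open>The product f0 of all (Z - val b)^M kills each X_r because the \<eta>_a sum to 1. If q
  is present, its values q^b are nonzero, so Z is comaximal to f0 and X_r has a polynomial
  inverse.\<close>

lemma Iz_annihilator: "\<exists>f. lead_coeff f = 1 \<and> degree f > 0 \<and> (\<forall>r\<in>{1..n}. Iz \<Lambda> (pe f (pvar r))) \<and>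
    (st \<noteq> Deg \<longrightarrow> (\<exists>g. \<forall>r\<in>{1..n}. Iz \<Lambda> (pvar r * pe g (pvar r) - 1)))"
proof -
  obtain B M \<eta> where v: "valid \<Lambda> B M \<eta>" using ex_valid by blast
  then have fin: "finite B" by (simp add: valid_def)
  define f0 :: "'k poly" where "f0 = (\<Prod>b\<in>B. [:- val b, 1:] ^ M)"
  \<comment> \<open>The factor Z makes the degree positive even if f0 = 1, so that the monomial 1 is
    among the reduced ones in \<open>polys_finite\<close>.\<close>
  define f where "f = pCons 0 f0"
  have l0: "lead_coeff f0 = 1"
    unfolding f0_def by (simp add: lead_coeff_prod lead_coeff_power)
  then have "f0 \<noteq> 0" by auto
  have f0: "Iz \<Lambda> (pe f0 (pvar r))" if r: "r \<in> {1..n}" for r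
  proof -
    interpret pe: comm_ring_hom "\<lambda>f. pe f (pvar r :: 'k mpol)" by (rule comm_ring_hom_pe)
    have "f0 = f0 * (\<Sum>a\<in>B. \<eta> a)" using v by (simp add: valid_def)
    also have "\<dots> = (\<Sum>a\<in>B. (\<Prod>b\<in>B - {a}. [:- val b, 1:] ^ M) * ([:- val a, 1:] ^ M * \<eta> a))"
      unfolding sum_distrib_left f0_def using fin
      by (intro sum.cong) (simp_all add: prod.remove ac_simps)
    finally have "pe f0 (pvar r) = (\<Sum>a\<in>B. pe (\<Prod>b\<in>B - {a}. [:- val b, 1:] ^ M) (pvar r)
        * ((pvar r - cst (val a)) ^ M * pe (\<eta> a) (pvar r)))"
      by (simp only: pe.hom_sum pe.hom_mult pe.hom_power pe_linear)
    moreover have "Iz \<Lambda> ((pvar r - cst (val a)) ^ M * pe (\<eta> a) (pvar r))" for a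
      using v r by (simp add: valid_def)
    ultimately show ?thesis by (simp only:) (rule Iz_sum, rule Iz_mult2)
  qed
  have "Iz \<Lambda> (pe f (pvar r))" if r: "r \<in> {1..n}" for r
  proof -
    have "pe f (pvar r) = pvar r * pe f0 (pvar r)"
      using \<open>f0 \<noteq> 0\<close> by (simp add: f_def pe_def map_poly_pCons)
    then show ?thesis using f0[OF r] by (simp add: Iz_mult2)
  qed
  moreover have "\<exists>g. \<forall>r\<in>{1..n}. Iz \<Lambda> (pvar r * pe g (pvar r) - 1)" if "st \<noteq> Deg"
  proof -
    have nz: "val b \<noteq> 0" for b using that admissible by (cases st) auto
    have "comax [:0, 1:] ([:- val b, 1:] :: 'k poly)" for b
      using nz[of b] by (intro comax_diff_unit[of _ _ "[:1 / val b:]"]) (simp add: one_pCons)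
    then have "comax [:0, 1:] f0" unfolding f0_def by (intro comax_prod comax_power)
    then obtain u w where uw: "u * [:0, 1:] + w * f0 = 1" unfolding comax_def by blast
    have "Iz \<Lambda> (pvar r * pe u (pvar r) - 1)" if r: "r \<in> {1..n}" for r
    proof -
      interpret pe: comm_ring_hom "\<lambda>f. pe f (pvar r :: 'k mpol)" by (rule comm_ring_hom_pe)
      have "pe (u * [:0, 1:] + w * f0) (pvar r) = 1" unfolding uw by simp
      then have "pe u (pvar r) * pvar r + pe w (pvar r) * pe f0 (pvar r) = 1"
        using pe_linear[of "0 :: 'k" "pvar r"] by (simp only: pe.hom_add pe.hom_mult) simp
      then have "pvar r * pe u (pvar r) - 1 = - (pe w (pvar r) * pe f0 (pvar r))"
        by (metis add_diff_cancel_left' minus_diff_eq mult.commute)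
      then show ?thesis using f0[OF r] by (simp add: Iz_uminus Iz_mult2)
    qed
    then show ?thesis by blast
  qed
  ultimately show ?thesis
    using l0 \<open>f0 \<noteq> 0\<close> by (intro exI[of _ f]) (auto simp: f_def)
qed

lemma polys_finite: "\<exists>D. finite D \<and> (\<forall>p\<in>polys n. Px p \<in> KS \<Lambda> D)"
proof -
  obtain f where f: "lead_coeff f = 1" "degree f > 0" "\<And>r. r \<in> {1..n} \<Longrightarrow> Iz \<Lambda> (pe f (pvar r))"
    using Iz_annihilator by blast
  define N where "N = degree f"
  define mon :: "(nat \<Rightarrow> nat) \<Rightarrow> 'k mpol" where "mon a = (\<Prod>r\<in>{1..n}. pvar r ^ a r)" for a
  define D where "D = (\<lambda>a. Px (mon a)) ` ({1..n} \<rightarrow>\<^sub>E {..<N})"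
  have fin: "finite D" unfolding D_def by (intro finite_imageI finite_PiE) auto
  have mon_D: "Px (mon a) \<in> KS \<Lambda> D" if "\<And>r. r \<in> {1..n} \<Longrightarrow> a r < N" for a
  proof -
    have "mon a = mon (restrict a {1..n})" by (simp add: mon_def)
    moreover have "restrict a {1..n} \<in> {1..n} \<rightarrow>\<^sub>E {..<N}" using that by auto
    ultimately show ?thesis using KS_base[OF fin] unfolding D_def by (metis imageI)
  qed
  have mon_upd: "mon (a(r := k)) = pvar r ^ k * (\<Prod>s\<in>{1..n} - {r}. pvar s ^ a s)"
    if "r \<in> {1..n}" for a r k
    unfolding mon_def using that by (simp add: prod.remove[of _ r] del: fun_upd_apply) simp
  have X: "Px (pvar r) * x \<in> KS \<Lambda> D" if r: "r \<in> {1..n}" and x: "x \<in> KS \<Lambda> D" for r x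
  proof -
    have "Px (pvar r) * b * 1 \<in> KS \<Lambda> D" if bD: "b \<in> D" for b
    proof -
      obtain a where a: "a \<in> {1..n} \<rightarrow>\<^sub>E {..<N}" "b = Px (mon a)" using bD unfolding D_def by blast
      let ?R = "\<Prod>s\<in>{1..n} - {r}. pvar s ^ a s :: 'k mpol"
      have m: "pvar r * mon a = mon (a(r := Suc (a r)))"
        using mon_upd[OF r, of a "a r"] mon_upd[OF r, of a "Suc (a r)"] by (simp add: mult.assoc)
      have "Px (mon (a(r := Suc (a r)))) \<in> KS \<Lambda> D"
      proof (cases "Suc (a r) < N")
        case True
        then show ?thesis using a by (intro mon_D) auto
      next
        case False
        then have aN: "Suc (a r) = N" using a r by (metis PiE_mem lessThan_iff less_SucE not_less_eq)
        \<comment> \<open>The remainder of Z^N modulo the monic f; it replaces X_r^N by lower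
          powers.\<close>
        define g where "g = monom 1 N - f"
        have g: "coeff g k = 0" if "k \<ge> N" for k
          using that f(1) le_degree[of f k] by (cases "k = N") (auto simp: g_def N_def)
        have "map_poly cst g = (\<Sum>k<N. monom (cst (coeff g k)) k :: 'k mpol poly)"
          by (rule poly_eqI) (auto simp: coeff_map_poly coeff_sum g)
        then have pg: "pe g (pvar r) = (\<Sum>k<N. cst (coeff g k) * pvar r ^ k)"
          by (simp add: pe_def poly_sum poly_monom)
        interpret pe: comm_ring_hom "\<lambda>f. pe f (pvar r :: 'k mpol)" by (rule comm_ring_hom_pe)
        have "pe (monom 1 N) (pvar r) = (pvar r :: 'k mpol) ^ N"
          by (simp add: pe_def map_poly_monom poly_monom)
        then have "pvar r ^ N = pe g (pvar r) + pe f (pvar r)"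
          by (simp add: g_def pe.hom_minus)
        then have "mon (a(r := Suc (a r))) = (\<Sum>k<N. cst (coeff g k) * mon (a(r := k))) + pe f (pvar r) * ?R"
          unfolding mon_upd[OF r] aN pg by (simp add: distrib_right sum_distrib_right mult.assoc)
        then have "ccong \<Lambda> (Px (mon (a(r := Suc (a r))))) (Px (\<Sum>k<N. cst (coeff g k) * mon (a(r := k))))"
          using Iz_mult[OF f(3)[OF r], of ?R] unfolding Iz_diff_iff[symmetric] by simp
        moreover have "Px (\<Sum>k<N. cst (coeff g k) * mon (a(r := k))) \<in> KS \<Lambda> D"
        proof -
          have "Px (sum F A) = (\<Sum>k\<in>A. Px (F k))" if "finite A" for F and A :: "nat set"
            using that by (induction A) (simp_all add: Px_add)
          then have "Px (\<Sum>k<N. cst (coeff g k) * mon (a(r := k))) = (\<Sum>k<N. cst (coeff g k) * Px (mon (a(r := k))))"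
            by (simp add: Px_cst_mult)
          also have "\<dots> \<in> KS \<Lambda> D" using a by (intro KS_sum KS_cst mon_D) auto
          finally show ?thesis .
        qed
        ultimately show ?thesis by (rule KS_cong)
      qed
      moreover have "ccong \<Lambda> (Px (pvar r) * b * 1) (Px (mon (a(r := Suc (a r)))))"
        unfolding a(2) m[symmetric] by (simp add: congr_hrels_crels[OF congr_sym[OF Px_mult]])
      ultimately show ?thesis by (rule KS_cong[rotated])
    qed
    from KS_map[OF this x] show ?thesis by simp
  qed
  have "\<forall>x\<in>KS \<Lambda> D. Px p * x \<in> KS \<Lambda> D" if "p \<in> polys n" for p
    using that
  proof (induction p rule: polys_n_induct)
    case (mult p p')
    show ?case
    proof
      fix x assume "x \<in> KS \<Lambda> D"
      then have "Px p * (Px p' * x) \<in> KS \<Lambda> D" using mult by blast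
      moreover have "ccong \<Lambda> (Px (p * p') * x) (Px p * (Px p' * x))"
        unfolding mult.assoc[symmetric] by (intro congr_hrels_crels congr_mult[OF Px_mult congr_refl])
      ultimately show "Px (p * p') * x \<in> KS \<Lambda> D" by (rule KS_cong[rotated])
    qed
  qed (use X in \<open>auto simp: KS_cst Px_add distrib_right KS_add\<close>)
  moreover have "1 \<in> KS \<Lambda> D"
    using mon_D[of "\<lambda>_. 0"] f(2) by (simp add: mon_def N_def)
  ultimately show ?thesis using fin by (intro exI[of _ D]) fastforce
qed

text \<open>Reduced monomials times normal words span. The power of \<open>Xall\<close> in
  \<open>LS_all\<close> is harmless, since \<open>Xall\<close> has a polynomial inverse in the
  quotient.\<close>

lemma cyclotomic_finite: "\<exists>B. finite B \<and> KS \<Lambda> B = UNIV"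
proof -
  obtain D where D: "finite D" "\<And>p. p \<in> polys n \<Longrightarrow> Px p \<in> KS \<Lambda> D"
    using polys_finite[of \<Lambda>] by auto
  define B where "B = (\<lambda>(d, u). d * Tw u) ` (D \<times> NF)"
  have fin: "finite B" using D(1) by (simp add: B_def)
  have LS_KS: "p \<in> KS \<Lambda> B" if pL: "p \<in> LS NF" for p
  proof -
    obtain c where c: "\<forall>u. c u \<in> polys n" "p \<approx> (\<Sum>u\<in>NF. Px (c u) * Tw u)"
      using pL unfolding LS_def by blast
    have "Px (c u) * Tw u \<in> KS \<Lambda> B" if "u \<in> NF" for u
    proof -
      have "1 * d * Tw u \<in> KS \<Lambda> B" if "d \<in> D" for d
        using \<open>u \<in> NF\<close> that by (intro KS_base[OF fin]) (auto simp: B_def)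
      from KS_map[OF this D(2), of "c u"] c(1) show ?thesis by simp
    qed
    then show ?thesis by (intro KS_cong[OF congr_hrels_crels[OF c(2)]] KS_sum)
  qed
  have "p \<in> KS \<Lambda> B" for p
  proof -
    obtain L where L: "st = Deg \<longrightarrow> L = 0" "Px (Xall ^ L) * p \<in> LS NF" using LS_all by blast
    show ?thesis
    proof (cases "st = Deg")
      case True
      then show ?thesis using L LS_KS by simp
    next
      case False
      then obtain g where g: "\<And>r. r \<in> {1..n} \<Longrightarrow> Iz \<Lambda> (pvar r * pe g (pvar r) - 1)"
        using Iz_annihilator[of \<Lambda>] by blast
      define G where "G = (\<Prod>r\<in>{1..n}. pe g (pvar r))"
      have G: "G \<in> polys n" unfolding G_def by (intro polys_prod pe_polys polys_pvar)
      have one_mult: "Iz \<Lambda> (a * b - 1)" if "Iz \<Lambda> (a - 1)" "Iz \<Lambda> (b - 1)" for a b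
      proof -
        have eq: "a * b - 1 = (a - 1) * b + (b - 1)" by (simp add: algebra_simps)
        show ?thesis unfolding eq by (intro Iz_add Iz_mult that)
      qed
      have "Iz \<Lambda> ((\<Prod>r\<in>A. pvar r * pe g (pvar r)) - 1)" if "A \<subseteq> {1..n}" for A
        using finite_subset[OF that] that by (induction A) (use g one_mult in \<open>auto\<close>)
      from this[of "{1..n}"] have "Iz \<Lambda> (G * Xall - 1)"
        by (simp add: G_def Xall_def prod.distrib mult.commute)
      then have "Iz \<Lambda> ((G * Xall) ^ L - 1)" by (induction L) (simp_all add: one_mult)
      then have 1: "ccong \<Lambda> (Px (G ^ L * Xall ^ L)) 1"
        using Iz_diff_iff[of \<Lambda> "(G * Xall) ^ L" 1] by (simp add: power_mult_distrib)
      have "ccong \<Lambda> p (Px (G ^ L * Xall ^ L) * p)"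
        using congr_mult[OF congr_sym[OF 1] congr_refl, of p] by simp
      also have "ccong \<Lambda> \<dots> (Px (G ^ L) * Px (Xall ^ L) * p)"
        by (intro congr_hrels_crels congr_mult[OF Px_mult congr_refl])
      also have "\<dots> = Px (G ^ L) * (Px (Xall ^ L) * p)" by (simp add: mult.assoc)
      finally show ?thesis
        by (rule KS_cong) (intro LS_KS LS_Px L polys_power G)
    qed
  qed
  then show ?thesis using fin by blast
qed

text \<open>A spanning set of least cardinality is independent: a nontrivial relation would allow
  one element to be removed.\<close>

lemma cyclotomic_basis:
  "\<exists>B. finite B \<and> KS \<Lambda> B = UNIV \<and> (\<forall>c. ccong \<Lambda> (\<Sum>b\<in>B. cst (c b) * b) 0 \<longrightarrow> (\<forall>b\<in>B. c b = 0))"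
proof -
  define P where "P B \<longleftrightarrow> finite B \<and> KS \<Lambda> B = UNIV" for B
  obtain B0 where "P B0" using cyclotomic_finite[of \<Lambda>] unfolding P_def by auto
  from ex_has_least_nat[of P, OF this, of card]
  obtain B where B: "P B" "\<And>B'. P B' \<Longrightarrow> card B \<le> card B'" by auto
  have "c b = 0" if c: "ccong \<Lambda> (\<Sum>b\<in>B. cst (c b) * b) 0" and b: "b \<in> B" for c b
  proof (rule ccontr)
    assume nz: "c b \<noteq> 0"
    have fin: "finite B" using B(1) by (simp add: P_def)
    have "ccong \<Lambda> (cst (- 1 / c b) * (\<Sum>b\<in>B. cst (c b) * b) + b) (cst (- 1 / c b) * 0 + b)"
      by (rule congr_add[OF congr_mult[OF congr_refl c] congr_refl])
    moreover have "cst (- 1 / c b) * (\<Sum>b\<in>B. cst (c b) * b) + b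
        = (\<Sum>x\<in>B - {b}. cst (- 1 / c b * c x) * x)"
    proof -
      have "cst (- 1 / c b) * (cst (c b) * b) = - b"
        using nz by (simp add: mult.assoc[symmetric] cst_mult[symmetric] cst_uminus)
      moreover have "cst (- 1 / c b) * (cst (c x) * x) = cst (- 1 / c b * c x) * x" for x
        by (simp only: cst_mult mult.assoc)
      ultimately show ?thesis
        by (simp only: sum.remove[OF fin b] distrib_left sum_distrib_left) simp
    qed
    ultimately have "ccong \<Lambda> b (\<Sum>x\<in>B - {b}. cst (- 1 / c b * c x) * x)"
      by (simp add: congr_sym)
    then have b': "b \<in> KS \<Lambda> (B - {b})"
      unfolding KS_def by (intro CollectI exI[of _ "\<lambda>x. - 1 / c b * c x"])
    have "p \<in> KS \<Lambda> (B - {b})" for p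
    proof -
      have "p \<in> KS \<Lambda> B" using B(1) by (simp add: P_def)
      moreover have "1 * x * 1 \<in> KS \<Lambda> (B - {b})" if "x \<in> B" for x
        using that b' fin by (cases "x = b") (auto intro: KS_base)
      ultimately show ?thesis using KS_map[of B 1 1 \<Lambda> "B - {b}" p] by simp
    qed
    then have "P (B - {b})" using fin by (auto simp: P_def)
    then show False using B(2)[of "B - {b}"] fin b by (metis card_Diff1_less not_le)
  qed
  then show ?thesis using B(1) unfolding P_def by (intro exI[of _ B]) auto
qed

end

lemma mat_eq_on_vecs:
  assumes A: "A \<in> carrier_mat d d" and B: "B \<in> carrier_mat d d"
    and "\<And>w. w \<in> carrier_vec d \<Longrightarrow> A *\<^sub>v w = B *\<^sub>v (w :: 'a::comm_ring_1 vec)"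
  shows "A = B"
proof (rule eq_matI)
  fix i j
  assume ij: "i < dim_row B" "j < dim_col B"
  have "(A *\<^sub>v unit_vec d j) $ i = (B *\<^sub>v unit_vec d j) $ i" by (simp add: assms(3))
  then show "A $$ (i, j) = B $$ (i, j)" using A B ij by simp
qed (use A B in auto)

context hecke
begin

section \<open>The regular representation\<close>

abbreviation "kp \<equiv> kap st n"
abbreviation "Cyc \<equiv> cyclotomic_hecke st n"

lemma kp_eq_iff: "kp \<Lambda> p = kp \<Lambda> p' \<longleftrightarrow> ccong \<Lambda> p p'"
  by (rule kap_eq_iff)

lemma kp_cst: "cyc_class st n \<Lambda> (cst c) = kp \<Lambda> (cst c)"
  by (simp add: kap_words)

lemma kp_X: "k \<in> {1..n} \<Longrightarrow> cyc_class st n \<Lambda> (X\<^sub>g k) = kp \<Lambda> (X\<^sub>g k)"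
  by (simp add: kap_words)

text \<open>The left regular representation in coordinates. It supplies the module on which the
  uniqueness of e(i) is tested.\<close>

lemma faithful_module:
  "\<exists>d M. fd_module (Cyc \<Lambda>) (\<lambda>c. cyc_class st n \<Lambda> (cst c)) d M \<and>
     (\<forall>a\<in>carrier (Cyc \<Lambda>). \<forall>a'\<in>carrier (Cyc \<Lambda>). M a = M a' \<longrightarrow> a = a')"
proof -
  obtain B where fin: "finite B" and span: "KS \<Lambda> B = UNIV"
    and indep: "\<And>c b. ccong \<Lambda> (\<Sum>b\<in>B. cst (c b) * b) 0 \<Longrightarrow> b \<in> B \<Longrightarrow> c b = 0"
    using cyclotomic_basis[of \<Lambda>] by auto
  \<comment> \<open>A choice of coordinates; by independence they respect congruence and are linear,
    see \<open>unique\<close>.\<close>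
  define co where "co p = (SOME c. ccong \<Lambda> p (\<Sum>b\<in>B. cst (c b) * b))" for p
  have co: "ccong \<Lambda> p (\<Sum>b\<in>B. cst (co p b) * b)" for p
  proof -
    have "\<exists>c. ccong \<Lambda> p (\<Sum>b\<in>B. cst (c b) * b)" using span unfolding KS_def by auto
    then show ?thesis unfolding co_def by (rule someI_ex)
  qed
  have unique: "co p b = c b" if "ccong \<Lambda> p (\<Sum>b\<in>B. cst (c b) * b)" "b \<in> B" for p b c
  proof -
    have "ccong \<Lambda> ((\<Sum>b\<in>B. cst (co p b) * b) - (\<Sum>b\<in>B. cst (c b) * b)) 0"
      using congr_trans[OF congr_sym[OF co] that(1)] by (simp add: congr_diff_0_iff)
    then have "ccong \<Lambda> (\<Sum>b\<in>B. cst (co p b - c b) * b) 0"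
      by (simp add: cst_diff left_diff_distrib sum_subtractf)
    from indep[OF this that(2)] show ?thesis by simp
  qed
  have co_cong: "co p b = co p' b" if "ccong \<Lambda> p p'" "b \<in> B" for p p' b
    by (rule unique[OF congr_trans[OF that(1) co] that(2)])
  have co_add: "co (p + p') b = co p b + co p' b" if "b \<in> B" for p p' b
  proof (rule unique[OF _ that])
    show "ccong \<Lambda> (p + p') (\<Sum>b\<in>B. cst (co p b + co p' b) * b)"
      using congr_add[OF co[of p] co[of p']] by (simp add: cst_add distrib_right sum.distrib)
  qed
  have co_cst: "co (cst a * p) b = a * co p b" if "b \<in> B" for a p b
  proof (rule unique[OF _ that])
    show "ccong \<Lambda> (cst a * p) (\<Sum>b\<in>B. cst (a * co p b) * b)"
      using congr_mult[OF congr_refl co[of p], of "cst a"] by (simp add: cst_mult sum_distrib_left mult.assoc)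
  qed
  have co_0: "co 0 b = 0" if "b \<in> B" for b using co_cst[OF that, of 0 0] by simp
  have co_sum: "co (sum f A) b = (\<Sum>x\<in>A. co (f x) b)" if "b \<in> B" "finite A" for f A b
    using that(2) by (induction A) (simp_all add: co_0 co_add that(1))
  have co_basis: "co b' b = (if b = b' then 1 else 0)" if "b \<in> B" "b' \<in> B" for b b'
  proof (rule unique[OF _ that(1)])
    have "(\<Sum>b\<in>B. cst (if b = b' then 1 else 0) * b) = (\<Sum>b\<in>B. if b = b' then b else 0)"
      by (intro sum.cong) auto
    then show "ccong \<Lambda> b' (\<Sum>b\<in>B. cst (if b = b' then 1 else 0) * b)"
      using fin that by simp
  qed
  define d where "d = card B"
  obtain \<beta> where \<beta>: "bij_betw \<beta> {0..<d} B"
    using ex_bij_betw_nat_finite[OF fin] unfolding d_def by blast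
  have \<beta>B: "\<beta> i \<in> B" if "i < d" for i using \<beta> that by (auto simp: bij_betw_def)
  have \<beta>inj: "\<beta> i = \<beta> j \<longleftrightarrow> i = j" if "i < d" "j < d" for i j
    using \<beta> that by (auto simp: bij_betw_def inj_on_def)
  define Mp where "Mp p = mat d d (\<lambda>(i, j). co (p * \<beta> j) (\<beta> i))" for p
  have Mp_cong: "Mp p = Mp p'" if "ccong \<Lambda> p p'" for p p'
    unfolding Mp_def using \<beta>B that
    by (intro cong_mat) (auto intro!: co_cong congr_mult[OF _ congr_refl])
  have Mp_mult: "Mp (p * p') = Mp p * Mp p'" for p p'
  proof (rule eq_matI)
    fix i j
    assume "i < dim_row (Mp p * Mp p')" "j < dim_col (Mp p * Mp p')"
    then have ij: "i < d" "j < d" by (simp_all add: Mp_def)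
    have "ccong \<Lambda> (p * p' * \<beta> j) (\<Sum>b\<in>B. cst (co (p' * \<beta> j) b) * (p * b))"
    proof -
      have "ccong \<Lambda> (p * (p' * \<beta> j)) (p * (\<Sum>b\<in>B. cst (co (p' * \<beta> j) b) * b))"
        by (rule congr_mult[OF congr_refl co])
      then show ?thesis by (simp add: sum_distrib_left mult.assoc cst_left_comm[of p])
    qed
    then have "co (p * p' * \<beta> j) (\<beta> i) = (\<Sum>b\<in>B. co (p' * \<beta> j) b * co (p * b) (\<beta> i))"
      using co_cong \<beta>B[OF ij(1)] by (simp add: co_sum fin co_cst)
    also have "\<dots> = (\<Sum>k\<in>{0..<d}. co (p' * \<beta> j) (\<beta> k) * co (p * \<beta> k) (\<beta> i))"
      by (rule sum.reindex_bij_betw[OF \<beta>, symmetric])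
    also have "\<dots> = (Mp p * Mp p') $$ (i, j)"
      using ij by (simp add: Mp_def scalar_prod_def mult.commute)
    finally show "Mp (p * p') $$ (i, j) = (Mp p * Mp p') $$ (i, j)"
      using ij by (simp add: Mp_def)
  qed (simp_all add: Mp_def)
  define M where "M a = Mp (SOME p. a = kp \<Lambda> p)" for a
  have M: "M (kp \<Lambda> p) = Mp p" for p
  proof -
    have "kp \<Lambda> p = kp \<Lambda> (SOME p'. kp \<Lambda> p = kp \<Lambda> p')" by (rule someI[of _ p]) simp
    then show ?thesis unfolding M_def kp_eq_iff by (intro Mp_cong) (simp add: congr_sym)
  qed
  have "M \<in> Ring.ring_hom (Cyc \<Lambda>) (ring_mat TYPE('k) d ())"
  proof (rule ring_hom_memI)
    fix x assume "x \<in> carrier (Cyc \<Lambda>)"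
    then obtain p where p: "x = kp \<Lambda> p" using kap_surj by blast
    show "M x \<in> carrier (ring_mat TYPE('k) d ())" by (simp add: p M ring_mat_simps Mp_def)
    fix y assume "y \<in> carrier (Cyc \<Lambda>)"
    then obtain p' where p': "y = kp \<Lambda> p'" using kap_surj by blast
    show "M (x \<otimes>\<^bsub>Cyc \<Lambda>\<^esub> y) = M x \<otimes>\<^bsub>ring_mat TYPE('k) d ()\<^esub> M y"
      by (simp add: p p' M kap_mult[symmetric] Mp_mult ring_mat_simps)
    show "M (x \<oplus>\<^bsub>Cyc \<Lambda>\<^esub> y) = M x \<oplus>\<^bsub>ring_mat TYPE('k) d ()\<^esub> M y"
      by (auto simp: p p' M kap_add[symmetric] ring_mat_simps Mp_def distrib_right co_add \<beta>B intro!: eq_matI)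
  next
    show "M \<one>\<^bsub>Cyc \<Lambda>\<^esub> = \<one>\<^bsub>ring_mat TYPE('k) d ()\<^esub>"
      by (auto simp: kap_1[symmetric] M ring_mat_simps Mp_def co_basis \<beta>B \<beta>inj intro!: eq_matI)
  qed
  moreover have "M (cyc_class st n \<Lambda> (cst c)) = c \<cdot>\<^sub>m 1\<^sub>m d" for c
    by (auto simp: kp_cst M Mp_def co_basis co_cst \<beta>B \<beta>inj intro!: eq_matI)
  moreover have "a = a'" if ac: "a \<in> carrier (Cyc \<Lambda>)" "a' \<in> carrier (Cyc \<Lambda>)" "M a = M a'" for a a'
  proof -
    obtain p where p1: "a = kp \<Lambda> p" using kap_surj[OF ac(1)] by blast
    obtain p' where p2: "a' = kp \<Lambda> p'" using kap_surj[OF ac(2)] by blast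
    note p = p1 p2
    have MM: "Mp p = Mp p'" using ac(3) by (simp add: p M)
    have eq: "ccong \<Lambda> (p * b) (p' * b)" if b: "b \<in> B" for b
    proof -
      obtain j where j: "j < d" "b = \<beta> j" using \<beta> b by (auto simp: bij_betw_def)
      have "co (p * b) b' = co (p' * b) b'" if b'B: "b' \<in> B" for b'
      proof -
        obtain i where i: "i < d" "b' = \<beta> i" using \<beta> b'B by (auto simp: bij_betw_def)
        have "Mp p $$ (i, j) = Mp p' $$ (i, j)" using MM by simp
        then show ?thesis using i j by (simp add: Mp_def)
      qed
      then have e: "(\<Sum>b'\<in>B. cst (co (p * b) b') * b') = (\<Sum>b'\<in>B. cst (co (p' * b) b') * b')"
        by (intro sum.cong) simp_all
      show ?thesis by (rule congr_trans[OF co[of "p * b", unfolded e] congr_sym[OF co]])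
    qed
    \<comment> \<open>Writing 1 in the basis recovers an element from its products with the basis
      vectors, that is, from its matrix.\<close>
    have one: "ccong \<Lambda> (x * 1) (\<Sum>b\<in>B. cst (co 1 b) * (x * b))" for x
      using congr_mult[OF congr_refl co, of x 1] by (simp add: sum_distrib_left cst_left_comm[of x])
    have "ccong \<Lambda> (p * 1) (\<Sum>b\<in>B. cst (co 1 b) * (p * b))" by (rule one)
    also have "ccong \<Lambda> \<dots> (\<Sum>b\<in>B. cst (co 1 b) * (p' * b))"
      by (intro congr_sum congr_mult[OF congr_refl] eq)
    also have "ccong \<Lambda> \<dots> (p' * 1)" by (rule congr_sym[OF one])
    finally show ?thesis by (simp add: p kp_eq_iff)
  qed
  ultimately show ?thesis unfolding fd_module_def by blast
qed


section \<open>Identification of the residue idempotents\<close>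

context
  fixes \<Lambda> :: "int multiset" and d :: nat and M
  assumes fd: "fd_module (Cyc \<Lambda>) (\<lambda>c. cyc_class st n \<Lambda> (cst c)) d M"
begin

definition mm :: "'k free \<Rightarrow> 'k vec \<Rightarrow> 'k vec" where
  "mm p w = M (kp \<Lambda> p) *\<^sub>v w"

lemma M_hom: "M \<in> Ring.ring_hom (Cyc \<Lambda>) (ring_mat TYPE('k) d ())"
  using fd by (simp add: fd_module_def)

lemma M_carrier [simp]: "M (kp \<Lambda> p) \<in> carrier_mat d d"
  using ring_hom_closed[OF M_hom kap_closed, of p] by (simp add: ring_mat_simps)

lemma M_dims [simp]: "dim_row (M (kp \<Lambda> p)) = d" "dim_col (M (kp \<Lambda> p)) = d"
  by (rule carrier_matD[OF M_carrier])+

lemma M_add: "M (kp \<Lambda> (p + p')) = M (kp \<Lambda> p) + M (kp \<Lambda> p')"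
  using ring_hom_add[OF M_hom kap_closed kap_closed] by (simp add: kap_add ring_mat_simps)

lemma M_mult: "M (kp \<Lambda> (p * p')) = M (kp \<Lambda> p) * M (kp \<Lambda> p')"
  using ring_hom_mult[OF M_hom kap_closed kap_closed] by (simp add: kap_mult ring_mat_simps)

lemma M_cst: "M (kp \<Lambda> (cst c)) = c \<cdot>\<^sub>m 1\<^sub>m d"
  using fd by (simp add: fd_module_def kp_cst)

lemma M_1: "M (kp \<Lambda> 1) = 1\<^sub>m d"
  using M_cst[of 1] by auto

lemma mm_carrier [simp]: "w \<in> carrier_vec d \<Longrightarrow> mm p w \<in> carrier_vec d"
  unfolding mm_def by (rule mult_mat_vec_carrier[OF M_carrier])

lemma mm_add: "w \<in> carrier_vec d \<Longrightarrow> mm (p + p') w = mm p w + mm p' w"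
  unfolding mm_def M_add by (rule add_mult_distrib_mat_vec[OF M_carrier M_carrier])

lemma mm_mult: "w \<in> carrier_vec d \<Longrightarrow> mm (p * p') w = mm p (mm p' w)"
  unfolding mm_def M_mult by (rule assoc_mult_mat_vec[OF M_carrier M_carrier])

lemma mm_1 [simp]: "w \<in> carrier_vec d \<Longrightarrow> mm 1 w = w"
  unfolding mm_def M_1 by (rule one_mult_mat_vec)

lemma mm_0 [simp]: "w \<in> carrier_vec d \<Longrightarrow> mm 0 w = 0\<^sub>v d"
  using M_cst[of 0] by (auto simp: mm_def intro!: eq_vecI)

lemma mm_zero_vec [simp]: "mm p (0\<^sub>v d) = 0\<^sub>v d"
  unfolding mm_def by (intro eq_vecI) simp_all

lemma mm_cong: "ccong \<Lambda> p p' \<Longrightarrow> mm p w = mm p' w"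
  by (simp add: mm_def kp_eq_iff[symmetric])

lemma mm_Px_mult: "w \<in> carrier_vec d \<Longrightarrow> mm (Px (p * p')) w = mm (Px p) (mm (Px p') w)"
  by (simp add: mm_cong[OF congr_hrels_crels[OF Px_mult]] mm_mult)

lemma mm_Iz: "Iz \<Lambda> p \<Longrightarrow> w \<in> carrier_vec d \<Longrightarrow> mm (Px p) w = 0\<^sub>v d"
  using mm_cong[of "Px p" 0] by (simp add: Iz_def)

lemma M_X_power:
  assumes r: "r \<in> {1..n}"
  shows "(M (cyc_class st n \<Lambda> (X\<^sub>g r)) - c \<cdot>\<^sub>m 1\<^sub>m d) ^\<^sub>m N *\<^sub>v w = mm (Px ((pvar r - cst c) ^ N)) w"
proof -
  have Xc: "Px (pvar r - cst c) = X\<^sub>g r - cst c" using r by (simp add: Px_diff)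
  have "M (kp \<Lambda> (X\<^sub>g r)) = M (kp \<Lambda> (Px (pvar r - cst c) + cst c))" by (simp add: Xc)
  also have "\<dots> = M (kp \<Lambda> (Px (pvar r - cst c))) + c \<cdot>\<^sub>m 1\<^sub>m d" by (simp only: M_add M_cst)
  finally have 1: "M (cyc_class st n \<Lambda> (X\<^sub>g r)) - c \<cdot>\<^sub>m 1\<^sub>m d = M (kp \<Lambda> (Px (pvar r - cst c)))"
    using M_carrier[of "Px (pvar r - cst c)"] kp_X[OF r] by (auto intro!: eq_matI)
  have "M (kp \<Lambda> (Px (p ^ N))) = M (kp \<Lambda> (Px p)) ^\<^sub>m N" for p
  proof (induction N)
    case (Suc N)
    have "kp \<Lambda> (Px (p ^ Suc N)) = kp \<Lambda> (Px (p ^ N) * Px p)"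
      unfolding kp_eq_iff power_Suc2 by (rule congr_hrels_crels[OF Px_mult])
    then show ?case by (simp add: M_mult Suc)
  qed (use M_carrier in \<open>auto simp: M_1\<close>)
  then show ?thesis unfolding 1 mm_def by simp
qed

abbreviation "W \<equiv> \<lambda>j. sim_gen_eigenspace n (\<lambda>r. cyc_class st n \<Lambda> (X\<^sub>g r)) (\<lambda>r. val (j r)) d M"

lemma W_iff: "w \<in> W j \<longleftrightarrow> w \<in> carrier_vec d \<and>
    (\<forall>r\<in>{1..n}. \<exists>N. mm (Px ((pvar r - cst (val (j r))) ^ N)) w = 0\<^sub>v d)"
  unfolding sim_gen_eigenspace_def using M_X_power by auto

context
  fixes B N \<eta>
  assumes v: "valid \<Lambda> B N \<eta>"
begin

lemma eps_W: "w \<in> carrier_vec d \<Longrightarrow> mm (Px (eps \<eta> i)) w \<in> W i"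
  unfolding W_iff using mm_Iz[OF eps_nilpotent[OF v]]
  by (auto simp: mm_Px_mult[symmetric] intro!: exI[of _ N])

text \<open>At an r with \<open>j r \<noteq> k r\<close>, one power of X_r -
  \<open>val (j r)\<close> kills the vector and one of X_r - \<open>val (k r)\<close> kills eps of
  \<open>k\<close>; the two are comaximal.\<close>

lemma eps_kills_W:
  assumes w: "w \<in> W j" and j: "j \<in> res_seqs e n" and k: "k \<in> res_seqs e n" and "j \<noteq> k"
  shows "mm (Px (eps \<eta> k)) w = 0\<^sub>v d"
proof -
  have "j \<in> extensional {1..n}" "k \<in> extensional {1..n}" using j k by (auto simp: res_seqs_def PiE_iff)
  then obtain r where r: "r \<in> {1..n}" "j r \<noteq> k r" using eps_extensional_neq[OF v] assms(4) by blast
  have ne: "val (j r) \<noteq> val (k r)" 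
  proof -
    have "j r \<in> residues_mod e" "k r \<in> residues_mod e"
      using j k r(1) unfolding res_seqs_def by (meson PiE_mem)+
    then show ?thesis using r(2) val_inj by blast
  qed
  have wc: "w \<in> carrier_vec d" using w by (simp add: W_iff)
  obtain L where L: "mm (Px ((pvar r - cst (val (j r))) ^ L)) w = 0\<^sub>v d"
    using w r(1) unfolding W_iff by blast
  obtain a b where ab: "a * (pvar r - cst (val (j r))) ^ L + b * (pvar r - cst (val (k r))) ^ N = 1"
    using comax_linear[OF ne, of "pvar r" L N] unfolding comax_def by blast
  let ?E = "eps \<eta> k"
  have "?E = ?E * (a * (pvar r - cst (val (j r))) ^ L + b * (pvar r - cst (val (k r))) ^ N)"
    unfolding ab by simp
  also have "\<dots> = (?E * a) * (pvar r - cst (val (j r))) ^ L + b * ((pvar r - cst (val (k r))) ^ N * ?E)"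
    by (simp add: algebra_simps)
  finally have "mm (Px ?E) w = mm (Px (?E * a) ) (mm (Px ((pvar r - cst (val (j r))) ^ L)) w)
      + mm (Px (b * ((pvar r - cst (val (k r))) ^ N * ?E))) w"
    using wc by (metis Px_add mm_add mm_Px_mult)
  also have "\<dots> = 0\<^sub>v d + 0\<^sub>v d"
    using L wc mm_Iz[OF Iz_mult2[OF eps_nilpotent[OF v r(1)]] wc] by simp
  finally show ?thesis by simp
qed

lemma PiE_res_seqs: "k \<in> {1..n} \<rightarrow>\<^sub>E B \<Longrightarrow> k \<in> res_seqs e n"
  using v by (auto simp: res_seqs_def valid_def PiE_iff)

lemma finite_PiE_B: "finite ({1..n} \<rightarrow>\<^sub>E B)"
  using v by (intro finite_PiE) (auto simp: valid_def)

lemma eps_fixes_W: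
  assumes w: "w \<in> W i" and i: "i \<in> res_seqs e n"
  shows "mm (Px (eps \<eta> i)) w = w"
proof -
  have wc: "w \<in> carrier_vec d" using w by (simp add: W_iff)
  have part: "mm (Px (\<Sum>k\<in>S. eps \<eta> k)) w = (if i \<in> S then mm (Px (eps \<eta> i)) w else 0\<^sub>v d)"
    if "finite S" "S \<subseteq> {1..n} \<rightarrow>\<^sub>E B" for S
    using that
  proof (induction S)
    case (insert k S)
    then show ?case
      using wc eps_kills_W[OF w i PiE_res_seqs, of k]
      by (cases "i = k") (auto simp: Px_add mm_add)
  qed (use wc in simp)
  have "w = mm (Px (\<Sum>k\<in>{1..n} \<rightarrow>\<^sub>E B. eps \<eta> k)) w"
    using wc by (simp only: eps_sum[OF v] Px_1 mm_1)
  also have "\<dots> = mm (Px (eps \<eta> i)) w"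
  proof (cases "i \<in> {1..n} \<rightarrow>\<^sub>E B")
    case False
    then have "\<exists>r\<in>{1..n}. i r \<notin> B" using i by (auto simp: res_seqs_def PiE_iff)
    then have "eps \<eta> i = 0" using eps_outside[OF v] by blast
    then show ?thesis using part[OF finite_PiE_B order_refl] False wc by simp
  qed (use part[OF finite_PiE_B order_refl] in simp)
  finally show ?thesis by simp
qed

text \<open>The images of the eps of \<open>k\<close> lie in the eigenspaces \<open>W k\<close> and
  add up to the whole module, so prescribed values on the eigenspaces determine the matrix.\<close>

lemma eps_unique:
  assumes i: "i \<in> res_seqs e n"
    and u: "\<And>w. w \<in> W i \<Longrightarrow> mm u w = w"
      "\<And>j w. j \<in> res_seqs e n - {i} \<Longrightarrow> w \<in> W j \<Longrightarrow> mm u w = 0\<^sub>v d"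
    and u': "\<And>w. w \<in> W i \<Longrightarrow> mm u' w = w"
      "\<And>j w. j \<in> res_seqs e n - {i} \<Longrightarrow> w \<in> W j \<Longrightarrow> mm u' w = 0\<^sub>v d"
  shows "M (kp \<Lambda> u) = M (kp \<Lambda> u')"
proof -
  have "mm u w = mm u' w" if wc: "w \<in> carrier_vec d" for w
  proof -
    have "mm u (mm (Px (\<Sum>k\<in>S. eps \<eta> k)) w) = mm u' (mm (Px (\<Sum>k\<in>S. eps \<eta> k)) w)"
      if "finite S" "S \<subseteq> {1..n} \<rightarrow>\<^sub>E B" for S
      using that
    proof (induction S)
      case (insert k S)
      have dist: "mm a (x + y) = mm a x + mm a y" if "x \<in> carrier_vec d" "y \<in> carrier_vec d" for a x y
        unfolding mm_def using that by (rule mult_add_distrib_mat_vec[OF M_carrier])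
      have "mm u (mm (Px (eps \<eta> k)) w) = mm u' (mm (Px (eps \<eta> k)) w)"
      proof (cases "k = i")
        case True
        then show ?thesis using u(1) u'(1) eps_W[OF wc] by simp
      next
        case False
        then have "k \<in> res_seqs e n - {i}" using PiE_res_seqs insert.prems by blast
        then show ?thesis using u(2) u'(2) eps_W[OF wc, of k] by metis
      qed
      then show ?case using insert wc by (simp add: Px_add mm_add dist)
    qed (use wc in simp)
    from this[OF finite_PiE_B order_refl] show ?thesis
      using wc by (simp only: eps_sum[OF v] Px_1 mm_1)
  qed
  then have "M (kp \<Lambda> u) *\<^sub>v w = M (kp \<Lambda> u') *\<^sub>v w" if "w \<in> carrier_vec d" for w
    using that by (simp add: mm_def)
  then show ?thesis
    by (rule mat_eq_on_vecs[OF M_carrier M_carrier])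
qed

end

end

text \<open>The polynomial projects correctly on every module. Any competitor has the same matrix on
  the faithful module and therefore coincides with it.\<close>

theorem residue_idem_eq:
  assumes v: "valid \<Lambda> B N \<eta>" and i: "i \<in> res_seqs e n"
  shows "residue_idem e st n \<Lambda> i = kp \<Lambda> (Px (eps \<eta> i))"
  unfolding residue_idem_def
proof (rule the_equality)
  have ext: "i \<in> extensional {1..n}" using i by (auto simp: res_seqs_def PiE_iff)
  show "is_residue_idem e st n \<Lambda> i (kp \<Lambda> (Px (eps \<eta> i)))"
    unfolding is_residue_idem_def Let_def
  proof (intro conjI allI impI ballI)
    show "kp \<Lambda> (Px (eps \<eta> i)) \<in> carrier (Cyc \<Lambda>)" by (rule kap_closed)
    have "ccong \<Lambda> (Px (eps \<eta> i) * Px (eps \<eta> i)) (Px (eps \<eta> i * eps \<eta> i))"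
      by (rule congr_hrels_crels[OF congr_sym[OF Px_mult]])
    also have "ccong \<Lambda> \<dots> (Px (eps \<eta> i))"
      using eps_idem[OF v ext] by (simp add: Iz_diff_iff)
    finally show "kp \<Lambda> (Px (eps \<eta> i)) \<otimes>\<^bsub>Cyc \<Lambda>\<^esub> kp \<Lambda> (Px (eps \<eta> i)) = kp \<Lambda> (Px (eps \<eta> i))"
      by (simp add: kap_mult[symmetric] kp_eq_iff)
    fix d M
    assume fd: "fd_module (Cyc \<Lambda>) (\<lambda>c. cyc_class st n \<Lambda> (cst c)) d M"
    let ?W = "\<lambda>j. sim_gen_eigenspace n (\<lambda>r. cyc_class st n \<Lambda> (X\<^sub>g r)) (\<lambda>r. val (j r)) d M"
    have fix1: "M (kp \<Lambda> (Px (eps \<eta> i))) *\<^sub>v w = w" if "w \<in> ?W i" for w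
      using eps_fixes_W[OF fd v that i] by (simp add: mm_def[OF fd])
    show "(\<lambda>w. M (kp \<Lambda> (Px (eps \<eta> i))) *\<^sub>v w) ` carrier_vec d = ?W i"
    proof
      show "(\<lambda>w. M (kp \<Lambda> (Px (eps \<eta> i))) *\<^sub>v w) ` carrier_vec d \<subseteq> ?W i"
        using eps_W[OF fd v] by (auto simp: mm_def[OF fd])
      show "?W i \<subseteq> (\<lambda>w. M (kp \<Lambda> (Px (eps \<eta> i))) *\<^sub>v w) ` carrier_vec d"
      proof
        fix w assume w: "w \<in> ?W i"
        then have "w \<in> carrier_vec d" by (simp add: W_iff[OF fd])
        then show "w \<in> (\<lambda>w. M (kp \<Lambda> (Px (eps \<eta> i))) *\<^sub>v w) ` carrier_vec d"
          using fix1[OF w] by (intro image_eqI[of _ _ w]) simp_all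
      qed
    qed
    show "M (kp \<Lambda> (Px (eps \<eta> i))) *\<^sub>v w = w" if "w \<in> ?W i" for w
      by (rule fix1[OF that])
    show "M (kp \<Lambda> (Px (eps \<eta> i))) *\<^sub>v w = 0\<^sub>v d" if "j \<in> res_seqs e n - {i}" "w \<in> ?W j" for j w
      using eps_kills_W[OF fd v that(2) _ i] that(1) by (auto simp: mm_def[OF fd])
  qed
  then have this': "is_residue_idem e st n \<Lambda> i (kp \<Lambda> (Px (eps \<eta> i)))" .
  fix u assume u: "is_residue_idem e st n \<Lambda> i u"
  obtain d M where fd: "fd_module (Cyc \<Lambda>) (\<lambda>c. cyc_class st n \<Lambda> (cst c)) d M"
    and inj0: "\<forall>a\<in>carrier (Cyc \<Lambda>). \<forall>a'\<in>carrier (Cyc \<Lambda>). M a = M a' \<longrightarrow> a = a'"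
    using faithful_module[of \<Lambda>] by (elim exE conjE)
  have inj: "a = a'" if "a \<in> carrier (Cyc \<Lambda>)" "a' \<in> carrier (Cyc \<Lambda>)" "M a = M a'" for a a'
    using inj0 that by blast
  have uc: "u \<in> carrier (Cyc \<Lambda>)" using u by (simp add: is_residue_idem_def Let_def)
  then obtain p where p: "u = kp \<Lambda> p" using kap_surj by blast
  have "M (kp \<Lambda> p) = M (kp \<Lambda> (Px (eps \<eta> i)))"
  proof (rule eps_unique[OF fd v i])
    show "mm \<Lambda> M p w = w" if "w \<in> sim_gen_eigenspace n (\<lambda>r. cyc_class st n \<Lambda> (X\<^sub>g r)) (\<lambda>r. val (i r)) d M" for w
      using u fd that unfolding p is_residue_idem_def Let_def mm_def[OF fd] by blast
    show "mm \<Lambda> M p w = 0\<^sub>v d" if "j \<in> res_seqs e n - {i}"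
      "w \<in> sim_gen_eigenspace n (\<lambda>r. cyc_class st n \<Lambda> (X\<^sub>g r)) (\<lambda>r. val (j r)) d M" for j w
      using u fd that unfolding p is_residue_idem_def Let_def mm_def[OF fd] by blast
    show "mm \<Lambda> M (Px (eps \<eta> i)) w = w" if "w \<in> sim_gen_eigenspace n (\<lambda>r. cyc_class st n \<Lambda> (X\<^sub>g r)) (\<lambda>r. val (i r)) d M" for w
      by (rule eps_fixes_W[OF fd v that i])
    show "mm \<Lambda> M (Px (eps \<eta> i)) w = 0\<^sub>v d" if "j \<in> res_seqs e n - {i}"
      "w \<in> sim_gen_eigenspace n (\<lambda>r. cyc_class st n \<Lambda> (X\<^sub>g r)) (\<lambda>r. val (j r)) d M" for j w
      using eps_kills_W[OF fd v that(2) _ i] that(1) by blast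
  qed
  then show "u = kp \<Lambda> (Px (eps \<eta> i))" unfolding p by (intro inj kap_closed)
qed

section \<open>The inverse limit\<close>

lemma aff_class_in_cyclotomic_ideal:
  assumes "p \<in> words_in (hecke_gens st n)"
  shows "aff_class st n p \<in> cyclotomic_ideal st n \<Lambda> \<longleftrightarrow> ccong \<Lambda> p 0"
proof -
  interpret A: ring "affine_hecke st n" by (rule ring_affine_hecke)
  interpret I: ideal "cyclotomic_ideal st n \<Lambda>" "affine_hecke st n" by (rule ideal_cyclotomic_ideal)
  have c: "aff_class st n p \<in> carrier (affine_hecke st n)"
    using ring_hom_closed[OF aff_class_hom] assms by simp
  have "aff_class st n p \<in> cyclotomic_ideal st n \<Lambda> \<longleftrightarrow>
      a_r_coset (affine_hecke st n) (cyclotomic_ideal st n \<Lambda>) (aff_class st n p) = cyclotomic_ideal st n \<Lambda>"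
    using c A.a_coset_join1[OF _ c I.a_subgroup] A.a_coset_join2[OF c I.a_subgroup] by blast
  also have "\<dots> \<longleftrightarrow> kp \<Lambda> p = kp \<Lambda> 0"
    using assms by (simp add: kap_0 kap_words cyc_class_def cyclotomic_hecke_def FactRing_def)
  finally show ?thesis by (simp add: kp_eq_iff)
qed

text \<open>The ideal of the larger weight is contained in that of the smaller, so adding the latter
  to a coset of the former yields the coset of the same element.\<close>

lemma cyc_proj_kp:
  assumes "\<Lambda> \<subseteq># \<Lambda>'"
  shows "cyc_proj st n \<Lambda> (kp \<Lambda>' p) = kp \<Lambda> p"
proof -
  interpret A: ring "affine_hecke st n" by (rule ring_affine_hecke)
  let ?I = "cyclotomic_ideal st n \<Lambda>" and ?I' = "cyclotomic_ideal st n \<Lambda>'"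
  interpret I: ideal ?I "affine_hecke st n" by (rule ideal_cyclotomic_ideal)
  interpret I': ideal ?I' "affine_hecke st n" by (rule ideal_cyclotomic_ideal)
  let ?p = "restrict_words (hecke_gens st n) p"
  have c: "aff_class st n ?p \<in> carrier (affine_hecke st n)"
    by (rule ring_hom_closed[OF aff_class_hom]) (simp add: restrict_words_in)
  have sub: "?I' \<subseteq> ?I"
  proof
    fix x assume x: "x \<in> ?I'"
    then obtain t where t: "t \<in> words_in (hecke_gens st n)" "x = aff_class st n t"
      using cyclotomic_ideal_two_sided by blast
    then have "ccong \<Lambda>' t 0" using x aff_class_in_cyclotomic_ideal by simp
    then show "x \<in> ?I" using t congr_crels_mono[OF assms] aff_class_in_cyclotomic_ideal by simp
  qed
  have "set_add (affine_hecke st n) ?I ?I' = ?I"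
  proof
    show "set_add (affine_hecke st n) ?I ?I' \<subseteq> ?I"
      using sub by (auto simp: set_add_def' intro: I.a_closed)
    show "?I \<subseteq> set_add (affine_hecke st n) ?I ?I'"
    proof
      fix x assume "x \<in> ?I"
      then have "x = x \<oplus>\<^bsub>affine_hecke st n\<^esub> \<zero>\<^bsub>affine_hecke st n\<^esub>" using I.a_Hcarr by simp
      then show "x \<in> set_add (affine_hecke st n) ?I ?I'"
        unfolding set_add_def' using \<open>x \<in> ?I\<close> I'.zero_closed by blast
    qed
  qed
  then show ?thesis
    unfolding cyc_proj_def kap_def cyc_class_def
    using A.a_setmult_rcos_assoc[OF I.a_subset I'.a_subset c] by simp
qed

abbreviation "R \<equiv> hecke_limit e st n"

text \<open>Elements of the limit are written as families of representatives in the free algebra,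
  where computations are done; \<open>coherent\<close> singles out the families that define limit
  elements.\<close>

definition lim :: "(int multiset \<Rightarrow> 'k free) \<Rightarrow> 'k limit" where
  "lim P = (\<lambda>\<Lambda>\<in>Pplus e. kp \<Lambda> (P \<Lambda>))"

definition coherent :: "(int multiset \<Rightarrow> 'k free) \<Rightarrow> bool" where
  "coherent P \<longleftrightarrow> (\<forall>\<Lambda>\<in>Pplus e. \<forall>\<Lambda>'\<in>Pplus e. \<Lambda> \<subseteq># \<Lambda>' \<longrightarrow> ccong \<Lambda> (P \<Lambda>') (P \<Lambda>))"

lemma lim_eq_iff: "lim P = lim Q \<longleftrightarrow> (\<forall>\<Lambda>\<in>Pplus e. ccong \<Lambda> (P \<Lambda>) (Q \<Lambda>))"
proof
  assume eq: "lim P = lim Q"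
  show "\<forall>\<Lambda>\<in>Pplus e. ccong \<Lambda> (P \<Lambda>) (Q \<Lambda>)"
  proof
    fix \<Lambda> assume "\<Lambda> \<in> Pplus e"
    then show "ccong \<Lambda> (P \<Lambda>) (Q \<Lambda>)"
      using fun_cong[OF eq, of \<Lambda>] by (simp add: lim_def kp_eq_iff)
  qed
next
  assume "\<forall>\<Lambda>\<in>Pplus e. ccong \<Lambda> (P \<Lambda>) (Q \<Lambda>)"
  then show "lim P = lim Q"
    unfolding lim_def by (intro restrict_ext) (simp add: kp_eq_iff)
qed

lemma carrier_R: "x \<in> carrier R \<longleftrightarrow> (\<exists>P. coherent P \<and> x = lim P)"
proof
  assume x: "x \<in> carrier R"
  then have xc: "x \<Lambda> \<in> carrier (Cyc \<Lambda>)" if "\<Lambda> \<in> Pplus e" for \<Lambda>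
    using that by (auto simp: hecke_limit_def PiE_iff)
  define P where "P \<Lambda> = (SOME p. x \<Lambda> = kp \<Lambda> p)" for \<Lambda>
  have P: "x \<Lambda> = kp \<Lambda> (P \<Lambda>)" if "\<Lambda> \<in> Pplus e" for \<Lambda>
    unfolding P_def using kap_surj[OF xc[OF that]] by (metis (mono_tags) someI_ex)
  have "x = lim P"
    using x P by (auto simp: hecke_limit_def lim_def PiE_iff intro!: extensionalityI[of x "Pplus e"])
  moreover have "coherent P"
    unfolding coherent_def
  proof (intro ballI impI)
    fix \<Lambda> \<Lambda>' assume L: "\<Lambda> \<in> Pplus e" "\<Lambda>' \<in> Pplus e" "\<Lambda> \<subseteq># \<Lambda>'"
    then have "cyc_proj st n \<Lambda> (x \<Lambda>') = x \<Lambda>" using x by (simp add: hecke_limit_def)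
    then show "ccong \<Lambda> (P \<Lambda>') (P \<Lambda>)" using P L by (simp add: cyc_proj_kp kp_eq_iff)
  qed
  ultimately show "\<exists>P. coherent P \<and> x = lim P" by blast
next
  assume "\<exists>P. coherent P \<and> x = lim P"
  then obtain P where P: "coherent P" "x = lim P" by blast
  have "cyc_proj st n \<Lambda> (lim P \<Lambda>') = lim P \<Lambda>"
    if "\<Lambda> \<in> Pplus e" "\<Lambda>' \<in> Pplus e" "\<Lambda> \<subseteq># \<Lambda>'" for \<Lambda> \<Lambda>'
    using P(1) that by (simp add: lim_def cyc_proj_kp kp_eq_iff coherent_def)
  moreover have "lim P \<in> (\<Pi>\<^sub>E \<Lambda> \<in> Pplus e. carrier (Cyc \<Lambda>))"
    by (simp add: lim_def kap_closed)
  ultimately show "x \<in> carrier R" by (simp add: P(2) hecke_limit_def)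
qed

lemma R_mult: "lim P \<otimes>\<^bsub>R\<^esub> lim Q = lim (\<lambda>\<Lambda>. P \<Lambda> * Q \<Lambda>)"
  and R_add: "lim P \<oplus>\<^bsub>R\<^esub> lim Q = lim (\<lambda>\<Lambda>. P \<Lambda> + Q \<Lambda>)"
  and R_one: "\<one>\<^bsub>R\<^esub> = lim (\<lambda>_. 1)"
  and R_zero: "\<zero>\<^bsub>R\<^esub> = lim (\<lambda>_. 0)"
  by (auto simp: hecke_limit_def lim_def kap_mult kap_add kap_1 kap_0 intro!: restrict_ext)

lemma coherent_intros:
  "coherent (\<lambda>_. p)"
  "coherent P \<Longrightarrow> coherent Q \<Longrightarrow> coherent (\<lambda>\<Lambda>. P \<Lambda> + Q \<Lambda>)"
  "coherent P \<Longrightarrow> coherent Q \<Longrightarrow> coherent (\<lambda>\<Lambda>. P \<Lambda> * Q \<Lambda>)"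
  unfolding coherent_def by (auto intro: congr_add congr_mult)

lemma ring_R: "ring R"
proof (rule ringI)
  have neg: "\<exists>y\<in>carrier R. y \<oplus>\<^bsub>R\<^esub> lim P = \<zero>\<^bsub>R\<^esub>" if "coherent P" for P
  proof (rule bexI[of _ "lim (\<lambda>\<Lambda>. (- 1) * P \<Lambda>)"])
    show "lim (\<lambda>\<Lambda>. - 1 * P \<Lambda>) \<in> carrier R"
      unfolding carrier_R using coherent_intros(3)[OF coherent_intros(1) that] by blast
  qed (simp add: R_add R_zero)
  have closed: "x \<oplus>\<^bsub>R\<^esub> y \<in> carrier R" "x \<otimes>\<^bsub>R\<^esub> y \<in> carrier R"
    if "x \<in> carrier R" "y \<in> carrier R" for x y
    using that coherent_intros unfolding carrier_R by (auto simp: R_add R_mult) blast+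
  have const: "lim (\<lambda>_. p) \<in> carrier R" for p unfolding carrier_R using coherent_intros(1) by blast
  show "abelian_group R"
  proof (rule abelian_groupI)
    show "\<exists>y\<in>carrier R. y \<oplus>\<^bsub>R\<^esub> x = \<zero>\<^bsub>R\<^esub>" if "x \<in> carrier R" for x
      using that neg unfolding carrier_R[of x] by blast
    show "\<zero>\<^bsub>R\<^esub> \<in> carrier R" unfolding R_zero by (rule const)
  qed (fact closed(1) | auto simp: carrier_R R_add R_zero ac_simps)+
  show "Group.monoid R"
  proof (rule Group.monoid.intro)
    show "\<one>\<^bsub>R\<^esub> \<in> carrier R" unfolding R_one by (rule const)
  qed (fact closed(2) | auto simp: carrier_R R_mult R_one mult.assoc)+
qed (auto simp: carrier_R R_mult R_add distrib_left distrib_right)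

interpretation R: ring R by (rule ring_R)

lemma hat_lim: "p \<in> words_in (hecke_gens st n) \<Longrightarrow> hat e st n p = lim (\<lambda>_. p)"
  by (auto simp: hat_def lim_def kap_words)

lemma limit_const_lim: "limit_const e st n c = lim (\<lambda>_. cst c)"
  by (simp add: limit_const_def hat_lim)

section \<open>Idempotents and inverses as families of polynomials\<close>

definition etaL :: "int multiset \<Rightarrow> int \<Rightarrow> 'k poly" where
  "etaL \<Lambda> = (SOME \<eta>. \<exists>B N. valid \<Lambda> B N \<eta>)"

definition EL :: "int multiset \<Rightarrow> (nat \<Rightarrow> int) \<Rightarrow> 'k mpol" where
  "EL \<Lambda> i = eps (etaL \<Lambda>) i"

lemma etaL_valid: "\<exists>B N. valid \<Lambda> B N (etaL \<Lambda>)"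
proof -
  have "\<exists>\<eta> B N. valid \<Lambda> B N \<eta>" using ex_valid by blast
  then show ?thesis unfolding etaL_def by (rule someI_ex)
qed

lemma EL_polys [simp]: "EL \<Lambda> i \<in> polys n"
  by (simp add: EL_def)

lemma sp_EL: "r \<in> {1..<n} \<Longrightarrow> sp r (EL \<Lambda> i) = EL \<Lambda> (i \<circ> simple_refl r)"
  unfolding EL_def by (rule sp_eps)

lemma EL_idem: "i \<in> res_seqs e n \<Longrightarrow> Iz \<Lambda> (EL \<Lambda> i * EL \<Lambda> i - EL \<Lambda> i)"
  unfolding EL_def using etaL_valid[of \<Lambda>] eps_idem by (auto simp: res_seqs_def PiE_iff)

lemma EL_orth:
  assumes "i \<in> res_seqs e n" "j \<in> res_seqs e n" "i \<noteq> j"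
  shows "Iz \<Lambda> (EL \<Lambda> i * EL \<Lambda> j)"
proof -
  obtain B N where v: "valid \<Lambda> B N (etaL \<Lambda>)" using etaL_valid by blast
  have "i \<in> extensional {1..n}" "j \<in> extensional {1..n}" using assms by (auto simp: res_seqs_def PiE_iff)
  then obtain r where "r \<in> {1..n}" "i r \<noteq> j r" using eps_extensional_neq[OF v] assms(3) by blast
  then show ?thesis unfolding EL_def by (rule eps_orthogonal[OF v])
qed

lemma EL_invert:
  assumes "r \<in> {1..n}" "s \<in> {1..n}" "val (i r) \<noteq> val (i s)"
  shows "\<exists>g. g \<in> polys n \<and> Iz \<Lambda> ((pvar r - pvar s) * g * EL \<Lambda> i - EL \<Lambda> i)"
proof -
  obtain B N where v: "valid \<Lambda> B N (etaL \<Lambda>)" using etaL_valid by blast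
  show ?thesis unfolding EL_def using eps_invert[OF v assms] by blast
qed

lemma hat_idem_lim: "i \<in> res_seqs e n \<Longrightarrow> hat_idem e st n i = lim (\<lambda>\<Lambda>. Px (EL \<Lambda> i))"
  unfolding hat_idem_def lim_def EL_def
  using etaL_valid residue_idem_eq by (intro restrict_ext) blast

text \<open>The data chosen for the larger weight are also valid for the smaller one, and both
  polynomials represent the same residue idempotent there.\<close>

lemma EL_coherent:
  assumes "i \<in> res_seqs e n"
  shows "coherent (\<lambda>\<Lambda>. Px (EL \<Lambda> i))"
  unfolding coherent_def
proof (intro ballI impI)
  fix \<Lambda> \<Lambda>' :: "int multiset" assume "\<Lambda> \<subseteq># \<Lambda>'"
  obtain B N B' N' where v: "valid \<Lambda> B N (etaL \<Lambda>)" and v': "valid \<Lambda>' B' N' (etaL \<Lambda>')"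
    using etaL_valid by metis
  have "kp \<Lambda> (Px (EL \<Lambda>' i)) = kp \<Lambda> (Px (EL \<Lambda> i))"
    unfolding EL_def residue_idem_eq[OF v assms, symmetric]
    by (rule residue_idem_eq[OF valid_mono[OF \<open>\<Lambda> \<subseteq># \<Lambda>'\<close> v'] assms, symmetric])
  then show "ccong \<Lambda> (Px (EL \<Lambda>' i)) (Px (EL \<Lambda> i))" by (simp add: kp_eq_iff)
qed

lemma hat_at_lim:
  "p \<in> words_in (hecke_gens st n) \<Longrightarrow> i \<in> res_seqs e n \<Longrightarrow>
    hat_at e st n p i = lim (\<lambda>\<Lambda>. p * Px (EL \<Lambda> i))"
  by (simp add: hat_at_def hat_lim hat_idem_lim R_mult)

lemma I_beta_res_seqs: "i \<in> I_beta e n \<beta> \<Longrightarrow> i \<in> res_seqs e n"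
  by (simp add: I_beta_def)

lemma val_neq:
  assumes "i \<in> res_seqs e n" "r \<in> {1..n}" "s \<in> {1..n}" "i r \<noteq> i s"
  shows "val (i r) \<noteq> val (i s)"
proof -
  have "i r \<in> residues_mod e" "i s \<in> residues_mod e"
    using assms unfolding res_seqs_def by (meson PiE_mem)+
  then show ?thesis using val_inj assms(4) by blast
qed

definition invL :: "(nat \<Rightarrow> int) \<Rightarrow> nat \<Rightarrow> nat \<Rightarrow> int multiset \<Rightarrow> 'k mpol" where
  "invL i r s \<Lambda> = (SOME g. g \<in> polys n \<and> Iz \<Lambda> ((pvar r - pvar s) * g * EL \<Lambda> i - EL \<Lambda> i))"

context
  fixes i r s
  assumes i: "i \<in> res_seqs e n" and r: "r \<in> {1..n}" and s: "s \<in> {1..n}" and ne: "i r \<noteq> i s"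
begin

lemma invL_polys [simp]: "invL i r s \<Lambda> \<in> polys n"
  and invL: "Iz \<Lambda> ((pvar r - pvar s) * invL i r s \<Lambda> * EL \<Lambda> i - EL \<Lambda> i)"
  unfolding invL_def using someI_ex[OF EL_invert[OF r s val_neq[OF i r s ne]]] by blast+

lemma invL_coherent: "coherent (\<lambda>\<Lambda>. Px (invL i r s \<Lambda> * EL \<Lambda> i))"
  unfolding coherent_def
proof (intro ballI impI)
  fix \<Lambda> \<Lambda>' assume L: "\<Lambda> \<in> Pplus e" "\<Lambda>' \<in> Pplus e" "\<Lambda> \<subseteq># \<Lambda>'"
  define z g g' e1 e' where "z = (pvar r - pvar s :: 'k mpol)" and "g = invL i r s \<Lambda>" and "g' = invL i r s \<Lambda>'"
    and "e1 = EL \<Lambda> i" and "e' = EL \<Lambda>' i"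
  have 1: "Iz \<Lambda> (z * g * e1 - e1)" using invL by (simp add: z_def g_def e1_def)
  have 2: "Iz \<Lambda> (z * g' * e' - e')" using Iz_mono[OF L(3) invL] by (simp add: z_def g'_def e'_def)
  have 3: "Iz \<Lambda> (e' - e1)"
    using EL_coherent[OF i] L unfolding coherent_def Iz_diff_iff e'_def e1_def by blast
  have 4: "Iz \<Lambda> (e1 * e1 - e1)" unfolding e1_def by (rule EL_idem[OF i])
  \<comment> \<open>Uniqueness of inverses, g' = g' z g = g, carried out with approximate
    idempotents: every summand on the right has a factor from 1 to 4, which lies in the
    kernel.\<close>
  have "g' * e' - g * e1 = g' * (e' - e1) - g' * (e1 * e1 - e1)
      - g' * e1 * (z * g * e1 - e1) + g * e1 * (z * g' * e' - e') - g * e1 * z * g' * (e' - e1)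
      + g * e1 * (e' - e1) + g * (e1 * e1 - e1)"
    by (simp add: algebra_simps)
  moreover have "Iz \<Lambda> \<dots>"
    by (intro Iz_add Iz_diff Iz_mult2 1 2 3 4)
  ultimately have "Iz \<Lambda> (g' * e' - g * e1)" by simp
  then show "ccong \<Lambda> (Px (invL i r s \<Lambda>' * EL \<Lambda>' i)) (Px (invL i r s \<Lambda> * EL \<Lambda> i))"
    by (simp add: Iz_diff_iff g_def g'_def e1_def e'_def)
qed

lemma corner_inverse_lim:
  "corner_inverse R (hat_idem e st n i) (hat_at e st n (X\<^sub>g r - X\<^sub>g s) i)
    = lim (\<lambda>\<Lambda>. Px (invL i r s \<Lambda> * EL \<Lambda> i))"
proof -
  define u a y where "u = hat_idem e st n i" and "a = hat_at e st n (X\<^sub>g r - X\<^sub>g s) i"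
    and "y = lim (\<lambda>\<Lambda>. Px (invL i r s \<Lambda> * EL \<Lambda> i))"
  have words: "X\<^sub>g r - X\<^sub>g s \<in> words_in (hecke_gens st n)" using r s by (intro words_in_diff) simp_all
  have a: "a = lim (\<lambda>\<Lambda>. Px ((pvar r - pvar s) * EL \<Lambda> i))"
    unfolding a_def hat_at_lim[OF words i] lim_eq_iff
    using r s congr_hrels_crels[OF congr_sym[OF Px_mult[of "pvar r - pvar s"]]] by (simp add: Px_diff)
  have u: "u = lim (\<lambda>\<Lambda>. Px (EL \<Lambda> i))" unfolding u_def by (rule hat_idem_lim[OF i])
  have mult: "lim (\<lambda>\<Lambda>. Px (A \<Lambda>)) \<otimes>\<^bsub>R\<^esub> lim (\<lambda>\<Lambda>. Px (B \<Lambda>)) = lim (\<lambda>\<Lambda>. Px (A \<Lambda> * B \<Lambda>))" for A B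
    unfolding R_mult lim_eq_iff by (auto intro: congr_hrels_crels[OF congr_sym[OF Px_mult]])
  have eqI: "lim (\<lambda>\<Lambda>. Px (A \<Lambda>)) = lim (\<lambda>\<Lambda>. Px (B \<Lambda>))" if "\<And>\<Lambda>. Iz \<Lambda> (A \<Lambda> - B \<Lambda>)" for A B
    using that unfolding lim_eq_iff Iz_diff_iff by blast
  have uR: "u \<in> carrier R" unfolding u carrier_R using EL_coherent[OF i] by blast
  have aR: "a \<in> carrier R"
    unfolding carrier_R a_def hat_at_lim[OF words i]
    using coherent_intros(3)[OF coherent_intros(1) EL_coherent[OF i]] by blast
  have yR: "y \<in> carrier R" unfolding y_def carrier_R using invL_coherent by blast
  have ee: "Iz \<Lambda> (EL \<Lambda> i * EL \<Lambda> i - EL \<Lambda> i)" for \<Lambda> by (rule EL_idem[OF i])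
  have uu: "u \<otimes>\<^bsub>R\<^esub> u = u" unfolding u mult by (rule eqI[OF ee])
  have yu: "y \<otimes>\<^bsub>R\<^esub> u = y" unfolding u y_def mult
  proof (rule eqI)
    fix \<Lambda>
    have "invL i r s \<Lambda> * EL \<Lambda> i * EL \<Lambda> i - invL i r s \<Lambda> * EL \<Lambda> i = invL i r s \<Lambda> * (EL \<Lambda> i * EL \<Lambda> i - EL \<Lambda> i)"
      by (simp add: algebra_simps)
    then show "Iz \<Lambda> (invL i r s \<Lambda> * EL \<Lambda> i * EL \<Lambda> i - invL i r s \<Lambda> * EL \<Lambda> i)"
      using Iz_mult2[OF ee] by simp
  qed
  have comm: "lim (\<lambda>\<Lambda>. Px (A \<Lambda>)) \<otimes>\<^bsub>R\<^esub> lim (\<lambda>\<Lambda>. Px (B \<Lambda>)) = lim (\<lambda>\<Lambda>. Px (B \<Lambda>)) \<otimes>\<^bsub>R\<^esub> lim (\<lambda>\<Lambda>. Px (A \<Lambda>))" for A B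
    unfolding mult by (simp add: mult.commute)
  have uy: "u \<otimes>\<^bsub>R\<^esub> y = y" using yu comm unfolding u y_def by simp
  have ya: "y \<otimes>\<^bsub>R\<^esub> a = u" unfolding u y_def a mult
  proof (rule eqI)
    fix \<Lambda>
    let ?E = "EL \<Lambda> i" and ?g = "invL i r s \<Lambda>" and ?z = "pvar r - pvar s :: 'k mpol"
    have eq: "?g * ?E * (?z * ?E) - ?E = ?z * ?g * (?E * ?E - ?E) + (?z * ?g * ?E - ?E)"
      by (simp add: algebra_simps)
    show "Iz \<Lambda> (?g * ?E * (?z * ?E) - ?E)"
      unfolding eq by (rule Iz_add[OF Iz_mult2[OF ee] invL])
  qed
  have ay: "a \<otimes>\<^bsub>R\<^esub> y = u" using ya comm unfolding y_def a by simp
  have "(THE y. y \<in> {u \<otimes>\<^bsub>R\<^esub> z \<otimes>\<^bsub>R\<^esub> u | z. z \<in> carrier R} \<and> a \<otimes>\<^bsub>R\<^esub> y = u \<and> y \<otimes>\<^bsub>R\<^esub> a = u) = y"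
  proof (rule the_equality)
    have "y = u \<otimes>\<^bsub>R\<^esub> y \<otimes>\<^bsub>R\<^esub> u" by (simp add: uy yu)
    then show "y \<in> {u \<otimes>\<^bsub>R\<^esub> z \<otimes>\<^bsub>R\<^esub> u | z. z \<in> carrier R} \<and> a \<otimes>\<^bsub>R\<^esub> y = u \<and> y \<otimes>\<^bsub>R\<^esub> a = u"
      using yR ay ya by blast
    fix y'
    assume y': "y' \<in> {u \<otimes>\<^bsub>R\<^esub> z \<otimes>\<^bsub>R\<^esub> u | z. z \<in> carrier R} \<and> a \<otimes>\<^bsub>R\<^esub> y' = u \<and> y' \<otimes>\<^bsub>R\<^esub> a = u"
    then obtain z where z: "z \<in> carrier R" "y' = u \<otimes>\<^bsub>R\<^esub> z \<otimes>\<^bsub>R\<^esub> u" by blast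
    have y'R: "y' \<in> carrier R" unfolding z(2) using z(1) uR by simp
    \<comment> \<open>Uniqueness in the corner: y' = u y' = (y a) y' = y (a y') = y u = y.\<close>
    have "y' = u \<otimes>\<^bsub>R\<^esub> y'"
      unfolding z(2) using z(1) uR uu by (metis R.m_assoc R.m_closed)
    also have "\<dots> = y \<otimes>\<^bsub>R\<^esub> (a \<otimes>\<^bsub>R\<^esub> y')"
      unfolding ya[symmetric] using yR aR y'R by (simp add: R.m_assoc)
    also have "\<dots> = y" using y' yu by simp
    finally show "y' = y" .
  qed
  then show ?thesis by (simp add: corner_inverse_def u_def a_def y_def)
qed

end

end

section \<open>Local rings at the points of the spectrum\<close>

text \<open>Substituting \<open>t\<^sub>k \<mapsto> c\<^sub>k + t\<^sub>k Z\<close> turns the order of vanishing at \<open>c\<close> into divisibility by powers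
  of \<open>Z\<close>.\<close>

definition expand :: "(nat \<Rightarrow> 'k) \<Rightarrow> 'k::field mpol \<Rightarrow> 'k mpol poly" where
  "expand c = mp_eval (\<lambda>a. [:cst a:]) (\<lambda>k. [:cst (c k), pvar k:])"

text \<open>The value at \<open>c\<close>, as a constant polynomial.\<close>

definition ev :: "(nat \<Rightarrow> 'k) \<Rightarrow> 'k::field mpol \<Rightarrow> 'k mpol" where
  "ev c p = poly (expand c p) 0"

lemma comm_ring_hom_const: "comm_ring_hom (\<lambda>a. [:cst a:] :: 'k::field mpol poly)"
  by standard (simp_all add: cst_add cst_mult one_pCons)

lemma comm_ring_hom_expand: "comm_ring_hom (expand c)"
  unfolding expand_def by (rule comm_ring_hom_mp_eval[OF comm_ring_hom_const])

lemma expand_simps [simp]: "expand c (cst a) = [:cst a:]" "expand c (pvar k) = [:cst (c k), pvar k:]"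
  by (simp_all add: expand_def mp_eval_cst[OF comm_ring_hom_const] mp_eval_pvar[OF comm_ring_hom_const])

lemma comm_ring_hom_poly_eval: "comm_ring_hom (\<lambda>p. poly p x)"
  by standard simp_all

lemma comm_ring_hom_ev: "comm_ring_hom (ev c)"
  unfolding ev_def[abs_def]
  by (rule comm_ring_hom_comp[of "\<lambda>p. poly p 0", OF comm_ring_hom_poly_eval comm_ring_hom_expand])

lemma ev_simps [simp]: "ev c (cst a) = cst a" "ev c (pvar k) = cst (c k)"
  by (simp_all add: ev_def)

lemma ev_perm_poly:
  assumes "bij w"
  shows "ev c (perm_poly w p) = ev (c \<circ> w) p"
proof (rule comm_ring_hom_mpol_eqI[where f = "\<lambda>p. ev c (perm_poly w p)"])
  show "comm_ring_hom (\<lambda>p. ev c (perm_poly w p))"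
    by (rule comm_ring_hom_comp[of "ev c", OF comm_ring_hom_ev comm_ring_hom_perm_poly[OF assms]])
  show "comm_ring_hom (ev (c \<circ> w))" by (rule comm_ring_hom_ev)
qed (simp_all add: assms perm_poly_pvar)

text \<open>Putting Z = 1 gives the translate p(c + t), and substituting t_k - c_k for t_k undoes
  the translation.\<close>

lemma expand_eq_0D:
  assumes "expand c p = 0"
  shows "p = 0"
proof -
  let ?bk = "mp_eval cst (\<lambda>k. pvar k - cst (c k)) :: 'a mpol \<Rightarrow> 'a mpol"
  have hb: "comm_ring_hom ?bk" by (rule comm_ring_hom_mp_eval[OF comm_ring_hom_cst])
  interpret bk: comm_ring_hom ?bk by (rule hb)
  have h1: "comm_ring_hom (\<lambda>p. poly (expand c p) 1)"
    by (rule comm_ring_hom_comp[of "\<lambda>p. poly p 1", OF comm_ring_hom_poly_eval comm_ring_hom_expand])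
  have "?bk (poly (expand c p) 1) = p"
  proof (rule comm_ring_hom_mpol_eqI[where f = "\<lambda>p. ?bk (poly (expand c p) 1)" and g = "\<lambda>p. p"])
    show "comm_ring_hom (\<lambda>p. ?bk (poly (expand c p) 1))"
      by (rule comm_ring_hom_comp[of ?bk, OF hb h1])
    show "comm_ring_hom (\<lambda>p :: 'a mpol. p)" by standard auto
    show "?bk (poly (expand c (cst a)) 1) = cst a" for a
      by (simp add: mp_eval_cst[OF comm_ring_hom_cst])
    show "?bk (poly (expand c (pvar k)) 1) = pvar k" for k
      by (simp add: bk.hom_add mp_eval_cst[OF comm_ring_hom_cst] mp_eval_pvar[OF comm_ring_hom_cst])
  qed
  then show ?thesis using assms by simp
qed

text \<open>Fractions regular at \<open>c\<close> and vanishing there to order at least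
  \<open>N\<close>; \<open>N = 0\<close> is the local ring at \<open>c\<close> inside the rational
  functions.\<close>

definition loc :: "(nat \<Rightarrow> 'k) \<Rightarrow> nat \<Rightarrow> 'k::field ratfun set" where
  "loc c N = {emb p / emb d | p d. ev c d \<noteq> 0 \<and> [:0, 1:] ^ N dvd expand c p}"

context
  fixes c :: "nat \<Rightarrow> 'k::field"
begin

interpretation x: comm_ring_hom "expand c" by (rule comm_ring_hom_expand)
interpretation ev: comm_ring_hom "ev c" by (rule comm_ring_hom_ev)

lemma locI: "ev c d \<noteq> 0 \<Longrightarrow> [:0, 1:] ^ N dvd expand c p \<Longrightarrow> emb p / emb d \<in> loc c N"
  unfolding loc_def by blast

lemma ev_nonzero: "ev c d \<noteq> 0 \<Longrightarrow> d \<noteq> 0"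
  by auto

lemma loc_0 [simp]: "0 \<in> loc c N"
  using locI[of 1 N 0] by simp

lemma loc_add:
  assumes "f \<in> loc c N" "g \<in> loc c N"
  shows "f + g \<in> loc c N"
proof -
  obtain p d p' d' where f: "f = emb p / emb d" "ev c d \<noteq> 0" "[:0, 1:] ^ N dvd expand c p"
    and g: "g = emb p' / emb d'" "ev c d' \<noteq> 0" "[:0, 1:] ^ N dvd expand c p'"
    using assms unfolding loc_def by blast
  have "f + g = emb (p * d' + p' * d) / emb (d * d')"
    using ev_nonzero[OF f(2)] ev_nonzero[OF g(2)]
    by (simp add: f g emb.hom_add emb.hom_mult field_simps)
  moreover have "[:0, 1:] ^ N dvd expand c (p * d' + p' * d)"
    unfolding x.hom_add x.hom_mult by (intro dvd_add dvd_mult2 f g)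
  ultimately show ?thesis
    using locI[of "d * d'" N] f(2) g(2) by (simp add: ev.hom_mult)
qed

lemma loc_mult:
  assumes "f \<in> loc c N" "g \<in> loc c M"
  shows "f * g \<in> loc c (N + M)"
proof -
  obtain p d p' d' where f: "f = emb p / emb d" "ev c d \<noteq> 0" "[:0, 1:] ^ N dvd expand c p"
    and g: "g = emb p' / emb d'" "ev c d' \<noteq> 0" "[:0, 1:] ^ M dvd expand c p'"
    using assms unfolding loc_def by blast
  have "f * g = emb (p * p') / emb (d * d')" by (simp add: f g emb.hom_mult)
  moreover have "[:0, 1:] ^ (N + M) dvd expand c (p * p')"
    unfolding x.hom_mult power_add by (intro mult_dvd_mono f g)
  ultimately show ?thesis
    using locI[of "d * d'" "N + M"] f(2) g(2) by (simp add: ev.hom_mult)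
qed

lemma loc_mult0: "f \<in> loc c 0 \<Longrightarrow> g \<in> loc c N \<Longrightarrow> f * g \<in> loc c N"
  using loc_mult[of f 0 g N] by simp

lemma loc_emb [simp]: "emb p \<in> loc c 0"
  using locI[of 1 0 p] by simp

lemma loc_inverse_emb: "ev c d \<noteq> 0 \<Longrightarrow> inverse (emb d) \<in> loc c 0"
  using locI[of d 0 1] by (simp add: divide_inverse)

lemma loc_emb_vanish:
  assumes "ev c p = 0"
  shows "emb p \<in> loc c 1"
proof -
  have "[:0, 1:] dvd expand c p"
    using assms poly_eq_0_iff_dvd[of "expand c p" 0] by (simp add: ev_def)
  then show ?thesis using locI[of 1 1 p] by simp
qed

lemma loc_minus: "f \<in> loc c N \<Longrightarrow> - f \<in> loc c N"
  using loc_mult0[of "emb (- 1)" f N] by (simp add: emb.hom_uminus del: loc_emb)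
    (metis emb.hom_one emb.hom_uminus loc_emb)

text \<open>The numerator of a nonzero fraction has a finite order in Z, order is additive over a
  domain, and admissible denominators have order 0. This bounds \<open>N\<close>.\<close>

lemma loc_Inter:
  assumes "\<And>N. f \<in> loc c N"
  shows "f = 0"
proof (rule ccontr)
  assume nz: "f \<noteq> 0"
  obtain p d where d: "d \<noteq> 0" and f: "f = emb p / emb d" by (rule ratfun_cases)
  have "p \<noteq> 0" using nz f by auto
  then have pz: "expand c p \<noteq> 0" using expand_eq_0D by blast
  define N where "N = Suc (order 0 (expand c p))"
  obtain p' d' where f': "f = emb p' / emb d'" "ev c d' \<noteq> 0" "[:0, 1:] ^ N dvd expand c p'"
    using assms[of N] unfolding loc_def by blast
  have "d' \<noteq> 0" using f'(2) ev_nonzero by blast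
  then have "emb (p * d') = emb (p' * d)"
    using f f'(1) d by (simp add: emb.hom_mult field_simps)
  then have eq: "expand c p * expand c d' = expand c p' * expand c d"
    by (simp add: x.hom_mult[symmetric])
  have nzd: "expand c d' \<noteq> 0" using \<open>d' \<noteq> 0\<close> expand_eq_0D by blast
  have "[:- 0, 1:] ^ N dvd expand c p * expand c d'" unfolding eq using f'(3) by simp
  then have "N \<le> order 0 (expand c p * expand c d')"
    using order_divides[of 0 N "expand c p * expand c d'"] pz nzd by simp
  also have "\<dots> = order 0 (expand c p)"
    using pz nzd f'(2) by (simp add: order_mult order_0I ev_def)
  finally show False by (simp add: N_def)
qed

end

lemma loc_perm:
  assumes w: "bij w" and "f \<in> loc (c \<circ> w) 0"
  shows "perm_rat w f \<in> loc c 0"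
proof -
  obtain p d where f: "f = emb p / emb d" "ev (c \<circ> w) d \<noteq> 0"
    using assms unfolding loc_def by blast
  have "d \<noteq> 0" using f(2) ev_nonzero by blast
  then have "perm_rat w f = emb (perm_poly w p) / emb (perm_poly w d)"
    unfolding f(1) by (rule perm_rat_emb_divide[OF w])
  moreover have "ev c (perm_poly w d) \<noteq> 0" using f(2) by (simp add: ev_perm_poly[OF w])
  ultimately show ?thesis using locI[of c "perm_poly w d" 0] by simp
qed

lemma diff_dvd_sp: "pvar (Suc r) - pvar r dvd p - perm_poly (simple_refl r) (p :: 'k::field mpol)"
proof -
  interpret s: comm_ring_hom "perm_poly (simple_refl r) :: 'k mpol \<Rightarrow> _"
    by (rule comm_ring_hom_perm_poly) simp
  show ?thesis
  proof (induction p rule: mpol_induct)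
    case (var k)
    consider "k = r" | "k = Suc r" | "k \<noteq> r" "k \<noteq> Suc r" by blast
    then show ?case
    proof cases
      case 1
      then show ?thesis by (simp add: perm_poly_pvar) (metis dvd_minus_iff dvd_refl minus_diff_eq)
    qed (simp_all add: perm_poly_pvar)
  next
    case (add p p')
    have eq: "p + p' - perm_poly (simple_refl r) (p + p')
        = (p - perm_poly (simple_refl r) p) + (p' - perm_poly (simple_refl r) p')"
      by (simp add: s.hom_add)
    show ?case unfolding eq by (rule dvd_add[OF add])
  next
    case (mult p p')
    have eq: "p * p' - perm_poly (simple_refl r) (p * p')
        = (p - perm_poly (simple_refl r) p) * p' + perm_poly (simple_refl r) p * (p' - perm_poly (simple_refl r) p')"
      by (simp add: s.hom_mult algebra_simps)
    show ?case unfolding eq by (intro dvd_add dvd_mult dvd_mult2 mult)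
  qed simp
qed

text \<open>The pole is removable. Over the denominator d s_r(d), nonzero at \<open>c\<close>
  because s_r fixes \<open>c\<close>, the numerator has the form P - s_r(P) and is divisible by
  t_(r+1) - t_r.\<close>

lemma loc_divided_difference:
  assumes c: "c \<circ> simple_refl r = c" and "f \<in> loc c 0"
  shows "(f - sr r f) / (tvar (Suc r) - tvar r) \<in> loc c 0"
proof -
  interpret s: comm_ring_hom "perm_poly (simple_refl r) :: 'a mpol \<Rightarrow> _"
    by (rule comm_ring_hom_perm_poly) simp
  interpret ev: comm_ring_hom "ev c" by (rule comm_ring_hom_ev)
  let ?s = "perm_poly (simple_refl r) :: 'a mpol \<Rightarrow> 'a mpol"
  obtain p d where f: "f = emb p / emb d" "ev c d \<noteq> 0" using assms unfolding loc_def by blast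
  have d: "d \<noteq> 0" using f(2) ev_nonzero by blast
  have sd: "ev c (?s d) \<noteq> 0" using f(2) by (simp add: ev_perm_poly c)
  have sd0: "?s d \<noteq> 0" using sd ev_nonzero by blast
  have "emb (?s (?s p)) = emb p" for p
    by (simp add: perm_rat_emb[OF bij_simple_refl, symmetric] del: emb_eq_iff)
  then have ss: "?s (?s p) = p" for p by simp
  obtain D where D: "p * ?s d - ?s (p * ?s d) = (pvar (Suc r) - pvar r) * D"
    using diff_dvd_sp[of r "p * ?s d"] unfolding dvd_def by blast
  have "sr r f = emb (?s p) / emb (?s d)"
    unfolding f(1) by (rule perm_rat_emb_divide[OF _ d]) simp
  then have "f - sr r f = emb (p * ?s d - ?s (p * ?s d)) / emb (d * ?s d)"
    using d sd0 by (simp add: f(1) s.hom_mult ss emb.hom_mult emb.hom_minus field_simps)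
  also have "\<dots> = (tvar (Suc r) - tvar r) * (emb D / emb (d * ?s d))"
    unfolding D by (simp add: emb.hom_mult emb.hom_minus tvar_emb)
  finally have "(f - sr r f) / (tvar (Suc r) - tvar r) = emb D / emb (d * ?s d)"
    by simp
  then show ?thesis using locI[of c "d * ?s d" 0 D] f(2) sd by (simp add: ev.hom_mult)
qed


section \<open>The lattice of local sections\<close>

lemma fun_sum_apply: "sum f A x = (\<Sum>a\<in>A. f a x)"
  by (induction A rule: infinite_finite_induct) simp_all

locale hecke_block = hecke e n st for e n and st :: "'k::field setting" +
  fixes \<beta> :: "int multiset"
  assumes \<beta>: "\<beta> \<in> Qplus e n"
begin

abbreviation "Ib \<equiv> I_beta e n \<beta>"

lemma finite_Ib: "finite Ib"
proof (rule finite_subset)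
  show "Ib \<subseteq> {1..n} \<rightarrow>\<^sub>E set_mset \<beta>"
  proof
    fix i assume i: "i \<in> Ib"
    then have "i \<in> extensional {1..n}" "image_mset i (mset_set {1..n}) = \<beta>"
      by (auto simp: I_beta_def res_seqs_def PiE_iff)
    moreover have "set_mset (image_mset i (mset_set {1..n})) = i ` {1..n}" by simp
    ultimately have "i ` {1..n} = set_mset \<beta>" by simp
    then show "i \<in> {1..n} \<rightarrow>\<^sub>E set_mset \<beta>"
      using \<open>i \<in> extensional {1..n}\<close> by (auto simp: PiE_iff)
  qed
qed (auto intro: finite_PiE)

lemma Ib_refl:
  assumes r: "r \<in> {1..<n}" and i: "i \<in> Ib"
  shows "i \<circ> simple_refl r \<in> Ib"
proof -
  note p = simple_refl_permutes[OF r]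
  have "i \<circ> simple_refl r \<in> res_seqs e n"
    using i permutes_in_image[OF p] permutes_not_in[OF p]
    by (auto simp: I_beta_def res_seqs_def PiE_iff extensional_def)
  moreover have "image_mset (simple_refl r) (mset_set {1..n}) = mset_set {1..n}"
    using image_mset_mset_set[OF permutes_inj_on[OF p], of "{1..n}"] permutes_image[OF p] by simp
  then have "image_mset (i \<circ> simple_refl r) (mset_set {1..n}) = image_mset i (mset_set {1..n})"
    by (metis multiset.map_comp)
  ultimately show ?thesis using i by (simp add: I_beta_def)
qed

lemma Ib_refl_iff: "r \<in> {1..<n} \<Longrightarrow> i \<circ> simple_refl r \<in> Ib \<longleftrightarrow> i \<in> Ib"
  using Ib_refl[of r i] Ib_refl[of r "i \<circ> simple_refl r"] by (auto simp: comp_assoc)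

abbreviation pt :: "(nat \<Rightarrow> int) \<Rightarrow> nat \<Rightarrow> 'k" where
  "pt j \<equiv> \<lambda>k. val (j k)"

definition Sec :: "'k pvec set" where
  "Sec = {v. (\<forall>j\<in>Ib. v j \<in> loc (pt j) 0) \<and> (\<forall>j. j \<notin> Ib \<longrightarrow> v j = 0)}"

lemma Sec_add: "u \<in> Sec \<Longrightarrow> v \<in> Sec \<Longrightarrow> u + v \<in> Sec"
  by (auto simp: Sec_def loc_add)

lemma Sec_mult: "(\<And>j. j \<in> Ib \<Longrightarrow> g j \<in> loc (pt j) 0) \<Longrightarrow> v \<in> Sec \<Longrightarrow> (\<lambda>j. g j * v j) \<in> Sec"
  by (auto simp: Sec_def loc_mult0)

lemma loc_rat_const [simp]: "rat_const a \<in> loc c 0" and loc_tvar [simp]: "tvar k \<in> loc c 0"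
  by (simp_all add: rat_const_emb tvar_emb)

lemma ev_diff_pvar: "ev (pt j) (pvar r - pvar s) = cst (val (j r) - val (j s))"
proof -
  interpret ev: comm_ring_hom "ev (pt j)" by (rule comm_ring_hom_ev)
  show ?thesis by (simp add: ev.hom_minus cst_diff)
qed

lemma loc_inverse_diff:
  assumes "j \<in> Ib" "r \<in> {1..n}" "s \<in> {1..n}" "j r \<noteq> j s"
  shows "inverse (tvar r - tvar s) \<in> loc (pt j) 0"
  using loc_inverse_emb[of "pt j" "pvar r - pvar s"] val_neq[OF I_beta_res_seqs assms(2-4)] assms(1)
  by (simp add: ev_diff_pvar emb.hom_minus tvar_emb)

text \<open>T_r v = q s_r v + b (v - s_r v). Where j_r = j_(r+1) the last term is a divided
  difference; elsewhere t_(r+1) - t_r is a unit of the local ring, so b itself is regular.\<close>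

lemma gact_Sec:
  assumes v: "v \<in> Sec"
  shows "gact st n g v \<in> Sec"
proof (cases "g \<in> hecke_gens st n")
  case False
  then show ?thesis by (auto simp: gact_def Sec_def)
next
  case g: True
  show ?thesis
  proof (cases g)
    case (gX k)
    then have "gact st n g v = (\<lambda>j. tvar k * v j)" using g by (simp add: gact_X fun_eq_iff)
    then show ?thesis using Sec_mult[OF _ v, of "\<lambda>_. tvar k"] by simp
  next
    case (gXinv k)
    then have "st \<noteq> Deg" using g by simp
    then have nz: "val a \<noteq> 0" for a using admissible by (cases st) auto
    have "inverse (tvar k) \<in> loc (pt j) 0" for j
      using loc_inverse_emb[of "pt j" "pvar k"] nz by (simp add: tvar_emb)
    moreover have "gact st n g v = (\<lambda>j. inverse (tvar k) * v j)"
      using g gXinv gact_Xinv[of k st n v] by (simp add: fun_eq_iff)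
    ultimately show ?thesis using Sec_mult[OF _ v, of "\<lambda>_. inverse (tvar k)"] by simp
  next
    case (gT r)
    then have r: "r \<in> {1..<n}" using g by simp
    have T: "gact st n g v j = rat_const q * sact r v j + bco st r * (v j - sact r v j)" for j
      using gact_T[OF r] by (simp add: gT algebra_simps)
    have out: "gact st n g v j = 0" if "j \<notin> Ib" for j
      using that v Ib_refl_iff[OF r] by (simp add: T sact_def Sec_def r)
    have "gact st n g v j \<in> loc (pt j) 0" if j: "j \<in> Ib" for j
    proof -
      have vj: "v j \<in> loc (pt j) 0" "v (j \<circ> simple_refl r) \<in> loc (pt (j \<circ> simple_refl r)) 0"
        using v j Ib_refl[OF r j] by (auto simp: Sec_def)
      have s: "sact r v j \<in> loc (pt j) 0"
        unfolding sact_def using vj(2) by (intro loc_perm) (simp_all add: comp_def)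
      have num: "rat_const (q - 1) * tvar (Suc r) + rat_const h \<in> loc (pt j) 0"
        by (intro loc_add loc_mult0[OF loc_rat_const] loc_rat_const loc_tvar)
      have bdef: "bco st r = (rat_const (q - 1) * tvar (Suc r) + rat_const h) / (tvar (Suc r) - tvar r)"
        by (simp add: bco_def bq_def rat_const_diff)
      have "bco st r * (v j - sact r v j) \<in> loc (pt j) 0"
      proof (cases "j r = j (Suc r)")
        case True
        have jj: "j \<circ> simple_refl r = j"
          using True by (auto simp: fun_eq_iff simple_refl_def transpose_def)
        have "pt j \<circ> simple_refl r = pt j" using jj by (metis comp_apply fun_eq_iff)
        from loc_divided_difference[OF this vj(1)]
        have dd: "(v j - sact r v j) / (tvar (Suc r) - tvar r) \<in> loc (pt j) 0"
          by (simp add: sact_def jj)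
        have "bco st r * (v j - sact r v j) = (rat_const (q - 1) * tvar (Suc r) + rat_const h)
            * ((v j - sact r v j) / (tvar (Suc r) - tvar r))"
          by (simp add: bdef)
        then show ?thesis using loc_mult0[OF num dd] by simp
      next
        case False
        have "inverse (tvar (Suc r) - tvar r) \<in> loc (pt j) 0"
          using False r by (intro loc_inverse_diff[OF j]) auto
        from loc_mult0[OF num this] have "bco st r \<in> loc (pt j) 0"
          by (simp add: bdef divide_inverse)
        moreover have "v j - sact r v j \<in> loc (pt j) 0"
          using loc_add[OF vj(1) loc_minus[OF s]] by simp
        ultimately show ?thesis by (rule loc_mult0)
      qed
      then show ?thesis unfolding T by (intro loc_add loc_mult0[OF loc_rat_const] s)
    qed
    then show ?thesis using out by (simp add: Sec_def)
  qed
qed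

lemma act_Sec: "v \<in> Sec \<Longrightarrow> act st n p v \<in> Sec"
proof (induction p rule: poly_mapping_additive_induct)
  case (single w c)
  have "wact st n w v \<in> Sec" by (induction w) (simp_all add: single gact_Sec)
  then show ?case unfolding act_single by (rule Sec_mult[rotated]) simp
next
  case (add p p')
  then show ?case unfolding act_plus by (intro Sec_add) auto
qed

section \<open>The filtration of local sections by powers of J\<close>

definition invariant :: "'k mpol \<Rightarrow> bool" where
  "invariant g \<longleftrightarrow> (\<forall>r\<in>{1..<n}. sp r g = g) \<and> (\<forall>j\<in>Ib. ev (pt j) g = 0)"

text \<open>The submodules \<open>J\<^sup>N Sec\<close>, \<open>J\<close> the ideal of symmetric polynomials vanishing on the orbit: symmetric
  elements commute with all operators, so these are stable.\<close>

inductive UU :: "nat \<Rightarrow> 'k pvec \<Rightarrow> bool" where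
  base: "v \<in> Sec \<Longrightarrow> UU 0 v"
| zero: "UU N 0"
| add: "UU N u \<Longrightarrow> UU N v \<Longrightarrow> UU N (u + v)"
| step: "UU N u \<Longrightarrow> invariant g \<Longrightarrow> UU (Suc N) (\<lambda>j. emb g * u j)"

lemma UU_act: "UU N u \<Longrightarrow> UU N (act st n p u)"
proof (induction rule: UU.induct)
  case (step N u g)
  have "sr r (emb g) = emb g" if "r \<in> {1..<n}" for r
    using step(2) that by (simp add: invariant_def perm_rat_emb)
  then have "act st n p (\<lambda>j. emb g * u j) = (\<lambda>j. emb g * act st n p u j)"
    by (rule act_symmetric)
  then show ?case using UU.step[OF step(3,2)] by simp
next
  case (base v)
  show ?case by (rule UU.base[OF act_Sec[OF base]])
next
  case (zero N)
  show ?case unfolding act_zero_vec by (rule UU.zero)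
next
  case (add N u v)
  show ?case unfolding act_add by (rule UU.add[OF add.IH])
qed

text \<open>The generators of J multiply all coordinates alike, whereas \<open>g\<close> may vary
  with the index. In particular it may be supported on one component, which allows division by
  functions invertible only there.\<close>

lemma UU_mult:
  assumes "UU N u" "\<And>j. j \<in> Ib \<Longrightarrow> g j \<in> loc (pt j) 0"
  shows "UU N (\<lambda>j. g j * u j)"
  using assms(1)
proof (induction rule: UU.induct)
  case (base v)
  then show ?case using Sec_mult assms(2) by (intro UU.base) blast
next
  case (zero N)
  have "(\<lambda>j. g j * (0 :: 'k pvec) j) = 0" by (simp add: fun_eq_iff)
  then show ?case using UU.zero by simp
next
  case (add N u v)
  have "(\<lambda>j. g j * (u + v) j) = (\<lambda>j. g j * u j) + (\<lambda>j. g j * v j)"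
    by (simp add: fun_eq_iff distrib_left)
  then show ?case using UU.add[OF add.IH] by simp
next
  case (step N u g')
  have "(\<lambda>j. g j * (emb g' * u j)) = (\<lambda>j. emb g' * (g j * u j))"
    by (simp add: mult.left_commute)
  then show ?case using UU.step[OF step(3,2)] by simp
qed

lemma UU_emb: "UU N u \<Longrightarrow> UU N (\<lambda>j. emb p * u j)"
  by (rule UU_mult) simp_all

lemma UU_minus:
  assumes "UU N u"
  shows "UU N (- u)"
proof -
  have "(\<lambda>j. emb (- 1) * u j) = - u" by (simp add: fun_eq_iff emb.hom_uminus)
  then show ?thesis using UU_emb[OF assms, of "- 1"] by simp
qed

lemma UU_diff: "UU N u \<Longrightarrow> UU N v \<Longrightarrow> UU N (u - v)"
  using UU.add[OF _ UU_minus, of N u v] by simp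

lemma UU_sum: "(\<And>x. x \<in> A \<Longrightarrow> UU N (f x)) \<Longrightarrow> UU N (sum f A)"
  by (induction A rule: infinite_finite_induct) (simp_all add: UU.zero UU.add)

lemma UU_loc: "UU N u \<Longrightarrow> (j \<in> Ib \<longrightarrow> u j \<in> loc (pt j) N) \<and> (j \<notin> Ib \<longrightarrow> u j = 0)"
proof (induction rule: UU.induct)
  case (step N u g)
  then show ?case
    using loc_mult[OF loc_emb_vanish, of "pt j" g "u j" N] by (auto simp: invariant_def)
qed (auto simp: Sec_def loc_add)

lemma UU_Inter:
  assumes "\<And>N. UU N u"
  shows "u = 0"
proof
  fix j show "u j = 0 j"
    using UU_loc[OF assms] loc_Inter[of "u j" "pt j"] by (cases "j \<in> Ib") auto
qed

definition chi :: "'k mpol poly" where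
  "chi = (\<Prod>b\<in>#\<beta>. [:- cst (val b), 1:])"

lemma map_poly_prod_linear:
  assumes "comm_ring_hom (f :: 'k mpol \<Rightarrow> 'k mpol)" "finite A"
  shows "map_poly f (\<Prod>r\<in>A. [:- x r, 1:]) = (\<Prod>r\<in>A. [:- f (x r), 1:])"
proof -
  interpret f: comm_ring_hom f by fact
  interpret m: map_poly_comm_ring_hom f ..
  show ?thesis by (simp add: m.hom_prod map_poly_pCons f.hom_uminus)
qed

lemma chi_prod: "j \<in> Ib \<Longrightarrow> chi = (\<Prod>r\<in>{1..n}. [:- cst (val (j r)), 1:])"
proof -
  assume "j \<in> Ib"
  then have "image_mset j (mset_set {1..n}) = \<beta>" by (simp add: I_beta_def)
  then have "chi = (\<Prod>r\<in>#mset_set {1..n}. [:- cst (val (j r)), 1:])"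
    unfolding chi_def by (auto simp: multiset.map_comp comp_def)
  then show ?thesis by (simp add: prod_unfold_prod_mset)
qed

lemma UU_chi:
  assumes n: "1 \<le> n" and u: "UU N u"
  shows "UU (Suc N) (\<lambda>j. emb (poly chi (pvar 1)) * u j)"
proof (cases "Ib = {}")
  case True
  have "u = 0" using UU_loc[OF u] True by (auto simp: fun_eq_iff)
  moreover have "(\<lambda>j :: nat \<Rightarrow> int. emb (poly chi (pvar 1)) * (0 :: 'k pvec) j) = 0" by (simp add: fun_eq_iff)
  ultimately show ?thesis using UU.zero by simp
next
  case False
  then obtain j0 where j0: "j0 \<in> Ib" by blast
  define X :: "'k mpol poly" where "X = (\<Prod>r\<in>{1..n}. [:- pvar r, 1:])"
  \<comment> \<open>The coefficients of \<open>chi\<close> are constants and those of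
    \<open>X\<close> are symmetric; evaluation at any point of the block turns \<open>X\<close> into
    \<open>chi\<close>.\<close>
  have inv: "invariant (coeff (chi - X) k)" for k
    unfolding invariant_def
  proof (intro conjI ballI)
    fix r assume r: "r \<in> {1..<n}"
    have hs: "comm_ring_hom (sp r)" by (rule comm_ring_hom_perm_poly) simp
    interpret s: comm_ring_hom "sp r" by (rule hs)
    have "map_poly (sp r) X = (\<Prod>k\<in>{1..n}. [:- pvar (simple_refl r k), 1:])"
      unfolding X_def by (subst map_poly_prod_linear[OF hs]) (simp_all add: perm_poly_pvar)
    also have "\<dots> = X"
      unfolding X_def using permutes_in_image[OF simple_refl_permutes[OF r]]
      by (intro prod.reindex_bij_witness[of _ "simple_refl r" "simple_refl r"]) auto
    finally have "coeff X k = sp r (coeff X k)" by (metis coeff_map_poly s.hom_zero)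
    moreover have "map_poly (sp r) chi = chi"
      unfolding chi_prod[OF j0] by (subst map_poly_prod_linear[OF hs]) simp_all
    then have "coeff chi k = sp r (coeff chi k)" by (metis coeff_map_poly s.hom_zero)
    ultimately show "sp r (coeff (chi - X) k) = coeff (chi - X) k" by (simp add: s.hom_minus)
  next
    fix j assume j: "j \<in> Ib"
    interpret ev: comm_ring_hom "ev (pt j)" by (rule comm_ring_hom_ev)
    have "map_poly (ev (pt j)) X = chi"
      unfolding X_def chi_prod[OF j] by (subst map_poly_prod_linear[OF comm_ring_hom_ev]) simp_all
    then have "ev (pt j) (coeff X k) = coeff chi k" by (metis coeff_map_poly ev.hom_zero)
    moreover have "map_poly (ev (pt j)) chi = chi"
      unfolding chi_prod[OF j] by (subst map_poly_prod_linear[OF comm_ring_hom_ev]) simp_all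
    then have "ev (pt j) (coeff chi k) = coeff chi k" by (metis coeff_map_poly ev.hom_zero)
    ultimately show "ev (pt j) (coeff (chi - X) k) = 0" by (simp add: ev.hom_minus)
  qed
  have "poly X (pvar 1) = 0"
    unfolding X_def poly_prod using n by (intro prod_zero) (auto intro!: bexI[of _ 1])
  then have "poly chi (pvar 1) = poly (chi - X) (pvar 1)" by simp
  also have "\<dots> = (\<Sum>k\<le>degree (chi - X). coeff (chi - X) k * pvar 1 ^ k)" by (rule poly_altdef)
  finally have eq: "(\<lambda>j. emb (poly chi (pvar 1)) * u j)
      = (\<Sum>k\<le>degree (chi - X). (\<lambda>j. emb (coeff (chi - X) k) * (emb (pvar 1 ^ k) * u j)))"
    by (simp add: fun_eq_iff emb.hom_sum emb.hom_mult sum_distrib_right mult.assoc fun_sum_apply)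
  show ?thesis unfolding eq by (intro UU_sum UU.step[OF UU_emb[OF u] inv])
qed

abbreviation "Lam N \<equiv> repeat_mset N \<beta>"

lemma Lam_Pplus: "Lam N \<in> Pplus e"
proof -
  have "set_mset (Lam N) \<subseteq> set_mset \<beta>" by (induction N) auto
  then show ?thesis using \<beta> by (auto simp: Qplus_def Pplus_def)
qed

lemma two_sided_Sec:
  assumes "p \<in> two_sided (crels st n (Lam N))" "v \<in> Sec"
  shows "UU N (act st n p v)"
proof -
  have "act st n p v \<in> Collect (UU N)"
  proof (rule act_two_sided[OF assms(1), where Q = Sec])
    fix s v assume s: "s \<in> crels st n (Lam N)" and v: "v \<in> Sec"
    show "act st n s v \<in> Collect (UU N)"
    proof (cases "s \<in> hrels st n")
      case True
      then show ?thesis using act_hecke_rels[OF q_nonzero] UU.zero by simp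
    next
      case False
      then obtain ks where ks: "s = prod_list (map (\<lambda>\<kappa>. X\<^sub>g 1 - cst (val \<kappa>)) ks)"
        "mset ks = Lam N" "1 \<le> n" using s by (auto simp: cycrels_def)
      have "act st n (prod_list (map (\<lambda>\<kappa>. X\<^sub>g 1 - cst (val \<kappa>)) ks)) v
          = (\<lambda>j. emb (\<Prod>\<kappa>\<in>#mset ks. pvar 1 - cst (val \<kappa>)) * v j)" for ks
      proof (induction ks)
        case (Cons k ks)
        have "act st n (X\<^sub>g 1 - cst (val k)) u = (\<lambda>j. emb (pvar 1 - cst (val k)) * u j)" for u
          using ks(3) by (simp add: act_diff fun_eq_iff gact_X emb.hom_minus tvar_emb rat_const_emb left_diff_distrib)
        then show ?case by (simp only: list.map prod_list.Cons act_mult Cons mset.simps)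
            (simp add: emb.hom_mult mult.assoc)
      qed simp
      \<comment> \<open>All orderings of the cyclotomic product act alike, and for the weight N
        \<beta> as the N-th power of the orbit polynomial at t_1.\<close>
      then have "act st n s v = (\<lambda>j. emb (\<Prod>\<kappa>\<in>#Lam N. pvar 1 - cst (val \<kappa>)) * v j)"
        by (simp add: ks)
      also have "(\<Prod>\<kappa>\<in>#Lam N. pvar 1 - cst (val \<kappa>)) = poly chi (pvar 1) ^ N"
      proof -
        have "poly (\<Prod>b\<in>#B. [:- cst (val b), 1:]) x = (\<Prod>b\<in>#B. x - cst (val b))" for B and x :: "'k mpol"
          by (induction B) (simp_all add: algebra_simps)
        then have "poly chi (pvar 1) = (\<Prod>\<kappa>\<in>#\<beta>. pvar 1 - cst (val \<kappa>))" by (simp add: chi_def)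
        then show ?thesis by (induction N) simp_all
      qed
      finally have s': "act st n s v = (\<lambda>j. emb (poly chi (pvar 1) ^ N) * v j)" .
      have "UU N (\<lambda>j. emb (poly chi (pvar 1) ^ N) * v j)"
      proof (induction N)
        case 0
        then show ?case using UU.base[OF v] by simp
      next
        case (Suc N)
        from UU_chi[OF ks(3) this] show ?case by (simp add: emb.hom_mult mult.assoc)
      qed
      then show ?thesis by (simp add: s')
    qed
  qed (use assms(2) in \<open>auto simp: act_Sec UU_act UU.zero UU.add\<close>)
  then show ?thesis by simp
qed

lemma Iz_Sec: "Iz (Lam N) p \<Longrightarrow> p \<in> polys n \<Longrightarrow> v \<in> Sec \<Longrightarrow> UU N (\<lambda>j. emb p * v j)"
  using two_sided_Sec[of "Px p" N v] by (simp add: Iz_def congr_0_iff act_Px)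

section \<open>Residue idempotents on local sections\<close>

definition pr :: "(nat \<Rightarrow> int) \<Rightarrow> 'k pvec \<Rightarrow> 'k pvec" where
  "pr i v = (\<lambda>j. if j = i then v j else 0)"

lemma pr_Sec: "i \<in> Ib \<Longrightarrow> v \<in> Sec \<Longrightarrow> pr i v \<in> Sec"
  by (auto simp: pr_def Sec_def)

context
  fixes N B M \<eta>
  assumes v: "valid (Lam N) B M \<eta>"
begin

text \<open>The product (X_r - val (i r))^M eps lies in the kernel, and at the point of
  \<open>j\<close> the first factor is a unit, so it can be divided out on that component.\<close>

lemma eps_off_diagonal:
  assumes w: "w \<in> Sec" and j: "j \<in> Ib" and i: "i \<in> extensional {1..n}" and "i \<noteq> j"
  shows "UU N (\<lambda>l. emb (eps \<eta> i) * pr j w l)"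
proof -
  have "j \<in> extensional {1..n}" using I_beta_res_seqs[OF j] by (auto simp: res_seqs_def PiE_iff)
  then obtain r where r: "r \<in> {1..n}" "i r \<noteq> j r" using eps_extensional_neq[OF v i] assms(4) by blast
  show ?thesis
  proof (cases "i r \<in> B")
    case False
    have "(\<lambda>l. emb (eps \<eta> i) * pr j w l) = 0"
      using eps_outside[where i = i, OF v r(1) False] by (simp add: fun_eq_iff)
    then show ?thesis using UU.zero by simp
  next
    case True
    let ?X = "pvar r - cst (val (i r)) :: 'k mpol"
    have "i r \<in> residues_mod e" "j r \<in> residues_mod e"
      using True v I_beta_res_seqs[OF j] r(1) unfolding valid_def res_seqs_def by (auto dest: PiE_mem)
    then have ne: "val (j r) \<noteq> val (i r)" using val_inj r(2) by metis
    interpret ev: comm_ring_hom "ev (pt j)" by (rule comm_ring_hom_ev)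
    have "ev (pt j) (?X ^ M) = cst ((val (j r) - val (i r)) ^ M)"
      by (simp add: ev.hom_power ev.hom_minus cst_diff cst_power)
    then have nz: "ev (pt j) (?X ^ M) \<noteq> 0" using ne by simp
    then have X0: "emb (?X ^ M) \<noteq> 0" unfolding emb_eq_0_iff by (rule ev_nonzero)
    have "UU N (\<lambda>l. emb (?X ^ M * eps \<eta> i) * pr j w l)"
      using r(1) by (intro Iz_Sec eps_nilpotent[OF v] pr_Sec w j polys_mult polys_power polys_diff) auto
    then have "UU N (\<lambda>l. (if l = j then inverse (emb (?X ^ M)) else 0) * (emb (?X ^ M * eps \<eta> i) * pr j w l))"
      by (rule UU_mult) (simp add: loc_inverse_emb[OF nz])
    moreover have "(if l = j then inverse (emb (?X ^ M)) else 0) * (emb (?X ^ M * eps \<eta> i) * pr j w l)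
        = emb (eps \<eta> i) * pr j w l" for l
      using X0 by (simp add: pr_def emb.hom_mult field_simps del: emb_eq_0_iff)
    ultimately show ?thesis by simp
  qed
qed

text \<open>The eps add up to 1, and all others are negligible on this component.\<close>

lemma eps_diagonal:
  assumes w: "w \<in> Sec" and j: "j \<in> Ib"
  shows "UU N ((\<lambda>l. emb (eps \<eta> j) * pr j w l) - pr j w)"
proof -
  let ?S = "{1..n} \<rightarrow>\<^sub>E B"
  have fin: "finite ?S" using v by (intro finite_PiE) (auto simp: valid_def)
  have jx: "j \<in> res_seqs e n" "j \<in> extensional {1..n}"
    using I_beta_res_seqs[OF j] by (auto simp: res_seqs_def PiE_iff)
  have "eps \<eta> j + (\<Sum>i\<in>?S - {j}. eps \<eta> i) = 1"
  proof (cases "j \<in> ?S")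
    case True
    then show ?thesis using eps_sum[OF v] sum.remove[OF fin True, of "eps \<eta>"] by simp
  next
    case False
    then obtain r where "r \<in> {1..n}" "j r \<notin> B" using jx unfolding PiE_iff by blast
    then have "eps \<eta> j = 0" by (rule eps_outside[where i = j, OF v])
    then show ?thesis using False eps_sum[OF v] by simp
  qed
  then have "eps \<eta> j = 1 - (\<Sum>i\<in>?S - {j}. eps \<eta> i)" by (simp add: eq_diff_eq)
  then have "(\<lambda>l. emb (eps \<eta> j) * pr j w l) - pr j w = - (\<Sum>i\<in>?S - {j}. (\<lambda>l. emb (eps \<eta> i) * pr j w l))"
    by (simp add: fun_eq_iff emb.hom_minus emb.hom_sum left_diff_distrib sum_distrib_right fun_sum_apply)
  moreover have "UU N (\<Sum>i\<in>?S - {j}. (\<lambda>l. emb (eps \<eta> i) * pr j w l))"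
    by (intro UU_sum eps_off_diagonal w j) (auto simp: PiE_iff)
  ultimately show ?thesis by (simp add: UU_minus)
qed

lemma eps_projects:
  assumes w: "w \<in> Sec" and i: "i \<in> Ib"
  shows "UU N ((\<lambda>l. emb (eps \<eta> i) * w l) - pr i w)"
proof -
  have ix: "i \<in> extensional {1..n}" using I_beta_res_seqs[OF i] by (auto simp: res_seqs_def PiE_iff)
  have wsum: "w = (\<Sum>j\<in>Ib. pr j w)"
  proof
    fix l show "w l = (\<Sum>j\<in>Ib. pr j w) l"
      using w finite_Ib by (cases "l \<in> Ib") (auto simp: fun_sum_apply pr_def Sec_def)
  qed
  have eq: "(\<lambda>l. emb (eps \<eta> i) * w l) - pr i w
      = ((\<lambda>l. emb (eps \<eta> i) * pr i w l) - pr i w) + (\<Sum>j\<in>Ib - {i}. (\<lambda>l. emb (eps \<eta> i) * pr j w l))"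
  proof -
    have "(\<lambda>l. emb (eps \<eta> i) * w l) = (\<Sum>j\<in>Ib. (\<lambda>l. emb (eps \<eta> i) * pr j w l))"
      by (subst wsum) (simp add: fun_eq_iff fun_sum_apply sum_distrib_left)
    then show ?thesis by (simp add: sum.remove[OF finite_Ib i])
  qed
  show ?thesis
    unfolding eq by (intro UU.add eps_diagonal UU_sum eps_off_diagonal w i ix) auto
qed

end

end

section \<open>Faithfulness of the affine action\<close>

text \<open>Adjacent transpositions generate; a general one is reached by induction on the distance
  of its two entries.\<close>

lemma permutes_generated [consumes 1, case_names id refl]:
  assumes "w permutes {1..n}" "P id"
    and refl: "\<And>r w. r \<in> {1..<n} \<Longrightarrow> w permutes {1..n} \<Longrightarrow> P w \<Longrightarrow> P (simple_refl r \<circ> w)"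
  shows "P w"
proof -
  have perm: "transpose a b \<circ> w permutes {1..n}" if "a \<in> {1..n}" "b \<in> {1..n}" "w permutes {1..n}" for a b w
    using that by (intro permutes_compose permutes_swap_id)
  have step: "P (transpose a (Suc (a + d)) \<circ> w)"
    if "1 \<le> a" "Suc (a + d) \<le> n" "w permutes {1..n}" "P w" for a d w
    using that
  proof (induction d arbitrary: w)
    case 0
    have "simple_refl a \<circ> w = transpose a (Suc (a + 0)) \<circ> w" by (simp add: simple_refl_def)
    moreover have "P (simple_refl a \<circ> w)" using refl[of a w] 0 by simp
    ultimately show ?case by (simp only:)
  next
    case (Suc d)
    let ?b = "Suc (a + d)"
    have b: "?b \<in> {1..<n}" using Suc.prems by simp
    have eq: "simple_refl ?b = transpose ?b (Suc ?b)" by (simp add: simple_refl_def)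
    have 1: "simple_refl ?b \<circ> w permutes {1..n}"
      unfolding eq by (rule perm[OF _ _ Suc.prems(3)]) (use b in auto)
    have Pw: "P (simple_refl ?b \<circ> w)" by (rule refl[OF b Suc.prems(3,4)])
    have 2: "P (transpose a ?b \<circ> (simple_refl ?b \<circ> w))"
      using Suc.prems(2) by (intro Suc.IH[OF Suc.prems(1) _ 1 Pw]) simp
    have "transpose a ?b \<circ> (simple_refl ?b \<circ> w) permutes {1..n}"
      using Suc.prems by (intro perm[OF _ _ 1]) auto
    from refl[OF b this 2] have "P (simple_refl ?b \<circ> (transpose a ?b \<circ> (simple_refl ?b \<circ> w)))" .
    \<comment> \<open>Conjugation by the adjacent transposition of b and b + 1 turns the exchange of
      a and b into that of a and b + 1.\<close>
    moreover have "simple_refl ?b \<circ> (transpose a ?b \<circ> (simple_refl ?b \<circ> w)) = transpose a (Suc ?b) \<circ> w"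
      by (auto simp: fun_eq_iff simple_refl_def transpose_def)
    ultimately show ?case by (simp only: add_Suc_right)
  qed
  have "P w \<and> w permutes {1..n}"
    using assms(1) finite_atLeastAtMost
  proof (induction rule: permutes_induct)
    case (swap a b w)
    have "P (transpose a b \<circ> w)"
    proof (cases "a < b")
      case True
      then show ?thesis using step[of a "b - Suc a" w] swap by simp
    next
      case False
      then show ?thesis using step[of b "a - Suc b" w] swap by (simp add: transpose_commute)
    qed
    then show ?case using swap perm by blast
  qed (use assms(2) permutes_id in blast)
  then show ?thesis ..
qed

text \<open>Dedekind's lemma for the distinct characters \<open>p \<mapsto> w(p)\<close>.\<close>

lemma perm_poly_independent:
  fixes c :: "(nat \<Rightarrow> nat) \<Rightarrow> 'k::field ratfun"
  assumes "finite A" "\<And>w. w \<in> A \<Longrightarrow> w permutes {1..n}"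
    and "\<And>p. p \<in> polys n \<Longrightarrow> (\<Sum>w\<in>A. c w * emb (perm_poly w p)) = 0" and "w \<in> A"
  shows "c w = 0"
  using assms
proof (induction A arbitrary: c w rule: finite_induct)
  case (insert w0 A)
  have bij: "bij w" if "w \<in> insert w0 A" for w using insert.prems(1)[OF that] permutes_bij by blast
  have cA: "c w = 0" if w: "w \<in> A" for w
  proof -
    have "w \<noteq> w0" using w insert.hyps by blast
    then obtain k where k: "w k \<noteq> w0 k" by (auto simp: fun_eq_iff)
    then have kn: "k \<in> {1..n}"
      using insert.prems(1)[of w] insert.prems(1)[of w0] w permutes_not_in by (metis insertCI)
    \<comment> \<open>The relation at t_k p minus t_(w0 k) times the relation at p: the term of
      \<open>w0\<close> cancels, and the coefficient of \<open>w\<close> is multiplied by a nonzero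
      factor.\<close>
    define c' where "c' v = c v * (emb (pvar (v k)) - emb (pvar (w0 k)))" for v
    have "(\<Sum>v\<in>A. c' v * emb (perm_poly v p)) = 0" if p: "p \<in> polys n" for p
    proof -
      have "perm_poly v (pvar k * p) = pvar (v k) * perm_poly v p" if "v \<in> insert w0 A" for v
        using bij[OF that] by (simp add: perm_poly_mult perm_poly_pvar)
      then have "(\<Sum>v\<in>insert w0 A. c v * emb (pvar (v k) * perm_poly v p)) = 0"
        using insert.prems(2)[OF polys_mult[OF polys_pvar[OF kn] p]]
        by (metis (mono_tags, lifting) sum.cong)
      moreover have "emb (pvar (w0 k)) * (\<Sum>v\<in>insert w0 A. c v * emb (perm_poly v p)) = 0"
        using insert.prems(2)[OF p] by simp
      ultimately have "(\<Sum>v\<in>insert w0 A. c v * emb (pvar (v k) * perm_poly v p))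
          - (\<Sum>v\<in>insert w0 A. emb (pvar (w0 k)) * (c v * emb (perm_poly v p))) = 0"
        unfolding sum_distrib_left[symmetric] by simp
      then show ?thesis
        using insert.hyps unfolding sum_subtractf[symmetric]
        by (simp add: c'_def emb.hom_mult algebra_simps)
    qed
    then have "c' w = 0" using insert.IH[of c' w] insert.prems(1) w by blast
    then show ?thesis using k by (simp add: c'_def)
  qed
  have "c w0 = 0"
    using insert.prems(2)[of 1] insert.hyps cA bij[of w0] perm_poly_cst[of w0 "1 :: 'k"] by simp
  then show ?case using cA insert.prems(3) by blast
qed simp

definition fscale :: "'k::field ratfun \<Rightarrow> ('k mpol \<Rightarrow> 'k ratfun) \<Rightarrow> 'k mpol \<Rightarrow> 'k ratfun" where
  "fscale c F = (\<lambda>p. c * F p)"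

lemma fscale_apply: "fscale c F p = c * F p"
  by (simp add: fscale_def)

interpretation fun_space: vector_space "fscale :: 'k::field ratfun \<Rightarrow> _"
  by standard (auto simp: fscale_def fun_eq_iff algebra_simps)

context hecke
begin

text \<open>No coefficient of an operator depends on the index, so constant families stay constant
  and the affine algebra acts on K(t) alone.\<close>

definition cop :: "'k free \<Rightarrow> 'k ratfun \<Rightarrow> 'k ratfun" where
  "cop p f = act st n p (\<lambda>_. f) (\<lambda>_. 0)"

lemma act_const: "act st n p (\<lambda>_. f) = (\<lambda>_. cop p f)"
proof -
  have g: "gact st n g v i = gact st n g v j" if "\<And>i j. v i = v j" for g i j and v :: "'k pvec"
  proof -
    have "v i = v j" "v (i \<circ> simple_refl r) = v (j \<circ> simple_refl r)" for r by (rule that)+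
    then show ?thesis unfolding gact_def sact_def by (simp split: gen.split)
  qed
  have w: "wact st n w v i = wact st n w v j" if "\<And>i j. v i = v j" for w i j and v :: "'k pvec"
  proof (induction w arbitrary: i j)
    case Nil
    show ?case unfolding wact_Nil by (rule that)
  next
    case (Cons a w)
    show ?case unfolding wact_Cons by (rule g[OF Cons])
  qed
  have "act st n p v i = act st n p v j" if "\<And>i j. v i = v j" for i j and v :: "'k pvec"
  proof (induction p rule: poly_mapping_additive_induct)
    case (single w c)
    show ?case unfolding act_single w[OF that, where i = i and j = j] ..
  next
    case (add p q)
    then show ?case unfolding act_plus by simp
  qed
  then show ?thesis unfolding cop_def by (intro ext) simp
qed

lemma cop_hcong: "p \<approx> p' \<Longrightarrow> cop p f = cop p' f"
  unfolding cop_def by (drule act_hcong[where v = "\<lambda>_. f"]) simp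

lemma cop_add: "cop (p + p') f = cop p f + cop p' f"
  by (simp add: cop_def act_plus)

lemma cop_sum: "cop (sum g A) f = (\<Sum>x\<in>A. cop (g x) f)"
  by (induction A rule: infinite_finite_induct) (simp_all add: cop_add, simp_all add: cop_def)

lemma cop_Px: "c \<in> polys n \<Longrightarrow> cop (Px c * p) f = emb c * cop p f"
  by (simp add: cop_def act_mult act_Px)

lemma cop_T: "r \<in> {1..<n} \<Longrightarrow> cop (T\<^sub>g r * p) f = (rat_const q - bco st r) * sr r (cop p f) + bco st r * cop p f"
  unfolding cop_def act_mult act_gen_elt
  by (subst gact_T) (simp_all add: sact_def act_const)

lemma q_bco_nonzero: "rat_const q - bco st r \<noteq> 0"
proof
  interpret ev: comm_ring_hom "ev c" for c :: "nat \<Rightarrow> 'k" by (rule comm_ring_hom_ev)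
  assume "rat_const q - bco st r = 0"
  then have "emb (pvar (Suc r) - cst q * pvar r - cst h) = 0"
    by (simp add: bco_def bq_def rat_const_diff rat_const_emb tvar_emb emb.hom_minus emb.hom_mult
        emb.hom_add divide_simps algebra_simps)
  \<comment> \<open>At t_r = 0 and t_(r+1) = h + 1 the polynomial t_(r+1) - q t_r - h takes the
    value 1.\<close>
  then have "ev (\<lambda>k. if k = r then 0 else h + 1) (pvar (Suc r) - cst q * pvar r - cst h) = 0"
    by (simp only: emb_eq_0_iff ev.hom_zero)
  then show False by (simp add: ev.hom_minus ev.hom_mult cst_add)
qed

text \<open>Cut off outside \<open>polys n\<close>, so that equality and independence of these
  functions concern arguments in \<open>polys n\<close> only; \<open>Wop\<close> is treated
  likewise.\<close>

definition Top :: "nat list \<Rightarrow> 'k mpol \<Rightarrow> 'k ratfun" where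
  "Top u = (\<lambda>p. if p \<in> polys n then cop (Tw u) (emb p) else 0)"

definition Wop :: "(nat \<Rightarrow> nat) \<Rightarrow> 'k mpol \<Rightarrow> 'k ratfun" where
  "Wop w = (\<lambda>p. if p \<in> polys n then emb (perm_poly w p) else 0)"

lemma Top_span:
  assumes "set u \<subseteq> {1..<n}"
  shows "Top u \<in> fun_space.span (Top ` NF)"
proof -
  obtain c where c: "\<And>u. c u \<in> polys n" and u: "Tw u \<approx> (\<Sum>u\<in>NF. Px (c u) * Tw u)"
    using LS_Tw[OF assms] unfolding LS_def by blast
  have "Top u = (\<Sum>u\<in>NF. fscale (emb (c u)) (Top u))"
    by (simp add: fun_eq_iff fscale_apply Top_def fun_sum_apply cop_hcong[OF u] cop_sum cop_Px[OF c])
  also have "\<dots> \<in> fun_space.span (Top ` NF)"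
    by (intro fun_space.span_sum fun_space.span_scale fun_space.span_base) blast
  finally show ?thesis .
qed

text \<open>Solving T_r = (q - b) s_r + b for s_r, which is possible as q - b is nonzero.\<close>

lemma span_refl:
  assumes r: "r \<in> {1..<n}" and "F \<in> fun_space.span (Top ` NF)"
  shows "(\<lambda>p. sr r (F p)) \<in> fun_space.span (Top ` NF)"
  using assms(2)
proof (induction rule: fun_space.span_induct_alt)
  case base
  have "(\<lambda>p :: 'k mpol. sr r ((0 :: _ \<Rightarrow> 'k ratfun) p)) = 0" by (simp add: fun_eq_iff)
  then show ?case using fun_space.span_zero by simp
next
  case (step c F G)
  then obtain u where u: "u \<in> NF" and F: "F = Top u" by blast
  let ?a = "inverse (rat_const q - bco st r)"
  have "x = inverse d * (d * x + y) + (- inverse d * y)" if "d \<noteq> 0" for d x y :: "'k ratfun"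
    using that by (simp add: field_simps)
  from this[OF q_bco_nonzero[of r]]
  have "sr r (Top u p) = ?a * Top (r # u) p + (- ?a * bco st r) * Top u p" for p
    unfolding Top_def by (simp add: cop_T[OF r] mult.assoc)
  then have eq: "(\<lambda>p. sr r ((fscale c F + G) p))
      = fscale (sr r c) (fscale ?a (Top (r # u)) + fscale (- ?a * bco st r) (Top u)) + (\<lambda>p. sr r (G p))"
    by (simp add: fun_eq_iff sr_simps fscale_apply F)
  have "set (r # u) \<subseteq> {1..<n}" "set u \<subseteq> {1..<n}" using r NF_letters[OF u] by auto
  then show ?case
    unfolding eq by (intro fun_space.span_add fun_space.span_scale step.IH Top_span)
qed

lemma Wop_span:
  assumes "w permutes {1..n}"
  shows "Wop w \<in> fun_space.span (Top ` NF)"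
  using assms
proof (induction rule: permutes_generated)
  case id
  have "Wop id = Top []"
    by (simp add: fun_eq_iff Wop_def Top_def cop_def perm_rat_emb[OF bij_id, symmetric] perm_rat_id)
  then show ?case using Top_span[of "[]"] unfolding \<open>Wop id = Top []\<close> by simp
next
  case (refl r w)
  have "bij w" using refl(2) permutes_bij by blast
  then have "Wop (simple_refl r \<circ> w) = (\<lambda>p. sr r (Wop w p))"
    by (simp add: fun_eq_iff Wop_def perm_rat_emb perm_poly_comp)
  then show ?case using span_refl[OF refl(1,3)] by (simp only:)
qed

lemma independent_Wop:
  "fun_space.independent (Wop ` {w. w permutes {1..n}})" "inj_on Wop {w. w permutes {1..n}}"
proof -
  let ?W = "{w. w permutes {1..n}}"
  have fin: "finite ?W" by (rule finite_permutations) simp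
  show inj: "inj_on Wop ?W"
  proof (rule inj_onI)
    fix w w' assume w: "w \<in> ?W" "w' \<in> ?W" and eq: "Wop w = Wop w'"
    have "bij w" "bij w'" using w permutes_bij by blast+
    show "w = w'"
    proof
      fix k show "w k = w' k"
      proof (cases "k \<in> {1..n}")
        case True
        then show ?thesis
          using fun_cong[OF eq, of "pvar k"] \<open>bij w\<close> \<open>bij w'\<close> by (simp add: Wop_def perm_poly_pvar)
      next
        case False
        then show ?thesis using w permutes_not_in by (metis mem_Collect_eq)
      qed
    qed
  qed
  show "fun_space.independent (Wop ` ?W)"
  proof
    assume "fun_space.dependent (Wop ` ?W)"
    then obtain c w where w: "w \<in> ?W" "c (Wop w) \<noteq> 0"
      and s: "(\<Sum>F\<in>Wop ` ?W. fscale (c F) F) = 0"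
      unfolding fun_space.dependent_finite[OF finite_imageI[OF fin]] by blast
    have "(\<Sum>w\<in>?W. c (Wop w) * emb (perm_poly w p)) = 0" if p: "p \<in> polys n" for p
    proof -
      have "(\<Sum>w\<in>?W. c (Wop w) * Wop w p) = 0"
        using fun_cong[OF s, of p] unfolding sum.reindex[OF inj] by (simp add: fun_sum_apply fscale_apply)
      then show ?thesis using p by (simp add: Wop_def[of _] if_distrib cong: if_cong)
    qed
    then have "c (Wop w) = 0"
      using perm_poly_independent[OF fin, of n "\<lambda>w. c (Wop w)" w] w(1) by blast
    then show False using w(2) by simp
  qed
qed

text \<open>At most n! functions span a space containing n! independent ones, so none of them
  coincide and none is redundant.\<close>

lemma independent_Top: "fun_space.independent (Top ` NF)" "inj_on Top NF"
proof -
  let ?W = "{w. w permutes {1..n}}"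
  have bound: "fact n \<le> card B"
    if "finite B" "fun_space.span (Top ` NF) \<subseteq> fun_space.span B" for B
  proof -
    have "Wop ` ?W \<subseteq> fun_space.span B" using Wop_span that(2) by blast
    from fun_space.independent_span_bound[OF that(1) independent_Wop(1) this]
    have "card (Wop ` ?W) \<le> card B" ..
    moreover have "card (Wop ` ?W) = fact n"
      using card_permutations[of "{1..n}" n] unfolding card_image[OF independent_Wop(2)] by simp
    ultimately show ?thesis by simp
  qed
  \<comment> \<open>For n = 0 the truncated index gives 1!, which equals 0!.\<close>
  have "fact (Suc (n - Suc 0)) = (fact n :: nat)" by (cases n) simp_all
  then have ub: "card NF \<le> fact n" using card_normal_words[of "n - Suc 0"] by simp
  have lb: "fact n \<le> card (Top ` NF)" by (rule bound) simp_all
  then have eq: "card (Top ` NF) = card NF"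
    using ub card_image_le[of NF Top] by simp
  then show "inj_on Top NF" by (intro eq_card_imp_inj_on) simp_all
  show "fun_space.independent (Top ` NF)"
  proof
    assume "fun_space.dependent (Top ` NF)"
    then obtain a where a: "a \<in> Top ` NF" "a \<in> fun_space.span (Top ` NF - {a})"
      unfolding fun_space.dependent_def by blast
    then have "fun_space.span (Top ` NF) = fun_space.span (Top ` NF - {a})"
      by (metis fun_space.span_redundant insert_Diff)
    then have "fact n \<le> card (Top ` NF - {a})" by (intro bound) simp_all
    also have "\<dots> < card (Top ` NF)" using a(1) by (intro psubset_card_mono) auto
    finally show False using ub eq by simp
  qed
qed

lemma X_cancel:
  assumes st: "st \<noteq> Deg" and k: "k \<in> {1..n}" and z: "X\<^sub>g k * y \<approx> 0"
  shows "y \<approx> 0"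
proof -
  obtain q' where st': "st = NonDeg q'" using st by (cases st) auto
  have "y \<approx> Xi\<^sub>g k * X\<^sub>g k * y"
    using congr_mult[OF congr_sym[OF gen_cong(7)[OF st' k]] congr_refl, of y] by simp
  also have "\<dots> \<approx> 0" using congr_mult[OF congr_refl z, of "Xi\<^sub>g k"] by (simp add: mult.assoc)
  finally show ?thesis .
qed

lemma Xall_cancel:
  assumes L: "st = Deg \<longrightarrow> L = 0" and z: "Px (Xall ^ L) * y \<approx> 0"
  shows "y \<approx> 0"
proof (cases "st = Deg")
  case True
  then show ?thesis using L z by simp
next
  case False
  have P: "y \<approx> 0" if "finite A" "A \<subseteq> {1..n}" "Px (\<Prod>k\<in>A. pvar k) * y \<approx> 0" for A y
    using that
  proof (induction A)
    case (insert k A)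
    have k: "k \<in> {1..n}" using insert by blast
    have "X\<^sub>g k * (Px (\<Prod>k\<in>A. pvar k) * y) \<approx> Px (\<Prod>k\<in>insert k A. pvar k) * y"
      using congr_sym[OF congr_mult[OF Px_mult[of "pvar k" "\<Prod>k\<in>A. pvar k"] congr_refl, of y]]
        insert.hyps k by (simp add: mult.assoc)
    then show ?case using X_cancel[OF False k] congr_trans insert by blast
  qed simp
  show ?thesis
    using z
  proof (induction L)
    case (Suc L)
    have "Px Xall * (Px (Xall ^ L) * y) \<approx> Px (Xall ^ Suc L) * y"
      using congr_sym[OF congr_mult[OF Px_mult[of Xall "Xall ^ L"] congr_refl, of y]]
      by (simp add: mult.assoc)
    then have "Px Xall * (Px (Xall ^ L) * y) \<approx> 0" using Suc.prems congr_trans by blast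
    then have "Px (Xall ^ L) * y \<approx> 0"
      using P[of "{1..n}" "Px (Xall ^ L) * y"] unfolding Xall_def[symmetric] by blast
    then show ?case by (rule Suc.IH)
  qed simp
qed

text \<open>At most \<open>n!\<close> normal words span the affine algebra over the polynomials, and their operators span
  the \<open>n!\<close> independent operators of the permutations.\<close>

lemma affine_faithful:
  assumes z: "\<And>p. p \<in> polys n \<Longrightarrow> cop y (emb p) = 0"
  shows "y \<approx> 0"
proof -
  obtain L where L: "st = Deg \<longrightarrow> L = 0" and "Px (Xall ^ L) * y \<in> LS NF" using LS_all by blast
  then obtain c where c: "\<And>u. c u \<in> polys n"
    and y: "Px (Xall ^ L) * y \<approx> (\<Sum>u\<in>NF. Px (c u) * Tw u)" unfolding LS_def by blast
  have "(\<Sum>u\<in>NF. emb (c u) * Top u p) = 0" for p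
  proof (cases "p \<in> polys n")
    case True
    have "cop (Px (Xall ^ L) * y) (emb p) = 0"
      by (simp add: cop_Px polys_power z[OF True])
    then show ?thesis
      using True by (simp add: cop_hcong[OF y] cop_sum cop_Px[OF c] Top_def)
  qed (simp add: Top_def)
  then have s: "(\<Sum>u\<in>NF. fscale (emb (c u)) (Top u)) = 0"
    by (simp add: fun_eq_iff fun_sum_apply fscale_apply)
  define d where "d F = emb (c (the_inv_into NF Top F))" for F
  have dT: "d (Top u) = emb (c u)" if "u \<in> NF" for u
    using the_inv_into_f_f[OF independent_Top(2) that] by (simp add: d_def)
  have "(\<Sum>F\<in>Top ` NF. fscale (d F) F) = (\<Sum>u\<in>NF. fscale (emb (c u)) (Top u))"
    unfolding sum.reindex[OF independent_Top(2)] by (rule sum.cong) (simp_all add: dT)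
  then have "(\<Sum>F\<in>Top ` NF. fscale (d F) F) = 0" using s by simp
  then have "d (Top u) = 0" if "u \<in> NF" for u
    using fun_space.independentD[OF independent_Top(1) _ order_refl, of d "Top u"] that by simp
  then have "c u = 0" if "u \<in> NF" for u using dT that by simp
  then have "(\<Sum>u\<in>NF. Px (c u) * Tw u) = 0" by simp
  then show ?thesis using Xall_cancel[OF L] y by simp
qed

end

section \<open>The operators of the modified algebra\<close>

lemma denoms_nonzero: "d \<in> denoms st n \<Longrightarrow> d \<noteq> (0 :: 'k::field mpol)"
  by (induction rule: denoms.induct) auto

lemma denoms_polys: "d \<in> denoms st n \<Longrightarrow> d \<in> polys n"
  by (induction rule: denoms.induct) (auto intro!: polys_mult polys_diff)

lemma denoms_mult:
  assumes "d \<in> denoms st n" "d' \<in> denoms st n"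
  shows "d * d' \<in> denoms st n"
  using assms(2)
  by (induction rule: denoms.induct)
    (simp_all add: assms(1) mult.assoc[symmetric] denoms.diff denoms.var)

lemma denoms_sp:
  assumes r: "r \<in> {1..<n}" and "d \<in> denoms st n"
  shows "perm_poly (simple_refl r) d \<in> denoms st n"
proof -
  interpret s: comm_ring_hom "perm_poly (simple_refl r) :: 'a mpol \<Rightarrow> _"
    by (rule comm_ring_hom_perm_poly) simp
  have i: "simple_refl r k \<in> {1..n} \<longleftrightarrow> k \<in> {1..n}" for k
    by (rule permutes_in_image[OF simple_refl_permutes[OF r]])
  have j: "simple_refl r a \<noteq> simple_refl r b" if "a \<noteq> b" for a b
    using that by (metis simple_refl_involutory)
  show ?thesis
    using assms(2)
  proof (induction rule: denoms.induct)
    case one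
    then show ?case by (simp add: denoms.one)
  next
    case (diff p a b)
    show ?case
      unfolding s.hom_mult s.hom_minus perm_poly_pvar[OF bij_simple_refl]
      by (rule denoms.diff[OF diff.IH]) (use diff.hyps i j in blast)+
  next
    case (var p a q)
    show ?case
      unfolding s.hom_mult perm_poly_pvar[OF bij_simple_refl]
      by (rule denoms.var[OF var.IH _ var.hyps(3)]) (use var.hyps i in blast)
  qed
qed

lemma Pn_iff: "f \<in> Pn st n \<longleftrightarrow> (\<exists>p\<in>polys n. \<exists>d\<in>denoms st n. f = emb p / emb d)"
proof -
  have "fract_of p d = emb p / emb d" if "d \<in> denoms st n" for p d
    by (rule fract_of_emb[OF denoms_nonzero[OF that]])
  then show ?thesis unfolding Pn_def by auto metis
qed

lemma Pn_emb [simp]: "p \<in> polys n \<Longrightarrow> emb p \<in> Pn st n"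
  unfolding Pn_iff by (intro bexI[of _ p] bexI[of _ 1]) (simp_all add: denoms.one)

lemma Pn_0 [simp]: "0 \<in> Pn st n"
  using Pn_emb[of 0 n st] by simp

lemma Pn_inverse: "d \<in> denoms st n \<Longrightarrow> inverse (emb d) \<in> Pn st n"
  unfolding Pn_iff by (intro bexI[of _ 1] bexI[of _ d]) (simp_all add: divide_inverse)

lemma Pn_mult:
  assumes "f \<in> Pn st n" "g \<in> Pn st n"
  shows "f * g \<in> Pn st n"
proof -
  obtain p d p' d' where "p \<in> polys n" "d \<in> denoms st n" "f = emb p / emb d"
    "p' \<in> polys n" "d' \<in> denoms st n" "g = emb p' / emb d'"
    using assms unfolding Pn_iff by blast
  then show ?thesis
    unfolding Pn_iff by (intro bexI[of _ "p * p'"] bexI[of _ "d * d'"])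
      (simp_all add: emb.hom_mult polys_mult denoms_mult)
qed

lemma Pn_add:
  assumes "f \<in> Pn st n" "g \<in> Pn st n"
  shows "f + g \<in> Pn st n"
proof -
  obtain p d p' d' where *: "p \<in> polys n" "d \<in> denoms st n" "f = emb p / emb d"
    "p' \<in> polys n" "d' \<in> denoms st n" "g = emb p' / emb d'"
    using assms unfolding Pn_iff by blast
  then have "f + g = emb (p * d' + p' * d) / emb (d * d')"
    using denoms_nonzero[OF *(2)] denoms_nonzero[OF *(5)]
    by (simp add: emb.hom_mult emb.hom_add field_simps)
  then show ?thesis
    unfolding Pn_iff using * by (intro bexI[of _ "p * d' + p' * d"] bexI[of _ "d * d'"])
      (simp_all add: polys_mult polys_add denoms_polys denoms_mult)
qed

lemma Pn_rat_const [simp]: "rat_const c \<in> Pn st n"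
  by (simp add: rat_const_emb)

lemma Pn_tvar [simp]: "k \<in> {1..n} \<Longrightarrow> tvar k \<in> Pn st n"
  by (simp add: tvar_emb)

lemma Pn_inverse_tvar: "k \<in> {1..n} \<Longrightarrow> st \<noteq> Deg \<Longrightarrow> inverse (tvar k) \<in> Pn st n"
  using Pn_inverse[OF denoms.var[OF denoms.one]] by (cases st) (auto simp: tvar_emb)

lemma Pn_inverse_diff: "r \<in> {1..n} \<Longrightarrow> s \<in> {1..n} \<Longrightarrow> r \<noteq> s \<Longrightarrow> inverse (tvar r - tvar s) \<in> Pn st n"
  using Pn_inverse[OF denoms.diff[OF denoms.one]] by (simp add: tvar_emb emb.hom_minus)

lemma Pn_sr:
  assumes r: "r \<in> {1..<n}" and "f \<in> Pn st n"
  shows "sr r f \<in> Pn st n"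
proof -
  obtain p d where *: "p \<in> polys n" "d \<in> denoms st n" "f = emb p / emb d"
    using assms(2) unfolding Pn_iff by blast
  have "sr r f = emb (perm_poly (simple_refl r) p) / emb (perm_poly (simple_refl r) d)"
    unfolding *(3) by (rule perm_rat_emb_divide[OF bij_simple_refl denoms_nonzero[OF *(2)]])
  then show ?thesis
    unfolding Pn_iff
    using polys_perm_poly[OF simple_refl_permutes[OF r] *(1)] denoms_sp[OF r *(2)] by blast
qed

lemma Pn_bco:
  assumes "r \<in> {1..<n}"
  shows "bco st r \<in> Pn st n"
proof -
  have "bco st r = (rat_const (qpar st - 1) * tvar (Suc r) + rat_const (hpar st)) * inverse (tvar (Suc r) - tvar r)"
    by (simp add: bco_def bq_def rat_const_diff divide_inverse)
  moreover have "inverse (tvar (Suc r) - tvar r) \<in> Pn st n"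
    using assms by (intro Pn_inverse_diff) auto
  moreover have "tvar (Suc r) \<in> Pn st n" using assms by (intro Pn_tvar) auto
  ultimately show ?thesis by (simp add: Pn_mult Pn_add)
qed

text \<open>The norm of d: its factors are the images of d under all permutations, the identity
  contributing d itself and s_r permuting the rest.\<close>

lemma symmetric_multiple:
  assumes "d \<noteq> (0 :: 'k::field mpol)"
  obtains D where "D \<noteq> 0" "d dvd D" "\<And>r. r \<in> {1..<n} \<Longrightarrow> perm_poly (simple_refl r) D = D"
proof -
  let ?W = "{w. w permutes {1..n}}"
  define D where "D = (\<Prod>w\<in>?W. perm_poly w d)"
  have fin: "finite ?W" by (rule finite_permutations) simp
  have bij: "bij w" if "w \<in> ?W" for w using that permutes_bij by blast
  have "D \<noteq> 0"
    unfolding D_def using fin assms perm_poly_eq_0_iff bij by (simp add: prod_zero_iff) blast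
  moreover have "perm_poly id d = d"
    using perm_rat_emb[OF bij_id, of d] by (simp add: perm_rat_id)
  then have "d dvd D"
    unfolding D_def using dvd_prodI[OF fin, of id "\<lambda>w. perm_poly w d"] permutes_id[of "{1..n}"]
    by (simp add: id_def)
  moreover have "perm_poly (simple_refl r) D = D" if r: "r \<in> {1..<n}" for r
  proof -
    interpret s: comm_ring_hom "perm_poly (simple_refl r) :: 'k mpol \<Rightarrow> _"
      by (rule comm_ring_hom_perm_poly) simp
    have "perm_poly (simple_refl r) D = (\<Prod>w\<in>?W. perm_poly (simple_refl r \<circ> w) d)"
      unfolding D_def s.hom_prod by (rule prod.cong) (simp_all add: perm_poly_comp bij)
    also have "\<dots> = D"
      unfolding D_def
    proof -
      have cl: "simple_refl r \<circ> w \<in> ?W" if "w \<in> ?W" for w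
        using that permutes_compose[OF _ simple_refl_permutes[OF r]] by blast
      show "(\<Prod>w\<in>?W. perm_poly (simple_refl r \<circ> w) d) = (\<Prod>w\<in>?W. perm_poly w d)"
        by (rule prod.reindex_bij_witness[of _ "\<lambda>w. simple_refl r \<circ> w" "\<lambda>w. simple_refl r \<circ> w"])
          (simp_all only: o_assoc simple_refl_comp id_o cl)
    qed
    finally show ?thesis .
  qed
  ultimately show thesis by (rule that)
qed

context hecke_block
begin

section \<open>Operators on vectors supported in the block\<close>

definition rest :: "'k pvec \<Rightarrow> 'k pvec" where
  "rest v = (\<lambda>j. if j \<in> Ib then v j else 0)"

definition PB :: "'k pvec set" where
  "PB = {v. \<forall>j. v j \<in> Pn st n \<and> (j \<notin> Ib \<longrightarrow> v j = 0)}"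

lemma gact_rest: "gact st n g (rest v) = rest (gact st n g v)"
  by (cases g) (auto simp: fun_eq_iff gact_def rest_def sact_def Ib_refl_iff)

lemma act_rest: "act st n p (rest v) = rest (act st n p v)"
proof (induction p rule: poly_mapping_additive_induct)
  case (single w c)
  have "wact st n w (rest v) = rest (wact st n w v)"
    by (induction w) (simp_all add: gact_rest)
  then show ?case unfolding act_single by (simp add: rest_def fun_eq_iff)
next
  case (add p p')
  then show ?case unfolding act_plus by (simp add: rest_def fun_eq_iff)
qed

lemma rest_idem: "(\<And>j. j \<notin> Ib \<Longrightarrow> v j = 0) \<Longrightarrow> rest v = v"
  by (auto simp: rest_def fun_eq_iff)

lemma gact_off: "(\<And>j. j \<notin> Ib \<Longrightarrow> v j = 0) \<Longrightarrow> j \<notin> Ib \<Longrightarrow> gact st n g v j = 0"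
  using gact_rest[of g v] rest_idem[of v] by (simp add: rest_def fun_eq_iff)

lemma gact_PB:
  assumes v: "v \<in> PB"
  shows "gact st n g v \<in> PB"
proof -
  have "gact st n g v j \<in> Pn st n" for j
  proof (cases "g \<in> hecke_gens st n")
    case False
    then show ?thesis by (simp add: gact_def)
  next
    case g: True
    have vj: "v j \<in> Pn st n" for j using v by (simp add: PB_def)
    show ?thesis
    proof (cases g)
      case (gX k)
      then show ?thesis using g vj by (simp add: gact_X Pn_mult)
    next
      case (gXinv k)
      then show ?thesis using g vj gact_Xinv[of k st n v] by (simp add: Pn_mult Pn_inverse_tvar)
    next
      case (gT r)
      then have r: "r \<in> {1..<n}" using g by simp
      have "rat_const q - bco st r = rat_const q + rat_const (- 1) * bco st r"
        by (simp add: rat_const_uminus)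
      then have "rat_const q - bco st r \<in> Pn st n"
        using Pn_add[OF Pn_rat_const Pn_mult[OF Pn_rat_const Pn_bco[OF r]]] by (simp only:)
      moreover have "sact r v j \<in> Pn st n" using Pn_sr[OF r vj] by (simp add: sact_def)
      ultimately show ?thesis
        using Pn_bco[OF r] vj unfolding gT gact_T[OF r] by (intro Pn_add Pn_mult)
    qed
  qed
  then show ?thesis using gact_off v by (simp add: PB_def)
qed

lemma pr_PB: "v \<in> PB \<Longrightarrow> pr i v \<in> PB"
  by (auto simp: PB_def pr_def)

text \<open>Derivations of an element together with its operator. Nothing is claimed here about
  different derivations of the same limit element; that they agree is \<open>rel_unique\<close>.
  Generators g e(i) project to the component first.\<close>

inductive rel :: "(int multiset \<Rightarrow> 'k free) \<Rightarrow> ('k pvec \<Rightarrow> 'k pvec) \<Rightarrow> bool" where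
  gen: "g \<in> hecke_gens st n \<Longrightarrow> i \<in> Ib \<Longrightarrow> rel (\<lambda>\<Lambda>. gen_elt g * Px (EL \<Lambda> i)) (\<lambda>v. gact st n g (pr i v))"
| idem: "i \<in> Ib \<Longrightarrow> rel (\<lambda>\<Lambda>. Px (EL \<Lambda> i)) (pr i)"
| inv: "i \<in> Ib \<Longrightarrow> 1 \<le> r \<Longrightarrow> r < s \<Longrightarrow> s \<le> n \<Longrightarrow> i r \<noteq> i s \<Longrightarrow>
    rel (\<lambda>\<Lambda>. Px (invL i r s \<Lambda> * EL \<Lambda> i)) (\<lambda>v j. inverse (tvar r - tvar s) * pr i v j)"
| zero: "rel (\<lambda>_. 0) (\<lambda>_. 0)"
| add: "rel P \<sigma> \<Longrightarrow> rel Q \<tau> \<Longrightarrow> rel (\<lambda>\<Lambda>. P \<Lambda> + Q \<Lambda>) (\<lambda>v. \<sigma> v + \<tau> v)"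
| mult: "rel P \<sigma> \<Longrightarrow> rel Q \<tau> \<Longrightarrow> rel (\<lambda>\<Lambda>. P \<Lambda> * Q \<Lambda>) (\<lambda>v. \<sigma> (\<tau> v))"
| scal: "rel P \<sigma> \<Longrightarrow> rel (\<lambda>\<Lambda>. cst c * P \<Lambda>) (\<lambda>v j. rat_const c * \<sigma> v j)"

lemma pr_add: "pr i (u + v) = pr i u + pr i v"
  by (simp add: pr_def fun_eq_iff)

lemma pr_scale: "pr i (\<lambda>j. c * v j) = (\<lambda>j. c * pr i v j)"
  by (simp add: pr_def fun_eq_iff)

lemma rel_add: "rel P \<sigma> \<Longrightarrow> \<sigma> (u + v) = \<sigma> u + \<sigma> v"
proof (induction arbitrary: u v rule: rel.induct)
  case (gen g i)
  show ?case unfolding pr_add by (rule gact_add)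
next
  case (idem i)
  show ?case by (rule pr_add)
next
  case (add P \<sigma> Q \<tau>)
  show ?case unfolding add.IH by (simp add: algebra_simps)
next
  case (mult P \<sigma> Q \<tau>)
  show ?case unfolding mult.IH ..
qed (simp_all add: fun_eq_iff distrib_left pr_def)

lemma rel_symmetric:
  assumes "rel P \<sigma>" and c: "\<And>r. r \<in> {1..<n} \<Longrightarrow> sr r c = c"
  shows "\<sigma> (\<lambda>j. c * v j) = (\<lambda>j. c * \<sigma> v j)"
  using assms(1)
proof (induction arbitrary: v rule: rel.induct)
  case (gen g i)
  show ?case unfolding pr_scale by (rule gact_symmetric[OF c])
next
  case (idem i)
  show ?case by (rule pr_scale)
next
  case (add P \<sigma> Q \<tau>)
  show ?case unfolding add.IH by (simp add: fun_eq_iff distrib_left)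
next
  case (mult P \<sigma> Q \<tau>)
  show ?case unfolding mult.IH ..
next
  case (scal P \<sigma> a)
  show ?case unfolding scal.IH by (simp add: fun_eq_iff mult.left_commute)
qed (simp_all add: fun_eq_iff pr_def)

lemma rel_PB: "rel P \<sigma> \<Longrightarrow> v \<in> PB \<Longrightarrow> \<sigma> v \<in> PB"
proof (induction arbitrary: v rule: rel.induct)
  case (gen g i)
  then show ?case by (intro gact_PB pr_PB)
next
  case (idem i)
  then show ?case by (intro pr_PB)
next
  case (inv i r s)
  have "inverse (tvar r - tvar s) \<in> Pn st n" using inv by (intro Pn_inverse_diff) auto
  then show ?case using pr_PB[OF inv(6)] by (auto simp: PB_def Pn_mult)
next
  case (add P \<sigma> Q \<tau>)
  then show ?case by (fastforce simp: PB_def Pn_add)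
next
  case (scal P \<sigma> c)
  then show ?case by (fastforce simp: PB_def Pn_mult)
qed (simp_all add: PB_def)

lemma rel_Sec: "rel P \<sigma> \<Longrightarrow> v \<in> Sec \<Longrightarrow> \<sigma> v \<in> Sec"
proof (induction arbitrary: v rule: rel.induct)
  case (gen g i)
  then show ?case by (intro gact_Sec pr_Sec)
next
  case (idem i)
  then show ?case by (intro pr_Sec)
next
  case (inv i r s)
  have "(\<lambda>j. inverse (tvar r - tvar s) * pr i v j) = (\<lambda>j. (if j = i then inverse (tvar r - tvar s) else 0) * pr i v j)"
    by (simp add: fun_eq_iff pr_def)
  also have "\<dots> \<in> Sec"
    using inv by (intro Sec_mult pr_Sec) (auto intro: loc_inverse_diff)
  finally show ?case .
next
  case zero
  then show ?case by (simp add: Sec_def)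
next
  case (add P \<sigma> Q \<tau>)
  show ?case by (intro Sec_add add)
next
  case (scal P \<sigma> c)
  show ?case by (rule Sec_mult) (simp_all add: scal)
qed simp

text \<open>Sampling at the weights N \<beta> suffices, because the error modules shrink to zero
  along them.\<close>

definition repr :: "(int multiset \<Rightarrow> 'k free) \<Rightarrow> ('k pvec \<Rightarrow> 'k pvec) \<Rightarrow> bool" where
  "repr P \<sigma> \<longleftrightarrow> (\<forall>N. \<forall>v\<in>Sec. UU N (act st n (P (Lam N)) v - \<sigma> v))"

lemma UU_trans: "UU N (u - v) \<Longrightarrow> UU N (v - w) \<Longrightarrow> UU N (u - w)"
  using UU.add[of N "u - v" "v - w"] by simp

lemma repr_unique:
  assumes "repr P \<sigma>" "repr Q \<tau>" and c: "\<And>\<Lambda>. \<Lambda> \<in> Pplus e \<Longrightarrow> ccong \<Lambda> (P \<Lambda>) (Q \<Lambda>)" and v: "v \<in> Sec"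
  shows "\<sigma> v = \<tau> v"
proof -
  have "UU N (\<sigma> v - \<tau> v)" for N
  proof -
    have 1: "UU N (act st n (P (Lam N)) v - \<sigma> v)" "UU N (act st n (Q (Lam N)) v - \<tau> v)"
      using assms by (auto simp: repr_def)
    have "UU N (act st n (P (Lam N)) v - act st n (Q (Lam N)) v)"
      using two_sided_Sec[OF _ v] c[OF Lam_Pplus] unfolding congr_def act_diff[symmetric] by blast
    from UU.add[OF UU_diff[OF this 1(1)] 1(2)] show ?thesis by (simp add: algebra_simps)
  qed
  then have "\<sigma> v - \<tau> v = 0" by (rule UU_Inter)
  then show ?thesis by simp
qed

lemma repr_idem: "i \<in> Ib \<Longrightarrow> repr (\<lambda>\<Lambda>. Px (EL \<Lambda> i)) (pr i)"
  unfolding repr_def EL_def act_Px[OF eps_polys]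
proof (intro allI ballI)
  fix N v assume "i \<in> Ib" "v \<in> Sec"
  moreover obtain B M where "valid (Lam N) B M (etaL (Lam N))" using etaL_valid by blast
  ultimately show "UU N ((\<lambda>j. emb (eps (etaL (Lam N)) i) * v j) - pr i v)" by (intro eps_projects)
qed

lemma repr_act: "repr (\<lambda>_. p) (act st n p)"
  by (simp add: repr_def UU.zero)

text \<open>The error of the right factor stays in the error module, which is stable; the left
  factor is then compared on \<tau> v, which must again be a local section.\<close>

lemma repr_mult:
  assumes P: "repr P \<sigma>" and Q: "repr Q \<tau>" and S: "\<And>v. v \<in> Sec \<Longrightarrow> \<tau> v \<in> Sec"
  shows "repr (\<lambda>\<Lambda>. P \<Lambda> * Q \<Lambda>) (\<lambda>v. \<sigma> (\<tau> v))"
  unfolding repr_def act_mult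
proof (intro allI ballI)
  fix N v assume v: "v \<in> Sec"
  have "UU N (act st n (P (Lam N)) (act st n (Q (Lam N)) v) - act st n (P (Lam N)) (\<tau> v))"
    unfolding act_diff_vec[symmetric] using Q v by (intro UU_act) (simp add: repr_def)
  then show "UU N (act st n (P (Lam N)) (act st n (Q (Lam N)) v) - \<sigma> (\<tau> v))"
    by (rule UU_trans) (use P S[OF v] in \<open>simp add: repr_def\<close>)
qed

lemma rel_repr: "rel P \<sigma> \<Longrightarrow> repr P \<sigma>"
proof (induction rule: rel.induct)
  case (gen g i)
  have "act st n (gen_elt g) = gact st n g" by (rule ext) simp
  then have "repr (\<lambda>_. gen_elt g) (gact st n g)" using repr_act[of "gen_elt g"] by simp
  from repr_mult[OF this repr_idem[OF gen(2)] pr_Sec[OF gen(2)]] show ?case .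
next
  case (idem i)
  then show ?case by (rule repr_idem)
next
  case (inv i r s)
  have rs: "r \<in> {1..n}" "s \<in> {1..n}" using inv by auto
  note ires = I_beta_res_seqs[OF inv(1)]
  let ?z = "pvar r - pvar s :: 'k mpol"
  show ?case
    unfolding repr_def
  proof (intro allI ballI)
    fix N v assume v: "v \<in> Sec"
    let ?g = "invL i r s (Lam N)" and ?E = "EL (Lam N) i" and ?w = "pr i v"
    have g: "?g \<in> polys n" by (rule invL_polys[OF ires rs inv(5)])
    \<comment> \<open>The value of the polynomial inverse g at weight N \<beta> on the component of
      i. Modulo the error module z W equals the component, with z = t_r - t_s; since z is a unit at
      the point of i, W may be replaced by 1/z times the component.\<close>
    define W where "W = (\<lambda>l. emb ?g * ?w l)"
    have pp: "pr i ?w = ?w" by (simp add: pr_def fun_eq_iff)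
    have 1: "UU N ((\<lambda>l. emb ?E * v l) - ?w)"
      using repr_idem[OF inv(1)] v by (simp add: repr_def act_Px)
    have 2: "UU N ((\<lambda>l. emb ?E * ?w l) - ?w)"
    proof -
      have "UU N (act st n (Px ?E) ?w - pr i ?w)"
        using repr_idem[OF inv(1)] pr_Sec[OF inv(1) v] unfolding repr_def by blast
      then show ?thesis by (simp only: act_Px[OF EL_polys] pp)
    qed
    have 3: "UU N (\<lambda>l. emb (?z * ?g * ?E - ?E) * ?w l)"
      using rs g by (intro Iz_Sec[OF invL[OF ires rs inv(5)]] pr_Sec inv v polys_diff polys_mult) simp_all
    have 4: "UU N ((\<lambda>l. emb (?g * ?E) * v l) - W)"
    proof -
      have "(\<lambda>l. emb ?g * ((\<lambda>l. emb ?E * v l) - ?w) l) = (\<lambda>l. emb (?g * ?E) * v l) - W"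
        by (simp add: W_def fun_eq_iff emb.hom_mult right_diff_distrib mult.assoc)
      then show ?thesis using UU_emb[OF 1, of ?g] by (simp only:)
    qed
    have "UU N ((\<lambda>l. emb (?z * ?g * ?E - ?E) * ?w l) - (\<lambda>l. emb (?z * ?g) * ((\<lambda>l. emb ?E * ?w l) - ?w) l)
        + ((\<lambda>l. emb ?E * ?w l) - ?w))"
      by (intro UU.add UU_diff UU_emb 2 3)
    also have "\<dots> = (\<lambda>l. emb ?z * W l) - ?w"
      by (simp add: W_def fun_eq_iff emb.hom_mult emb.hom_minus emb.hom_add algebra_simps)
    finally have "UU N (\<lambda>l. (if l = i then inverse (tvar r - tvar s) else 0) * ((\<lambda>l. emb ?z * W l) - ?w) l)"
      by (rule UU_mult) (simp add: loc_inverse_diff[OF inv(1) rs inv(5)])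
    also have "(\<lambda>l. (if l = i then inverse (tvar r - tvar s) else 0) * ((\<lambda>l. emb ?z * W l) - ?w) l)
        = W - (\<lambda>j. inverse (tvar r - tvar s) * ?w j)"
    proof -
      have ez: "emb ?z = tvar r - tvar s" by (simp add: emb.hom_minus tvar_emb)
      have "tvar r - tvar s \<noteq> (0 :: 'k ratfun)" using inv by simp
      moreover have "inverse d * (d * a - b) = a - inverse d * b" if "d \<noteq> 0" for a b d :: "'k ratfun"
        using that by (simp add: right_diff_distrib mult.assoc[symmetric])
      ultimately have *: "inverse (tvar r - tvar s) * (emb ?z * a - b) = a - inverse (tvar r - tvar s) * b" for a b
        unfolding ez by blast
      show ?thesis
      proof
        fix l
        show "(if l = i then inverse (tvar r - tvar s) else 0) * ((\<lambda>l. emb ?z * W l) - ?w) l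
          = (W - (\<lambda>j. inverse (tvar r - tvar s) * ?w j)) l"
          using * by (cases "l = i") (simp_all add: W_def pr_def)
      qed
    qed
    finally have 5: "UU N (W - (\<lambda>j. inverse (tvar r - tvar s) * ?w j))" .
    have "act st n (Px (?g * ?E)) v = (\<lambda>l. emb (?g * ?E) * v l)"
      by (intro act_Px polys_mult g EL_polys)
    then show "UU N (act st n (Px (?g * ?E)) v - (\<lambda>j. inverse (tvar r - tvar s) * ?w j))"
      using UU_trans[OF 4 5] by (simp only:)
  qed
next
  case zero
  show ?case unfolding repr_def act_0 diff_self by (intro allI ballI UU.zero)
next
  case (add P \<sigma> Q \<tau>)
  show ?case
    unfolding repr_def
  proof (intro allI ballI)
    fix N v assume v: "v \<in> Sec"
    have "UU N ((act st n (P (Lam N)) v - \<sigma> v) + (act st n (Q (Lam N)) v - \<tau> v))"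
      using add.IH v by (intro UU.add) (simp_all add: repr_def)
    then show "UU N (act st n (P (Lam N) + Q (Lam N)) v - (\<sigma> v + \<tau> v))"
      by (simp add: act_plus algebra_simps)
  qed
next
  case (mult P \<sigma> Q \<tau>)
  show ?case by (rule repr_mult[OF mult.IH rel_Sec[OF mult.hyps(2)]])
next
  case (scal P \<sigma> c)
  show ?case
    unfolding repr_def
  proof (intro allI ballI)
    fix N v assume v: "v \<in> Sec"
    have "UU N (act st n (P (Lam N)) v - \<sigma> v)" using scal.IH v unfolding repr_def by blast
    then have "UU N (\<lambda>j. rat_const c * (act st n (P (Lam N)) v - \<sigma> v) j)"
      by (rule UU_mult) (rule loc_rat_const)
    moreover have "(\<lambda>j. rat_const c * (act st n (P (Lam N)) v - \<sigma> v) j)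
        = act st n (cst c * P (Lam N)) v - (\<lambda>j. rat_const c * \<sigma> v j)"
      by (simp add: act_mult fun_eq_iff right_diff_distrib)
    ultimately show "UU N (act st n (cst c * P (Lam N)) v - (\<lambda>j. rat_const c * \<sigma> v j))" by (simp only:)
  qed
qed

lemma common_denominator:
  assumes "\<And>j. j \<notin> Ib \<Longrightarrow> v j = (0 :: 'k ratfun)"
  obtains D where "D \<noteq> 0" "(\<lambda>j. emb D * v j) \<in> Sec" "\<forall>r\<in>{1..<n}. sp r D = D"
proof -
  have "\<exists>d. d \<noteq> 0 \<and> (\<exists>p. v j = emb p / emb d)" for j by (metis ratfun_cases)
  then obtain d where d: "\<And>j. d j \<noteq> 0" "\<And>j. \<exists>p. v j = emb p / emb (d j)" by metis
  have "(\<Prod>j\<in>Ib. d j) \<noteq> 0" using d(1) finite_Ib by (simp add: prod_zero_iff)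
  from symmetric_multiple[OF this, of n] obtain D where
    D: "D \<noteq> 0" "(\<Prod>j\<in>Ib. d j) dvd D" "\<And>r. r \<in> {1..<n} \<Longrightarrow> sp r D = D" by blast
  have "emb D * v j \<in> loc (pt j) 0" if j: "j \<in> Ib" for j
  proof -
    have "d j dvd D" using dvd_prodI[OF finite_Ib j, of d] D(2) by (rule dvd_trans)
    then obtain k where "D = d j * k" by (elim dvdE)
    moreover obtain p where "v j = emb p / emb (d j)" using d(2) by blast
    ultimately have "emb D * v j = emb (k * p)" using d(1)[of j] by (simp add: emb.hom_mult)
    then show ?thesis by simp
  qed
  then have "(\<lambda>j. emb D * v j) \<in> Sec" using assms by (simp add: Sec_def)
  with D(1,3) show thesis by (intro that) auto
qed

text \<open>A symmetric D with D v in \<open>Sec\<close> commutes with both operators, so agreement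
  on \<open>Sec\<close> gives D \<sigma> v = D \<tau> v, and D cancels.\<close>

lemma rel_unique:
  assumes "rel P \<sigma>" "rel Q \<tau>" and c: "lim P = lim Q" and v: "\<And>j. j \<notin> Ib \<Longrightarrow> v j = 0"
  shows "\<sigma> v = \<tau> v"
proof -
  obtain D where D: "D \<noteq> 0" "(\<lambda>j. emb D * v j) \<in> Sec" "\<forall>r\<in>{1..<n}. sp r D = D"
    using common_denominator[of v] v by blast
  have sD: "sr r (emb D) = emb D" if "r \<in> {1..<n}" for r using D(3) that by (simp add: perm_rat_emb)
  have "\<sigma> (\<lambda>j. emb D * v j) = \<tau> (\<lambda>j. emb D * v j)"
    by (rule repr_unique[OF rel_repr[OF assms(1)] rel_repr[OF assms(2)] _ D(2)])
      (use c in \<open>simp add: lim_eq_iff\<close>)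
  then have "(\<lambda>j. emb D * \<sigma> v j) = (\<lambda>j. emb D * \<tau> v j)"
    using rel_symmetric[OF assms(1), of "emb D" v] rel_symmetric[OF assms(2), of "emb D" v] sD by simp
  then show ?thesis using D(1) by (simp add: fun_eq_iff)
qed

lemma rel_sum:
  assumes "finite A" "\<And>i. i \<in> A \<Longrightarrow> rel (P i) (\<sigma> i)"
  shows "rel (\<lambda>\<Lambda>. \<Sum>i\<in>A. P i \<Lambda>) (\<lambda>v. \<Sum>i\<in>A. \<sigma> i v)"
  using assms by (induction A rule: finite_induct) (simp_all add: rel.zero rel.add)

section \<open>The identity element of the block\<close>

definition ONE :: "int multiset \<Rightarrow> 'k mpol" where
  "ONE \<Lambda> = (\<Sum>i\<in>Ib. EL \<Lambda> i)"

lemma Px_sum: "Px (sum f A) = (\<Sum>x\<in>A. Px (f x))"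
  by (induction A rule: infinite_finite_induct) (simp_all add: Px_add)

lemma rel_ONE: "rel (\<lambda>\<Lambda>. Px (ONE \<Lambda>)) rest"
proof -
  have "rest v = (\<Sum>i\<in>Ib. pr i v)" for v
    by (rule ext) (simp add: fun_sum_apply rest_def pr_def finite_Ib)
  then have "rest = (\<lambda>v. \<Sum>i\<in>Ib. pr i v)" by (rule ext)
  then show ?thesis
    using rel_sum[OF finite_Ib rel.idem] by (simp add: ONE_def Px_sum)
qed

lemma ONE_polys [simp]: "ONE \<Lambda> \<in> polys n"
  unfolding ONE_def by (intro polys_sum) simp

text \<open>s_r permutes the summands. By symmetry the block identity then commutes with the T_r, as
  used in \<open>gen_ONE_comm\<close>.\<close>

lemma sp_ONE:
  assumes r: "r \<in> {1..<n}"
  shows "sp r (ONE \<Lambda>) = ONE \<Lambda>"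
proof -
  interpret s: comm_ring_hom "sp r" by (rule comm_ring_hom_perm_poly) simp
  have "sp r (ONE \<Lambda>) = (\<Sum>i\<in>Ib. EL \<Lambda> (i \<circ> simple_refl r))"
    by (simp add: ONE_def s.hom_sum sp_EL[OF r])
  also have "\<dots> = ONE \<Lambda>"
    unfolding ONE_def
    by (rule sum.reindex_bij_witness[of _ "\<lambda>i. i \<circ> simple_refl r" "\<lambda>i. i \<circ> simple_refl r"])
      (simp_all add: comp_assoc Ib_refl[OF r])
  finally show ?thesis .
qed

lemma ONE_EL:
  assumes i: "i \<in> Ib"
  shows "Iz \<Lambda> (ONE \<Lambda> * EL \<Lambda> i - EL \<Lambda> i)"
proof -
  have eq: "ONE \<Lambda> * EL \<Lambda> i - EL \<Lambda> i = (EL \<Lambda> i * EL \<Lambda> i - EL \<Lambda> i) + (\<Sum>j\<in>Ib - {i}. EL \<Lambda> j * EL \<Lambda> i)"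
    unfolding ONE_def sum.remove[OF finite_Ib i, of "EL \<Lambda>"]
    by (simp add: distrib_right sum_distrib_right)
  show ?thesis
    unfolding eq using i by (intro Iz_add Iz_sum EL_idem EL_orth I_beta_res_seqs) auto
qed

lemma Xi_Px_comm:
  assumes g: "gXinv k \<in> hecke_gens st n"
  shows "Xi\<^sub>g k * Px p \<approx> Px p * Xi\<^sub>g k"
proof -
  obtain q' where st: "st = NonDeg q'" using g by (cases st) auto
  have k: "k \<in> {1..n}" using g by simp
  note i1 = gen_cong(7)[OF st k] and i2 = gen_cong(8)[OF st k]
  have c: "X\<^sub>g k * Px p \<approx> Px p * X\<^sub>g k" using Px_comm[of "pvar k" p] k by simp
  have "Xi\<^sub>g k * Px p \<approx> Xi\<^sub>g k * (Px p * (X\<^sub>g k * Xi\<^sub>g k))"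
    using congr_sym[OF congr_mult[OF congr_refl congr_mult[OF congr_refl i2]], of "Xi\<^sub>g k" "Px p"] by simp
  also have "\<dots> = Xi\<^sub>g k * (Px p * X\<^sub>g k) * Xi\<^sub>g k" by (simp add: mult.assoc)
  also have "\<dots> \<approx> Xi\<^sub>g k * (X\<^sub>g k * Px p) * Xi\<^sub>g k"
    by (rule congr_mult[OF congr_mult[OF congr_refl congr_sym[OF c]] congr_refl])
  also have "\<dots> = (Xi\<^sub>g k * X\<^sub>g k) * (Px p * Xi\<^sub>g k)" by (simp add: mult.assoc)
  also have "\<dots> \<approx> 1 * (Px p * Xi\<^sub>g k)" by (rule congr_mult[OF i1 congr_refl])
  finally show ?thesis by simp
qed

lemma gen_ONE_comm:
  assumes "g \<in> hecke_gens st n"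
  shows "gen_elt g * Px (ONE \<Lambda>) \<approx> Px (ONE \<Lambda>) * gen_elt g"
proof (cases g)
  case (gT r)
  then show ?thesis using assms T_symmetric_comm[OF _ ONE_polys sp_ONE] by simp
next
  case (gX k)
  then show ?thesis using assms Px_comm[of "pvar k" "ONE \<Lambda>"] by simp
next
  case (gXinv k)
  then show ?thesis using assms Xi_Px_comm by simp
qed

lemma Iz_ccong: "Iz \<Lambda> (p - p') \<Longrightarrow> ccong \<Lambda> (Px p) (Px p')"
  by (simp add: Iz_diff_iff)

lemma rel_ONE_mult: "rel P \<sigma> \<Longrightarrow> ccong \<Lambda> (Px (ONE \<Lambda>) * P \<Lambda>) (P \<Lambda>)"
proof (induction rule: rel.induct)
  case (gen g i)
  have "ccong \<Lambda> (Px (ONE \<Lambda>) * (gen_elt g * Px (EL \<Lambda> i))) (gen_elt g * (Px (ONE \<Lambda>) * Px (EL \<Lambda> i)))"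
    using congr_mult[OF congr_sym[OF congr_hrels_crels[OF gen_ONE_comm[OF gen(1)]]] congr_refl, of \<Lambda> \<Lambda> "Px (EL \<Lambda> i)"]
    by (simp add: mult.assoc)
  also have "ccong \<Lambda> \<dots> (gen_elt g * Px (ONE \<Lambda> * EL \<Lambda> i))"
    by (rule congr_mult[OF congr_refl congr_sym[OF congr_hrels_crels[OF Px_mult]]])
  also have "ccong \<Lambda> \<dots> (gen_elt g * Px (EL \<Lambda> i))"
    by (rule congr_mult[OF congr_refl Iz_ccong[OF ONE_EL[OF gen(2)]]])
  finally show ?case .
next
  case (idem i)
  show ?case
    by (rule congr_trans[OF congr_sym[OF congr_hrels_crels[OF Px_mult]] Iz_ccong[OF ONE_EL[OF idem]]])
next
  case (inv i r s)
  have "Iz \<Lambda> (ONE \<Lambda> * (invL i r s \<Lambda> * EL \<Lambda> i) - invL i r s \<Lambda> * EL \<Lambda> i)"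
    using Iz_mult[OF ONE_EL[OF inv(1)], of \<Lambda> "invL i r s \<Lambda>"] by (simp add: algebra_simps)
  then show ?case by (rule congr_trans[OF congr_sym[OF congr_hrels_crels[OF Px_mult]] Iz_ccong])
next
  case (add P \<sigma> Q \<tau>)
  then show ?case unfolding distrib_left by (intro congr_add)
next
  case (mult P \<sigma> Q \<tau>)
  show ?case using congr_mult[OF mult.IH(1) congr_refl, of "Q \<Lambda>"] by (simp add: mult.assoc)
next
  case (scal P \<sigma> c)
  show ?case
    using congr_mult[OF congr_refl scal.IH, of "cst c"] by (simp add: cst_left_comm)
qed simp

section \<open>Faithfulness\<close>

text \<open>Products of differences that are invertible on e(j); they are the denominators that can
  arise in row j.\<close>

inductive sep :: "(nat \<Rightarrow> int) \<Rightarrow> 'k mpol \<Rightarrow> bool" for j where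
  one: "sep j 1"
| step: "sep j D \<Longrightarrow> r \<in> {1..n} \<Longrightarrow> s \<in> {1..n} \<Longrightarrow> j r \<noteq> j s \<Longrightarrow> sep j ((pvar r - pvar s) * D)"

lemma sep_polys: "sep j D \<Longrightarrow> D \<in> polys n"
  by (induction rule: sep.induct) (auto intro!: polys_mult polys_diff)

lemma sep_mult:
  assumes "sep j D" "sep j D'"
  shows "sep j (D * D')"
  using assms(1) by (induction rule: sep.induct) (simp_all add: assms(2) mult.assoc sep.step)

lemma sep_diff: "r \<in> {1..n} \<Longrightarrow> s \<in> {1..n} \<Longrightarrow> j r \<noteq> j s \<Longrightarrow> sep j (pvar r - pvar s)"
  using sep.step[OF sep.one] by simp

lemma sep_sp:
  assumes k: "k \<in> {1..<n}" and "sep j D"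
  shows "sep (j \<circ> simple_refl k) (sp k D)"
  using assms(2)
proof (induction rule: sep.induct)
  case one
  show ?case by (simp add: sp_hom sep.one)
next
  case (step D r s)
  have i: "simple_refl k a \<in> {1..n} \<longleftrightarrow> a \<in> {1..n}" for a
    by (rule permutes_in_image[OF simple_refl_permutes[OF k]])
  show ?case
    unfolding sp_hom by (rule sep.step[OF step.IH]) (use step.hyps i in auto)
qed

lemma sep_invert: "sep j D \<Longrightarrow> j \<in> Ib \<Longrightarrow> \<exists>g. Iz \<Lambda> (g * D * EL \<Lambda> j - EL \<Lambda> j)"
proof (induction rule: sep.induct)
  case one
  show ?case by (rule exI[of _ 1]) simp
next
  case (step D r s)
  then obtain g where g: "Iz \<Lambda> (g * D * EL \<Lambda> j - EL \<Lambda> j)" by blast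
  let ?z = "pvar r - pvar s :: 'k mpol" and ?i = "invL j r s \<Lambda>"
  have eq: "?i * g * (?z * D) * EL \<Lambda> j - EL \<Lambda> j
      = (?z * ?i * EL \<Lambda> j - EL \<Lambda> j) * (g * D) + (g * D * EL \<Lambda> j - EL \<Lambda> j)"
    by (simp add: algebra_simps)
  have "Iz \<Lambda> (?i * g * (?z * D) * EL \<Lambda> j - EL \<Lambda> j)"
    unfolding eq using step by (intro Iz_add Iz_mult g invL I_beta_res_seqs)
  then show ?case by blast
qed

lemma Px_Px: "ccong \<Lambda> (Px a * (Px b * y)) (Px (a * b) * y)"
  using congr_mult[OF congr_sym[OF congr_hrels_crels[OF Px_mult]] congr_refl, of \<Lambda> a b y]
  by (simp add: mult.assoc)

lemma Px_swap: "ccong \<Lambda> (Px a * (Px b * y)) (Px b * (Px a * y))"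
  using congr_mult[OF congr_hrels_crels[OF Px_comm] congr_refl, of \<Lambda> a b y] by (simp add: mult.assoc)

lemma Px_ccong: "Iz \<Lambda> (a - b) \<Longrightarrow> ccong \<Lambda> (Px a * y) (Px b * y)"
  by (rule congr_mult[OF Iz_ccong congr_refl])

lemma ccong_left: "ccong \<Lambda> a b \<Longrightarrow> ccong \<Lambda> (c * a) (c * b)"
  by (rule congr_mult[OF congr_refl])

lemma hcong_ccong_mult: "a \<approx> b \<Longrightarrow> ccong \<Lambda> (a * y) (b * y)"
  by (rule congr_mult[OF congr_hrels_crels congr_refl])

text \<open>After clearing differences \<open>t\<^sub>r - t\<^sub>s\<close> with \<open>j\<^sub>r \<noteq> j\<^sub>s\<close>, every element \<open>x\<close> of the modified algebra
  satisfies \<open>D e(j) x = e(j) h\<close> with \<open>h\<close> from the affine algebra.\<close>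

definition cleared :: "(nat \<Rightarrow> int) \<Rightarrow> 'k mpol \<Rightarrow> 'k free \<Rightarrow> (int multiset \<Rightarrow> 'k free) \<Rightarrow> bool" where
  "cleared j D y Q \<longleftrightarrow> sep j D \<and> (\<forall>\<Lambda>. ccong \<Lambda> (Px (D * EL \<Lambda> j) * Q \<Lambda>) (Px (EL \<Lambda> j) * y))"

definition SS :: "(int multiset \<Rightarrow> 'k free) \<Rightarrow> bool" where
  "SS Q \<longleftrightarrow> (\<forall>j\<in>Ib. \<exists>D y. cleared j D y Q)"

lemma SS_I: "(\<And>j. j \<in> Ib \<Longrightarrow> \<exists>D y. cleared j D y Q) \<Longrightarrow> SS Q"
  by (simp add: SS_def)

lemma SS_E:
  assumes "SS Q" "j \<in> Ib"
  obtains D y where "cleared j D y Q"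
  using assms by (auto simp: SS_def)

lemma cleared_ext:
  assumes "cleared j D y Q"
  shows "ccong \<Lambda> (Px (p * (D * EL \<Lambda> j)) * Q \<Lambda>) (Px (EL \<Lambda> j) * (Px p * y))"
proof -
  have "ccong \<Lambda> (Px (p * (D * EL \<Lambda> j)) * Q \<Lambda>) (Px p * (Px (D * EL \<Lambda> j) * Q \<Lambda>))"
    by (rule congr_sym[OF Px_Px])
  also have "ccong \<Lambda> \<dots> (Px p * (Px (EL \<Lambda> j) * y))"
    using assms by (intro ccong_left) (simp add: cleared_def)
  also have "ccong \<Lambda> \<dots> (Px (EL \<Lambda> j) * (Px p * y))" by (rule Px_swap)
  finally show ?thesis .
qed

lemma SS_1: "SS (\<lambda>_. 1)"
  by (intro SS_I exI[of _ 1]) (simp add: cleared_def sep.one)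

lemma SS_0: "SS (\<lambda>_. 0)"
  by (intro SS_I exI[of _ 1] exI[of _ 0]) (simp add: cleared_def sep.one)

lemma SS_add:
  assumes "SS P" "SS Q"
  shows "SS (\<lambda>\<Lambda>. P \<Lambda> + Q \<Lambda>)"
proof (rule SS_I)
  fix j assume j: "j \<in> Ib"
  obtain D y where D: "cleared j D y P" by (rule SS_E[OF assms(1) j])
  obtain D' y' where D': "cleared j D' y' Q" by (rule SS_E[OF assms(2) j])
  have "ccong \<Lambda> (Px (D * D' * EL \<Lambda> j) * (P \<Lambda> + Q \<Lambda>)) (Px (EL \<Lambda> j) * (Px D' * y + Px D * y'))" for \<Lambda>
  proof -
    have e: "D * D' * EL \<Lambda> j = D' * (D * EL \<Lambda> j)" "D * D' * EL \<Lambda> j = D * (D' * EL \<Lambda> j)"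
      by (simp_all add: ac_simps)
    have "ccong \<Lambda> (Px (D * D' * EL \<Lambda> j) * P \<Lambda>) (Px (EL \<Lambda> j) * (Px D' * y))"
      unfolding e(1) by (rule cleared_ext[OF D])
    moreover have "ccong \<Lambda> (Px (D * D' * EL \<Lambda> j) * Q \<Lambda>) (Px (EL \<Lambda> j) * (Px D * y'))"
      unfolding e(2) by (rule cleared_ext[OF D'])
    ultimately show ?thesis unfolding distrib_left by (rule congr_add)
  qed
  then have "cleared j (D * D') (Px D' * y + Px D * y') (\<lambda>\<Lambda>. P \<Lambda> + Q \<Lambda>)"
    using D D' by (simp add: cleared_def sep_mult)
  then show "\<exists>D y. cleared j D y (\<lambda>\<Lambda>. P \<Lambda> + Q \<Lambda>)" by blast
qed

lemma SS_cst:
  assumes "SS Q"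
  shows "SS (\<lambda>\<Lambda>. cst c * Q \<Lambda>)"
proof (rule SS_I)
  fix j assume j: "j \<in> Ib"
  obtain D y where D: "cleared j D y Q" by (rule SS_E[OF assms j])
  have "cleared j D (cst c * y) (\<lambda>\<Lambda>. cst c * Q \<Lambda>)"
    unfolding cleared_def cst_left_comm using D by (auto simp: cleared_def intro: ccong_left)
  then show "\<exists>D y. cleared j D y (\<lambda>\<Lambda>. cst c * Q \<Lambda>)" by blast
qed

text \<open>Rows other than i vanish by orthogonality; in row i the factor z undoes p. The case z =
  1 covers idempotents, z = X_r - X_s the inverses.\<close>

lemma SS_local:
  assumes "SS Q" and i: "i \<in> Ib" and p: "\<And>\<Lambda>. p \<Lambda> = p' \<Lambda> * EL \<Lambda> i"
    and z: "sep i z" "\<And>\<Lambda>. Iz \<Lambda> (z * p \<Lambda> - EL \<Lambda> i)"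
  shows "SS (\<lambda>\<Lambda>. Px (p \<Lambda>) * Q \<Lambda>)"
proof (rule SS_I)
  fix j assume j: "j \<in> Ib"
  show "\<exists>D y. cleared j D y (\<lambda>\<Lambda>. Px (p \<Lambda>) * Q \<Lambda>)"
  proof (cases "j = i")
    case False
    have "ccong \<Lambda> (Px (1 * EL \<Lambda> j) * (Px (p \<Lambda>) * Q \<Lambda>)) (Px (EL \<Lambda> j) * 0)" for \<Lambda>
    proof -
      have eq: "1 * EL \<Lambda> j * p \<Lambda> - 0 = p' \<Lambda> * (EL \<Lambda> j * EL \<Lambda> i)"
        by (simp add: p ac_simps)
      have "Iz \<Lambda> (1 * EL \<Lambda> j * p \<Lambda> - 0)"
        unfolding eq by (rule Iz_mult2[OF EL_orth[OF I_beta_res_seqs[OF j] I_beta_res_seqs[OF i] False]])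
      from congr_trans[OF Px_Px Px_ccong[OF this]] show ?thesis by simp
    qed
    then have "cleared j 1 0 (\<lambda>\<Lambda>. Px (p \<Lambda>) * Q \<Lambda>)" by (simp add: cleared_def sep.one)
    then show ?thesis by blast
  next
    case True
    obtain D y where D: "cleared i D y Q" by (rule SS_E[OF assms(1) i])
    have "ccong \<Lambda> (Px (z * D * EL \<Lambda> i) * (Px (p \<Lambda>) * Q \<Lambda>)) (Px (EL \<Lambda> i) * y)" for \<Lambda>
    proof -
      have eq: "z * D * EL \<Lambda> i * p \<Lambda> - D * EL \<Lambda> i
          = (z * p \<Lambda> - EL \<Lambda> i) * (D * EL \<Lambda> i) + D * (EL \<Lambda> i * EL \<Lambda> i - EL \<Lambda> i)"
        by (simp add: algebra_simps)
      have "Iz \<Lambda> (z * D * EL \<Lambda> i * p \<Lambda> - D * EL \<Lambda> i)"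
        unfolding eq by (rule Iz_add[OF Iz_mult[OF z(2)] Iz_mult2[OF EL_idem[OF I_beta_res_seqs[OF i]]]])
      from congr_trans[OF Px_Px Px_ccong[OF this]]
      show ?thesis using D unfolding cleared_def by (blast intro: congr_trans)
    qed
    then have "cleared i (z * D) y (\<lambda>\<Lambda>. Px (p \<Lambda>) * Q \<Lambda>)"
      using D z(1) by (simp add: cleared_def sep_mult)
    then show ?thesis using True by blast
  qed
qed

lemma SS_commuting:
  assumes "SS Q" and c: "\<And>p. gen_elt g * Px p \<approx> Px p * gen_elt g"
  shows "SS (\<lambda>\<Lambda>. gen_elt g * Q \<Lambda>)"
proof (rule SS_I)
  fix j assume j: "j \<in> Ib"
  obtain D y where D: "cleared j D y Q" by (rule SS_E[OF assms(1) j])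
  have c': "ccong \<Lambda> (Px p * (gen_elt g * u)) (gen_elt g * (Px p * u))" for \<Lambda> p u
    using hcong_ccong_mult[OF congr_sym[OF c], of \<Lambda> p u] by (simp add: mult.assoc)
  have "ccong \<Lambda> (Px (D * EL \<Lambda> j) * (gen_elt g * Q \<Lambda>)) (Px (EL \<Lambda> j) * (gen_elt g * y))" for \<Lambda>
  proof -
    have "ccong \<Lambda> (gen_elt g * (Px (D * EL \<Lambda> j) * Q \<Lambda>)) (gen_elt g * (Px (EL \<Lambda> j) * y))"
      using D by (intro ccong_left) (simp add: cleared_def)
    then show ?thesis using c' congr_sym[OF c'] by (blast intro: congr_trans)
  qed
  then have "cleared j D (gen_elt g * y) (\<lambda>\<Lambda>. gen_elt g * Q \<Lambda>)" using D by (simp add: cleared_def)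
  then show "\<exists>D y. cleared j D y (\<lambda>\<Lambda>. gen_elt g * Q \<Lambda>)" by blast
qed

text \<open>If j_k = j_(k+1), multiplying D by s_k(D) makes the factor in front symmetric, and T_k
  passes. Otherwise X_(k+1) - X_k is an allowed denominator and (X_(k+1) - X_k) T_k = phi_k + B_k;
  the intertwiner leads to row s_k j, so the data of both rows enter.\<close>

lemma SS_T:
  assumes "SS Q" and k: "k \<in> {1..<n}"
  shows "SS (\<lambda>\<Lambda>. T\<^sub>g k * Q \<Lambda>)"
proof (rule SS_I)
  fix j assume j: "j \<in> Ib"
  let ?j' = "j \<circ> simple_refl k"
  obtain D y where D: "cleared j D y Q" by (rule SS_E[OF assms(1) j])
  have D0: "D \<in> polys n" "sep j D" using D sep_polys by (auto simp: cleared_def)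
  show "\<exists>D y. cleared j D y (\<lambda>\<Lambda>. T\<^sub>g k * Q \<Lambda>)"
  proof (cases "j k = j (Suc k)")
    case True
    then have jj: "?j' = j" by (auto simp: fun_eq_iff simple_refl_def transpose_def)
    have "emb (sp k (sp k D)) = emb D"
      by (simp add: perm_rat_emb[OF bij_simple_refl, symmetric] del: emb_eq_iff)
    then have ss: "sp k (sp k D) = D" by simp
    have "ccong \<Lambda> (Px (sp k D * D * EL \<Lambda> j) * (T\<^sub>g k * Q \<Lambda>)) (Px (EL \<Lambda> j) * (T\<^sub>g k * (Px (sp k D) * y)))" for \<Lambda>
    proof -
      let ?S = "sp k D * D * EL \<Lambda> j"
      have sE: "sp k (EL \<Lambda> j) = EL \<Lambda> j" using sp_EL[OF k, of \<Lambda> j] by (simp only: jj)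
      have sS: "sp k ?S = ?S" unfolding sp_hom ss sE by (simp add: ac_simps)
      have S: "?S \<in> polys n" by (intro polys_mult sp_polys k D0 EL_polys)
      have "ccong \<Lambda> (Px ?S * (T\<^sub>g k * Q \<Lambda>)) (T\<^sub>g k * (Px ?S * Q \<Lambda>))"
        using hcong_ccong_mult[OF congr_sym[OF T_symmetric_comm[OF k S sS]], of \<Lambda> "Q \<Lambda>"] by (simp add: mult.assoc)
      also have "ccong \<Lambda> \<dots> (T\<^sub>g k * (Px (EL \<Lambda> j) * (Px (sp k D) * y)))"
        unfolding mult.assoc[of "sp k D"] by (intro ccong_left cleared_ext[OF D])
      also have "ccong \<Lambda> \<dots> (Px (EL \<Lambda> j) * (T\<^sub>g k * (Px (sp k D) * y)))"
        using hcong_ccong_mult[OF T_symmetric_comm[OF k EL_polys sE], of \<Lambda> "Px (sp k D) * y"]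
        by (simp add: mult.assoc)
      finally show ?thesis .
    qed
    then have "cleared j (sp k D * D) (T\<^sub>g k * (Px (sp k D) * y)) (\<lambda>\<Lambda>. T\<^sub>g k * Q \<Lambda>)"
      using sep_mult[OF _ D0(2)] sep_sp[OF k D0(2)] by (simp add: cleared_def jj)
    then show ?thesis by blast
  next
    case False
    obtain D' y' where D': "cleared ?j' D' y' Q" by (rule SS_E[OF assms(1) Ib_refl[OF k j]])
    have D0': "D' \<in> polys n" "sep ?j' D'" using D' sep_polys by (auto simp: cleared_def)
    let ?z = "pvar (Suc k) - pvar k :: 'k mpol"
    have "ccong \<Lambda> (Px (?z * (sp k D' * D) * EL \<Lambda> j) * (T\<^sub>g k * Q \<Lambda>))
        (Px (EL \<Lambda> j) * (Px D * (phi k * y') + Px (sp k D' * Bp k) * y))" for \<Lambda>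
    proof -
      let ?E = "EL \<Lambda> j" and ?E' = "EL \<Lambda> ?j'"
      have sE: "sp k ?E' = ?E" using sp_EL[OF k, of \<Lambda> ?j'] by (simp add: comp_assoc)
      have phi: "ccong \<Lambda> (Px (sp k p) * (phi k * u)) (phi k * (Px p * u))" if "p \<in> polys n" for p u
        using hcong_ccong_mult[OF congr_sym[OF phi_Px[OF k that]], of \<Lambda> u] by (simp add: mult.assoc)
      have a1: "ccong \<Lambda> (Px (sp k D' * D * ?E) * (phi k * Q \<Lambda>)) (Px ?E * (Px D * (phi k * y')))"
      proof -
        have e: "sp k D' * D * ?E = D * sp k (D' * ?E')" unfolding sp_hom sE by (simp add: ac_simps)
        have "ccong \<Lambda> (Px (sp k D' * D * ?E) * (phi k * Q \<Lambda>)) (Px D * (Px (sp k (D' * ?E')) * (phi k * Q \<Lambda>)))"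
          unfolding e by (rule congr_sym[OF Px_Px])
        also have "ccong \<Lambda> \<dots> (Px D * (phi k * (Px (D' * ?E') * Q \<Lambda>)))"
          by (intro ccong_left phi polys_mult D0' EL_polys)
        also have "ccong \<Lambda> \<dots> (Px D * (phi k * (Px ?E' * y')))"
          using D' by (intro ccong_left) (simp add: cleared_def)
        also have "ccong \<Lambda> \<dots> (Px D * (Px ?E * (phi k * y')))"
          by (rule ccong_left[OF congr_sym[OF phi[OF EL_polys, of \<Lambda> ?j' y', unfolded sE]]])
        also have "ccong \<Lambda> \<dots> (Px ?E * (Px D * (phi k * y')))" by (rule Px_swap)
        finally show ?thesis .
      qed
      have a2: "ccong \<Lambda> (Px (sp k D' * D * ?E) * (Px (Bp k) * Q \<Lambda>)) (Px ?E * (Px (sp k D' * Bp k) * y))"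
      proof -
        have e: "sp k D' * D * ?E * Bp k = (sp k D' * Bp k) * (D * ?E)" by (simp add: ac_simps)
        have "ccong \<Lambda> (Px (sp k D' * D * ?E) * (Px (Bp k) * Q \<Lambda>)) (Px (sp k D' * D * ?E * Bp k) * Q \<Lambda>)"
          by (rule Px_Px)
        also have "ccong \<Lambda> \<dots> (Px ?E * (Px (sp k D' * Bp k) * y))"
          unfolding e by (rule cleared_ext[OF D])
        finally show ?thesis .
      qed
      have e: "?z * (sp k D' * D) * ?E = (sp k D' * D * ?E) * ?z" by (simp add: ac_simps)
      have "ccong \<Lambda> (Px (?z * (sp k D' * D) * ?E) * (T\<^sub>g k * Q \<Lambda>)) (Px (sp k D' * D * ?E) * (Px ?z * (T\<^sub>g k * Q \<Lambda>)))"
        unfolding e by (rule congr_sym[OF Px_Px])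
      also have "Px ?z * (T\<^sub>g k * Q \<Lambda>) = phi k * Q \<Lambda> + Px (Bp k) * Q \<Lambda>"
        by (simp add: phi_def algebra_simps)
      also have "ccong \<Lambda> (Px (sp k D' * D * ?E) * (phi k * Q \<Lambda> + Px (Bp k) * Q \<Lambda>))
          (Px ?E * (Px D * (phi k * y') + Px (sp k D' * Bp k) * y))"
        unfolding distrib_left by (rule congr_add[OF a1 a2])
      finally show ?thesis .
    qed
    moreover have "sep j (?z * (sp k D' * D))"
      using sep_sp[OF k D0'(2)] k False
      by (intro sep_mult sep_diff D0) (auto simp: comp_assoc)
    ultimately have "cleared j (?z * (sp k D' * D)) (Px D * (phi k * y') + Px (sp k D' * Bp k) * y)
        (\<lambda>\<Lambda>. T\<^sub>g k * Q \<Lambda>)"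
      unfolding cleared_def by blast
    then show ?thesis by blast
  qed
qed

lemma SS_gen:
  assumes "SS Q" "g \<in> hecke_gens st n"
  shows "SS (\<lambda>\<Lambda>. gen_elt g * Q \<Lambda>)"
proof (cases g)
  case (gT r)
  then show ?thesis using SS_T[OF assms(1)] assms(2) by simp
next
  case (gX k)
  then have "k \<in> {1..n}" using assms(2) by simp
  then have "X\<^sub>g k * Px p \<approx> Px p * X\<^sub>g k" for p using Px_comm[of "pvar k" p] by simp
  then show ?thesis unfolding gX by (rule SS_commuting[OF assms(1)])
next
  case (gXinv k)
  then show ?thesis using SS_commuting[OF assms(1) Xi_Px_comm] assms(2) by simp
qed

text \<open>Formulated for left multiplication onto an already clearable family, so that a product
  needs only associativity. Taking 1 for this family yields the elements themselves.\<close>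

lemma rel_SS: "rel P \<sigma> \<Longrightarrow> SS Q \<Longrightarrow> SS (\<lambda>\<Lambda>. P \<Lambda> * Q \<Lambda>)"
proof (induction arbitrary: Q rule: rel.induct)
  case (gen g i)
  have "SS (\<lambda>\<Lambda>. Px (EL \<Lambda> i) * Q \<Lambda>)"
    by (rule SS_local[OF gen(3,2), where p' = "\<lambda>_. 1" and z = 1]) (simp_all add: sep.one)
  from SS_gen[OF this gen(1)] show ?case by (simp add: mult.assoc)
next
  case (idem i)
  show ?case
    by (rule SS_local[OF idem(2,1), where p' = "\<lambda>_. 1" and z = 1]) (simp_all add: sep.one)
next
  case (inv i r s)
  have rs: "r \<in> {1..n}" "s \<in> {1..n}" using inv by auto
  show ?case
    by (rule SS_local[OF inv(6,1), where p' = "\<lambda>\<Lambda>. invL i r s \<Lambda>" and z = "pvar r - pvar s"])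
      (use invL[OF I_beta_res_seqs[OF inv(1)] rs inv(5)] sep_diff[OF rs, of i] inv(5) in \<open>simp_all add: mult.assoc\<close>)
next
  case zero
  show ?case by (simp add: SS_0)
next
  case (add P \<sigma> P' \<tau>)
  show ?case unfolding distrib_right by (intro SS_add add)
next
  case (mult P \<sigma> P' \<tau>)
  show ?case unfolding mult.assoc by (intro mult.IH mult.prems)
next
  case (scal P \<sigma> c)
  show ?case unfolding mult.assoc by (intro SS_cst scal)
qed

lemma rest_const:
  assumes "p \<in> polys n"
  shows "rest (\<lambda>_. emb p) \<in> Sec" "rest (\<lambda>_. emb p) \<in> PB"
  using assms by (auto simp: rest_def Sec_def PB_def)

lemma repr_Px_EL:
  assumes "j \<in> Ib" "D \<in> polys n"
  shows "repr (\<lambda>\<Lambda>. Px (D * EL \<Lambda> j)) (\<lambda>v l. emb D * pr j v l)"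
  unfolding repr_def
proof (intro allI ballI)
  fix N v assume "v \<in> Sec"
  then have "UU N (act st n (Px (EL (Lam N) j)) v - pr j v)"
    using repr_idem[OF assms(1)] unfolding repr_def by blast
  then have "UU N (\<lambda>l. emb D * (act st n (Px (EL (Lam N) j)) v - pr j v) l)" by (rule UU_emb)
  moreover have "(\<lambda>l. emb D * (act st n (Px (EL (Lam N) j)) v - pr j v) l)
      = act st n (Px (D * EL (Lam N) j)) v - (\<lambda>l. emb D * pr j v l)"
    by (simp add: act_Px polys_mult assms(2) fun_eq_iff emb.hom_mult algebra_simps)
  ultimately show "UU N (act st n (Px (D * EL (Lam N) j)) v - (\<lambda>l. emb D * pr j v l))" by (simp only:)
qed

lemma rel_faithful:
  assumes P: "rel P \<sigma>" and z: "\<And>v. v \<in> PB \<Longrightarrow> \<sigma> v = 0"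
  shows "ccong \<Lambda> (P \<Lambda>) 0"
proof -
  have "ccong \<Lambda> (Px (EL \<Lambda> j) * P \<Lambda>) 0" if j: "j \<in> Ib" for j
  proof -
    obtain D y where D: "cleared j D y (\<lambda>\<Lambda>. P \<Lambda> * 1)" by (rule SS_E[OF rel_SS[OF P SS_1] j])
    then have sD: "sep j D" and c: "\<And>\<Lambda>. ccong \<Lambda> (Px (D * EL \<Lambda> j) * P \<Lambda>) (Px (EL \<Lambda> j) * y)"
      by (simp_all add: cleared_def)
    have "cop y (emb p) = 0" if p: "p \<in> polys n" for p
    proof -
      let ?v = "rest (\<lambda>_. emb p)"
      \<comment> \<open>D e(j) P and e(j) y agree in every cyclotomic quotient, hence have the same
        operator on \<open>Sec\<close>. The left one is zero by assumption, so y kills all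
        polynomials.\<close>
      have "(\<lambda>l. emb D * pr j (\<sigma> ?v) l) = pr j (act st n y ?v)"
        by (rule repr_unique[OF repr_mult[OF repr_Px_EL[OF j sep_polys[OF sD]] rel_repr[OF P] rel_Sec[OF P]]
              repr_mult[OF repr_idem[OF j] repr_act act_Sec] c rest_const(1)[OF p]])
      then have "(\<lambda>l. emb D * pr j 0 l) = pr j (rest (\<lambda>_. cop y (emb p)))"
        unfolding z[OF rest_const(2)[OF p]] act_rest act_const .
      from fun_cong[OF this, of j] show ?thesis using j by (simp add: pr_def rest_def)
    qed
    then have "y \<approx> 0" by (rule affine_faithful)
    then have "ccong \<Lambda> (Px (EL \<Lambda> j) * y) 0"
      using ccong_left[OF congr_hrels_crels, of y 0 \<Lambda> "Px (EL \<Lambda> j)"] by simp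
    with c have 0: "ccong \<Lambda> (Px (D * EL \<Lambda> j) * P \<Lambda>) 0" by (rule congr_trans)
    obtain g where "Iz \<Lambda> (g * D * EL \<Lambda> j - EL \<Lambda> j)" using sep_invert[OF sD j] by blast
    from Px_ccong[OF this, of "P \<Lambda>"]
    have "ccong \<Lambda> (Px (EL \<Lambda> j) * P \<Lambda>) (Px (g * (D * EL \<Lambda> j)) * P \<Lambda>)"
      unfolding mult.assoc by (rule congr_sym)
    also have "ccong \<Lambda> \<dots> (Px g * (Px (D * EL \<Lambda> j) * P \<Lambda>))" by (rule congr_sym[OF Px_Px])
    also have "ccong \<Lambda> \<dots> (Px g * 0)" by (rule ccong_left[OF 0])
    finally show ?thesis by simp
  qed
  \<comment> \<open>All rows of P vanish, and they add up to P by
    \<open>rel_ONE_mult\<close>.\<close>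
  then have "ccong \<Lambda> (\<Sum>j\<in>Ib. Px (EL \<Lambda> j) * P \<Lambda>) (\<Sum>j\<in>Ib. 0)" by (intro congr_sum)
  then have "ccong \<Lambda> (Px (ONE \<Lambda>) * P \<Lambda>) 0"
    by (simp add: ONE_def Px_sum sum_distrib_right)
  then show ?thesis using congr_trans[OF congr_sym[OF rel_ONE_mult[OF P]]] by blast
qed

end

section \<open>The representation\<close>

lemma lookup_scale: "Poly_Mapping.lookup (scale c v) j = rat_const c * Poly_Mapping.lookup v j"
  by (simp add: scale_def Poly_Mapping.map.rep_eq when_def)

context hecke_block
begin

interpretation R: ring R by (rule ring_R)

abbreviation "HH \<equiv> modified_hecke e st n \<beta>"
abbreviation "smul \<equiv> modified_smult e st n"
abbreviation "Pol \<equiv> Pol_beta e st n \<beta>"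

lemma HH_simps [simp]:
  "carrier HH = subalg_gen R (limit_const e st n) (modified_gens e st n \<beta>)"
  "x \<otimes>\<^bsub>HH\<^esub> y = x \<otimes>\<^bsub>R\<^esub> y" "x \<oplus>\<^bsub>HH\<^esub> y = x \<oplus>\<^bsub>R\<^esub> y"
  by (simp_all add: modified_hecke_def)

lemma hat_at_gen:
  "g \<in> hecke_gens st n \<Longrightarrow> i \<in> Ib \<Longrightarrow> hat_at e st n (gen_elt g) i = lim (\<lambda>\<Lambda>. gen_elt g * Px (EL \<Lambda> i))"
  by (intro hat_at_lim I_beta_res_seqs) simp

lemma hat_idem_Ib: "i \<in> Ib \<Longrightarrow> hat_idem e st n i = lim (\<lambda>\<Lambda>. Px (EL \<Lambda> i))"
  by (intro hat_idem_lim I_beta_res_seqs)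

lemma corner_inverse_Ib:
  assumes "i \<in> Ib" "1 \<le> r" "r < s" "s \<le> n" "i r \<noteq> i s"
  shows "corner_inverse R (hat_idem e st n i) (hat_at e st n (X\<^sub>g r - X\<^sub>g s) i)
    = lim (\<lambda>\<Lambda>. Px (invL i r s \<Lambda> * EL \<Lambda> i))"
  using assms by (intro corner_inverse_lim I_beta_res_seqs) auto

lemma smul_lim: "smul c (lim P) = lim (\<lambda>\<Lambda>. cst c * P \<Lambda>)"
  by (simp add: modified_smult_def limit_const_lim R_mult)

lemma unit_gens_hecke_gens: "unit_gens st n \<union> gT ` {1..<n} = hecke_gens st n"
  by (cases st) auto

text \<open>The constructors of \<open>rel\<close> mirror those of \<open>subalg_gen\<close>, so
  every element of the algebra comes with at least one operator.\<close>

lemma carrier_HH: "x \<in> carrier HH \<longleftrightarrow> (\<exists>P \<sigma>. rel P \<sigma> \<and> x = lim P)"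
proof
  assume "x \<in> carrier HH"
  then have "x \<in> subalg_gen R (limit_const e st n) (modified_gens e st n \<beta>)" by simp
  then show "\<exists>P \<sigma>. rel P \<sigma> \<and> x = lim P"
  proof (induction rule: subalg_gen.induct)
    case (incl x)
    then consider g i where "g \<in> hecke_gens st n" "i \<in> Ib" "x = hat_at e st n (gen_elt g) i"
      | i where "i \<in> Ib" "x = hat_idem e st n i"
      | r s i where "i \<in> Ib" "1 \<le> r" "r < s" "s \<le> n" "i r \<noteq> i s"
          "x = corner_inverse R (hat_idem e st n i) (hat_at e st n (X\<^sub>g r - X\<^sub>g s) i)"
      unfolding modified_gens_def unit_gens_hecke_gens[symmetric] by blast
    then show ?case
    proof cases
      case 1
      show ?thesis unfolding 1(3) hat_at_gen[OF 1(1,2)] using rel.gen[OF 1(1,2)] by blast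
    next
      case 2
      show ?thesis unfolding 2(2) hat_idem_Ib[OF 2(1)] using rel.idem[OF 2(1)] by blast
    next
      case 3
      show ?thesis unfolding 3(6) corner_inverse_Ib[OF 3(1-5)] using rel.inv[OF 3(1-5)] by blast
    qed
  next
    case zero
    show ?case unfolding R_zero using rel.zero by blast
  next
    case (add x y)
    then obtain P \<sigma> Q \<tau> where "rel P \<sigma>" "x = lim P" "rel Q \<tau>" "y = lim Q" by blast
    then show ?case using rel.add[of P \<sigma> Q \<tau>] R_add[of P Q] by blast
  next
    case (mult x y)
    then obtain P \<sigma> Q \<tau> where "rel P \<sigma>" "x = lim P" "rel Q \<tau>" "y = lim Q" by blast
    then show ?case using rel.mult[of P \<sigma> Q \<tau>] R_mult[of P Q] by blast
  next
    case (scal x c)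
    then obtain P \<sigma> where "rel P \<sigma>" "x = lim P" by blast
    then show ?case using rel.scal[of P \<sigma> c] smul_lim[of c P] unfolding modified_smult_def by blast
  qed
next
  assume "\<exists>P \<sigma>. rel P \<sigma> \<and> x = lim P"
  then obtain P \<sigma> where "rel P \<sigma>" and x: "x = lim P" by blast
  then have "lim P \<in> subalg_gen R (limit_const e st n) (modified_gens e st n \<beta>)" (is "_ \<in> ?H")
  proof (induction arbitrary: x rule: rel.induct)
    case (gen g i)
    have "g \<in> unit_gens st n \<union> gT ` {1..<n}" using gen unit_gens_hecke_gens by blast
    then have "hat_at e st n (gen_elt g) i \<in> modified_gens e st n \<beta>"
      using gen(2) unfolding modified_gens_def by blast
    from subalg_gen.incl[OF this] show ?case unfolding hat_at_gen[OF gen(1,2)] .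
  next
    case (idem i)
    then have "hat_idem e st n i \<in> modified_gens e st n \<beta>" unfolding modified_gens_def by blast
    from subalg_gen.incl[OF this] show ?case unfolding hat_idem_Ib[OF idem(1)] .
  next
    case (inv i r s)
    then have "corner_inverse R (hat_idem e st n i) (hat_at e st n (X\<^sub>g r - X\<^sub>g s) i) \<in> modified_gens e st n \<beta>"
      unfolding modified_gens_def by blast
    from subalg_gen.incl[OF this] show ?case unfolding corner_inverse_Ib[OF inv(1-5)] .
  next
    case zero
    show ?case using subalg_gen.zero unfolding R_zero[symmetric] .
  next
    case (add P \<sigma> Q \<tau>)
    show ?case unfolding R_add[symmetric] using add.IH by (intro subalg_gen.add) blast+
  next
    case (mult P \<sigma> Q \<tau>)
    show ?case unfolding R_mult[symmetric] using mult.IH by (intro subalg_gen.mult) blast+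
  next
    case (scal P \<sigma> c)
    show ?case unfolding smul_lim[symmetric] modified_smult_def using scal.IH by (intro subalg_gen.scal) blast
  qed
  then show "x \<in> carrier HH" by (simp add: x)
qed

lemma one_HH: "\<one>\<^bsub>HH\<^esub> = lim (\<lambda>\<Lambda>. Px (ONE \<Lambda>))"
proof -
  have "(\<Oplus>\<^bsub>R\<^esub> i \<in> A. hat_idem e st n i) = lim (\<lambda>\<Lambda>. \<Sum>i\<in>A. Px (EL \<Lambda> i))" if "finite A" "A \<subseteq> Ib" for A
    using that
  proof (induction A rule: finite_induct)
    case empty
    then show ?case by (simp add: R_zero)
  next
    case (insert i A)
    have c: "hat_idem e st n i \<in> carrier R" if "i \<in> Ib" for i
      using EL_coherent[OF I_beta_res_seqs[OF that]] hat_idem_Ib[OF that] carrier_R by blast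
    have "(\<Oplus>\<^bsub>R\<^esub> i \<in> insert i A. hat_idem e st n i) = hat_idem e st n i \<oplus>\<^bsub>R\<^esub> (\<Oplus>\<^bsub>R\<^esub> i \<in> A. hat_idem e st n i)"
      using insert c by (intro R.finsum_insert) auto
    then show ?case using insert by (simp add: hat_idem_Ib R_add)
  qed
  from this[OF finite_Ib order_refl] show ?thesis
    by (simp add: modified_hecke_def ONE_def Px_sum)
qed

section \<open>The representation on the polynomial space\<close>

lemma Pol_iff: "v \<in> Pol \<longleftrightarrow> Poly_Mapping.lookup v \<in> PB"
  by (auto simp: Pol_beta_def PB_def in_keys_iff)

lemma lookup_Abs_PB: "u \<in> PB \<Longrightarrow> Poly_Mapping.lookup (Abs_poly_mapping u) = u"
  by (rule Abs_poly_mapping_inverse) (auto simp: PB_def intro: finite_subset[OF _ finite_Ib])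

lemma comp_at_Pol: "i \<in> Ib \<Longrightarrow> f \<in> Pn st n \<Longrightarrow> comp_at i f \<in> Pol"
  by (auto simp: Pol_iff PB_def lookup_single when_def)

text \<open>The chosen operator may come from any derivation of \<open>x\<close>; on vectors
  supported in the block the choice is immaterial by \<open>rel_unique\<close>.\<close>

definition rho :: "'k limit \<Rightarrow> ((nat \<Rightarrow> int) \<Rightarrow>\<^sub>0 'k ratfun) \<Rightarrow> ((nat \<Rightarrow> int) \<Rightarrow>\<^sub>0 'k ratfun)" where
  "rho x v = Abs_poly_mapping ((SOME \<sigma>. \<exists>P. rel P \<sigma> \<and> x = lim P) (Poly_Mapping.lookup v))"

lemma lookup_rho:
  assumes P: "rel P \<sigma>" and v: "v \<in> Pol"
  shows "Poly_Mapping.lookup (rho (lim P) v) = \<sigma> (Poly_Mapping.lookup v)"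
proof -
  let ?s = "SOME \<sigma>. \<exists>Q. rel Q \<sigma> \<and> lim P = lim Q"
  obtain Q where Q: "rel Q ?s" "lim P = lim Q"
    using someI[of "\<lambda>\<sigma>. \<exists>Q. rel Q \<sigma> \<and> lim P = lim Q" \<sigma>] P by blast
  have PB: "Poly_Mapping.lookup v \<in> PB" using v by (simp add: Pol_iff)
  have "?s (Poly_Mapping.lookup v) = \<sigma> (Poly_Mapping.lookup v)"
    using PB by (intro rel_unique[OF Q(1) P Q(2)[symmetric]]) (auto simp: PB_def)
  then show ?thesis unfolding rho_def using lookup_Abs_PB[OF rel_PB[OF P PB]] by simp
qed

lemma rho_Pol: "rel P \<sigma> \<Longrightarrow> v \<in> Pol \<Longrightarrow> rho (lim P) v \<in> Pol"
  using rel_PB lookup_rho by (simp add: Pol_iff)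

lemma Pol_add: "v \<in> Pol \<Longrightarrow> w \<in> Pol \<Longrightarrow> v + w \<in> Pol"
  by (auto simp: Pol_iff PB_def lookup_add Pn_add)

lemma Pol_scale: "v \<in> Pol \<Longrightarrow> scale c v \<in> Pol"
  by (auto simp: Pol_iff PB_def lookup_scale Pn_mult)

lemma lookup_add_fun: "Poly_Mapping.lookup (v + w) = Poly_Mapping.lookup v + Poly_Mapping.lookup w"
  by (simp add: fun_eq_iff lookup_add)

lemma lookup_scale_fun: "Poly_Mapping.lookup (scale c v) = (\<lambda>j. rat_const c * Poly_Mapping.lookup v j)"
  by (simp add: fun_eq_iff lookup_scale)

lemma rel_cases:
  assumes "x \<in> carrier HH"
  obtains P \<sigma> where "rel P \<sigma>" "x = lim P"
  using assms unfolding carrier_HH by blast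

lemma rho_representation: "is_representation HH smul Pol rho"
  unfolding is_representation_def
proof (intro conjI ballI allI)
  fix x v assume x: "x \<in> carrier HH" and v: "v \<in> Pol"
  obtain P \<sigma> where P: "rel P \<sigma>" "x = lim P" using x by (rule rel_cases)
  show "rho x v \<in> Pol" using rho_Pol[OF P(1) v] P(2) by simp
  show "rho x (v + w) = rho x v + rho x w" if w: "w \<in> Pol" for w
    unfolding P(2) lookup_inject[symmetric] lookup_add_fun lookup_rho[OF P(1) v] lookup_rho[OF P(1) w]
      lookup_rho[OF P(1) Pol_add[OF v w]] by (rule rel_add[OF P(1)])
  show "rho x (scale c v) = scale c (rho x v)" for c
    unfolding P(2) lookup_inject[symmetric] lookup_scale_fun lookup_rho[OF P(1) v]
      lookup_rho[OF P(1) Pol_scale[OF v]] by (rule rel_symmetric[OF P(1)]) simp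
  show "rho (smul c x) v = scale c (rho x v)" for c
    unfolding P(2) smul_lim lookup_inject[symmetric] lookup_scale_fun lookup_rho[OF P(1) v]
      lookup_rho[OF rel.scal[OF P(1)] v] ..
  fix y assume y: "y \<in> carrier HH"
  obtain Q \<tau> where Q: "rel Q \<tau>" "y = lim Q" using y by (rule rel_cases)
  show "rho (x \<otimes>\<^bsub>HH\<^esub> y) v = rho x (rho y v)"
    unfolding P(2) Q(2) HH_simps R_mult lookup_inject[symmetric] lookup_rho[OF rel.mult[OF P(1) Q(1)] v]
      lookup_rho[OF P(1) rho_Pol[OF Q(1) v]] lookup_rho[OF Q(1) v] ..
  show "rho (x \<oplus>\<^bsub>HH\<^esub> y) v = rho x v + rho y v"
    unfolding P(2) Q(2) HH_simps R_add lookup_inject[symmetric] lookup_rho[OF rel.add[OF P(1) Q(1)] v]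
      lookup_add_fun lookup_rho[OF P(1) v] lookup_rho[OF Q(1) v] ..
next
  fix v assume v: "v \<in> Pol"
  then have "rest (Poly_Mapping.lookup v) = Poly_Mapping.lookup v"
    by (intro rest_idem) (simp add: Pol_iff PB_def)
  then show "rho \<one>\<^bsub>HH\<^esub> v = v"
    unfolding one_HH lookup_inject[symmetric] lookup_rho[OF rel_ONE v] .
qed

lemma rho_faithful: "faithful HH Pol rho"
  unfolding faithful_def
proof (intro ballI impI)
  fix x y assume x: "x \<in> carrier HH" and y: "y \<in> carrier HH" and eq: "\<forall>v\<in>Pol. rho x v = rho y v"
  obtain P \<sigma> where P: "rel P \<sigma>" "x = lim P" using x by (rule rel_cases)
  obtain Q \<tau> where Q: "rel Q \<tau>" "y = lim Q" using y by (rule rel_cases)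
  \<comment> \<open>The difference of the two elements, with its own operator, so that only
    vanishing has to be tested.\<close>
  note D = rel.add[OF P(1) rel.scal[OF Q(1), of "- 1"]]
  have "\<sigma> v + (\<lambda>j. rat_const (- 1) * \<tau> v j) = 0" if v: "v \<in> PB" for v
  proof -
    have Pol: "Abs_poly_mapping v \<in> Pol" using v by (simp add: Pol_iff lookup_Abs_PB)
    then have "\<sigma> v = \<tau> v"
      using eq lookup_rho[OF P(1) Pol] lookup_rho[OF Q(1) Pol] P(2) Q(2) by (simp add: lookup_Abs_PB[OF v])
    then show ?thesis by (simp add: fun_eq_iff rat_const_uminus)
  qed
  from rel_faithful[OF D this] have "ccong \<Lambda> (P \<Lambda> - Q \<Lambda>) 0" for \<Lambda> by (simp add: cst_uminus)
  then show "x = y" by (simp add: P Q lim_eq_iff congr_diff_0_iff)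
qed

section \<open>The action rules in terms of operators\<close>

lemma pr_comp_at:
  "pr j (Poly_Mapping.lookup (comp_at i f)) = Poly_Mapping.lookup (if j = i then comp_at i f else 0)"
  by (auto simp: fun_eq_iff pr_def lookup_single when_def)

lemma gact_0: "gact st n g (Poly_Mapping.lookup 0) = Poly_Mapping.lookup 0"
proof -
  have "Poly_Mapping.lookup 0 = (0 :: 'k pvec)" by (simp add: fun_eq_iff)
  then show ?thesis by (simp only: gact_zero)
qed

lemma gact_comp_at:
  "k \<in> {1..n} \<Longrightarrow> gact st n (gX k) (Poly_Mapping.lookup (comp_at i f)) = Poly_Mapping.lookup (comp_at i (tvar k * f))"
  "k \<in> {1..n} \<Longrightarrow> st \<noteq> Deg \<Longrightarrow> gact st n (gXinv k) (Poly_Mapping.lookup (comp_at i f))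
    = Poly_Mapping.lookup (comp_at i (inverse (tvar k) * f))"
  by (auto simp: fun_eq_iff gact_X gact_Xinv lookup_single when_def)

lemma gact_T_comp_at:
  assumes r: "r \<in> {1..<n}"
  shows "gact st n (gT r) (Poly_Mapping.lookup (comp_at i f)) = Poly_Mapping.lookup
    (comp_at (place_perm (simple_refl r) i) ((rat_const q - bco st r) * sr r f) + comp_at i (bco st r * f))"
proof
  fix j
  have "i = j \<circ> simple_refl r \<longleftrightarrow> i \<circ> simple_refl r = j" by (auto simp: comp_assoc)
  then show "gact st n (gT r) (Poly_Mapping.lookup (comp_at i f)) j = Poly_Mapping.lookup
    (comp_at (place_perm (simple_refl r) i) ((rat_const q - bco st r) * sr r f) + comp_at i (bco st r * f)) j"
    unfolding gact_T[OF r] place_perm_simple_refl lookup_add lookup_single sact_def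
    by (simp add: when_def)
qed

lemma hecke_gens_ball: "(\<forall>g\<in>hecke_gens st n. Q g) \<longleftrightarrow> (\<forall>r\<in>{1..<n}. Q (gT r)) \<and>
    (\<forall>k\<in>{1..n}. Q (gX k) \<and> (st \<noteq> Deg \<longrightarrow> Q (gXinv k)))"
  by (cases st) auto

lemma T_coefficients:
  "rat_const q - bco st r = (tvar (r + 1) - rat_const q * tvar r - rat_const h) / (tvar (r + 1) - tvar r)"
  "bco st r = (rat_const (q - 1) * tvar (r + 1) + rat_const h) / (tvar (r + 1) - tvar r)"
proof -
  show 2: "bco st r = (rat_const (q - 1) * tvar (r + 1) + rat_const h) / (tvar (r + 1) - tvar r)"
    by (simp add: bco_def bq_def rat_const_diff)
  have "tvar (r + 1) - tvar r \<noteq> (0 :: 'k ratfun)" by simp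
  then show "rat_const q - bco st r = (tvar (r + 1) - rat_const q * tvar r - rat_const h) / (tvar (r + 1) - tvar r)"
    unfolding 2 by (simp add: field_simps rat_const_diff)
qed

text \<open>One form for both settings: g e(j) acts as g after projection to component j. Existence
  and uniqueness can then be argued without distinguishing the settings.\<close>

lemma action_rules_iff:
  "action_rules e st n \<beta> \<rho> \<longleftrightarrow> (\<forall>i\<in>Ib. \<forall>j\<in>Ib. \<forall>f\<in>Pn st n.
     (\<forall>g\<in>hecke_gens st n. Poly_Mapping.lookup (\<rho> (hat_at e st n (gen_elt g) j) (comp_at i f))
        = gact st n g (pr j (Poly_Mapping.lookup (comp_at i f)))) \<and>
     Poly_Mapping.lookup (\<rho> (hat_idem e st n j) (comp_at i f)) = pr j (Poly_Mapping.lookup (comp_at i f)))"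
proof -
  have a: "gact st n g (pr j (Poly_Mapping.lookup (comp_at i f)))
      = (if j = i then gact st n g (Poly_Mapping.lookup (comp_at i f)) else Poly_Mapping.lookup 0)"
    for g i j f unfolding pr_comp_at using gact_0 by simp
  have X: "gact st n (gX k) (pr j (Poly_Mapping.lookup (comp_at i f)))
      = Poly_Mapping.lookup (if j = i then comp_at i (tvar k * f) else 0)" if "k \<in> {1..n}" for k i j f
    using that by (simp add: a gact_comp_at)
  have Xi: "gact st n (gXinv k) (pr j (Poly_Mapping.lookup (comp_at i f)))
      = Poly_Mapping.lookup (if j = i then comp_at i (inverse (tvar k) * f) else 0)"
    if "k \<in> {1..n}" "st \<noteq> Deg" for k i j f
    using that by (simp add: a gact_comp_at)
  have T: "gact st n (gT r) (pr j (Poly_Mapping.lookup (comp_at i f))) = Poly_Mapping.lookup (if j = i then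
      comp_at (place_perm (simple_refl r) i) ((rat_const q - bco st r) * sr r f) + comp_at i (bco st r * f) else 0)"
    if "r \<in> {1..<n}" for r i j f
    using that by (simp add: a gact_T_comp_at)
  have E: "Poly_Mapping.lookup u = pr j (Poly_Mapping.lookup (comp_at i f)) \<longleftrightarrow> u = (if j = i then comp_at i f else 0)"
    for u i j f by (simp only: pr_comp_at lookup_inject)
  show ?thesis
  proof (cases st)
    case (NonDeg q')
    have c: "rat_const q - bco st r = (tvar (r + 1) - rat_const q' * tvar r) / (tvar (r + 1) - tvar r)"
      "bco st r = rat_const (q' - 1) * (tvar (r + 1) / (tvar (r + 1) - tvar r))" for r
      using T_coefficients[of r] by (simp_all add: NonDeg)
    have rules: "action_rules e st n \<beta> \<rho> \<longleftrightarrow> (\<forall>i\<in>Ib. \<forall>j\<in>Ib. \<forall>f\<in>Pn st n.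
        (\<forall>k\<in>{1..n}.
           \<rho> (hat_at e st n (X\<^sub>g k) j) (comp_at i f) = (if j = i then comp_at i (tvar k * f) else 0) \<and>
           \<rho> (hat_at e st n (Xi\<^sub>g k) j) (comp_at i f) = (if j = i then comp_at i (inverse (tvar k) * f) else 0)) \<and>
        \<rho> (hat_idem e st n j) (comp_at i f) = (if j = i then comp_at i f else 0) \<and>
        (\<forall>r\<in>{1..<n}. \<rho> (hat_at e st n (T\<^sub>g r) j) (comp_at i f) = (if j = i then
          comp_at (place_perm (simple_refl r) i) ((rat_const q - bco st r) * sr r f) + comp_at i (bco st r * f) else 0)))"
      unfolding c(1) unfolding c(2) unfolding NonDeg action_rules.simps by (rule refl)
    have "st \<noteq> Deg" by (simp add: NonDeg)
    then show ?thesis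
      unfolding rules hecke_gens_ball
      by (intro ball_cong refl) (auto simp: X Xi T E lookup_inject simp del: if_split)
  next
    case Deg
    have c: "rat_const q - bco st r = (tvar (r + 1) - tvar r - 1) / (tvar (r + 1) - tvar r)"
      "bco st r = 1 / (tvar (r + 1) - tvar r)" for r
      using T_coefficients[of r] by (simp_all add: Deg)
    have rules: "action_rules e st n \<beta> \<rho> \<longleftrightarrow> (\<forall>i\<in>Ib. \<forall>j\<in>Ib. \<forall>f\<in>Pn st n.
        (\<forall>k\<in>{1..n}.
           \<rho> (hat_at e st n (X\<^sub>g k) j) (comp_at i f) = (if j = i then comp_at i (tvar k * f) else 0)) \<and>
        \<rho> (hat_idem e st n j) (comp_at i f) = (if j = i then comp_at i f else 0) \<and>
        (\<forall>r\<in>{1..<n}. \<rho> (hat_at e st n (T\<^sub>g r) j) (comp_at i f) = (if j = i then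
          comp_at (place_perm (simple_refl r) i) ((rat_const q - bco st r) * sr r f) + comp_at i (bco st r * f) else 0)))"
      unfolding c(1) unfolding c(2) unfolding Deg action_rules.simps by (rule refl)
    show ?thesis
      unfolding rules hecke_gens_ball
      by (intro ball_cong refl) (auto simp: Deg[symmetric] X T E lookup_inject simp del: if_split)
  qed
qed

lemma rho_rules: "action_rules e st n \<beta> rho"
  unfolding action_rules_iff
  by (auto simp: hat_at_gen hat_idem_Ib lookup_rho[OF rel.gen] lookup_rho[OF rel.idem] comp_at_Pol)

text \<open>Sums, products and scalars are forced by the representation axioms, the generators by
  the rules. Only the inverses need an argument: with a = (X_r - X_s) e(i) and inverse y, one solves
  a u = e(i) v inside the space and gets y v = y e(i) v = y a u = e(i) u = u.\<close>

lemma representation_unique: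
  assumes rep: "is_representation HH smul Pol \<rho>'" and rules: "action_rules e st n \<beta> \<rho>'"
    and "rel P \<sigma>" "v \<in> Pol"
  shows "Poly_Mapping.lookup (\<rho>' (lim P) v) = \<sigma> (Poly_Mapping.lookup v)"
proof -
  note r1 = rep[unfolded is_representation_def]
  note r2 = r1[THEN conjunct2] note r5 = r2[THEN conjunct2, THEN conjunct2, THEN conjunct2]
  note r6 = r5[THEN conjunct2] note r7 = r6[THEN conjunct2]
  have HHc: "lim P \<in> carrier HH" if "rel P \<sigma>" for P \<sigma> using that carrier_HH by blast
  have closed: "\<rho>' (lim P) v \<in> Pol" if "rel P \<sigma>" "v \<in> Pol" for P \<sigma> v
    by (rule r1[THEN conjunct1, rule_format, OF HHc[OF that(1)] that(2)])
  have plus: "\<rho>' (lim P) (v + w) = \<rho>' (lim P) v + \<rho>' (lim P) w" if "rel P \<sigma>" "v \<in> Pol" "w \<in> Pol" for P \<sigma> v w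
    by (rule r2[THEN conjunct1, rule_format, OF HHc[OF that(1)] that(2,3)])
  have times: "\<rho>' (lim (\<lambda>\<Lambda>. P \<Lambda> * Q \<Lambda>)) v = \<rho>' (lim P) (\<rho>' (lim Q) v)"
    if "rel P \<sigma>" "rel Q \<tau>" "v \<in> Pol" for P Q \<sigma> \<tau> v
    by (rule r5[THEN conjunct1, rule_format, OF HHc[OF that(1)] HHc[OF that(2)] that(3), unfolded HH_simps R_mult])
  have padd: "\<rho>' (lim (\<lambda>\<Lambda>. P \<Lambda> + Q \<Lambda>)) v = \<rho>' (lim P) v + \<rho>' (lim Q) v"
    if "rel P \<sigma>" "rel Q \<tau>" "v \<in> Pol" for P Q \<sigma> \<tau> v
    by (rule r6[THEN conjunct1, rule_format, OF HHc[OF that(1)] HHc[OF that(2)] that(3), unfolded HH_simps R_add])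
  have pscal: "\<rho>' (lim (\<lambda>\<Lambda>. cst c * P \<Lambda>)) v = scale c (\<rho>' (lim P) v)" if "rel P \<sigma>" "v \<in> Pol" for P \<sigma> v c
    by (rule r7[rule_format, OF HHc[OF that(1)] that(2), unfolded smul_lim])
  have zero: "\<rho>' (lim P) 0 = 0" if "rel P \<sigma>" for P \<sigma>
  proof -
    have "(0 :: (nat \<Rightarrow> int) \<Rightarrow>\<^sub>0 'k ratfun) \<in> Pol" by (simp add: Pol_iff PB_def)
    from plus[OF that this this] show ?thesis by simp
  qed
  \<comment> \<open>The rules speak of single components only; additivity extends them to arbitrary
    vectors, which are finite sums of such components.\<close>
  have basis: "Poly_Mapping.lookup (\<rho>' (lim P) v) = \<sigma> (Poly_Mapping.lookup v)"
    if P: "rel P \<sigma>" and v: "v \<in> Pol"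
      and b: "\<And>i f. i \<in> Ib \<Longrightarrow> f \<in> Pn st n \<Longrightarrow>
        Poly_Mapping.lookup (\<rho>' (lim P) (comp_at i f)) = \<sigma> (Poly_Mapping.lookup (comp_at i f))" for P \<sigma> v
  proof -
    have s0: "\<sigma> 0 = 0" using rel_add[OF P, of 0 0] by simp
    have s: "(\<Sum>i\<in>A. comp_at i (Poly_Mapping.lookup v i)) \<in> Pol \<and>
        Poly_Mapping.lookup (\<rho>' (lim P) (\<Sum>i\<in>A. comp_at i (Poly_Mapping.lookup v i)))
        = \<sigma> (Poly_Mapping.lookup (\<Sum>i\<in>A. comp_at i (Poly_Mapping.lookup v i)))" if "finite A" "A \<subseteq> Ib" for A
      using that
    proof (induction A rule: finite_induct)
      case empty
      have "Poly_Mapping.lookup 0 = (0 :: 'k pvec)" by (simp add: fun_eq_iff)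
      then show ?case by (simp only: sum.empty zero[OF P] s0) (simp add: Pol_iff PB_def)
    next
      case (insert i A)
      have i: "i \<in> Ib" "Poly_Mapping.lookup v i \<in> Pn st n" using insert v by (auto simp: Pol_iff PB_def)
      have S: "(\<Sum>i\<in>A. comp_at i (Poly_Mapping.lookup v i)) \<in> Pol" using insert by blast
      show ?case
        unfolding sum.insert[OF insert.hyps] plus[OF P comp_at_Pol[OF i] S] lookup_add_fun rel_add[OF P]
        using b[OF i] insert Pol_add[OF comp_at_Pol[OF i] S] by simp
    qed
    have "v = (\<Sum>i\<in>Ib. comp_at i (Poly_Mapping.lookup v i))"
      using v finite_Ib
      by (intro poly_mapping_eqI) (auto simp: lookup_sum lookup_single when_def Pol_iff PB_def)
    then show ?thesis using s[OF finite_Ib order_refl] by (simp only:)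
  qed
  show ?thesis
    using assms(3,4)
  proof (induction arbitrary: v rule: rel.induct)
    case (gen g i)
    show ?case
      using rules gen unfolding action_rules_iff
      by (intro basis[OF rel.gen[OF gen(1,2)] gen(3)]) (simp add: hat_at_gen)
  next
    case (idem i)
    show ?case
      using rules idem unfolding action_rules_iff
      by (intro basis[OF rel.idem[OF idem(1)] idem(2)]) (simp add: hat_idem_Ib)
  next
    case (inv i r s)
    have rs: "r \<in> {1..n}" "s \<in> {1..n}" using inv by auto
    note ires = I_beta_res_seqs[OF inv(1)]
    let ?Y = "\<lambda>\<Lambda>. Px (invL i r s \<Lambda> * EL \<Lambda> i)" and ?E = "\<lambda>\<Lambda>. Px (EL \<Lambda> i)"
    let ?A = "\<lambda>\<Lambda>. X\<^sub>g r * Px (EL \<Lambda> i) + cst (- 1) * (X\<^sub>g s * Px (EL \<Lambda> i))"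
    let ?c = "inverse (tvar r - tvar s) :: 'k ratfun"
    note Y = rel.inv[OF inv(1-5)] and E = rel.idem[OF inv(1)]
    have gr: "gX r \<in> hecke_gens st n" "gX s \<in> hecke_gens st n" using rs by simp_all
    note A1 = rel.gen[OF gr(1) inv(1)] and A2 = rel.gen[OF gr(2) inv(1)]
    note A = rel.add[OF A1 rel.scal[OF A2, of "- 1"]]
    \<comment> \<open>The solution of a u = e(i) v. It lies in the space because t_r - t_s is
      inverted there.\<close>
    define u where "u = Abs_poly_mapping (\<lambda>j. ?c * pr i (Poly_Mapping.lookup v) j)"
    have uPB: "(\<lambda>j. ?c * pr i (Poly_Mapping.lookup v) j) \<in> PB"
      using rel_PB[OF Y] inv(6) by (simp add: Pol_iff)
    then have lu: "Poly_Mapping.lookup u = (\<lambda>j. ?c * pr i (Poly_Mapping.lookup v) j)" and u: "u \<in> Pol"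
      by (simp_all add: u_def lookup_Abs_PB Pol_iff)
    have known: "Poly_Mapping.lookup (\<rho>' (lim (\<lambda>\<Lambda>. X\<^sub>g k * Px (EL \<Lambda> i))) w) = gact st n (gX k) (pr i (Poly_Mapping.lookup w))"
      if "k \<in> {1..n}" "w \<in> Pol" for k w
    proof -
      have k: "gX k \<in> hecke_gens st n" using that(1) by simp
      show ?thesis
        using rules inv(1) k unfolding action_rules_iff
        by (intro basis[OF rel.gen[OF k inv(1)] that(2)]) (simp add: hat_at_gen)
    qed
    have knownE: "Poly_Mapping.lookup (\<rho>' (lim ?E) w) = pr i (Poly_Mapping.lookup w)" if "w \<in> Pol" for w
      using rules inv(1) unfolding action_rules_iff
      by (intro basis[OF E that]) (simp add: hat_idem_Ib)
    have nz: "tvar r - tvar s \<noteq> (0 :: 'k ratfun)" using inv by simp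
    have Au: "\<rho>' (lim ?A) u = \<rho>' (lim ?E) v"
    proof (rule poly_mapping_eqI)
      fix j
      have "Poly_Mapping.lookup (\<rho>' (lim ?A) u) j = tvar r * (?c * pr i (Poly_Mapping.lookup v) j)
          - tvar s * (?c * pr i (Poly_Mapping.lookup v) j)"
        unfolding padd[OF A1 rel.scal[OF A2] u] pscal[OF A2 u] lookup_add lookup_scale known[OF rs(1) u] known[OF rs(2) u]
          gact_X[OF rs(1)] gact_X[OF rs(2)] lu
        by (simp add: pr_def rat_const_uminus)
      also have "\<dots> = (tvar r - tvar s) * ?c * pr i (Poly_Mapping.lookup v) j" by (simp add: algebra_simps)
      finally show "Poly_Mapping.lookup (\<rho>' (lim ?A) u) j = Poly_Mapping.lookup (\<rho>' (lim ?E) v) j"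
        using nz by (simp add: knownE[OF inv(6)])
    qed
    have YE: "lim (\<lambda>\<Lambda>. ?Y \<Lambda> * ?E \<Lambda>) = lim ?Y"
      unfolding lim_eq_iff
    proof
      fix \<Lambda>
      have eq: "invL i r s \<Lambda> * EL \<Lambda> i * EL \<Lambda> i - invL i r s \<Lambda> * EL \<Lambda> i
          = invL i r s \<Lambda> * (EL \<Lambda> i * EL \<Lambda> i - EL \<Lambda> i)" by (simp add: algebra_simps)
      have "Iz \<Lambda> (invL i r s \<Lambda> * EL \<Lambda> i * EL \<Lambda> i - invL i r s \<Lambda> * EL \<Lambda> i)"
        unfolding eq by (intro Iz_mult2 EL_idem ires)
      from congr_trans[OF congr_sym[OF congr_hrels_crels[OF Px_mult]] Iz_ccong[OF this]]
      show "ccong \<Lambda> (?Y \<Lambda> * ?E \<Lambda>) (?Y \<Lambda>)" .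
    qed
    have YA: "lim (\<lambda>\<Lambda>. ?Y \<Lambda> * ?A \<Lambda>) = lim ?E"
      unfolding lim_eq_iff
    proof
      fix \<Lambda>
      have A: "?A \<Lambda> = Px (pvar r - pvar s) * Px (EL \<Lambda> i)"
        using rs by (simp add: Px_diff cst_uminus algebra_simps)
      have eq: "invL i r s \<Lambda> * EL \<Lambda> i * ((pvar r - pvar s) * EL \<Lambda> i) - EL \<Lambda> i
          = ((pvar r - pvar s) * invL i r s \<Lambda> * EL \<Lambda> i - EL \<Lambda> i) * EL \<Lambda> i + (EL \<Lambda> i * EL \<Lambda> i - EL \<Lambda> i)"
        by (simp add: algebra_simps)
      have "Iz \<Lambda> (invL i r s \<Lambda> * EL \<Lambda> i * ((pvar r - pvar s) * EL \<Lambda> i) - EL \<Lambda> i)"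
        unfolding eq by (intro Iz_add Iz_mult invL[OF ires rs inv(5)] EL_idem ires)
      then have 1: "ccong \<Lambda> (Px (invL i r s \<Lambda> * EL \<Lambda> i * ((pvar r - pvar s) * EL \<Lambda> i))) (?E \<Lambda>)"
        by (rule Iz_ccong)
      have "ccong \<Lambda> (?Y \<Lambda> * ?A \<Lambda>) (?Y \<Lambda> * Px ((pvar r - pvar s) * EL \<Lambda> i))"
        unfolding A by (rule ccong_left[OF congr_sym[OF congr_hrels_crels[OF Px_mult]]])
      also have "ccong \<Lambda> \<dots> (Px (invL i r s \<Lambda> * EL \<Lambda> i * ((pvar r - pvar s) * EL \<Lambda> i)))"
        by (rule congr_sym[OF congr_hrels_crels[OF Px_mult]])
      also note 1
      finally show "ccong \<Lambda> (?Y \<Lambda> * ?A \<Lambda>) (?E \<Lambda>)" .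
    qed
    have "\<rho>' (lim ?Y) v = \<rho>' (lim ?Y) (\<rho>' (lim ?E) v)" using times[OF Y E inv(6)] unfolding YE .
    also have "\<dots> = \<rho>' (lim ?E) u" unfolding Au[symmetric] times[OF Y A u, symmetric] YA ..
    also have "\<dots> = u"
    proof -
      have "pr i (\<lambda>j. ?c * pr i (Poly_Mapping.lookup v) j) = (\<lambda>j. ?c * pr i (Poly_Mapping.lookup v) j)"
        by (rule ext) (simp add: pr_def)
      then show ?thesis by (simp only: lookup_inject[symmetric] knownE[OF u] lu)
    qed
    finally show ?case by (simp add: lu)
  next
    case zero
    \<comment> \<open>That zero acts by zero follows from compatibility with scalars, zero being 0
      times itself.\<close>
    have "lim (\<lambda>\<Lambda>. cst 0 * (0 :: 'k free)) = lim (\<lambda>_. 0)" by simp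
    then have "\<rho>' (lim (\<lambda>_. 0)) v = scale 0 (\<rho>' (lim (\<lambda>_. 0)) v)"
      using pscal[OF rel.zero zero(1), of 0] by simp
    moreover have "Poly_Mapping.lookup (scale 0 w) = (0 :: 'k pvec)" for w by (simp add: fun_eq_iff lookup_scale)
    ultimately show ?case by metis
  next
    case (add P \<sigma> Q \<tau>)
    show ?case unfolding padd[OF add.hyps add.prems] lookup_add_fun using add by simp
  next
    case (mult P \<sigma> Q \<tau>)
    show ?case
      unfolding times[OF mult.hyps mult.prems] mult.IH(1)[OF closed[OF mult.hyps(2) mult.prems]] mult.IH(2)[OF mult.prems] ..
  next
    case (scal P \<sigma> c)
    show ?case unfolding pscal[OF scal.hyps scal.prems] lookup_scale_fun scal.IH[OF scal.prems] ..
  qed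
qed

lemma rho_unique_faithful: "\<exists>\<rho>. is_representation HH smul Pol \<rho> \<and> action_rules e st n \<beta> \<rho> \<and> faithful HH Pol \<rho> \<and>
    (\<forall>\<rho>'. is_representation HH smul Pol \<rho>' \<and> action_rules e st n \<beta> \<rho>' \<longrightarrow>
      (\<forall>h\<in>carrier HH. \<forall>v\<in>Pol. \<rho>' h v = \<rho> h v))"
proof (intro exI[of _ rho] conjI allI impI ballI rho_representation rho_rules rho_faithful)
  fix \<rho>' x v
  assume r: "is_representation HH smul Pol \<rho>' \<and> action_rules e st n \<beta> \<rho>'"
    and x: "x \<in> carrier HH" and v: "v \<in> Pol"
  obtain P \<sigma> where P: "rel P \<sigma>" "x = lim P" using x by (rule rel_cases)
  show "\<rho>' x v = rho x v"
    using representation_unique[OF _ _ P(1) v, of \<rho>'] r lookup_rho[OF P(1) v]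
    unfolding P(2) lookup_inject[symmetric] by simp
qed

end

theorem proposition3p42:
  fixes e n :: nat and \<beta> :: "int multiset" and st :: "'k::field setting"
  assumes "e \<noteq> 1" and "admissible e st" and "\<beta> \<in> Qplus e n"
  shows "\<exists>\<rho>.
     is_representation (modified_hecke e st n \<beta>) (modified_smult e st n) (Pol_beta e st n \<beta>) \<rho> \<and>
     action_rules e st n \<beta> \<rho> \<and>
     faithful (modified_hecke e st n \<beta>) (Pol_beta e st n \<beta>) \<rho> \<and>
     (\<forall>\<rho>'. is_representation (modified_hecke e st n \<beta>) (modified_smult e st n)
               (Pol_beta e st n \<beta>) \<rho>' \<and>
            action_rules e st n \<beta> \<rho>' \<longrightarrow>
        (\<forall>h\<in>carrier (modified_hecke e st n \<beta>). \<forall>v\<in>Pol_beta e st n \<beta>. \<rho>' h v = \<rho> h v))"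
proof -
  interpret hecke_block e n st \<beta> by standard (rule assms(2), rule assms(3))
  show ?thesis by (rule rho_unique_faithful)
qed

end
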